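(* Let $n\ge2$ be an integer, $p\ge2$, and let $f\in C^1(\mathbb{R})$ satisfy $uf(u)>0$ for all $u\ne0$. Suppose there exist constants $\alpha_0$, $\beta_0$, $c>0$ and $M>0$ such that one of the following conditions holds: (1) $p<n$, $p-1<\alpha_0\le\beta_0<p^*-1$ with $p^*=\frac{np}{n-p}$, and $$\alpha_0\,uf(u)\le u^2f'(u)\le\beta_0\,uf(u),\qquad\forall u\in\mathbb{R};$$ (2) $p\ge n$, $p-1<\alpha_0\le\beta_0<\infty$, and $$u^2f'(u)\ge\alpha_0\,uf(u),\quad\forall u\in\mathbb{R},\qquad\text{and}\qquad uf(u)\ge c|u|^{\beta_0+1},\quad\forall |u|<M .$$ Then every solution $u$ of $-\Delta_p^H u=f(u)$ in $\mathbb{R}^n$ with finite Morse index is trivial, that is, $u\equiv0$.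
   Context: $H\in C^2(\mathbb{R}^n\setminus\{0\})\cap C(\mathbb{R}^n)$ is a fixed positively homogeneous function of degree one ($H(t\xi)=tH(\xi)$ for $t>0$, $H(0)=0$), positive on $\mathbb{S}^{n-1}$ (not assumed even), and uniformly convex, i.e. the unit ball $\{\xi: H(\xi)<1\}$ is uniformly convex (its boundary has principal curvatures bounded below by a positive constant). Set $a(\xi)=\frac1p\nabla_\xi H^p(\xi)$ (with $a(0)=0$) and $\Delta_p^H u=\operatorname{div}(a(\nabla u))$. A solution of $-\Delta_p^H u=f(u)$ in $\mathbb{R}^n$ is a (possibly sign-changing) function $u\in W^{1,p}_{\mathrm{loc}}(\mathbb{R}^n)\cap L^\infty_{\mathrm{loc}}(\mathbb{R}^n)$ such that $\int_{\mathbb{R}^n}a(\nabla u)\cdot\nabla\varphi=\int_{\mathbb{R}^n}f(u)\varphi$ for all $\varphi\in C_c^\infty(\mathbb{R}^n)$. The linearized operator $\mathcal{L}_u$ at $u$ is given by $$\langle\mathcal{L}_u\varphi,\psi\rangle_{L^2}=\int_{\mathbb{R}^n}\frac1p\nabla^2_{\xi_i\xi_j}H^p(\nabla u)\,\partial_i\varphi\,\partial_j\psi-\int_{\mathbb{R}^n}f'(u)\varphi\psi,\qquad\varphi,\psi\in C_c^1(\mathbb{R}^n)$$ (summation over repeated indices; for $p>2$ the matrix $\nabla_\xi^2H^p(\xi)$ is extended by $0$ to $\xi=0$; for $p=2$ it is given any fixed symmetric matrix value at $\xi=0$, the natural one if $H^2$ is $C^2$ at $0$). The solution $u$ has finite Morse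 index if the dimensions of the linear subspaces $\mathcal{M}\subset C_c^1(\mathbb{R}^n)$ such that $\langle\mathcal{L}_u\varphi,\varphi\rangle_{L^2}<0$ for all $\varphi\in\mathcal{M}\setminus\{0\}$ are bounded by a finite number. *)

theory Defs
  imports "HOL-Analysis.Analysis" "HOL-Library.Function_Algebras"
begin

definition partial :: "'n::finite \<Rightarrow> (real^'n \<Rightarrow> real) \<Rightarrow> real^'n \<Rightarrow> real" where
  "partial i g x = frechet_derivative g (at x) (axis i 1)"

definition grad :: "(real^'n::finite \<Rightarrow> real) \<Rightarrow> real^'n \<Rightarrow> real^'n" where
  "grad g x = (\<chi> i. partial i g x)"

definition hessian :: "(real^'n::finite \<Rightarrow> real) \<Rightarrow> real^'n \<Rightarrow> real^'n^'n" where
  "hessian g x = (\<chi> i j. partial i (partial j g) x)"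

text \<open>The class \<open>C\<^sup>k(S)\<close>; only meaningful for open \<open>S\<close>, since derivatives are taken in the
  full space.\<close>

primrec Ck_on :: "nat \<Rightarrow> (real^'n::finite) set \<Rightarrow> (real^'n \<Rightarrow> real) \<Rightarrow> bool" where
  "Ck_on 0 S g \<longleftrightarrow> continuous_on S g"
| "Ck_on (Suc k) S g \<longleftrightarrow> (\<forall>x\<in>S. g differentiable (at x)) \<and> (\<forall>i. Ck_on k S (partial i g))"

definition compactly_supported :: "(real^'n::finite \<Rightarrow> real) \<Rightarrow> bool" where
  "compactly_supported \<phi> \<longleftrightarrow> compact (closure {x. \<phi> x \<noteq> 0})"

definition Cc1 :: "(real^'n::finite \<Rightarrow> real) set" where
  "Cc1 = {\<phi>. Ck_on 1 UNIV \<phi> \<and> compactly_supported \<phi>}"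

definition Cc_infinity :: "(real^'n::finite \<Rightarrow> real) set" where
  "Cc_infinity = {\<phi>. (\<forall>k. Ck_on k UNIV \<phi>) \<and> compactly_supported \<phi>}"

definition Lp_loc :: "real \<Rightarrow> (real^'n::finite \<Rightarrow> 'b::euclidean_space) \<Rightarrow> bool" where
  "Lp_loc p g \<longleftrightarrow> g \<in> borel_measurable lebesgue \<and>
     (\<forall>K. compact K \<longrightarrow> set_integrable lebesgue K (\<lambda>x. norm (g x) powr p))"

definition Linfty_loc :: "(real^'n::finite \<Rightarrow> real) \<Rightarrow> bool" where
  "Linfty_loc g \<longleftrightarrow> g \<in> borel_measurable lebesgue \<and>
     (\<forall>K. compact K \<longrightarrow> (\<exists>C. AE x in lebesgue. x \<in> K \<longrightarrow> \<bar>g x\<bar> \<le> C))"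

definition is_weak_grad :: "(real^'n::finite \<Rightarrow> real) \<Rightarrow> (real^'n \<Rightarrow> real^'n) \<Rightarrow> bool" where
  "is_weak_grad u G \<longleftrightarrow> Lp_loc 1 u \<and> Lp_loc 1 G \<and>
     (\<forall>\<phi>\<in>Cc_infinity. \<forall>i.
        (LINT x|lebesgue. u x * partial i \<phi> x) = - (LINT x|lebesgue. G x $ i * \<phi> x))"

text \<open>A weak gradient is unique up to null sets; the choice of representative is immaterial
  below, because it only enters through integrals.\<close>

definition weak_grad :: "(real^'n::finite \<Rightarrow> real) \<Rightarrow> real^'n \<Rightarrow> real^'n" where
  "weak_grad u = (SOME G. is_weak_grad u G)"

definition W1p_loc :: "real \<Rightarrow> (real^'n::finite \<Rightarrow> real) \<Rightarrow> bool" where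
  "W1p_loc p u \<longleftrightarrow> Lp_loc p u \<and> (\<exists>G. is_weak_grad u G \<and> Lp_loc p G)"

text \<open>Principal curvatures of a regular level set of \<open>H\<close>, with respect to the unit normal
  \<open>\<nabla>H / |\<nabla>H|\<close>: the eigenvalues of the differential of the Gauss map on the tangent space
  \<open>(\<nabla>H(\<xi>))\<^sup>\<bottom>\<close>. For a sublevel set the normal points outwards, so that round spheres have
  positive curvature.\<close>

definition gauss_map :: "(real^'n::finite \<Rightarrow> real) \<Rightarrow> real^'n \<Rightarrow> real^'n" where
  "gauss_map H \<xi> = grad H \<xi> /\<^sub>R norm (grad H \<xi>)"

definition principal_curvature :: "(real^'n::finite \<Rightarrow> real) \<Rightarrow> real^'n \<Rightarrow> real \<Rightarrow> bool" where
  "principal_curvature H \<xi> \<kappa> \<longleftrightarrow>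
     (\<exists>v. v \<noteq> 0 \<and> v \<bullet> grad H \<xi> = 0 \<and>
          frechet_derivative (gauss_map H) (at \<xi>) v = \<kappa> *\<^sub>R v)"

definition uniformly_convex :: "(real^'n::finite \<Rightarrow> real) \<Rightarrow> bool" where
  "uniformly_convex H \<longleftrightarrow>
     (\<exists>\<kappa>0>0. \<forall>\<xi>\<in>frontier {\<eta>. H \<eta> < 1}. \<forall>\<kappa>. principal_curvature H \<xi> \<kappa> \<longrightarrow> \<kappa>0 \<le> \<kappa>)"

definition anisotropy :: "(real^'n::finite \<Rightarrow> real) \<Rightarrow> bool" where
  "anisotropy H \<longleftrightarrow>
     Ck_on 2 (- {0}) H \<and> continuous_on UNIV H \<and>
     H 0 = 0 \<and> (\<forall>t>0. \<forall>\<xi>. H (t *\<^sub>R \<xi>) = t * H \<xi>) \<and>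
     (\<forall>\<xi>\<in>sphere 0 1. 0 < H \<xi>) \<and>
     uniformly_convex H"

definition flux :: "real \<Rightarrow> (real^'n::finite \<Rightarrow> real) \<Rightarrow> real^'n \<Rightarrow> real^'n" where
  "flux p H \<xi> = (if \<xi> = 0 then 0 else (1 / p) *\<^sub>R grad (\<lambda>\<eta>. H \<eta> powr p) \<xi>)"

text \<open>The matrix \<open>\<nabla>\<^sup>2H\<^sup>p\<close> with its conventional value at the origin: \<open>0\<close> for \<open>p > 2\<close>; for
  \<open>p = 2\<close> the genuine Hessian if \<open>H\<^sup>2\<close> is \<open>C\<^sup>2\<close> near \<open>0\<close>, and the prescribed matrix \<open>A0\<close>
  otherwise.\<close>

definition hess_Hp :: "real \<Rightarrow> (real^'n::finite \<Rightarrow> real) \<Rightarrow> real^'n^'n \<Rightarrow> real^'n \<Rightarrow> real^'n^'n" where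
  "hess_Hp p H A0 \<xi> =
     (if \<xi> \<noteq> 0 then hessian (\<lambda>\<eta>. H \<eta> powr p) \<xi>
      else if p > 2 then 0
      else if \<exists>U. open U \<and> 0 \<in> U \<and> Ck_on 2 U (\<lambda>\<eta>. (H \<eta>)\<^sup>2) then hessian (\<lambda>\<eta>. (H \<eta>)\<^sup>2) 0
      else A0)"

definition is_solution ::
  "real \<Rightarrow> (real^'n::finite \<Rightarrow> real) \<Rightarrow> (real \<Rightarrow> real) \<Rightarrow> (real^'n \<Rightarrow> real) \<Rightarrow> bool" where
  "is_solution p H f u \<longleftrightarrow> W1p_loc p u \<and> Linfty_loc u \<and>
     (\<forall>\<phi>\<in>Cc_infinity.
        (LINT x|lebesgue. flux p H (weak_grad u x) \<bullet> grad \<phi> x) = (LINT x|lebesgue. f (u x) * \<phi> x))"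

definition linearized ::
  "real \<Rightarrow> (real^'n::finite \<Rightarrow> real) \<Rightarrow> real^'n^'n \<Rightarrow> (real \<Rightarrow> real) \<Rightarrow> (real^'n \<Rightarrow> real)
    \<Rightarrow> (real^'n \<Rightarrow> real) \<Rightarrow> (real^'n \<Rightarrow> real) \<Rightarrow> real" where
  "linearized p H A0 f u \<phi> \<psi> =
     (LINT x|lebesgue. (\<Sum>i\<in>UNIV. \<Sum>j\<in>UNIV.
        (1 / p) * hess_Hp p H A0 (weak_grad u x) $ i $ j * partial i \<phi> x * partial j \<psi> x))
     - (LINT x|lebesgue. deriv f (u x) * \<phi> x * \<psi> x)"

global_interpretation fun_space: vector_space "\<lambda>(c::real) (g::'a \<Rightarrow> real) x. c * g x"
  by unfold_locales (auto simp: fun_eq_iff algebra_simps)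

text \<open>The bound on the dimension is expressed by the existence of a finite basis rather than
  through \<open>dim\<close>, which is \<open>0\<close> on infinite-dimensional subspaces.\<close>

definition finite_morse_index ::
  "real \<Rightarrow> (real^'n::finite \<Rightarrow> real) \<Rightarrow> real^'n^'n \<Rightarrow> (real \<Rightarrow> real) \<Rightarrow> (real^'n \<Rightarrow> real) \<Rightarrow> bool" where
  "finite_morse_index p H A0 f u \<longleftrightarrow>
     (\<exists>N. \<forall>V. fun_space.subspace V \<and> V \<subseteq> Cc1 \<and>
               (\<forall>\<phi>\<in>V - {0}. linearized p H A0 f u \<phi> \<phi> < 0) \<longrightarrow>
        (\<exists>B. finite B \<and> card B \<le> N \<and> \<not> fun_space.dependent B \<and> fun_space.span B = V))"

end

theory Submission
  imports Defs
begin

text \<open>Finite Morse index makes the solution stable outside a ball. Testing stability with \<open>u\<psi>\<close> and the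
  equation with \<open>u\<psi>\<^sup>2\<close>, the terms linear in \<open>\<nabla>\<psi>\<close> cancel by Euler's relations, and Young's inequality
  bounds the energy \<open>\<integral> |\<nabla>u|\<^sup>p + u f(u)\<close> over the annulus of radius \<open>R\<close> by
  \<open>C R powr (n - p (\<beta>0 + 1) / (\<beta>0 + 1 - p))\<close>, where the exponent is negative.
  A Pohozaev inequality with an error on the same annulus replaces the Pohozaev identity: the weak
  equation is tested with \<open>\<eta>(x) (u(lx) - u(x))\<close>, its left side is estimated by the tangent inequality for the
  convex function \<open>H\<^sup>p / p\<close> and its right side by a second-order Taylor bound for the primitive \<open>F\<close> of \<open>f\<close>,
  and \<open>l \<longlongrightarrow> 1\<close> from below; no second derivatives of \<open>u\<close> are needed. As \<open>R \<longlongrightarrow> \<infinity>\<close> this gives \<open>n \<integral> F(u) \<le> (n - p) / p \<integral> H(\<nabla>u)\<^sup>p\<close>, while the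
  energy identity and the growth bound give \<open>\<integral> H(\<nabla>u)\<^sup>p = \<integral> u f(u) \<le> (\<beta>0 + 1) \<integral> F(u)\<close>; subcriticality
  forces \<open>F(u) = 0\<close>. For \<open>p \<ge> n\<close> the first inequality alone suffices.\<close>

section \<open>Smooth functions\<close>

text \<open>The obstacle is regularity: u is only locally in W^{1,p}, so the classical Pohozaev test
  function x . grad u, whose gradient contains second derivatives, is not admissible, whereas u(lx)
  - u(x) is. The price is an inequality instead of an identity; its direction is the useful one
  because a convex function lies above its tangents. Dividing by 1 - l works since the Taylor
  remainder carries |u(lx) - u(x)|^2, of order (1 - l)^2 as p >= 2; its factor may depend on R,
  because l tends to 1 before R grows. All first-order errors sit on annuli, where the decay
  estimate applies. Subcriticality is used twice, in two equivalent forms of (n - p)(\<beta>0 + 1) <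
  n p: the decay exponent is negative, and n / (\<beta>0 + 1) exceeds (n - p) / p. For p >= n the
  exponent is negative because p (\<beta>0 + 1) / (\<beta>0 + 1 - p) > p. Convexity has to be
  extracted from the lower bound on principal curvatures: the least value of the Hessian form on
  unit tangent vectors, divided by |grad H|, is such a curvature.\<close>

lemma has_derivative_grad:
  fixes g :: "real^'n \<Rightarrow> real"
  assumes "g differentiable (at x)"
  shows "(g has_derivative (\<lambda>h. grad g x \<bullet> h)) (at x)"
proof -
  have D: "(g has_derivative frechet_derivative g (at x)) (at x)"
    using assms frechet_derivative_works by blast
  then interpret bounded_linear "frechet_derivative g (at x)"
    by (rule has_derivative_bounded_linear)
  have "frechet_derivative g (at x) h = grad g x \<bullet> h" for h
  proof -
    have "frechet_derivative g (at x) h = frechet_derivative g (at x) (\<Sum>i\<in>UNIV. h $ i *\<^sub>R axis i 1)"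
      by (metis (no_types) basis_expansion scalar_mult_eq_scaleR)
    also have "\<dots> = (\<Sum>i\<in>UNIV. h $ i * partial i g x)"
      by (simp add: sum scaleR partial_def)
    finally show ?thesis
      by (simp add: grad_def inner_vec_def mult.commute)
  qed
  then show ?thesis
    using D by presburger
qed

lemma grad_eqI:
  fixes g :: "real^'n \<Rightarrow> real"
  assumes "(g has_derivative (\<lambda>h. v \<bullet> h)) (at x)"
  shows "grad g x = v" "partial i g x = v $ i"
proof -
  have "frechet_derivative g (at x) = (\<lambda>h. v \<bullet> h)"
    using assms frechet_derivative_at by metis
  then have *: "partial i g x = v $ i" for i
    by (simp add: partial_def inner_axis)
  then show "grad g x = v" "partial i g x = v $ i"
    by (simp_all add: grad_def vec_eq_iff)
qed

lemma grad_nth [simp]: "grad g x $ i = partial i g x"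
  by (simp add: grad_def)

lemma Ck_on_SucD: "Ck_on (Suc k) S g \<Longrightarrow> Ck_on k S g"
proof (induction k arbitrary: g)
  case 0
  then show ?case
    by (auto intro!: continuous_at_imp_continuous_on differentiable_imp_continuous_within)
qed auto

lemma partial_cong_open:
  fixes g h :: "real^'n \<Rightarrow> real"
  assumes "open S" "x \<in> S" "\<And>y. y \<in> S \<Longrightarrow> g y = h y"
  shows "partial i g x = partial i h x"
    and "g differentiable (at x) \<longleftrightarrow> h differentiable (at x)"
proof -
  \<comment> \<open>Stated for every candidate D: \<open>frechet_derivative\<close> is a choice from
    this predicate, so the two choices agree even at points where neither function is
    differentiable.\<close>
  have *: "(g has_derivative D) (at x) \<longleftrightarrow> (h has_derivative D) (at x)" for D
    using assms by (metis has_derivative_transform_within_open)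
  then show "partial i g x = partial i h x"
    by (simp add: partial_def frechet_derivative_def)
  show "g differentiable (at x) \<longleftrightarrow> h differentiable (at x)"
    by (simp add: differentiable_def *)
qed

lemma Ck_on_cong:
  fixes g h :: "real^'n \<Rightarrow> real"
  assumes "open S" "\<And>y. y \<in> S \<Longrightarrow> g y = h y"
  shows "Ck_on k S g \<longleftrightarrow> Ck_on k S h"
  using assms(2)
proof (induction k arbitrary: g h)
  case 0
  then show ?case by (auto intro: continuous_on_eq)
next
  case (Suc k)
  have "Ck_on k S (partial i g) \<longleftrightarrow> Ck_on k S (partial i h)" for i
    by (intro Suc.IH partial_cong_open[OF assms(1)] Suc.prems)
  moreover have "g differentiable (at x) \<longleftrightarrow> h differentiable (at x)" if "x \<in> S" for x
    using partial_cong_open(2)[OF assms(1) that] Suc.prems by blast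
  ultimately show ?case by simp
qed

lemma partial_const [simp]: "partial i (\<lambda>x. c) = (\<lambda>x. 0)"
  by (simp add: partial_def fun_eq_iff)

lemma
  fixes g h :: "real^'n \<Rightarrow> real"
  assumes "g differentiable (at x)" "h differentiable (at x)"
  shows grad_add: "grad (\<lambda>x. g x + h x) x = grad g x + grad h x"
    and grad_mult: "grad (\<lambda>x. g x * h x) x = g x *\<^sub>R grad h x + h x *\<^sub>R grad g x"
    and grad_diff: "grad (\<lambda>x. g x - h x) x = grad g x - grad h x"
    and partial_add: "partial i (\<lambda>x. g x + h x) x = partial i g x + partial i h x"
    and partial_mult: "partial i (\<lambda>x. g x * h x) x = g x * partial i h x + h x * partial i g x"
    and partial_diff: "partial i (\<lambda>x. g x - h x) x = partial i g x - partial i h x"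
proof -
  note D = has_derivative_grad[OF assms(1)] has_derivative_grad[OF assms(2)]
  have a: "((\<lambda>x. g x + h x) has_derivative (\<lambda>v. (grad g x + grad h x) \<bullet> v)) (at x)"
    by (rule has_derivative_eq_rhs[OF has_derivative_add[OF D]]) (simp add: inner_add_left)
  have b: "((\<lambda>x. g x * h x) has_derivative (\<lambda>v. (g x *\<^sub>R grad h x + h x *\<^sub>R grad g x) \<bullet> v)) (at x)"
    by (rule has_derivative_eq_rhs[OF has_derivative_mult[OF D]])
      (simp add: inner_add_left algebra_simps)
  have c: "((\<lambda>x. g x - h x) has_derivative (\<lambda>v. (grad g x - grad h x) \<bullet> v)) (at x)"
    by (rule has_derivative_eq_rhs[OF has_derivative_diff[OF D]]) (simp add: inner_diff_left)
  show "grad (\<lambda>x. g x + h x) x = grad g x + grad h x"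
    "grad (\<lambda>x. g x * h x) x = g x *\<^sub>R grad h x + h x *\<^sub>R grad g x"
    "grad (\<lambda>x. g x - h x) x = grad g x - grad h x"
    "partial i (\<lambda>x. g x + h x) x = partial i g x + partial i h x"
    "partial i (\<lambda>x. g x * h x) x = g x * partial i h x + h x * partial i g x"
    "partial i (\<lambda>x. g x - h x) x = partial i g x - partial i h x"
    using grad_eqI[OF a] grad_eqI[OF b] grad_eqI[OF c] by simp_all
qed

lemma Ck_on_const: "Ck_on k S (\<lambda>x. c)"
  by (induction k arbitrary: c) (auto simp: continuous_on_const)

lemma Ck_on_add:
  assumes "open S" "Ck_on k S g" "Ck_on k S h"
  shows "Ck_on k S (\<lambda>x. g x + h x)"
  using assms(2,3)
proof (induction k arbitrary: g h)
  case 0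
  then show ?case by (auto intro: continuous_intros)
next
  case (Suc k)
  have "Ck_on k S (\<lambda>x. partial i g x + partial i h x)" for i
    using Suc by auto
  then have "Ck_on k S (partial i (\<lambda>x. g x + h x))" for i
    using Ck_on_cong[OF assms(1), of "partial i (\<lambda>x. g x + h x)"] Suc.prems
    by (simp add: partial_add)
  then show ?case using Suc.prems by (auto intro: differentiable_add)
qed

lemma Ck_on_mult:
  assumes "open S" "Ck_on k S g" "Ck_on k S h"
  shows "Ck_on k S (\<lambda>x. g x * h x)"
  using assms(2,3)
proof (induction k arbitrary: g h)
  case 0
  then show ?case by (auto intro: continuous_intros)
next
  case (Suc k)
  have "Ck_on k S (\<lambda>x. g x * partial i h x + h x * partial i g x)" for i
    using Suc.prems Suc.prems[THEN Ck_on_SucD] by (intro Ck_on_add[OF assms(1)] Suc.IH) simp_all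
  then have "Ck_on k S (partial i (\<lambda>x. g x * h x))" for i
    using Ck_on_cong[OF assms(1), of "partial i (\<lambda>x. g x * h x)"] Suc.prems
    by (simp add: partial_mult)
  then show ?case using Suc.prems by (auto intro: differentiable_mult)
qed

definition smooth :: "(real^'n \<Rightarrow> real) \<Rightarrow> bool" where
  "smooth g \<longleftrightarrow> (\<forall>k. Ck_on k UNIV g)"

text \<open>Spares formulas for higher derivatives: it is enough to exhibit a class of functions
  stable under \<open>partial\<close>. The classes used below are multiples of affine substitutions,
  the algebra \<open>flat_algebra\<close>, and the convolutions of one function with all smooth
  kernels of a given support radius.\<close>

lemma smooth_coinduct:
  assumes "g \<in> X" "\<And>h x. h \<in> X \<Longrightarrow> h differentiable (at x)"
    and "\<And>h i. h \<in> X \<Longrightarrow> partial i h \<in> X"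
  shows "smooth g"
proof -
  have "Ck_on k UNIV h" if "h \<in> X" for k h
    using that
  proof (induction k arbitrary: h)
    case 0
    then show ?case
      by (auto intro!: continuous_at_imp_continuous_on differentiable_imp_continuous_within assms(2))
  qed (auto simp: assms)
  then show ?thesis using assms(1) by (simp add: smooth_def)
qed

lemma smooth_differentiable: "smooth g \<Longrightarrow> g differentiable (at x)"
  and smooth_partial: "smooth g \<Longrightarrow> smooth (partial i g)"
  and smooth_continuous_on: "smooth g \<Longrightarrow> continuous_on S g"
proof -
  assume *: "smooth g"
  then have "Ck_on (Suc k) UNIV g" for k by (simp only: smooth_def)
  then show "g differentiable (at x)" "smooth (partial i g)"
    by (auto simp: smooth_def)
  have "Ck_on 0 UNIV g" using * by (simp only: smooth_def)
  then show "continuous_on S g" using continuous_on_subset by auto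
qed

lemma smooth_const [simp]: "smooth (\<lambda>x. c)"
  and smooth_add: "smooth g \<Longrightarrow> smooth h \<Longrightarrow> smooth (\<lambda>x. g x + h x)"
  and smooth_mult: "smooth g \<Longrightarrow> smooth h \<Longrightarrow> smooth (\<lambda>x. g x * h x)"
  by (auto simp: smooth_def intro: Ck_on_const Ck_on_add Ck_on_mult)

lemma smooth_diff: "smooth g \<Longrightarrow> smooth h \<Longrightarrow> smooth (\<lambda>x. g x - h x)"
  using smooth_add[OF _ smooth_mult[OF smooth_const[of "-1"]], of g h] by simp

lemma smooth_power: "smooth g \<Longrightarrow> smooth (\<lambda>x. g x ^ m)"
  by (induction m) (auto intro: smooth_mult)

lemma smooth_continuous_grad: "smooth g \<Longrightarrow> continuous_on S (grad g)"
  unfolding grad_def by (intro continuous_on_vec_lambda smooth_continuous_on smooth_partial)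

lemma grad_affine:
  fixes g :: "real^'n \<Rightarrow> real"
  assumes "g differentiable (at (b + c *\<^sub>R x))"
  shows "grad (\<lambda>x. g (b + c *\<^sub>R x)) x = c *\<^sub>R grad g (b + c *\<^sub>R x)"
    and "(\<lambda>x. g (b + c *\<^sub>R x)) differentiable (at x)"
proof -
  have *: "((\<lambda>x. b + c *\<^sub>R x) has_derivative (\<lambda>h. c *\<^sub>R h)) (at x)"
    by (auto intro!: derivative_eq_intros)
  have **: "((\<lambda>x. g (b + c *\<^sub>R x)) has_derivative (\<lambda>h. (c *\<^sub>R grad g (b + c *\<^sub>R x)) \<bullet> h)) (at x)"
    using has_derivative_compose[OF * has_derivative_grad[OF assms]] by simp
  show "grad (\<lambda>x. g (b + c *\<^sub>R x)) x = c *\<^sub>R grad g (b + c *\<^sub>R x)"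
    using grad_eqI(1)[OF **] .
  show "(\<lambda>x. g (b + c *\<^sub>R x)) differentiable (at x)"
    using ** differentiable_def by blast
qed

lemma smooth_affine:
  fixes g :: "real^'n \<Rightarrow> real"
  assumes "smooth g"
  shows "smooth (\<lambda>x. g (b + c *\<^sub>R x))"
\<comment> \<open>The factor \<open>a\<close> absorbs the power of \<open>c\<close> that the chain
  rule brings out at each differentiation.\<close>
proof (rule smooth_coinduct[where X = "{(\<lambda>x. a * h (b + c *\<^sub>R x)) |a h. smooth h}"], goal_cases)
  case 1
  have "(\<lambda>x. g (b + c *\<^sub>R x)) = (\<lambda>x. 1 * g (b + c *\<^sub>R x))" by simp
  then show ?case using assms by blast
next
  case (2 h x)
  then show ?case
    by (auto intro: differentiable_mult grad_affine(2)[OF smooth_differentiable])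
next
  case (3 h i)
  then obtain a k where h: "h = (\<lambda>x. a * k (b + c *\<^sub>R x))" "smooth k" by blast
  have "partial i h x = (a * c) * partial i k (b + c *\<^sub>R x)" for x
  proof -
    have d: "(\<lambda>x. k (b + c *\<^sub>R x)) differentiable (at x)"
      by (intro grad_affine(2) smooth_differentiable h)
    have "partial i (\<lambda>x. k (b + c *\<^sub>R x)) x = c * partial i k (b + c *\<^sub>R x)"
      using arg_cong[OF grad_affine(1)[OF smooth_differentiable[OF h(2)], of b c x], of "\<lambda>v. v $ i"]
      by simp
    then show ?thesis
      using partial_mult[OF _ d, of "\<lambda>x. a" i] by (simp add: h)
  qed
  then have "partial i h = (\<lambda>x. (a * c) * partial i k (b + c *\<^sub>R x))" by blast
  then show ?case using smooth_partial[OF h(2)] by blast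
qed

section \<open>Flat functions and smooth bumps\<close>

definition flat :: "nat \<Rightarrow> real \<Rightarrow> real" where
  "flat k t = (if t > 0 then exp (- inverse t) * inverse t ^ k else 0)"

text \<open>The functions exp(-1/t) t^(-k), extended by 0 to t <= 0, form a family whose derivatives
  are combinations of its own members; this replaces the usual induction for the smoothness of
  exp(-1/t).\<close>

lemma has_derivative_flat:
  "(flat k has_real_derivative (flat (k + 2) t - real k * flat (k + 1) t)) (at t)"
proof -
  consider "t > 0" | "t = 0" | "t < 0" by linarith
  then show ?thesis
  proof cases
    case 1
    have "((\<lambda>t. exp (- inverse t) * inverse t ^ k) has_real_derivative
        (flat (k + 2) t - real k * flat (k + 1) t)) (at t)"
      using 1 by (auto intro!: derivative_eq_intros simp: flat_def power2_eq_square algebra_simps)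
        (cases k; simp add: algebra_simps)
    then show ?thesis
      by (rule has_field_derivative_transform_within_open[where S = "{0<..}"])
        (use 1 in \<open>auto simp: flat_def\<close>)
  next
    case 3
    have "((\<lambda>t. 0) has_real_derivative (flat (k + 2) t - real k * flat (k + 1) t)) (at t)"
      using 3 by (auto simp: flat_def)
    then show ?thesis
      by (rule has_field_derivative_transform_within_open[where S = "{..<0}"])
        (use 3 in \<open>auto simp: flat_def\<close>)
  next
    case 2
    \<comment> \<open>With s = 1/t the right difference quotient at the origin is s^(k+1) / exp s
      for s at infinity.\<close>
    have "((\<lambda>s::real. s ^ Suc k / exp s) \<longlongrightarrow> 0) at_top"
      by (rule tendsto_power_div_exp_0)
    then have "((\<lambda>h. inverse h ^ Suc k / exp (inverse h)) \<longlongrightarrow> 0) (at_right (0::real))"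
      by (rule filterlim_compose) (rule filterlim_inverse_at_top_right)
    then have R: "((\<lambda>h. flat k h / h) \<longlongrightarrow> 0) (at_right 0)"
      by (rule Lim_transform_eventually)
        (auto simp: eventually_at_filter flat_def exp_minus field_simps)
    have L: "((\<lambda>h. flat k h / h) \<longlongrightarrow> 0) (at_left 0)"
      by (rule Lim_transform_eventually[OF tendsto_const])
        (auto simp: eventually_at_filter flat_def)
    have "((\<lambda>h. flat k h / h) \<longlongrightarrow> 0) (at 0)"
      using L R filterlim_split_at by blast
    then show ?thesis using 2 by (simp add: DERIV_def flat_def)
  qed
qed

text \<open>Generated by the radial functions flat k (r - |x|^2) and by what their partial
  derivatives bring in: the coordinates, from the inner derivative -2x, and constants. It is stable
  under \<open>partial\<close>, hence a class fit for \<open>smooth_coinduct\<close>.\<close>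

inductive_set flat_algebra :: "(real^'n \<Rightarrow> real) set" where
  const: "(\<lambda>x. c) \<in> flat_algebra"
| coord: "(\<lambda>x. x $ i) \<in> flat_algebra"
| flat: "(\<lambda>x. flat k (r - x \<bullet> x)) \<in> flat_algebra"
| add: "g \<in> flat_algebra \<Longrightarrow> h \<in> flat_algebra \<Longrightarrow> (\<lambda>x. g x + h x) \<in> flat_algebra"
| mult: "g \<in> flat_algebra \<Longrightarrow> h \<in> flat_algebra \<Longrightarrow> (\<lambda>x. g x * h x) \<in> flat_algebra"

lemma flat_algebra_partial:
  fixes g :: "real^'n \<Rightarrow> real"
  assumes "g \<in> flat_algebra"
  shows "(\<forall>x. g differentiable (at x)) \<and> partial i g \<in> flat_algebra"
  using assms
proof induction
  case (const c)
  then show ?case by (auto intro: flat_algebra.const)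
next
  case (coord j)
  have "((\<lambda>x::real^'n. x $ j) has_derivative (\<lambda>h. axis j 1 \<bullet> h)) (at x)" for x
    by (simp add: inner_axis' bounded_linear_imp_has_derivative bounded_linear_vec_nth)
  then have "partial i (\<lambda>x. x $ j) = (\<lambda>x. axis j 1 $ i)" "\<forall>x. (\<lambda>x::real^'n. x $ j) differentiable (at x)"
    by (auto simp: grad_eqI(2) differentiable_def)
  then show ?case by (auto intro: flat_algebra.const)
next
  case (flat k r)
  have "((\<lambda>x::real^'n. flat k (r - x \<bullet> x)) has_derivative
     (\<lambda>h. (((flat (k + 2) (r - x \<bullet> x) - real k * flat (k + 1) (r - x \<bullet> x)) * (-2)) *\<^sub>R x) \<bullet> h)) (at x)" for x
  proof -
    have "((\<lambda>x::real^'n. r - x \<bullet> x) has_derivative (\<lambda>h. - 2 * (x \<bullet> h))) (at x)"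
      by (auto intro!: derivative_eq_intros simp: inner_commute)
    from has_derivative_compose[OF this has_derivative_flat[of k "r - x \<bullet> x", unfolded has_field_derivative_def]]
    show ?thesis by (rule has_derivative_eq_rhs) (auto simp: fun_eq_iff algebra_simps)
  qed
  note D = this
  have "partial i (\<lambda>x::real^'n. flat k (r - x \<bullet> x)) =
     (\<lambda>x. ((flat (k + 2) (r - x \<bullet> x) + (- real k) * flat (k + 1) (r - x \<bullet> x)) * (-2)) * x $ i)"
    using grad_eqI(2)[OF D] by auto
  moreover have "\<forall>x. (\<lambda>x::real^'n. flat k (r - x \<bullet> x)) differentiable (at x)"
    using D differentiable_def by blast
  moreover have "(\<lambda>x::real^'n. ((flat (k + 2) (r - x \<bullet> x) + (- real k) * flat (k + 1) (r - x \<bullet> x)) * (-2)) * x $ i)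
      \<in> flat_algebra"
    by (intro flat_algebra.intros)
  ultimately show ?case by simp
next
  case (add g h)
  then have "partial i (\<lambda>x. g x + h x) = (\<lambda>x. partial i g x + partial i h x)"
    by (auto simp: partial_add)
  then show ?case using add by (auto intro: flat_algebra.intros differentiable_add)
next
  case (mult g h)
  then have "partial i (\<lambda>x. g x * h x) = (\<lambda>x. g x * partial i h x + h x * partial i g x)"
    by (auto simp: partial_mult)
  then show ?case using mult by (auto intro!: flat_algebra.intros differentiable_mult)
qed

lemma smooth_flat: "smooth (\<lambda>x::real^'n. flat k (r - x \<bullet> x))"
  by (rule smooth_coinduct[where X = flat_algebra]) (use flat_algebra_partial in \<open>auto intro: flat_algebra.flat\<close>)

lemma compactly_supportedI:
  fixes \<phi> :: "real^'n \<Rightarrow> real"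
  assumes "\<And>x. norm x > r \<Longrightarrow> \<phi> x = 0"
  shows "compactly_supported \<phi>"
proof -
  have "{x. \<phi> x \<noteq> 0} \<subseteq> cball 0 r" using assms by force
  then show ?thesis
    unfolding compactly_supported_def
    by (meson bounded_cball bounded_subset compact_closure)
qed

lemma compactly_supportedE:
  fixes \<phi> :: "real^'n \<Rightarrow> real"
  assumes "compactly_supported \<phi>"
  obtains r where "r > 0" "\<And>x. norm x \<ge> r \<Longrightarrow> \<phi> x = 0"
proof -
  have "bounded {x. \<phi> x \<noteq> 0}"
    using assms bounded_subset[OF compact_imp_bounded closure_subset]
    unfolding compactly_supported_def by blast
  then obtain r where "\<And>x. \<phi> x \<noteq> 0 \<Longrightarrow> norm x \<le> r" by (auto simp: bounded_iff)
  then show ?thesis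
    by (intro that[of "\<bar>r\<bar> + 1"]) fastforce+
qed

lemma Cc_infinity_iff: "\<phi> \<in> Cc_infinity \<longleftrightarrow> smooth \<phi> \<and> compactly_supported \<phi>"
  by (simp add: Cc_infinity_def smooth_def)

lemma Cc_infinity_subset_Cc1: "Cc_infinity \<subseteq> Cc1"
  unfolding Cc_infinity_def Cc1_def by blast

lemma partial_eq_0_outside:
  fixes \<phi> :: "real^'n \<Rightarrow> real"
  assumes "\<And>x. norm x > r \<Longrightarrow> \<phi> x = 0" "norm x > r"
  shows "partial i \<phi> x = 0" "grad \<phi> x = 0"
proof -
  have o: "open {x::real^'n. norm x > r}" by (intro open_Collect_less continuous_intros)
  have "partial i \<phi> x = 0" for i
    using partial_cong_open(1)[OF o, of x \<phi> "\<lambda>_. 0" i] assms by simp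
  then show "partial i \<phi> x = 0" "grad \<phi> x = 0" by (simp_all add: vec_eq_iff)
qed

lemma bump_exists:
  assumes "e > 0"
  obtains \<kappa> :: "real^'n \<Rightarrow> real" where "smooth \<kappa>" "\<And>x. \<kappa> x \<ge> 0" "\<And>x. norm x \<ge> e \<Longrightarrow> \<kappa> x = 0"
    "integrable lborel \<kappa>" "(LINT x|lborel. \<kappa> x) = 1"
proof -
  define b where "b x = flat 0 (e\<^sup>2 - x \<bullet> x)" for x :: "real^'n"
  have s: "smooth b" unfolding b_def[abs_def] by (rule smooth_flat)
  have nn: "b x \<ge> 0" for x by (simp add: b_def flat_def)
  have pos: "b x > 0 \<longleftrightarrow> norm x < e" for x
  proof -
    have "norm x < e \<longleftrightarrow> (norm x)\<^sup>2 < e\<^sup>2"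
      using assms by (simp add: power_mono_iff not_le[symmetric] del: not_le)
    then show ?thesis by (simp add: b_def flat_def dot_square_norm)
  qed
  have out: "b x = 0" if "norm x \<ge> e" for x using pos[of x] nn[of x] that by linarith
  have int: "integrable lborel b"
  proof -
    have "b = (\<lambda>x. indicator (cball 0 e) x *\<^sub>R b x)"
      using out by (fastforce simp: indicator_def fun_eq_iff)
    moreover have "integrable lborel (\<lambda>x. indicator (cball 0 e) x *\<^sub>R b x)"
      by (rule borel_integrable_compact) (auto intro: smooth_continuous_on s)
    ultimately show ?thesis by simp
  qed
  \<comment> \<open>With integral 0 the nonnegative function would vanish almost everywhere, and the
    open ball on which it is positive would be a null set.\<close>
  have I: "(LINT x|lborel. b x) > 0"
  proof (rule ccontr)
    assume "\<not> (LINT x|lborel. b x) > 0"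
    then have "(LINT x|lborel. b x) = 0"
      using integral_nonneg_AE[of b lborel] nn by (simp add: order_less_le)
    then have "AE x in lborel. b x = 0"
      using integral_nonneg_eq_0_iff_AE[OF int] nn by simp
    then have "AE x in lborel. x \<notin> ball (0::real^'n) e"
      by eventually_elim (use pos in \<open>auto simp: less_le\<close>)
    then have "ball (0::real^'n) e \<in> null_sets lborel"
      by (subst AE_iff_null_sets) auto
    then have "negligible (ball (0::real^'n) e)"
      by (simp add: negligible_iff_null_sets null_sets_completionI)
    then show False
      using assms open_not_negligible[of "ball (0::real^'n) e"] by auto
  qed
  show ?thesis
  proof (rule that[of "\<lambda>x. inverse (LINT x|lborel. b x) * b x"])
    show "smooth (\<lambda>x. inverse (LINT x|lborel. b x) * b x)" by (intro smooth_mult s smooth_const)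
  qed (use I nn out int in auto)
qed

section \<open>Mollification\<close>

text \<open>Convexity of r^p on the closed half line; the boundary cases are separate because the
  second derivative is used only at positive arguments. It serves twice: as Jensen's inequality for
  mollifications and, composed with \<open>H\<close>, for the convexity of H^p.\<close>

lemma powr_above_tangent:
  fixes a b p :: real
  assumes "p \<ge> 1" "a \<ge> 0" "b \<ge> 0"
  shows "a powr p + p * a powr (p - 1) * (b - a) \<le> b powr p"
proof -
  consider "a = 0" | "a > 0" "b = 0" | "a > 0" "b > 0" using assms by linarith
  then show ?thesis
  proof cases
    case 2
    have "a powr (p - 1) * a = a powr p"
      using 2 by (metis add.commute diff_add_cancel powr_mult_base less_imp_le mult.commute)
    then have "p * a powr (p - 1) * a = p * a powr p" by simp
    moreover have "1 * a powr p \<le> p * a powr p" using assms by (intro mult_right_mono) auto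
    ultimately have "a powr p \<le> p * a powr (p - 1) * a" by linarith
    then show ?thesis using 2 assms by simp
  next
    case 3
    have "(p * a powr (p - 1)) * (b - a) \<le> b powr p - a powr p"
    proof (rule f''_imp_f'[of "{0<..}" "\<lambda>x. x powr p" "\<lambda>x. p * x powr (p - 1)"
          "\<lambda>x. p * ((p - 1) * x powr (p - 2))"])
      show "((\<lambda>x. p * x powr (p - 1)) has_real_derivative p * ((p - 1) * x powr (p - 2))) (at x)"
        if "x \<in> {0<..}" for x
        using that by (auto intro!: derivative_eq_intros)
    qed (use 3 assms in \<open>auto intro!: derivative_eq_intros convex_real_interval\<close>)
    then show ?thesis by linarith
  qed auto
qed

lemma
  fixes t :: "'a::euclidean_space" and c :: real
  assumes c: "c \<noteq> 0"
  shows nn_integral_lborel_affine: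
      "f \<in> borel_measurable borel \<Longrightarrow>
        (\<integral>\<^sup>+x. f x \<partial>lborel) = ennreal (\<bar>c\<bar> ^ DIM('a)) * (\<integral>\<^sup>+x. f (t + c *\<^sub>R x) \<partial>lborel)"
    and integral_lborel_affine:
      "g \<in> borel_measurable borel \<Longrightarrow>
        (LINT x|lborel. g x) = \<bar>c\<bar> ^ DIM('a) *\<^sub>R (LINT x|lborel. g (t + c *\<^sub>R x) :: 'b::{banach, second_countable_topology})"
    and AE_lborel_affine:
      "Measurable.pred borel P \<Longrightarrow> AE x in lborel. P x \<Longrightarrow> AE x in lborel. P (t + c *\<^sub>R x)"
proof -
  note L = lborel_affine[OF c, of t]
  show "(\<integral>\<^sup>+x. f x \<partial>lborel) = ennreal (\<bar>c\<bar> ^ DIM('a)) * (\<integral>\<^sup>+x. f (t + c *\<^sub>R x) \<partial>lborel)"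
    if [measurable]: "f \<in> borel_measurable borel"
    by (subst L) (simp add: nn_integral_density nn_integral_distr nn_integral_cmult)
  show "(LINT x|lborel. g x) = \<bar>c\<bar> ^ DIM('a) *\<^sub>R (LINT x|lborel. g (t + c *\<^sub>R x))"
    if [measurable]: "g \<in> borel_measurable borel" for g :: "'a \<Rightarrow> 'b"
    by (subst L) (simp add: integral_density integral_distr)
  show "AE x in lborel. P (t + c *\<^sub>R x)"
    if [measurable]: "Measurable.pred borel P" and "AE x in lborel. P x"
    using that(2) c by (subst (asm) L) (simp add: AE_density AE_distr_iff)
qed

lemma mvt_grad:
  fixes g :: "real^'n \<Rightarrow> real"
  assumes "\<And>t. t \<in> {0..1} \<Longrightarrow> g differentiable (at (x + t *\<^sub>R h))"
  shows "\<exists>t\<in>{0<..<1}. g (x + h) - g x = grad g (x + t *\<^sub>R h) \<bullet> h"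
proof -
  have D: "((\<lambda>t. g (x + t *\<^sub>R h)) has_real_derivative grad g (x + t *\<^sub>R h) \<bullet> h) (at t)"
    if "0 \<le> t" "t \<le> 1" for t
  proof -
    have "((\<lambda>t. x + t *\<^sub>R h) has_derivative (\<lambda>s. s *\<^sub>R h)) (at t)"
      by (auto intro!: derivative_eq_intros)
    from has_derivative_compose[OF this has_derivative_grad[OF assms]] that
    show ?thesis by (simp add: has_field_derivative_def mult_commute_abs)
  qed
  have "\<exists>t>0. t < 1 \<and> g (x + 1 *\<^sub>R h) - g (x + 0 *\<^sub>R h) = (1 - 0) * (grad g (x + t *\<^sub>R h) \<bullet> h)"
    by (rule MVT2) (use D in auto)
  then show ?thesis by auto
qed

lemma uniformly_continuous_vanishing_outside:
  fixes G :: "real^'n \<Rightarrow> 'b::real_normed_vector"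
  assumes "continuous_on UNIV G" and out: "\<And>x. norm x > r \<Longrightarrow> G x = 0" and "e > 0"
  obtains d where "0 < d" "d \<le> 1" "\<And>x y :: real^'n. dist x y < d \<Longrightarrow> norm (G x - G y) < e"
proof -
  have "uniformly_continuous_on (cball 0 (r + 1)) G"
    using assms by (intro compact_uniformly_continuous) (auto intro: continuous_on_subset)
  then obtain d where d: "d > 0" "\<And>x y. \<lbrakk>x \<in> cball 0 (r + 1); y \<in> cball 0 (r + 1); dist x y < d\<rbrakk> \<Longrightarrow> dist (G x) (G y) < e"
    using \<open>e > 0\<close> unfolding uniformly_continuous_on_def by metis
  show ?thesis
  \<comment> \<open>At distance below 1 either both points lie in the ball of radius
    \<open>r + 1\<close>, or both lie outside the ball of radius \<open>r\<close>, where
    \<open>G\<close> vanishes.\<close>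
  proof (rule that[of "min d 1"])
    fix x y :: "real^'n" assume *: "dist x y < min d 1"
    then have xy: "norm x \<le> norm y + 1" "norm y \<le> norm x + 1"
      using norm_triangle_sub[of x y] norm_triangle_sub[of y x] by (auto simp: dist_norm norm_minus_commute)
    show "norm (G x - G y) < e"
    proof (cases "norm x \<le> r + 1 \<and> norm y \<le> r + 1")
      case True
      then show ?thesis using d(2)[of x y] * by (auto simp: dist_norm)
    next
      case False
      then have "norm x > r" "norm y > r" using xy by auto
      then show ?thesis using out \<open>e > 0\<close> by simp
    qed
  qed (use d in auto)
qed

section \<open>Convolution with a smooth kernel\<close>

definition locally_integrable :: "(real^'n \<Rightarrow> 'b::euclidean_space) \<Rightarrow> bool" where
  "locally_integrable g \<longleftrightarrow> g \<in> borel_measurable borel \<and> (\<forall>R. set_integrable lborel (cball 0 R) g)"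

definition conv :: "(real^'n \<Rightarrow> real) \<Rightarrow> (real^'n \<Rightarrow> 'b::euclidean_space) \<Rightarrow> real^'n \<Rightarrow> 'b" where
  "conv \<kappa> g x = (LINT y|lborel. \<kappa> (x - y) *\<^sub>R g y)"

lemma locally_integrable_measurable [measurable_dest]:
  "locally_integrable g \<Longrightarrow> g \<in> borel_measurable borel"
  by (simp add: locally_integrable_def)

lemma continuous_vanishing_outside_bounded:
  fixes \<kappa> :: "real^'n \<Rightarrow> 'b::real_normed_vector"
  assumes "continuous_on UNIV \<kappa>" "\<And>x. norm x > e \<Longrightarrow> \<kappa> x = 0"
  obtains B where "B > 0" "\<And>x. norm (\<kappa> x) \<le> B"
proof -
  have "compact (\<kappa> ` cball 0 e)"
    using assms by (intro compact_continuous_image) (auto intro: continuous_on_subset)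
  then obtain B where B: "B > 0" "\<And>y. y \<in> \<kappa> ` cball 0 e \<Longrightarrow> norm y \<le> B"
    using compact_imp_bounded bounded_pos by metis
  have "norm (\<kappa> x) \<le> B" for x
    by (cases "norm x \<le> e") (use B assms(2)[of x] in auto)
  with B(1) that show ?thesis by blast
qed

lemma conv_integrable:
  fixes g :: "real^'n \<Rightarrow> 'b::euclidean_space"
  assumes "continuous_on UNIV \<kappa>" "\<And>x. norm x > e \<Longrightarrow> \<kappa> x = 0" "locally_integrable g"
  shows "integrable lborel (\<lambda>y. \<kappa> (x - y) *\<^sub>R g y)"
proof -
  obtain B where B: "B > 0" "\<And>x. norm (\<kappa> x) \<le> B"
    using continuous_vanishing_outside_bounded[OF assms(1,2)] by blast
  have [measurable]: "\<kappa> \<in> borel_measurable borel" "g \<in> borel_measurable borel"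
    using assms borel_measurable_continuous_onI by (auto simp: locally_integrable_def)
  have "integrable lborel (\<lambda>y. B *\<^sub>R (indicator (cball 0 (norm x + e)) y *\<^sub>R g y))"
    using assms(3) unfolding locally_integrable_def set_integrable_def
    by (intro integrable_scaleR_right) blast
  then show ?thesis
  proof (rule Bochner_Integration.integrable_bound)
    show "AE y in lborel. norm (\<kappa> (x - y) *\<^sub>R g y) \<le> norm (B *\<^sub>R (indicator (cball 0 (norm x + e)) y *\<^sub>R g y))"
    proof (rule AE_I2)
      fix y
      show "norm (\<kappa> (x - y) *\<^sub>R g y) \<le> norm (B *\<^sub>R (indicator (cball 0 (norm x + e)) y *\<^sub>R g y))"
      proof (cases "y \<in> cball 0 (norm x + e)")
        case True
        then show ?thesis using B(2)[of "x - y"] B(1) by (auto intro: mult_right_mono)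
      next
        case False
        then have "norm (x - y) > e" using norm_triangle_ineq2[of y x] by (auto simp: norm_minus_commute)
        then show ?thesis using assms(2) by simp
      qed
    qed
  qed auto
qed

text \<open>Differentiation under the integral sign without a limit theorem: the gradient of the
  kernel is uniformly continuous, so the first-order Taylor remainder of the kernel is at most a
  small multiple of |h| uniformly in the point, and it is integrated against |u| over a fixed
  ball.\<close>

lemma conv_has_derivative:
  fixes u :: "real^'n \<Rightarrow> real"
  assumes k: "smooth \<kappa>" "\<And>x. norm x > e \<Longrightarrow> \<kappa> x = 0" and u: "locally_integrable u"
  shows "(conv \<kappa> u has_derivative (\<lambda>h. (\<chi> i. conv (partial i \<kappa>) u x) \<bullet> h)) (at x)"
  unfolding has_derivative_at_alt
proof (intro conjI allI impI)
  show "bounded_linear (\<lambda>h. (\<chi> i. conv (partial i \<kappa>) u x) \<bullet> h)"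
    by (rule bounded_linear_inner_right)
  fix \<epsilon> :: real assume "\<epsilon> > 0"
  have out': "grad \<kappa> x = 0" "partial i \<kappa> x = 0" if "norm x > e" for x i
    using partial_eq_0_outside[of e \<kappa> x] k(2) that by blast+
  \<comment> \<open>Only increments shorter than 1 are considered, so outside this ball both shifted
    kernels and the gradient of the kernel vanish.\<close>
  define K where "K = cball (0::real^'n) (norm x + e + 1)"
  define I where "I = (LINT y|lborel. indicator K y *\<^sub>R \<bar>u y\<bar>)"
  have intK: "integrable lborel (\<lambda>y. indicator K y *\<^sub>R \<bar>u y\<bar>)"
    using u integrable_abs[of lborel "\<lambda>y. indicator K y *\<^sub>R u y"]
    unfolding locally_integrable_def set_integrable_def K_def by (simp add: abs_mult)
  have I: "I \<ge> 0" unfolding I_def by (rule integral_nonneg_AE) auto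
  have [measurable]: "u \<in> borel_measurable borel" using u by measurable
  obtain d where d: "0 < d" "d \<le> 1" "\<And>x y. dist x y < d \<Longrightarrow> norm (grad \<kappa> x - grad \<kappa> y) < \<epsilon> / (I + 1)"
    using uniformly_continuous_vanishing_outside[of "grad \<kappa>" e "\<epsilon> / (I + 1)"]
      smooth_continuous_grad[OF k(1)] out'(1) \<open>\<epsilon> > 0\<close> I
    by (metis add_nonneg_pos divide_pos_pos zero_less_one)
  have taylor: "\<bar>\<kappa> (z + h) - \<kappa> z - grad \<kappa> z \<bullet> h\<bar> \<le> \<epsilon> / (I + 1) * norm h" if "norm h < d" for z h
  proof -
    obtain t where t: "t \<in> {0<..<1}" "\<kappa> (z + h) - \<kappa> z = grad \<kappa> (z + t *\<^sub>R h) \<bullet> h"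
      using mvt_grad[of \<kappa> z h] smooth_differentiable[OF k(1)] by blast
    have "\<bar>(grad \<kappa> (z + t *\<^sub>R h) - grad \<kappa> z) \<bullet> h\<bar> \<le> norm (grad \<kappa> (z + t *\<^sub>R h) - grad \<kappa> z) * norm h"
      by (rule Cauchy_Schwarz_ineq2)
    also have "norm (t *\<^sub>R h) < d"
      using t that by (auto intro: le_less_trans[OF mult_left_le_one_le])
    then have "norm (grad \<kappa> (z + t *\<^sub>R h) - grad \<kappa> z) * norm h \<le> \<epsilon> / (I + 1) * norm h"
      by (intro mult_right_mono less_imp_le[OF d(3)]) (auto simp: dist_norm)
    finally show ?thesis by (simp add: t inner_diff_left)
  qed
  show "\<exists>d>0. \<forall>y. norm (y - x) < d \<longrightarrow>
      norm (conv \<kappa> u y - conv \<kappa> u x - (\<chi> i. conv (partial i \<kappa>) u x) \<bullet> (y - x)) \<le> \<epsilon> * norm (y - x)"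
  proof (intro exI[of _ d] conjI allI impI d(1))
    fix y assume y: "norm (y - x) < d"
    define h where "h = y - x"
    have ints: "integrable lborel (\<lambda>z. \<kappa> (y - z) * u z)" "integrable lborel (\<lambda>z. \<kappa> (x - z) * u z)"
      "\<And>i. integrable lborel (\<lambda>z. partial i \<kappa> (x - z) * u z)"
      using conv_integrable[OF smooth_continuous_on[OF k(1)] k(2) u]
        conv_integrable[OF smooth_continuous_on[OF smooth_partial[OF k(1)]] out'(2) u] by simp_all
    have "conv \<kappa> u y - conv \<kappa> u x - (\<chi> i. conv (partial i \<kappa>) u x) \<bullet> h =
       (LINT z|lborel. \<kappa> (y - z) * u z) - (LINT z|lborel. \<kappa> (x - z) * u z) -
       (LINT z|lborel. (\<Sum>i\<in>UNIV. partial i \<kappa> (x - z) * u z * h $ i))"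
      by (subst Bochner_Integration.integral_sum) (auto simp: conv_def inner_vec_def ints)
    also have "\<dots> = (LINT z|lborel. \<kappa> (y - z) * u z - \<kappa> (x - z) * u z -
        (\<Sum>i\<in>UNIV. partial i \<kappa> (x - z) * u z * h $ i))"
      by (subst Bochner_Integration.integral_diff | intro ints Bochner_Integration.integrable_diff
          Bochner_Integration.integrable_sum integrable_mult_left | rule refl | simp)+
    also have "\<dots> = (LINT z|lborel. (\<kappa> (y - z) - \<kappa> (x - z) - grad \<kappa> (x - z) \<bullet> h) * u z)"
      by (rule Bochner_Integration.integral_cong)
        (auto simp: algebra_simps inner_vec_def sum_distrib_left sum_distrib_right)
    finally have eq: "conv \<kappa> u y - conv \<kappa> u x - (\<chi> i. conv (partial i \<kappa>) u x) \<bullet> h =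
      (LINT z|lborel. (\<kappa> (y - z) - \<kappa> (x - z) - grad \<kappa> (x - z) \<bullet> h) * u z)" .
    have "norm \<dots> \<le> (LINT z|lborel. (\<epsilon> / (I + 1) * norm h) * (indicator K z *\<^sub>R \<bar>u z\<bar>))"
    proof (rule Bochner_Integration.integral_norm_bound_integral)
      show "integrable lborel (\<lambda>z. (\<epsilon> / (I + 1) * norm h) * (indicator K z *\<^sub>R \<bar>u z\<bar>))"
        using intK by simp
      have [measurable]: "\<kappa> \<in> borel_measurable borel" "grad \<kappa> \<in> borel_measurable borel"
        using k smooth_continuous_on smooth_continuous_grad by (auto intro!: borel_measurable_continuous_onI)
      show bd: "norm ((\<kappa> (y - z) - \<kappa> (x - z) - grad \<kappa> (x - z) \<bullet> h) * u z)
          \<le> (\<epsilon> / (I + 1) * norm h) * (indicator K z *\<^sub>R \<bar>u z\<bar>)" for z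
      proof (cases "z \<in> K")
        case True
        have "\<bar>\<kappa> (y - z) - \<kappa> (x - z) - grad \<kappa> (x - z) \<bullet> h\<bar> \<le> \<epsilon> / (I + 1) * norm h"
          using taylor[of h "x - z"] y by (simp add: h_def algebra_simps)
        from mult_right_mono[OF this abs_ge_zero[of "u z"]] show ?thesis
          using True by (simp add: abs_mult)
      next
        case False
        then have "norm (x - z) > e + 1"
          using norm_triangle_ineq2[of z x] by (auto simp: K_def norm_minus_commute)
        moreover have "norm (y - z) > e"
          using norm_triangle_ineq2[of "x - z" "x - y"] y d calculation by (simp add: norm_minus_commute)
        ultimately show ?thesis using k(2) out' False by simp
      qed
      show "integrable lborel (\<lambda>z. (\<kappa> (y - z) - \<kappa> (x - z) - grad \<kappa> (x - z) \<bullet> h) * u z)"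
      proof (rule Bochner_Integration.integrable_bound[of _ "\<lambda>z. (\<epsilon> / (I + 1) * norm h) * (indicator K z *\<^sub>R \<bar>u z\<bar>)"])
        show "AE z in lborel. norm ((\<kappa> (y - z) - \<kappa> (x - z) - grad \<kappa> (x - z) \<bullet> h) * u z)
          \<le> norm ((\<epsilon> / (I + 1) * norm h) * (indicator K z *\<^sub>R \<bar>u z\<bar>))"
          by (rule AE_I2, rule order_trans[OF bd]) (unfold real_norm_def, rule abs_ge_self)
      qed (use intK in auto)
    qed
    also have "\<dots> = (\<epsilon> * norm h) * (I / (I + 1))"
      unfolding I_def by simp
    also have "\<dots> \<le> \<epsilon> * norm h"
      using I \<open>\<epsilon> > 0\<close> by (intro mult_left_le) auto
    finally show "norm (conv \<kappa> u y - conv \<kappa> u x - (\<chi> i. conv (partial i \<kappa>) u x) \<bullet> (y - x)) \<le> \<epsilon> * norm (y - x)"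
      using eq by (simp add: h_def)
  qed
qed

lemma
  fixes u :: "real^'n \<Rightarrow> real"
  assumes k: "smooth \<kappa>" "\<And>x. norm x > e \<Longrightarrow> \<kappa> x = 0" and u: "locally_integrable u"
  shows partial_conv: "partial i (conv \<kappa> u) = conv (partial i \<kappa>) u"
    and smooth_conv: "smooth (conv \<kappa> u)"
proof -
  have p: "partial i (conv \<kappa> u) = conv (partial i \<kappa>) u"
    if "smooth \<kappa>" "\<And>x. norm x > e \<Longrightarrow> \<kappa> x = 0" for i \<kappa>
    using grad_eqI(2)[OF conv_has_derivative[OF that u]] by auto
  show "partial i (conv \<kappa> u) = conv (partial i \<kappa>) u" by (rule p[OF k])
  show "smooth (conv \<kappa> u)"
  proof (rule smooth_coinduct[where X = "{conv \<kappa> u |\<kappa>. smooth \<kappa> \<and> (\<forall>x. norm x > e \<longrightarrow> \<kappa> x = 0)}"], goal_cases)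
    case (2 h x)
    then show ?case using conv_has_derivative[OF _ _ u] unfolding differentiable_def by blast
  next
    case (3 h i)
    then obtain k where k': "h = conv k u" "smooth k" "\<And>x. norm x > e \<Longrightarrow> k x = 0" by blast
    then have "partial i h = conv (partial i k) u" using p by blast
    moreover have "\<And>x. norm x > e \<Longrightarrow> partial i k x = 0"
      by (rule partial_eq_0_outside(1)[of e k]) (use k' in blast)+
    ultimately show ?case using smooth_partial[OF k'(2)] by blast
  qed (use k in blast)
qed

text \<open>The reflected kernel y -> kappa(x - y) is itself a test function. Its derivative in y is
  minus the derivative of the kernel, which cancels the minus sign in the definition of the weak
  gradient.\<close>

lemma grad_conv_weak:
  fixes u :: "real^'n \<Rightarrow> real" and G :: "real^'n \<Rightarrow> real^'n"
  assumes k: "smooth \<kappa>" "\<And>x. norm x > e \<Longrightarrow> \<kappa> x = 0" and u: "locally_integrable u" "locally_integrable G"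
    and weak: "\<And>\<phi> i. \<phi> \<in> Cc_infinity \<Longrightarrow>
      (LINT x|lborel. u x * partial i \<phi> x) = - (LINT x|lborel. G x $ i * \<phi> x)"
  shows "grad (conv \<kappa> u) x = conv \<kappa> G x"
proof -
  have "partial i (conv \<kappa> u) x = conv \<kappa> G x $ i" for i
  proof -
    define \<phi> where "\<phi> y = \<kappa> (x + (-1) *\<^sub>R y)" for y
    have s: "smooth \<phi>" unfolding \<phi>_def[abs_def] by (rule smooth_affine[OF k(1)])
    have "\<phi> y = 0" if "norm y > norm x + e" for y
      using that norm_triangle_ineq2[of y x] k(2)[of "x - y"] by (simp add: \<phi>_def norm_minus_commute)
    then have "compactly_supported \<phi>" by (rule compactly_supportedI)
    with s have \<phi>: "\<phi> \<in> Cc_infinity" by (simp add: Cc_infinity_iff)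
    have d: "partial i \<phi> y = - partial i \<kappa> (x - y)" for y
      using arg_cong[OF grad_affine(1)[OF smooth_differentiable[OF k(1)], of x "-1" y], of "\<lambda>v. v $ i"]
      by (simp add: \<phi>_def[abs_def])
    have "partial i (conv \<kappa> u) x = - (LINT y|lborel. u y * partial i \<phi> y)"
      by (simp add: partial_conv[OF k u(1)] conv_def d mult.commute)
    also have "\<dots> = (LINT y|lborel. G y $ i * \<phi> y)" using weak[OF \<phi>, of i] by simp
    also have "\<dots> = (LINT y|lborel. (\<kappa> (x - y) *\<^sub>R G y) $ i)"
      by (simp add: \<phi>_def mult.commute)
    also have "\<dots> = conv \<kappa> G x $ i"
      unfolding conv_def
      by (intro integral_bounded_linear bounded_linear_vec_nth conv_integrable[OF smooth_continuous_on[OF k(1)] k(2) u(2)])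
    finally show ?thesis .
  qed
  then show ?thesis by (simp add: vec_eq_iff)
qed

text \<open>Jensen's inequality for the probability density y -> kappa(x - y): the tangent to r^p at
  the mean \<open>m\<close> of |g| is integrated against the density, and its linear part integrates
  to zero.\<close>

lemma norm_conv_powr_le:
  fixes g :: "real^'n \<Rightarrow> 'b::euclidean_space"
  assumes k: "continuous_on UNIV \<kappa>" "\<And>x. norm x > e \<Longrightarrow> \<kappa> x = 0" "\<And>x. \<kappa> x \<ge> 0"
    and int: "integrable lborel (\<lambda>y. \<kappa> (x - y))" "(LINT y|lborel. \<kappa> (x - y)) = 1"
    and p: "p \<ge> 1" and g: "locally_integrable g" "locally_integrable (\<lambda>y. norm (g y) powr p)"
  shows "norm (conv \<kappa> g x) powr p \<le> conv \<kappa> (\<lambda>y. norm (g y) powr p) x"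
proof -
  have ig: "integrable lborel (\<lambda>y. \<kappa> (x - y) *\<^sub>R g y)" by (rule conv_integrable[OF k(1,2) g(1)])
  have ip: "integrable lborel (\<lambda>y. \<kappa> (x - y) * norm (g y) powr p)"
    using conv_integrable[OF k(1,2) g(2)] by simp
  have in1: "integrable lborel (\<lambda>y. \<kappa> (x - y) * norm (g y))"
    using integrable_norm[OF ig] k(3) by simp
  define m where "m = (LINT y|lborel. \<kappa> (x - y) * norm (g y))"
  have m: "m \<ge> 0" unfolding m_def using k(3) by (auto intro!: integral_nonneg_AE)
  have "norm (conv \<kappa> g x) \<le> m"
    unfolding conv_def m_def using integral_norm_bound[of lborel "\<lambda>y. \<kappa> (x - y) *\<^sub>R g y"] k(3) by simp
  then have "norm (conv \<kappa> g x) powr p \<le> m powr p"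
    using p by (intro powr_mono2) auto
  also have "\<dots> = (m powr p - p * m powr (p - 1) * m) * (LINT y|lborel. \<kappa> (x - y)) +
       (p * m powr (p - 1)) * (LINT y|lborel. \<kappa> (x - y) * norm (g y))"
    using int by (simp add: m_def)
  also have "\<dots> = (LINT y|lborel. (m powr p - p * m powr (p - 1) * m) * \<kappa> (x - y) +
       (p * m powr (p - 1)) * (\<kappa> (x - y) * norm (g y)))"
    by (subst Bochner_Integration.integral_add) (use int in1 in auto)
  also have "\<dots> \<le> (LINT y|lborel. \<kappa> (x - y) * norm (g y) powr p)"
  proof (rule integral_mono)
    fix y
    have "\<kappa> (x - y) * (m powr p + p * m powr (p - 1) * (norm (g y) - m)) \<le> \<kappa> (x - y) * norm (g y) powr p"
      by (intro mult_left_mono powr_above_tangent p m k(3)) auto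
    then show "(m powr p - p * m powr (p - 1) * m) * \<kappa> (x - y) + p * m powr (p - 1) * (\<kappa> (x - y) * norm (g y))
        \<le> \<kappa> (x - y) * norm (g y) powr p"
      by (simp add: algebra_simps)
  qed (use int in1 ip in auto)
  finally show ?thesis by (simp add: conv_def)
qed

text \<open>Measurability on the whole space provides continuous functions converging almost
  everywhere, but without domination. Truncating them and \<open>g\<close> at a level
  \<open>m\<close> gives a constant majorant on the compact set; \<open>m\<close> is chosen first,
  so that the truncation alone costs at most half of the error.\<close>

lemma continuous_L1_approx:
  fixes g :: "real^'n \<Rightarrow> 'b::euclidean_space"
  assumes [measurable]: "g \<in> borel_measurable borel" and g: "set_integrable lborel K g" and K: "compact K"
    and "e > (0::real)"
  obtains \<phi> where "continuous_on UNIV \<phi>" "(\<integral>\<^sup>+x\<in>K. ennreal (norm (g x - \<phi> x)) \<partial>lborel) \<le> ennreal e"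
proof -
  have Km [measurable]: "K \<in> sets borel" using K by (simp add: borel_compact)
  have gK: "(\<integral>\<^sup>+x. ennreal (norm (g x) * indicator K x) \<partial>lborel) < \<infinity>"
    using g unfolding set_integrable_def integrable_iff_bounded by (simp add: mult.commute)
  \<comment> \<open>The radial retraction onto the ball of radius \<open>m\<close>: it is
    continuous, increases no norm, and fixes any given vector once \<open>m\<close> is
    large.\<close>
  define P where "P m v = (real m / max (real m) (norm v)) *\<^sub>R v" for m :: nat and v :: 'b
  have cP: "continuous_on UNIV (P m)" if "m > 0" for m
    unfolding P_def using that by (auto intro!: continuous_intros)
  have P1: "norm (P m v) \<le> real m" for m v
    unfolding P_def by (cases "norm v \<le> real m") (auto simp: max_def)
  have Pconv: "(\<lambda>m. P m v) \<longlonglongrightarrow> v" for v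
  proof (rule tendsto_eventually)
    obtain N :: nat where N: "norm v < real N" using reals_Archimedean2 by blast
    have "P m v = v" if "m \<ge> N" for m
    proof -
      have "norm v < real m" using N that by (meson less_le_trans of_nat_le_iff)
      then show ?thesis
        using order.strict_trans1[OF norm_ge_zero, of v "real m"] by (simp add: P_def max_def)
    qed
    then show "\<forall>\<^sub>F m in sequentially. P m v = v" using eventually_sequentially by blast
  qed
  have P2: "norm (P m v) \<le> norm v" for m v
    unfolding P_def by (auto simp: max_def divide_le_eq_1 intro!: mult_left_le_one_le)
  have [measurable]: "(\<lambda>x. P m (g x)) \<in> borel_measurable borel" for m
    unfolding P_def by measurable
  have "(\<lambda>m. \<integral>\<^sup>+x. ennreal (norm (indicator K x *\<^sub>R g x - indicator K x *\<^sub>R P m (g x))) \<partial>lborel) \<longlonglongrightarrow> 0"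
  proof (rule nn_integral_dominated_convergence_norm[where w = "\<lambda>x. norm (g x) * indicator K x"])
    show "AE x in lborel. norm (indicator K x *\<^sub>R P j (g x)) \<le> norm (g x) * indicator K x" for j
      using P2 by (intro AE_I2) (auto simp: indicator_def)
  qed (use gK Pconv in \<open>auto intro!: tendsto_intros\<close>)
  then have "\<forall>\<^sub>F m in sequentially. (\<integral>\<^sup>+x. ennreal (norm (indicator K x *\<^sub>R g x - indicator K x *\<^sub>R P m (g x))) \<partial>lborel) < ennreal (e / 2)"
    using \<open>e > 0\<close> by (intro order_tendstoD) auto
  then have "\<forall>\<^sub>F m in sequentially. (\<integral>\<^sup>+x. ennreal (norm (indicator K x *\<^sub>R g x - indicator K x *\<^sub>R P m (g x))) \<partial>lborel) < ennreal (e / 2) \<and> m > 0"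
    using eventually_gt_at_top[of 0] eventually_conj by blast
  then obtain m where m: "m > 0" "(\<integral>\<^sup>+x. ennreal (norm (indicator K x *\<^sub>R g x - indicator K x *\<^sub>R P m (g x))) \<partial>lborel) < ennreal (e / 2)"
    using eventually_happens'[OF sequentially_bot] by blast
  have "g \<in> borel_measurable lebesgue"
    using measurable_completion[of g lborel borel] by simp
  then have "g measurable_on UNIV"
    by (simp add: measurable_on_iff_borel_measurable)
  then obtain N q where N: "negligible N" and q: "\<And>n. continuous_on UNIV (q n)" "\<And>x. x \<notin> N \<Longrightarrow> (\<lambda>n. q n x) \<longlonglongrightarrow> g x"
    unfolding measurable_on_def by auto
  have [measurable]: "q n \<in> borel_measurable borel" for n
    using q borel_measurable_continuous_onI by blast
  have [measurable]: "(\<lambda>x. P m (q n x)) \<in> borel_measurable borel" for n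
    unfolding P_def by measurable
  have AEN: "AE x in lborel. x \<notin> N"
    using N AE_not_in AE_completion_iff negligible_iff_null_sets by blast
  have "(\<lambda>n. \<integral>\<^sup>+x. ennreal (norm (indicator K x *\<^sub>R P m (g x) - indicator K x *\<^sub>R P m (q n x))) \<partial>lborel) \<longlonglongrightarrow> 0"
  proof (rule nn_integral_dominated_convergence_norm[where w = "\<lambda>x. real m * indicator K x"])
    show "AE x in lborel. norm (indicator K x *\<^sub>R P m (q j x)) \<le> real m * indicator K x" for j
      using P1 by (intro AE_I2) (auto simp: indicator_def)
    show "(\<integral>\<^sup>+x. ennreal (real m * indicator K x) \<partial>lborel) < \<infinity>"
      using emeasure_compact_finite[OF K]
      by (simp add: ennreal_mult ennreal_indicator nn_integral_cmult ennreal_mult_less_top)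
    show "AE x in lborel. (\<lambda>n. indicator K x *\<^sub>R P m (q n x)) \<longlonglongrightarrow> indicator K x *\<^sub>R P m (g x)"
      using AEN
    proof eventually_elim
      case (elim x)
      have "isCont (P m) (g x)" using cP[OF m(1)] by (simp add: continuous_on_eq_continuous_at)
      then show ?case using q(2)[OF elim] by (intro tendsto_scaleR tendsto_const isCont_tendsto_compose[of _ "P m"])
    qed
  qed auto
  then have "\<forall>\<^sub>F n in sequentially. (\<integral>\<^sup>+x. ennreal (norm (indicator K x *\<^sub>R P m (g x) - indicator K x *\<^sub>R P m (q n x))) \<partial>lborel) < ennreal (e / 2)"
    using \<open>e > 0\<close> by (intro order_tendstoD) auto
  then obtain n where n: "(\<integral>\<^sup>+x. ennreal (norm (indicator K x *\<^sub>R P m (g x) - indicator K x *\<^sub>R P m (q n x))) \<partial>lborel) < ennreal (e / 2)"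
    using eventually_happens'[OF sequentially_bot] by blast
  show ?thesis
  proof (rule that[of "\<lambda>x. P m (q n x)"])
    show "continuous_on UNIV (\<lambda>x. P m (q n x))"
      using continuous_on_compose2[OF cP[OF m(1)] q(1)] by simp
    have "(\<integral>\<^sup>+x\<in>K. ennreal (norm (g x - P m (q n x))) \<partial>lborel) \<le>
      (\<integral>\<^sup>+x. ennreal (norm (indicator K x *\<^sub>R g x - indicator K x *\<^sub>R P m (g x))) +
        ennreal (norm (indicator K x *\<^sub>R P m (g x) - indicator K x *\<^sub>R P m (q n x))) \<partial>lborel)"
    proof (rule nn_integral_mono)
      fix x
      have "norm (g x - P m (q n x)) \<le> norm (g x - P m (g x)) + norm (P m (g x) - P m (q n x))"
        using norm_triangle_ineq[of "g x - P m (g x)" "P m (g x) - P m (q n x)"] by simp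
      then show "ennreal (norm (g x - P m (q n x))) * indicator K x \<le>
        ennreal (norm (indicator K x *\<^sub>R g x - indicator K x *\<^sub>R P m (g x))) +
        ennreal (norm (indicator K x *\<^sub>R P m (g x) - indicator K x *\<^sub>R P m (q n x)))"
        by (cases "x \<in> K") (simp_all flip: ennreal_plus add: ennreal_leI)
    qed
    also have "\<dots> \<le> ennreal (e / 2) + ennreal (e / 2)"
      by (subst nn_integral_add) (use m(2) n in \<open>auto intro: add_mono\<close>)
    also have "\<dots> = ennreal e" using \<open>e > 0\<close> by (simp flip: ennreal_plus)
    finally show "(\<integral>\<^sup>+x\<in>K. ennreal (norm (g x - P m (q n x))) \<partial>lborel) \<le> ennreal e" .
  qed
qed

section \<open>Continuity of translations and convergence of mollifications in L^1\<close>

lemma nn_integral_translate: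
  fixes f :: "'a::euclidean_space \<Rightarrow> ennreal"
  assumes "f \<in> borel_measurable borel"
  shows "(\<integral>\<^sup>+x. f (x - h) \<partial>lborel) = (\<integral>\<^sup>+x. f x \<partial>lborel)"
  using nn_integral_lborel_affine[of 1 f "-h"] assms by simp

lemma L1_translation_continuous:
  fixes g :: "real^'n \<Rightarrow> 'b::euclidean_space"
  assumes g: "locally_integrable g" and "e > (0::real)"
  obtains d where "d > 0" "d \<le> 1"
    "\<And>h. norm h \<le> d \<Longrightarrow> (\<integral>\<^sup>+x\<in>cball 0 R. ennreal (norm (g (x - h) - g x)) \<partial>lborel) \<le> ennreal e"
proof -
  have gm [measurable]: "g \<in> borel_measurable borel" using g by measurable
  \<comment> \<open>One unit larger than the ball of integration, so that it also contains all
    translates by at most 1.\<close>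
  define K where "K = cball (0::real^'n) (R + 1)"
  have K: "compact K" and [measurable]: "K \<in> sets borel" by (simp_all add: K_def)
  have mK: "measure lborel K \<ge> 0" "emeasure lborel K < \<infinity>"
    using emeasure_compact_finite[OF K] by auto
  obtain \<phi> where phi: "continuous_on UNIV \<phi>" "(\<integral>\<^sup>+x\<in>K. ennreal (norm (g x - \<phi> x)) \<partial>lborel) \<le> ennreal (e / 3)"
    using continuous_L1_approx[OF gm _ K, of "e / 3"] g \<open>e > 0\<close> unfolding locally_integrable_def K_def by auto
  have [measurable]: "\<phi> \<in> borel_measurable borel" using phi borel_measurable_continuous_onI by blast
  \<comment> \<open>One third of the error: \<open>s\<close> times the measure of \<open>K\<close>
    must not exceed e / 3. Adding 1 keeps the denominator positive.\<close>
  define s where "s = e / 3 / (measure lborel K + 1)"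
  have "s > 0" unfolding s_def using \<open>e > 0\<close> mK(1) by (intro divide_pos_pos) linarith+
  have "uniformly_continuous_on K \<phi>"
    by (intro compact_uniformly_continuous K continuous_on_subset[OF phi(1)]) simp
  then obtain d where d: "d > 0" "\<And>x y. x \<in> K \<Longrightarrow> y \<in> K \<Longrightarrow> dist y x < d \<Longrightarrow> dist (\<phi> y) (\<phi> x) < s"
    using \<open>s > 0\<close> unfolding uniformly_continuous_on_def by metis
  show ?thesis
  proof (rule that[of "min (d / 2) 1"])
    fix h :: "real^'n" assume h: "norm h \<le> min (d / 2) 1"
    have in1: "x - h \<in> K" "x \<in> K" if "x \<in> cball 0 R" for x
      using that h norm_triangle_ineq4[of x h] by (auto simp: K_def)
    have "(\<integral>\<^sup>+x\<in>cball 0 R. ennreal (norm (g (x - h) - g x)) \<partial>lborel) \<le>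
      (\<integral>\<^sup>+x. (ennreal (norm (g (x - h) - \<phi> (x - h))) * indicator K (x - h) + ennreal s * indicator K x) +
        ennreal (norm (g x - \<phi> x)) * indicator K x \<partial>lborel)"
    proof (rule nn_integral_mono)
      fix x
      show "ennreal (norm (g (x - h) - g x)) * indicator (cball 0 R) x \<le>
        (ennreal (norm (g (x - h) - \<phi> (x - h))) * indicator K (x - h) + ennreal s * indicator K x) +
        ennreal (norm (g x - \<phi> x)) * indicator K x"
      proof (cases "x \<in> cball 0 R")
        case True
        have "dist (x - h) x < d" using h d(1) by (simp add: dist_norm)
        then have "dist (\<phi> (x - h)) (\<phi> x) < s" using d(2)[of x "x - h"] in1[OF True] by blast
        then have "norm (g (x - h) - g x) \<le> norm (g (x - h) - \<phi> (x - h)) + s + norm (g x - \<phi> x)"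
          using norm_triangle_ineq[of "g (x - h) - \<phi> (x - h)" "(\<phi> (x - h) - \<phi> x) - (g x - \<phi> x)"]
            norm_triangle_ineq4[of "\<phi> (x - h) - \<phi> x" "g x - \<phi> x"] by (simp add: dist_norm)
        then show ?thesis using True in1[OF True] \<open>s > 0\<close> by (simp flip: ennreal_plus add: ennreal_leI)
      qed simp
    qed
    also have "\<dots> = (\<integral>\<^sup>+x. ennreal (norm (g (x - h) - \<phi> (x - h))) * indicator K (x - h) \<partial>lborel) +
        ennreal s * emeasure lborel K + (\<integral>\<^sup>+x\<in>K. ennreal (norm (g x - \<phi> x)) \<partial>lborel)"
      by (simp add: nn_integral_add nn_integral_cmult)
    also have "(\<integral>\<^sup>+x. ennreal (norm (g (x - h) - \<phi> (x - h))) * indicator K (x - h) \<partial>lborel) =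
       (\<integral>\<^sup>+x\<in>K. ennreal (norm (g x - \<phi> x)) \<partial>lborel)"
      by (rule nn_integral_translate) simp
    also have "ennreal s * emeasure lborel K \<le> ennreal (e / 3)"
    proof -
      have "ennreal s * emeasure lborel K = ennreal (s * measure lborel K)"
        using mK \<open>s > 0\<close> by (simp add: emeasure_eq_ennreal_measure ennreal_mult)
      also have "s * measure lborel K \<le> s * (measure lborel K + 1)"
        using \<open>s > 0\<close> by (intro mult_left_mono) auto
      also have "\<dots> = e / 3"
      proof -
        have "measure lborel K + 1 \<noteq> 0" using mK(1) by linarith
        from nonzero_eq_divide_eq[OF this, of s "e / 3"] show ?thesis unfolding s_def by blast
      qed
      finally show ?thesis by (simp add: ennreal_leI)
    qed
    also have "(\<integral>\<^sup>+x\<in>K. ennreal (norm (g x - \<phi> x)) \<partial>lborel) \<le> ennreal (e / 3)"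
      using phi(2) by simp
    also have "ennreal (e / 3) + ennreal (e / 3) + ennreal (e / 3) = ennreal e"
      using \<open>e > 0\<close> by (simp flip: ennreal_plus)
    finally show "(\<integral>\<^sup>+x\<in>cball 0 R. ennreal (norm (g (x - h) - g x)) \<partial>lborel) \<le> ennreal e"
      by (simp add: add_mono)
  qed (use d in auto)
qed

definition mollifier :: "real \<Rightarrow> (real^'n \<Rightarrow> real) \<Rightarrow> bool" where
  "mollifier e \<kappa> \<longleftrightarrow> smooth \<kappa> \<and> (\<forall>x. 0 \<le> \<kappa> x) \<and> (\<forall>x. norm x > e \<longrightarrow> \<kappa> x = 0) \<and>
     integrable lborel \<kappa> \<and> (LINT x|lborel. \<kappa> x) = 1"

lemma mollifier_exists: "e > 0 \<Longrightarrow> \<exists>\<kappa> :: real^'n \<Rightarrow> real. mollifier e \<kappa>"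
  by (rule bump_exists[of e]) (auto simp: mollifier_def)

lemma
  assumes "mollifier e \<kappa>"
  shows mollifier_nn_integral: "(\<integral>\<^sup>+x. ennreal (\<kappa> x) \<partial>lborel) = 1"
    and mollifier_reflect: "(LINT y|lborel. \<kappa> (x - y)) = 1" "integrable lborel (\<lambda>y. \<kappa> (x - y))"
    and mollifier_borel: "\<kappa> \<in> borel_measurable borel"
proof -
  show m [measurable]: "\<kappa> \<in> borel_measurable borel"
    using assms smooth_continuous_on unfolding mollifier_def by (blast intro: borel_measurable_continuous_onI)
  show nn: "(\<integral>\<^sup>+x. ennreal (\<kappa> x) \<partial>lborel) = 1"
    using assms unfolding mollifier_def by (subst nn_integral_eq_integral) auto
  show "(LINT y|lborel. \<kappa> (x - y)) = 1"
    using integral_lborel_affine[of "-1" \<kappa> x] assms m by (simp add: mollifier_def)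
  have "(\<integral>\<^sup>+y. ennreal (\<kappa> (x - y)) \<partial>lborel) = 1"
    using nn_integral_lborel_affine[of "-1" "\<lambda>y. ennreal (\<kappa> y)" x] nn by simp
  then show "integrable lborel (\<lambda>y. \<kappa> (x - y))"
    using assms unfolding mollifier_def by (intro integrableI_bounded) auto
qed

text \<open>The difference is the mean of g(x - z) - g(x) for the density kappa(z), so by Fubini it
  is controlled by translations of length at most d. The same \<open>d\<close> serves every
  mollifier of that radius; hence one kernel can be made to work for several functions at
  once.\<close>

lemma conv_L1_close:
  fixes g :: "real^'n \<Rightarrow> 'b::euclidean_space"
  assumes g: "locally_integrable g" and "e > (0::real)"
  obtains d where "d > 0" "d \<le> 1"
    "\<And>\<kappa>. mollifier d \<kappa> \<Longrightarrow> (\<integral>\<^sup>+x\<in>cball 0 R. ennreal (norm (conv \<kappa> g x - g x)) \<partial>lborel) \<le> ennreal e"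
proof -
  obtain d where d: "d > 0" "d \<le> 1"
    "\<And>h. norm h \<le> d \<Longrightarrow> (\<integral>\<^sup>+x\<in>cball 0 R. ennreal (norm (g (x - h) - g x)) \<partial>lborel) \<le> ennreal e"
    using L1_translation_continuous[OF assms] by blast
  have [measurable]: "g \<in> borel_measurable borel" using g by measurable
  have [measurable]: "cball (0::real^'n) R \<in> sets borel" by simp
  show ?thesis
  proof (rule that[OF d(1,2)])
    fix \<kappa> :: "real^'n \<Rightarrow> real" assume k: "mollifier d \<kappa>"
    note [measurable] = mollifier_borel[OF k]
    have k': "\<kappa> x \<ge> 0" "norm x > d \<Longrightarrow> \<kappa> x = 0" "continuous_on UNIV \<kappa>" for x
      using k smooth_continuous_on by (auto simp: mollifier_def)
    have pw: "ennreal (norm (conv \<kappa> g x - g x)) \<le> (\<integral>\<^sup>+z. ennreal (\<kappa> z) * ennreal (norm (g (x - z) - g x)) \<partial>lborel)" for x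
    proof -
      have i: "integrable lborel (\<lambda>y. \<kappa> (x - y) *\<^sub>R g y)" "integrable lborel (\<lambda>y. \<kappa> (x - y) *\<^sub>R g x)"
        using conv_integrable[OF k'(3,2) g] mollifier_reflect(2)[OF k] by auto
      have "conv \<kappa> g x - g x = (LINT y|lborel. \<kappa> (x - y) *\<^sub>R g y) - (LINT y|lborel. \<kappa> (x - y) *\<^sub>R g x)"
        using mollifier_reflect[OF k, of x] by (simp add: conv_def)
      also have "\<dots> = (LINT y|lborel. \<kappa> (x - y) *\<^sub>R (g y - g x))"
        using i by (simp add: scaleR_diff_right)
      finally have eq: "conv \<kappa> g x - g x = (LINT y|lborel. \<kappa> (x - y) *\<^sub>R (g y - g x))" .
      have "ennreal (norm (conv \<kappa> g x - g x)) \<le> (\<integral>\<^sup>+y. norm (\<kappa> (x - y) *\<^sub>R (g y - g x)) \<partial>lborel)"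
        unfolding eq by (rule integral_norm_bound_ennreal) (use i in \<open>simp add: scaleR_diff_right\<close>)
      also have "\<dots> = (\<integral>\<^sup>+z. norm (\<kappa> z *\<^sub>R (g (x - z) - g x)) \<partial>lborel)"
        using nn_integral_lborel_affine[of "-1" "\<lambda>y. ennreal (norm (\<kappa> (x - y) *\<^sub>R (g y - g x)))" x] by simp
      finally show ?thesis using k' by (simp add: ennreal_mult)
    qed
    have "(\<integral>\<^sup>+x\<in>cball 0 R. ennreal (norm (conv \<kappa> g x - g x)) \<partial>lborel) \<le>
      (\<integral>\<^sup>+x. (\<integral>\<^sup>+z. ennreal (\<kappa> z) * ennreal (norm (g (x - z) - g x)) * indicator (cball 0 R) x \<partial>lborel) \<partial>lborel)"
      using pw by (intro nn_integral_mono) (simp add: nn_integral_multc mult_right_mono)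
    also have "\<dots> = (\<integral>\<^sup>+z. (\<integral>\<^sup>+x. ennreal (\<kappa> z) * ennreal (norm (g (x - z) - g x)) * indicator (cball 0 R) x \<partial>lborel) \<partial>lborel)"
    proof (rule lborel_pair.Fubini')
      have "(\<lambda>(z, x). ennreal (\<kappa> z) * ennreal (norm (g (x - z) - g x)) * indicator (cball 0 R) x)
          \<in> borel_measurable (borel \<Otimes>\<^sub>M borel)" by measurable
      then show "(\<lambda>(z, x). ennreal (\<kappa> z) * ennreal (norm (g (x - z) - g x)) * indicator (cball 0 R) x)
          \<in> borel_measurable (lborel \<Otimes>\<^sub>M lborel)"
        by (simp cong: measurable_cong_sets sets_pair_measure_cong)
    qed
    also have "\<dots> \<le> (\<integral>\<^sup>+z. ennreal (\<kappa> z) * ennreal e \<partial>lborel)"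
    proof (rule nn_integral_mono)
      fix z
      have "(\<integral>\<^sup>+x. ennreal (\<kappa> z) * ennreal (norm (g (x - z) - g x)) * indicator (cball 0 R) x \<partial>lborel) =
         ennreal (\<kappa> z) * (\<integral>\<^sup>+x\<in>cball 0 R. ennreal (norm (g (x - z) - g x)) \<partial>lborel)"
        by (simp add: nn_integral_cmult mult.assoc)
      also have "\<dots> \<le> ennreal (\<kappa> z) * ennreal e"
        using d(3)[of z] k'(2)[of z] by (cases "norm z \<le> d") (auto intro: mult_left_mono)
      finally show "(\<integral>\<^sup>+x. ennreal (\<kappa> z) * ennreal (norm (g (x - z) - g x)) * indicator (cball 0 R) x \<partial>lborel)
        \<le> ennreal (\<kappa> z) * ennreal e" .
    qed
    also have "\<dots> = ennreal e" by (simp add: nn_integral_multc mollifier_nn_integral[OF k])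
    finally show "(\<integral>\<^sup>+x\<in>cball 0 R. ennreal (norm (conv \<kappa> g x - g x)) \<partial>lborel) \<le> ennreal e" .
  qed
qed

lemma mollifier_mono: "mollifier d \<kappa> \<Longrightarrow> d \<le> d' \<Longrightarrow> mollifier d' \<kappa>"
  by (auto simp: mollifier_def)

text \<open>Besides convergence almost everywhere, a single integrable majorant for all |grad v_k|^p
  is required, since the later limits are limits of dominated convergence. Both come from L^1 errors
  of size 2^(-k) for u, G and |G|^p: their sum is integrable, so the errors tend to 0 without
  passing to a subsequence, and Jensen's inequality gives |grad v_k|^p <= |G|^p + error.\<close>

lemma mollified_sequence:
  fixes u :: "real^'n \<Rightarrow> real" and G :: "real^'n \<Rightarrow> real^'n"
  assumes p: "p \<ge> 1" and u: "locally_integrable u" and G: "locally_integrable G"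
    and Gp: "locally_integrable (\<lambda>x. norm (G x) powr p)"
    and bd: "AE x in lborel. norm x \<le> R + 1 \<longrightarrow> \<bar>u x\<bar> \<le> C"
    and weak: "\<And>\<phi> i. \<phi> \<in> Cc_infinity \<Longrightarrow>
      (LINT x|lborel. u x * partial i \<phi> x) = - (LINT x|lborel. G x $ i * \<phi> x)"
  obtains v :: "nat \<Rightarrow> real^'n \<Rightarrow> real" and w :: "real^'n \<Rightarrow> real"
  where "\<And>k. smooth (v k)"
    and "AE x in lborel. norm x \<le> R \<longrightarrow> (\<lambda>k. v k x) \<longlonglongrightarrow> u x \<and> (\<lambda>k. grad (v k) x) \<longlonglongrightarrow> G x"
    and "\<And>k x. norm x \<le> R \<Longrightarrow> \<bar>v k x\<bar> \<le> C"
    and "AE x in lborel. norm x \<le> R \<longrightarrow> (\<forall>k. norm (grad (v k) x) powr p \<le> w x)"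
    and "integrable lborel w" "\<And>x. 0 \<le> w x"
proof -
  let ?N = "\<lambda>x. norm (G x) powr p"
  have "\<forall>k::nat. \<exists>\<kappa> :: real^'n \<Rightarrow> real. mollifier 1 \<kappa> \<and>
      (\<integral>\<^sup>+x\<in>cball 0 R. ennreal (norm (conv \<kappa> u x - u x)) \<partial>lborel) \<le> ennreal ((1/2)^k) \<and>
      (\<integral>\<^sup>+x\<in>cball 0 R. ennreal (norm (conv \<kappa> G x - G x)) \<partial>lborel) \<le> ennreal ((1/2)^k) \<and>
      (\<integral>\<^sup>+x\<in>cball 0 R. ennreal (norm (conv \<kappa> ?N x - ?N x)) \<partial>lborel) \<le> ennreal ((1/2)^k)"
  proof
    fix k :: nat
    have e: "(1/2)^k > (0::real)" by simp
    obtain d1 where d1: "d1 > 0" "d1 \<le> 1" "\<And>\<kappa>. mollifier d1 \<kappa> \<Longrightarrow>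
        (\<integral>\<^sup>+x\<in>cball 0 R. ennreal (norm (conv \<kappa> u x - u x)) \<partial>lborel) \<le> ennreal ((1/2)^k)"
      using conv_L1_close[OF u e] by blast
    obtain d2 where d2: "d2 > 0" "d2 \<le> 1" "\<And>\<kappa>. mollifier d2 \<kappa> \<Longrightarrow>
        (\<integral>\<^sup>+x\<in>cball 0 R. ennreal (norm (conv \<kappa> G x - G x)) \<partial>lborel) \<le> ennreal ((1/2)^k)"
      using conv_L1_close[OF G e] by blast
    obtain d3 where d3: "d3 > 0" "d3 \<le> 1" "\<And>\<kappa>. mollifier d3 \<kappa> \<Longrightarrow>
        (\<integral>\<^sup>+x\<in>cball 0 R. ennreal (norm (conv \<kappa> ?N x - ?N x)) \<partial>lborel) \<le> ennreal ((1/2)^k)"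
      using conv_L1_close[OF Gp e] by blast
    obtain \<kappa> :: "real^'n \<Rightarrow> real" where "mollifier (min d1 (min d2 d3)) \<kappa>"
      using mollifier_exists[of "min d1 (min d2 d3)"] d1(1) d2(1) d3(1) by auto
    then have "mollifier d1 \<kappa>" "mollifier d2 \<kappa>" "mollifier d3 \<kappa>" "mollifier 1 \<kappa>"
      using d1(2) by (auto elim!: mollifier_mono)
    then show "\<exists>\<kappa> :: real^'n \<Rightarrow> real. mollifier 1 \<kappa> \<and>
      (\<integral>\<^sup>+x\<in>cball 0 R. ennreal (norm (conv \<kappa> u x - u x)) \<partial>lborel) \<le> ennreal ((1/2)^k) \<and>
      (\<integral>\<^sup>+x\<in>cball 0 R. ennreal (norm (conv \<kappa> G x - G x)) \<partial>lborel) \<le> ennreal ((1/2)^k) \<and>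
      (\<integral>\<^sup>+x\<in>cball 0 R. ennreal (norm (conv \<kappa> ?N x - ?N x)) \<partial>lborel) \<le> ennreal ((1/2)^k)"
      using d1(3) d2(3) d3(3) by blast
  qed
  from choice[OF this] obtain \<kappa> :: "nat \<Rightarrow> real^'n \<Rightarrow> real" where k: "\<And>k. mollifier 1 (\<kappa> k)"
    and L1: "\<And>k. (\<integral>\<^sup>+x\<in>cball 0 R. ennreal (norm (conv (\<kappa> k) u x - u x)) \<partial>lborel) \<le> ennreal ((1/2)^k)"
      "\<And>k. (\<integral>\<^sup>+x\<in>cball 0 R. ennreal (norm (conv (\<kappa> k) G x - G x)) \<partial>lborel) \<le> ennreal ((1/2)^k)"
      "\<And>k. (\<integral>\<^sup>+x\<in>cball 0 R. ennreal (norm (conv (\<kappa> k) ?N x - ?N x)) \<partial>lborel) \<le> ennreal ((1/2)^k)"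
    by blast
  have k': "smooth (\<kappa> k)" "\<kappa> k x \<ge> 0" "norm x > 1 \<Longrightarrow> \<kappa> k x = 0" "continuous_on UNIV (\<kappa> k)" for k x
    using k[of k] smooth_continuous_on by (auto simp: mollifier_def)
  have sm: "smooth (conv (\<kappa> k) u)" for k by (rule smooth_conv[OF k'(1,3) u])
  have gr: "grad (conv (\<kappa> k) u) = conv (\<kappa> k) G" for k
    using grad_conv_weak[OF k'(1,3) u G weak] by blast
  have [measurable]: "u \<in> borel_measurable borel" "G \<in> borel_measurable borel"
    "cball (0::real^'n) R \<in> sets borel" "\<kappa> k \<in> borel_measurable borel" for k
    using u G mollifier_borel[OF k] by (auto simp: locally_integrable_def)
  have [measurable]: "conv (\<kappa> k) u \<in> borel_measurable borel" "conv (\<kappa> k) G \<in> borel_measurable borel"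
    "conv (\<kappa> k) ?N \<in> borel_measurable borel" for k
    unfolding conv_def by measurable
  define D where "D k x = (norm (conv (\<kappa> k) u x - u x) + norm (conv (\<kappa> k) G x - G x) +
      norm (conv (\<kappa> k) ?N x - ?N x)) * indicator (cball 0 R) x" for k x
  have D0: "D k x \<ge> 0" for k x by (simp add: D_def)
  have [measurable]: "D k \<in> borel_measurable borel" for k unfolding D_def by measurable
  have "(\<integral>\<^sup>+x. ennreal (D k x) \<partial>lborel) \<le> ennreal (3 * (1/2)^k)" for k
  proof -
    have "(\<integral>\<^sup>+x. ennreal (D k x) \<partial>lborel) =
      (\<integral>\<^sup>+x. ennreal (norm (conv (\<kappa> k) u x - u x)) * indicator (cball 0 R) x +
         ennreal (norm (conv (\<kappa> k) G x - G x)) * indicator (cball 0 R) x +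
         ennreal (norm (conv (\<kappa> k) ?N x - ?N x)) * indicator (cball 0 R) x \<partial>lborel)"
      by (intro nn_integral_cong) (simp add: D_def indicator_def)
    also have "\<dots> \<le> ennreal ((1/2)^k) + ennreal ((1/2)^k) + ennreal ((1/2)^k)"
      by (subst nn_integral_add, measurable, subst nn_integral_add, measurable) (intro add_mono L1)
    also have "\<dots> = ennreal (3 * (1/2)^k)" by (simp flip: ennreal_plus)
    finally show ?thesis .
  qed
  then have "(\<Sum>k. (\<integral>\<^sup>+x. ennreal (D k x) \<partial>lborel)) \<le> (\<Sum>k. ennreal (3 * (1/2)^k))"
    by (intro suminf_le) auto
  also have "\<dots> < \<infinity>"
  proof -
    have "summable (\<lambda>k. 3 * (1/2)^k :: real)" by (intro summable_mult summable_geometric) simp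
    then show ?thesis by (subst suminf_ennreal2) auto
  qed
  finally have fin: "(\<integral>\<^sup>+x. (\<Sum>k. ennreal (D k x)) \<partial>lborel) < \<infinity>"
    by (subst nn_integral_suminf) auto
  have "AE x in lborel. (\<Sum>k. ennreal (D k x)) \<noteq> \<infinity>"
    by (rule nn_integral_noteq_infinite) (use fin in auto)
  then have AEs: "AE x in lborel. summable (\<lambda>k. D k x)"
    by eventually_elim (auto intro!: summable_suminf_not_top D0)
  \<comment> \<open>The sum is finite only almost everywhere, and \<open>enn2real\<close> sends an
    infinite value to 0; hence the domination below also holds only almost everywhere.\<close>
  define w where "w x = ?N x * indicator (cball 0 R) x + enn2real (\<Sum>k. ennreal (D k x))" for x
  show ?thesis
  proof (rule that[of "\<lambda>k. conv (\<kappa> k) u" w])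
    show "AE x in lborel. norm x \<le> R \<longrightarrow> (\<lambda>k. conv (\<kappa> k) u x) \<longlonglongrightarrow> u x \<and> (\<lambda>k. grad (conv (\<kappa> k) u) x) \<longlonglongrightarrow> G x"
      using AEs
    proof eventually_elim
      case (elim x)
      have D: "(\<lambda>k. D k x) \<longlonglongrightarrow> 0" by (rule summable_LIMSEQ_zero[OF elim])
      show ?case
      proof (intro impI conjI)
        assume x: "norm x \<le> R"
        show "(\<lambda>k. conv (\<kappa> k) u x) \<longlonglongrightarrow> u x"
          by (rule Lim_transform_bound[THEN LIM_zero_cancel, OF _ D])
            (use x in \<open>auto simp: D_def intro!: always_eventually\<close>)
        show "(\<lambda>k. grad (conv (\<kappa> k) u) x) \<longlonglongrightarrow> G x"
          unfolding gr by (rule Lim_transform_bound[THEN LIM_zero_cancel, OF _ D])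
            (use x in \<open>auto simp: D_def intro!: always_eventually\<close>)
      qed
    qed
    show "AE x in lborel. norm x \<le> R \<longrightarrow> (\<forall>k. norm (grad (conv (\<kappa> k) u) x) powr p \<le> w x)"
      using AEs
    proof eventually_elim
      case (elim x)
      show ?case
      proof (intro impI allI)
        fix k assume x: "norm x \<le> R"
        have "norm (conv (\<kappa> k) G x) powr p \<le> conv (\<kappa> k) ?N x"
          by (rule norm_conv_powr_le[OF k'(4,3,2) mollifier_reflect(2)[OF k] mollifier_reflect(1)[OF k] p G Gp])
        also have "\<dots> \<le> ?N x + D k x"
        proof -
          have "D k x = norm (conv (\<kappa> k) u x - u x) + norm (conv (\<kappa> k) G x - G x) + norm (conv (\<kappa> k) ?N x - ?N x)"
            using x by (simp add: D_def)
          then show ?thesis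
            using norm_ge_zero[of "conv (\<kappa> k) G x - G x"] abs_ge_self[of "conv (\<kappa> k) ?N x - ?N x"]
              norm_ge_zero[of "conv (\<kappa> k) u x - u x"] unfolding real_norm_def by linarith
        qed
        also have "D k x \<le> (\<Sum>k. D k x)"
          using sum_le_suminf[OF elim, of "{k}"] D0 by simp
        also have "\<dots> = enn2real (\<Sum>k. ennreal (D k x))"
          using suminf_nonneg[OF elim] D0 elim by (subst suminf_ennreal2) auto
        finally show "norm (grad (conv (\<kappa> k) u) x) powr p \<le> w x" using x by (simp add: w_def gr)
      qed
    qed
    show "integrable lborel w"
      unfolding w_def
    proof (rule Bochner_Integration.integrable_add)
      show "integrable lborel (\<lambda>x. ?N x * indicator (cball 0 R) x)"
        using Gp by (simp add: locally_integrable_def set_integrable_def mult.commute)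
      show "integrable lborel (\<lambda>x. enn2real (\<Sum>k. ennreal (D k x)))"
      proof (rule integrableI_nonneg)
        have "(\<integral>\<^sup>+x. ennreal (enn2real (\<Sum>k. ennreal (D k x))) \<partial>lborel) \<le> (\<integral>\<^sup>+x. (\<Sum>k. ennreal (D k x)) \<partial>lborel)"
        proof (rule nn_integral_mono)
          show "ennreal (enn2real t) \<le> t" for t :: ennreal by (cases t) auto
        qed
        then show "(\<integral>\<^sup>+x. ennreal (enn2real (\<Sum>k. ennreal (D k x))) \<partial>lborel) < \<infinity>"
          using fin by (rule le_less_trans)
      qed auto
    qed
    \<comment> \<open>The kernel has radius 1, so values of \<open>u\<close> up to radius R + 1
      enter; this is why \<open>bd\<close> reaches that far.\<close>
    show "\<bar>conv (\<kappa> k) u x\<bar> \<le> C" if x: "norm x \<le> R" for k x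
    proof -
      have i: "integrable lborel (\<lambda>y. \<kappa> k (x - y) *\<^sub>R u y)"
        by (rule conv_integrable[OF k'(4,3) u])
      have "\<bar>conv (\<kappa> k) u x\<bar> \<le> (LINT y|lborel. norm (\<kappa> k (x - y) *\<^sub>R u y))"
        unfolding conv_def using integral_norm_bound[of lborel "\<lambda>y. \<kappa> k (x - y) *\<^sub>R u y"] by simp
      also have "\<dots> \<le> (LINT y|lborel. \<kappa> k (x - y) * C)"
      proof (rule integral_mono_AE)
        show "AE y in lborel. norm (\<kappa> k (x - y) *\<^sub>R u y) \<le> \<kappa> k (x - y) * C"
          using bd
        proof eventually_elim
          case (elim y)
          show ?case
          proof (cases "norm (x - y) > 1")
            case False
            then have "norm y \<le> R + 1" using norm_triangle_ineq2[of y x] x by (simp add: norm_minus_commute)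
            then show ?thesis using elim k'(2) by (simp add: abs_mult mult_left_mono)
          qed (use k'(3) in simp)
        qed
      qed (use integrable_norm[OF i] mollifier_reflect(2)[OF k] in auto)
      also have "\<dots> = C" using mollifier_reflect(1)[OF k] by simp
      finally show ?thesis .
    qed
  qed (use sm in \<open>auto simp: w_def\<close>)
qed

section \<open>The anisotropic energy\<close>

lemma Ck_on_powr:
  fixes h :: "real^'n \<Rightarrow> real"
  assumes "open S" "\<And>x. x \<in> S \<Longrightarrow> h x > 0" "Ck_on k S h"
  shows "Ck_on k S (\<lambda>x. h x powr a)"
  using assms(3)
proof (induction k arbitrary: a)
  case 0
  then show ?case using assms(2) by (force intro!: continuous_intros)
next
  case (Suc k)
  have D: "((\<lambda>x. h x powr a) has_derivative (\<lambda>v. ((a * h x powr (a - 1)) *\<^sub>R grad h x) \<bullet> v)) (at x)" if "x \<in> S" for x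
  proof -
    have "((\<lambda>y. y powr a) has_real_derivative a * h x powr (a - 1)) (at (h x))"
      using assms(2)[OF that] by (intro has_real_derivative_powr)
    then have "((\<lambda>y. y powr a) has_derivative (\<lambda>y. a * h x powr (a - 1) * y)) (at (h x))"
      by (simp add: has_field_derivative_def)
    moreover have "h differentiable (at x)" using Suc.prems that by simp
    ultimately have "((\<lambda>x. h x powr a) has_derivative (\<lambda>v. a * h x powr (a - 1) * (grad h x \<bullet> v))) (at x)"
      using has_derivative_compose[where f = h, OF has_derivative_grad] by blast
    then show ?thesis by simp
  qed
  have "Ck_on k S (\<lambda>x. a * h x powr (a - 1) * partial i h x)" for i
  proof (intro Ck_on_mult[OF assms(1)] Ck_on_const)
    show "Ck_on k S (\<lambda>x. h x powr (a - 1))" by (rule Suc.IH[OF Ck_on_SucD[OF Suc.prems]])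
    show "Ck_on k S (partial i h)" using Suc.prems by simp
  qed
  then have "Ck_on k S (partial i (\<lambda>x. h x powr a))" for i
    using Ck_on_cong[OF assms(1), of "partial i (\<lambda>x. h x powr a)"] grad_eqI(2)[OF D] by simp
  then show ?case using D by (auto simp: differentiable_def)
qed

section \<open>Homogeneous functions\<close>

lemma
  fixes g :: "real^'n \<Rightarrow> real"
  assumes hom: "\<And>t \<xi>. t > 0 \<Longrightarrow> \<xi> \<noteq> 0 \<Longrightarrow> g (t *\<^sub>R \<xi>) = t powr d * g \<xi>"
    and diff: "\<And>\<xi>. \<xi> \<noteq> 0 \<Longrightarrow> g differentiable (at \<xi>)" and "\<xi> \<noteq> 0"
  shows homogeneous_partial: "t > 0 \<Longrightarrow> partial i g (t *\<^sub>R \<xi>) = t powr (d - 1) * partial i g \<xi>"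
    and homogeneous_Euler: "\<xi> \<bullet> grad g \<xi> = d * g \<xi>"
proof -
  assume t: "t > 0"
  have "t * partial i g (0 + t *\<^sub>R \<xi>) = partial i (\<lambda>y. g (0 + t *\<^sub>R y)) \<xi>"
    using arg_cong[OF grad_affine(1)[of g 0 t \<xi>], of "\<lambda>v. v $ i"] diff t \<open>\<xi> \<noteq> 0\<close> by simp
  also have "\<dots> = partial i (\<lambda>y. t powr d * g y) \<xi>"
    by (rule partial_cong_open[of "-{0}"]) (use hom t \<open>\<xi> \<noteq> 0\<close> in auto)
  also have "\<dots> = t powr d * partial i g \<xi>"
    using partial_mult[of "\<lambda>y. t powr d" \<xi> g i] diff[OF \<open>\<xi> \<noteq> 0\<close>] by simp
  also have "t powr d = t * t powr (d - 1)"
    using t by (simp add: powr_diff)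
  finally show "partial i g (t *\<^sub>R \<xi>) = t powr (d - 1) * partial i g \<xi>"
    using t by simp
next
  have "((\<lambda>t. t *\<^sub>R \<xi>) has_derivative (\<lambda>s. s *\<^sub>R \<xi>)) (at 1)"
    by (auto intro!: derivative_eq_intros)
  from has_derivative_compose[OF this, of g "\<lambda>h. grad g \<xi> \<bullet> h"] has_derivative_grad[OF diff[OF \<open>\<xi> \<noteq> 0\<close>]]
  have "((\<lambda>t. g (t *\<^sub>R \<xi>)) has_derivative (\<lambda>s. s * (grad g \<xi> \<bullet> \<xi>))) (at 1)" by simp
  then have "((\<lambda>t. g (t *\<^sub>R \<xi>)) has_real_derivative (\<xi> \<bullet> grad g \<xi>)) (at 1)"
    by (simp add: has_field_derivative_def mult_commute_abs inner_commute)
  moreover have "((\<lambda>t. t powr d * g \<xi>) has_real_derivative (d * g \<xi>)) (at 1)"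
    by (auto intro!: derivative_eq_intros)
  then have "((\<lambda>t. g (t *\<^sub>R \<xi>)) has_real_derivative (d * g \<xi>)) (at 1)"
    by (rule has_field_derivative_transform_within_open[where S = "{0<..}"]) (use hom \<open>\<xi> \<noteq> 0\<close> in auto)
  ultimately show "\<xi> \<bullet> grad g \<xi> = d * g \<xi>" by (rule DERIV_unique)
qed

lemma homogeneous_bounded:
  fixes g :: "real^'n \<Rightarrow> real"
  assumes hom: "\<And>t \<xi>. t > 0 \<Longrightarrow> \<xi> \<noteq> 0 \<Longrightarrow> g (t *\<^sub>R \<xi>) = t powr d * g \<xi>"
    and "continuous_on (sphere 0 1) g"
  obtains B where "B \<ge> 0" "\<And>\<xi>. \<xi> \<noteq> 0 \<Longrightarrow> \<bar>g \<xi>\<bar> \<le> B * norm \<xi> powr d"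
proof -
  have "compact (g ` sphere 0 1)" using assms(2) by (intro compact_continuous_image) auto
  then obtain B where B: "B > 0" "\<And>x. x \<in> sphere 0 1 \<Longrightarrow> \<bar>g x\<bar> \<le> B"
    using compact_imp_bounded bounded_pos by (metis image_eqI real_norm_def)
  have "\<bar>g \<xi>\<bar> \<le> B * norm \<xi> powr d" if "\<xi> \<noteq> 0" for \<xi>
  proof -
    have "g \<xi> = norm \<xi> powr d * g (\<xi> /\<^sub>R norm \<xi>)"
      using hom[of "norm \<xi>" "\<xi> /\<^sub>R norm \<xi>"] that by simp
    moreover have "\<bar>g (\<xi> /\<^sub>R norm \<xi>)\<bar> \<le> B" using that by (intro B) simp
    ultimately show ?thesis
      by (simp add: abs_mult mult.commute[of B] mult_left_mono)
  qed
  then show ?thesis using that B(1) by (meson less_imp_le)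
qed

text \<open>The second difference g(x + sa + sb) - g(x + sa) - g(x + sb) + g(x) is symmetric in the
  directions a and b, and two applications of the mean value theorem express it as s^2 times a mixed
  derivative at a nearby point. Continuity of both mixed derivatives then forces them to
  agree.\<close>

lemma partial_commute:
  fixes g :: "real^'n \<Rightarrow> real"
  assumes "open S" "Ck_on 2 S g" "x \<in> S"
  shows "partial i (partial j g) x = partial j (partial i g) x"
proof -
  have C: "g differentiable (at y)" "partial a g differentiable (at y)"
    "continuous_on S (partial a (partial b g))" if "y \<in> S" for y a b
    using assms(2) that by (auto simp: eval_nat_numeral)
  obtain r where r: "r > 0" "ball x r \<subseteq> S" using assms openE by blast
  have key: "\<exists>y. dist y x < 2 * s \<and> g (x + s *\<^sub>R axis a 1 + s *\<^sub>R axis b 1) - g (x + s *\<^sub>R axis a 1) - g (x + s *\<^sub>R axis b 1) + g x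
      = s\<^sup>2 * partial b (partial a g) y" if s: "0 < s" "2 * s < r" for s a b
  proof -
    have inS: "x + t *\<^sub>R axis a 1 + t' *\<^sub>R axis b 1 \<in> S" "dist (x + t *\<^sub>R axis a 1 + t' *\<^sub>R axis b 1) x \<le> t + t'"
      if "0 \<le> t" "t \<le> s" "0 \<le> t'" "t' \<le> s" for t t'
    proof -
      show *: "dist (x + t *\<^sub>R axis a 1 + t' *\<^sub>R axis b 1) x \<le> t + t'"
        using norm_triangle_ineq[of "t *\<^sub>R axis a (1::real)" "t' *\<^sub>R axis b 1"] that
        by (simp add: dist_norm norm_axis_1)
      show "x + t *\<^sub>R axis a 1 + t' *\<^sub>R axis b 1 \<in> S"
        using r(2) * s that by (auto simp: mem_ball dist_commute)
    qed
    \<comment> \<open>The increment in direction \<open>b\<close>; its increment in direction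
      \<open>a\<close> is the second difference. The form \<open>1 *\<^sub>R y\<close> is that of
      \<open>grad_affine\<close>.\<close>
    define \<psi> where "\<psi> y = g (s *\<^sub>R axis b 1 + 1 *\<^sub>R y) - g y" for y
    have gp: "\<psi> differentiable (at (x + t *\<^sub>R axis a 1))"
       "partial a \<psi> (x + t *\<^sub>R axis a 1) = partial a g (x + t *\<^sub>R axis a 1 + s *\<^sub>R axis b 1) - partial a g (x + t *\<^sub>R axis a 1)"
      if t: "0 \<le> t" "t \<le> s" for t
    proof -
      have d1: "g differentiable at (s *\<^sub>R axis b 1 + 1 *\<^sub>R (x + t *\<^sub>R axis a 1))"
        using C(1)[OF inS(1)[of t s]] t s by (simp add: algebra_simps)
      have d2: "g differentiable at (x + t *\<^sub>R axis a 1)"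
        using C(1)[OF inS(1)[of t 0]] t s by simp
      show "\<psi> differentiable (at (x + t *\<^sub>R axis a 1))"
        unfolding \<psi>_def by (intro differentiable_diff grad_affine(2) d1 d2)
      show "partial a \<psi> (x + t *\<^sub>R axis a 1) = partial a g (x + t *\<^sub>R axis a 1 + s *\<^sub>R axis b 1) - partial a g (x + t *\<^sub>R axis a 1)"
        unfolding \<psi>_def partial_diff[OF grad_affine(2)[OF d1] d2]
        using arg_cong[OF grad_affine(1)[OF d1], of "\<lambda>v. v $ a"] by (simp add: algebra_simps)
    qed
    obtain t where t: "0 < t" "t < 1" "\<psi> (x + s *\<^sub>R axis a 1) - \<psi> x = s * partial a \<psi> (x + (t * s) *\<^sub>R axis a 1)"
      using mvt_grad[of \<psi> x "s *\<^sub>R axis a 1"] gp(1) s by (auto simp: inner_axis mult_le_cancel_right1)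
    have ts: "0 \<le> t * s" "t * s \<le> s" using t s by (auto simp: mult_le_cancel_right1)
    have "partial a g differentiable at (x + (t * s) *\<^sub>R axis a 1 + t' *\<^sub>R (s *\<^sub>R axis b 1))" if "t' \<in> {0..1}" for t'
      using C(2)[OF inS(1)[of "t * s" "t' * s"]] ts s that by (simp add: mult_le_cancel_right1)
    then obtain t' where t': "0 < t'" "t' < 1" "partial a g (x + (t * s) *\<^sub>R axis a 1 + s *\<^sub>R axis b 1) - partial a g (x + (t * s) *\<^sub>R axis a 1)
       = s * partial b (partial a g) (x + (t * s) *\<^sub>R axis a 1 + (t' * s) *\<^sub>R axis b 1)"
      using mvt_grad[of "partial a g" "x + (t * s) *\<^sub>R axis a 1" "s *\<^sub>R axis b 1"] by (auto simp: inner_axis)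
    show ?thesis
    proof (intro exI conjI)
      have "t * s + t' * s < 1 * s + 1 * s"
        using t t' s by (intro add_strict_mono mult_strict_right_mono) auto
      moreover have "0 \<le> t' * s" "t' * s \<le> s" using t' s by (auto simp: mult_le_cancel_right1)
      ultimately show "dist (x + (t * s) *\<^sub>R axis a 1 + (t' * s) *\<^sub>R axis b 1) x < 2 * s"
        using inS(2)[OF ts, of "t' * s"] by simp
      have "\<psi> (x + s *\<^sub>R axis a 1) - \<psi> x = s * (s * partial b (partial a g) (x + (t * s) *\<^sub>R axis a 1 + (t' * s) *\<^sub>R axis b 1))"
        using t(3) gp(2)[OF ts] t'(3) by simp
      then show "g (x + s *\<^sub>R axis a 1 + s *\<^sub>R axis b 1) - g (x + s *\<^sub>R axis a 1) - g (x + s *\<^sub>R axis b 1) + g x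
          = s\<^sup>2 * partial b (partial a g) (x + (t * s) *\<^sub>R axis a 1 + (t' * s) *\<^sub>R axis b 1)"
        by (simp add: \<psi>_def power2_eq_square algebra_simps)
    qed
  qed
  show ?thesis
  proof (rule ccontr)
    assume neq: "\<not> ?thesis"
    define e where "e = \<bar>partial i (partial j g) x - partial j (partial i g) x\<bar> / 2"
    have "e > 0" using neq by (simp add: e_def)
    have "isCont (partial a (partial b g)) x" for a b
      using C(3)[OF assms(3)] assms by (simp add: continuous_on_eq_continuous_at)
    then obtain d1 d2 where d1: "d1 > 0" "\<And>y. dist y x < d1 \<Longrightarrow> \<bar>partial i (partial j g) y - partial i (partial j g) x\<bar> < e"
      and d2: "d2 > 0" "\<And>y. dist y x < d2 \<Longrightarrow> \<bar>partial j (partial i g) y - partial j (partial i g) x\<bar> < e"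
      using \<open>e > 0\<close> unfolding continuous_at_eps_delta dist_real_def by metis
    define s where "s = min r (min d1 d2) / 4"
    have s: "0 < s" "2 * s < r" "2 * s < d1" "2 * s < d2"
      using r d1 d2 by (auto simp: s_def)
    obtain y where y: "dist y x < 2 * s" "g (x + s *\<^sub>R axis i 1 + s *\<^sub>R axis j 1) - g (x + s *\<^sub>R axis i 1) - g (x + s *\<^sub>R axis j 1) + g x
        = s\<^sup>2 * partial j (partial i g) y" using key[OF s(1,2)] by blast
    obtain y' where y': "dist y' x < 2 * s" "g (x + s *\<^sub>R axis j 1 + s *\<^sub>R axis i 1) - g (x + s *\<^sub>R axis j 1) - g (x + s *\<^sub>R axis i 1) + g x
        = s\<^sup>2 * partial i (partial j g) y'" using key[OF s(1,2)] by blast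
    have "s\<^sup>2 * partial j (partial i g) y = s\<^sup>2 * partial i (partial j g) y'"
      using y(2) y'(2) by (simp add: algebra_simps)
    then have "partial j (partial i g) y = partial i (partial j g) y'" using s by simp
    moreover have "\<bar>partial i (partial j g) y' - partial i (partial j g) x\<bar> < e" using d1(2) y' s by simp
    moreover have "\<bar>partial j (partial i g) y - partial j (partial i g) x\<bar> < e" using d2(2) y s by simp
    ultimately have "\<bar>partial i (partial j g) x - partial j (partial i g) x\<bar> < 2 * e" by linarith
    then show False by (simp add: e_def)
  qed
qed

section \<open>Convexity from principal curvatures\<close>

definition hess_apply :: "(real^'n \<Rightarrow> real) \<Rightarrow> real^'n \<Rightarrow> real^'n \<Rightarrow> real^'n" where
  "hess_apply g \<xi> v = (\<chi> j. grad (partial j g) \<xi> \<bullet> v)"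

lemma grad_has_derivative:
  fixes g :: "real^'n \<Rightarrow> real"
  assumes "\<And>j. partial j g differentiable (at \<xi>)"
  shows "(grad g has_derivative hess_apply g \<xi>) (at \<xi>)"
proof -
  have "((\<lambda>x. grad g x \<bullet> b) has_derivative (\<lambda>v. hess_apply g \<xi> v \<bullet> b)) (at \<xi>)" if bB: "b \<in> Basis" for b
  proof -
    obtain j where b: "b = axis j 1" using bB by (auto simp: Basis_vec_def)
    show ?thesis using has_derivative_grad[OF assms[of j]] by (simp add: b inner_axis hess_apply_def)
  qed
  then show ?thesis
    using has_derivative_componentwise_within[of "grad g" "hess_apply g \<xi>" \<xi> UNIV] by simp
qed

lemma hess_apply_linear: "linear (hess_apply g \<xi>)"
  by (rule linearI) (auto simp: hess_apply_def vec_eq_iff inner_add_right)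

lemma hess_apply_symmetric:
  fixes g :: "real^'n \<Rightarrow> real"
  assumes "open S" "Ck_on 2 S g" "\<xi> \<in> S"
  shows "w \<bullet> hess_apply g \<xi> v = v \<bullet> hess_apply g \<xi> w"
proof -
  have "w \<bullet> hess_apply g \<xi> v = (\<Sum>j\<in>UNIV. \<Sum>i\<in>UNIV. w $ j * (partial i (partial j g) \<xi> * v $ i))"
    by (simp add: hess_apply_def inner_vec_def sum_distrib_left)
  also have "\<dots> = (\<Sum>j\<in>UNIV. \<Sum>i\<in>UNIV. v $ i * (partial j (partial i g) \<xi> * w $ j))"
    using partial_commute[OF assms] by (simp add: mult_ac)
  also have "\<dots> = (\<Sum>i\<in>UNIV. \<Sum>j\<in>UNIV. v $ i * (partial j (partial i g) \<xi> * w $ j))"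
    by (rule sum.swap)
  also have "\<dots> = v \<bullet> hess_apply g \<xi> w"
    by (simp add: hess_apply_def inner_vec_def sum_distrib_left)
  finally show ?thesis .
qed

lemma anisotropyD:
  fixes H :: "real^'n \<Rightarrow> real"
  assumes "anisotropy H"
  shows "Ck_on 2 (- {0}) H" "continuous_on UNIV H" "H 0 = 0" "\<And>t \<xi>. t > 0 \<Longrightarrow> H (t *\<^sub>R \<xi>) = t * H \<xi>"
    "\<And>\<xi>. \<xi> \<noteq> 0 \<Longrightarrow> H \<xi> > 0" "uniformly_convex H" "\<And>\<xi>. H \<xi> \<ge> 0"
    "\<And>\<xi>. \<xi> \<noteq> 0 \<Longrightarrow> H differentiable (at \<xi>)" "\<And>\<xi> i. \<xi> \<noteq> 0 \<Longrightarrow> partial i H differentiable (at \<xi>)"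
proof -
  show *: "Ck_on 2 (- {0}) H" "continuous_on UNIV H" "H 0 = 0" "\<And>t \<xi>. t > 0 \<Longrightarrow> H (t *\<^sub>R \<xi>) = t * H \<xi>"
    "uniformly_convex H" using assms by (auto simp: anisotropy_def)
  show pos: "H \<xi> > 0" if "\<xi> \<noteq> 0" for \<xi>
  proof -
    have "\<xi> /\<^sub>R norm \<xi> \<in> sphere 0 1" using that by simp
    then have "H (\<xi> /\<^sub>R norm \<xi>) > 0" using assms unfolding anisotropy_def by blast
    then show ?thesis using *(4)[of "norm \<xi>" "\<xi> /\<^sub>R norm \<xi>"] that by simp
  qed
  show "H \<xi> \<ge> 0" for \<xi> using pos[of \<xi>] *(3) by (cases "\<xi> = 0") auto
  show "H differentiable (at \<xi>)" "partial i H differentiable (at \<xi>)" if "\<xi> \<noteq> 0" for \<xi> i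
    using *(1) that by (auto simp: eval_nat_numeral)
qed

lemma nonneg_quadratic_imp_linear_0:
  fixes B C :: real
  assumes "\<And>t. 0 \<le> 2 * t * B + t\<^sup>2 * C"
  shows "B = 0"
proof (rule ccontr)
  assume "B \<noteq> 0"
  \<comment> \<open>For t = -B / D the form equals B^2 (C - 2 D) / D^2, which is negative since C <
    D.\<close>
  define D where "D = \<bar>C\<bar> + 1"
  have D: "D > 0" "C < D" by (auto simp: D_def)
  have "0 \<le> 2 * (- B / D) * B + (- B / D)\<^sup>2 * C" by (rule assms)
  also have "\<dots> = (B\<^sup>2 / D\<^sup>2) * (C - 2 * D)"
    using D by (simp add: field_simps power2_eq_square)
  also have "\<dots> < 0" using \<open>B \<noteq> 0\<close> D by (intro mult_pos_neg) auto
  finally show False by simp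
qed

text \<open>The curvature condition concerns eigenvalues of the differential of the Gauss map, not a
  quadratic form. The link is variational: a unit tangent vector \<open>v0\<close> minimizing the
  Hessian form is an eigenvector of the Hessian up to a normal component, and normalizing the
  gradient removes exactly that component. Hence the minimum divided by |grad H| is a principal
  curvature, and so nonnegative.\<close>

lemma hess_apply_psd_tangent:
  fixes H :: "real^'n \<Rightarrow> real"
  assumes n: "CARD('n) \<ge> 2" and H: "anisotropy H" and \<xi>: "H \<xi> = 1" and v: "v \<bullet> grad H \<xi> = 0"
  shows "0 \<le> v \<bullet> hess_apply H \<xi> v"
proof -
  note A = anisotropyD[OF H]
  have x0: "\<xi> \<noteq> 0" using \<xi> A(3) by auto
  define g where "g = grad H \<xi>"
  define N where "N = hess_apply H \<xi>"
  interpret N: linear N unfolding N_def by (rule hess_apply_linear)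
  have sym: "w \<bullet> N v = v \<bullet> N w" for v w
    unfolding N_def by (rule hess_apply_symmetric[OF _ A(1)]) (use x0 in auto)
  have "\<xi> \<bullet> g = 1"
    using homogeneous_Euler[of H 1 \<xi>] A x0 \<xi> by (simp add: g_def)
  then have g0: "g \<noteq> 0" by auto
  define T where "T = {v. v \<bullet> g = 0} \<inter> sphere 0 1"
  have "compact T" unfolding T_def
    by (intro closed_Int_compact closed_Collect_eq continuous_intros) auto
  \<comment> \<open>A tangent direction exists because the dimension is at least 2.\<close>
  moreover have "T \<noteq> {}"
  proof -
    obtain y where y: "y \<noteq> 0" "orthogonal g y" using orthogonal_to_vector_exists[of g] n by auto
    then have "y /\<^sub>R norm y \<in> T" by (simp add: T_def orthogonal_def inner_commute)
    then show ?thesis by blast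
  qed
  moreover have "continuous_on T (\<lambda>v. v \<bullet> N v)"
    using linear_continuous_on[OF N.linear_axioms[unfolded linear_conv_bounded_linear]]
    by (intro continuous_intros)
  ultimately obtain v0 where v0: "v0 \<in> T" and min: "\<And>v. v \<in> T \<Longrightarrow> v0 \<bullet> N v0 \<le> v \<bullet> N v"
    using continuous_attains_inf[of T "\<lambda>v. v \<bullet> N v"] by blast
  define m where "m = v0 \<bullet> N v0"
  have v0': "v0 \<bullet> g = 0" "norm v0 = 1" using v0 by (auto simp: T_def)
  have q: "m * (z \<bullet> z) \<le> z \<bullet> N z" if z: "z \<bullet> g = 0" for z
  proof (cases "z = 0")
    case False
    then have "z /\<^sub>R norm z \<in> T" using z by (simp add: T_def)
    from min[OF this] have "m \<le> (z \<bullet> N z) / (norm z)\<^sup>2"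
      by (simp add: m_def N.scale power2_eq_square field_simps)
    then show ?thesis using False by (simp add: field_simps dot_square_norm)
  qed (simp add: N.zero)
  \<comment> \<open>First variation: along v0 + t w the form minus \<open>m\<close> times the
    squared norm is nonnegative and vanishes at t = 0, so its linear coefficient is 0.\<close>
  have lagrange: "w \<bullet> N v0 = m * (w \<bullet> v0)" if w: "w \<bullet> g = 0" for w
  proof -
    have "0 \<le> 2 * t * (w \<bullet> N v0 - m * (w \<bullet> v0)) + t\<^sup>2 * (w \<bullet> N w - m * (w \<bullet> w))" for t
    proof -
      have "m * ((v0 + t *\<^sub>R w) \<bullet> (v0 + t *\<^sub>R w)) \<le> (v0 + t *\<^sub>R w) \<bullet> N (v0 + t *\<^sub>R w)"
        by (rule q) (simp add: inner_add_left v0' w)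
      moreover have "v0 \<bullet> v0 = 1" using v0' by (simp add: dot_square_norm)
      ultimately show ?thesis
        using sym[of v0 w] by (simp add: N.add N.scale inner_add_left inner_add_right m_def[symmetric]
            inner_commute[of v0 w] power2_eq_square algebra_simps)
    qed
    from nonneg_quadratic_imp_linear_0[OF this] show ?thesis by simp
  qed
  \<comment> \<open>Derivative of y / |y| at y = grad H, composed with the Hessian: N h is scaled by
    1 / |g| and loses its component along the normal \<open>g\<close>.\<close>
  define P where "P h = N h /\<^sub>R norm g - ((g \<bullet> N h) / norm g ^ 3) *\<^sub>R g" for h
  have "(gauss_map H has_derivative P) (at \<xi>)"
  proof -
    have G: "(grad H has_derivative N) (at \<xi>)"
      unfolding N_def by (rule grad_has_derivative) (use A(9) x0 in blast)
    have "((\<lambda>x. inverse (norm x)) has_derivative (\<lambda>h. - ((g \<bullet> h) / norm g ^ 3))) (at g)"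
      using g0 by (auto intro!: derivative_eq_intros has_derivative_norm[OF g0] simp: fun_eq_iff sgn_div_norm power3_eq_cube field_simps inner_commute)
    from has_derivative_compose[OF G, folded g_def, OF this]
    have I: "((\<lambda>x. inverse (norm (grad H x))) has_derivative (\<lambda>h. - ((g \<bullet> N h) / norm g ^ 3))) (at \<xi>)" .
    have "((\<lambda>x. grad H x /\<^sub>R norm (grad H x)) has_derivative P) (at \<xi>)"
      by (rule has_derivative_eq_rhs[OF has_derivative_scaleR[OF I G]])
        (auto simp: P_def g_def fun_eq_iff)
    then show ?thesis by (simp add: gauss_map_def[abs_def])
  qed
  then have fd: "frechet_derivative (gauss_map H) (at \<xi>) = P" by (metis frechet_derivative_at)
  have Pv0: "P v0 = (m / norm g) *\<^sub>R v0"
  proof -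
    \<comment> \<open>What N v0 leaves after its normal part and \<open>m\<close> times
      \<open>v0\<close> are removed. It is tangent, so \<open>lagrange\<close> applies to it and
      yields z . z = 0.\<close>
    define z where "z = N v0 - ((g \<bullet> N v0) / (g \<bullet> g)) *\<^sub>R g - m *\<^sub>R v0"
    have zg: "z \<bullet> g = 0" using g0 v0' by (simp add: z_def inner_diff_left inner_commute[of g "N v0"])
    have "z \<bullet> z = z \<bullet> N v0 - ((g \<bullet> N v0) / (g \<bullet> g)) * (z \<bullet> g) - m * (z \<bullet> v0)"
      by (subst (2) z_def) (simp add: inner_diff_right)
    then have "z = 0" using zg lagrange[OF zg] by simp
    then have "N v0 = ((g \<bullet> N v0) / (g \<bullet> g)) *\<^sub>R g + m *\<^sub>R v0" by (simp add: z_def algebra_simps)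
    then have "N v0 /\<^sub>R norm g = (((g \<bullet> N v0) / (g \<bullet> g)) *\<^sub>R g + m *\<^sub>R v0) /\<^sub>R norm g" by simp
    also have "\<dots> = ((g \<bullet> N v0) / norm g ^ 3) *\<^sub>R g + (m / norm g) *\<^sub>R v0"
      by (simp add: scaleR_add_right dot_square_norm power3_eq_cube power2_eq_square field_simps)
    finally show ?thesis by (simp add: P_def)
  qed
  have "principal_curvature H \<xi> (m / norm g)"
    unfolding principal_curvature_def using v0' fd Pv0 by (intro exI[of _ v0]) (auto simp: g_def)
  moreover have "\<xi> \<in> frontier {\<eta>. H \<eta> < 1}"
  proof -
    have "open {\<eta>. H \<eta> < 1}" using A(2) by (intro open_Collect_less) (auto intro: continuous_intros)
    moreover have "\<xi> \<in> closure {\<eta>. H \<eta> < 1}"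
    proof -
      have "(\<lambda>k. (1 - 1 / real (Suc (Suc k))) *\<^sub>R \<xi>) \<longlonglongrightarrow> (1 - 0) *\<^sub>R \<xi>"
        by (intro tendsto_intros LIMSEQ_Suc[OF lim_1_over_n[where 'a = real, THEN LIMSEQ_Suc]])
      moreover have "(1 - 1 / real (Suc (Suc k))) *\<^sub>R \<xi> \<in> {\<eta>. H \<eta> < 1}" for k
      proof -
        have "0 < 1 - 1 / real (Suc (Suc k))" by (simp add: field_simps)
        from A(4)[OF this, of \<xi>] show ?thesis using \<xi> by (simp only: mem_Collect_eq) simp
      qed
      ultimately show ?thesis unfolding closure_sequential
        by (intro exI[of _ "\<lambda>k. (1 - 1 / real (Suc (Suc k))) *\<^sub>R \<xi>"]) simp
    qed
    ultimately show ?thesis using \<xi> by (simp add: frontier_def interior_open)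
  qed
  ultimately have "0 \<le> m / norm g"
    using A(6) unfolding uniformly_convex_def by (meson less_imp_le order_trans)
  then have "m \<ge> 0" using g0 by (simp add: zero_le_divide_iff)
  then have "0 \<le> m * (v \<bullet> v)" by simp
  also have "\<dots> \<le> v \<bullet> N v" using q v by (simp add: g_def)
  finally show ?thesis by (simp add: N_def)
qed

text \<open>Second derivatives of \<open>H\<close> are homogeneous of degree -1, which reduces the
  claim to the level set H = 1. There the radial direction lies in the kernel of the Hessian by
  Euler's relation, so subtracting from \<open>v\<close> the multiple of \<open>\<eta>\<close> that
  makes it tangent does not change the form.\<close>

lemma hess_apply_psd:
  fixes H :: "real^'n \<Rightarrow> real"
  assumes n: "CARD('n) \<ge> 2" and H: "anisotropy H" and \<xi>: "\<xi> \<noteq> 0"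
  shows "0 \<le> v \<bullet> hess_apply H \<xi> v"
proof -
  note A = anisotropyD[OF H]
  have hp: "partial i H (t *\<^sub>R \<eta>) = t powr 0 * partial i H \<eta>" if "t > 0" "\<eta> \<noteq> 0" for i t \<eta>
    using homogeneous_partial[of H 1 \<eta> t i] A that by simp
  have hh: "grad (partial j H) (t *\<^sub>R \<eta>) = (1 / t) *\<^sub>R grad (partial j H) \<eta>" if "t > 0" "\<eta> \<noteq> 0" for j t \<eta>
    using homogeneous_partial[of "partial j H" 0 \<eta> t] hp A(9) that
    by (simp add: vec_eq_iff powr_minus divide_inverse)
  define s where "s = H \<xi>"
  define \<eta> where "\<eta> = (1 / s) *\<^sub>R \<xi>"
  have s: "s > 0" using A(5) \<xi> by (simp add: s_def)
  have \<eta>: "H \<eta> = 1" "\<eta> \<noteq> 0" "\<xi> = s *\<^sub>R \<eta>" using s \<xi> A(4)[of "1 / s" \<xi>] by (auto simp: \<eta>_def s_def)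
  have red: "hess_apply H \<xi> v = (1 / s) *\<^sub>R hess_apply H \<eta> v"
    unfolding \<eta>(3) hess_apply_def hh[OF s \<eta>(2)] by (simp add: vec_eq_iff)
  have N0: "hess_apply H \<eta> \<eta> = 0"
    using homogeneous_Euler[of "partial _ H" 0 \<eta>] hp A(9) \<eta>(2)
    by (simp add: hess_apply_def vec_eq_iff inner_commute)
  interpret N: linear "hess_apply H \<eta>" by (rule hess_apply_linear)
  have sym: "w \<bullet> hess_apply H \<eta> v = v \<bullet> hess_apply H \<eta> w" for v w
    by (rule hess_apply_symmetric[OF _ A(1)]) (use \<eta> in auto)
  have "\<eta> \<bullet> grad H \<eta> = 1" using homogeneous_Euler[of H 1 \<eta>] A \<eta> by simp
  define w where "w = v - (v \<bullet> grad H \<eta>) *\<^sub>R \<eta>"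
  have "w \<bullet> grad H \<eta> = 0" using \<open>\<eta> \<bullet> grad H \<eta> = 1\<close> by (simp add: w_def inner_diff_left)
  then have "0 \<le> w \<bullet> hess_apply H \<eta> w" by (rule hess_apply_psd_tangent[OF n H \<eta>(1)])
  also have "\<dots> = v \<bullet> hess_apply H \<eta> v"
    using sym[of \<eta> v] by (simp add: w_def N.diff N.scale N0 inner_diff_left)
  finally show ?thesis using s by (simp add: red)
qed

text \<open>Along a segment through the origin the second derivative is not available, but there the
  inequality is trivial.\<close>

lemma anisotropy_above_tangent:
  fixes H :: "real^'n \<Rightarrow> real"
  assumes n: "CARD('n) \<ge> 2" and H: "anisotropy H" and \<xi>: "\<xi> \<noteq> 0"
  shows "grad H \<xi> \<bullet> \<eta> \<le> H \<eta>"
proof -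
  note A = anisotropyD[OF H]
  have E: "grad H \<xi> \<bullet> \<xi> = H \<xi>" using homogeneous_Euler[of H 1 \<xi>] A \<xi> by (simp add: inner_commute)
  show ?thesis
  proof (cases "\<exists>t\<in>{0..1}. \<xi> + t *\<^sub>R (\<eta> - \<xi>) = 0")
    case True
    \<comment> \<open>Here \<open>\<eta>\<close> is a nonpositive multiple of \<open>\<xi>\<close>,
      so the left side is nonpositive by Euler's relation, while \<open>H\<close> is
      nonnegative.\<close>
    then obtain t where t: "0 \<le> t" "t \<le> 1" "t *\<^sub>R \<eta> = (t - 1) *\<^sub>R \<xi>" by (auto simp: algebra_simps)
    then have "t > 0" using \<xi> by (cases "t = 0") auto
    have "t * (grad H \<xi> \<bullet> \<eta>) = (t - 1) * H \<xi>"
      using arg_cong[OF t(3), of "\<lambda>v. grad H \<xi> \<bullet> v"] E by simp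
    also have "\<dots> \<le> 0" using t A(7)[of \<xi>] by (simp add: mult_nonpos_nonneg)
    finally have "grad H \<xi> \<bullet> \<eta> \<le> 0" using \<open>t > 0\<close> by (simp add: mult_le_0_iff)
    then show ?thesis using A(7)[of \<eta>] by linarith
  next
    case False
    define v where "v = \<eta> - \<xi>"
    have ne: "\<xi> + t *\<^sub>R v \<noteq> 0" if "0 \<le> t" "t \<le> 1" for t using False that by (auto simp: v_def)
    have D: "((\<lambda>t. grad H (\<xi> + t *\<^sub>R v) \<bullet> v) has_real_derivative (v \<bullet> hess_apply H (\<xi> + t *\<^sub>R v) v)) (at t)"
      if "0 \<le> t" "t \<le> 1" for t
    proof -
      have a: "((\<lambda>t. \<xi> + t *\<^sub>R v) has_derivative (\<lambda>s. s *\<^sub>R v)) (at t)"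
        by (auto intro!: derivative_eq_intros)
      have "((\<lambda>t. grad H (\<xi> + t *\<^sub>R v)) has_derivative (\<lambda>s. hess_apply H (\<xi> + t *\<^sub>R v) (s *\<^sub>R v))) (at t)"
        by (rule has_derivative_compose[OF a grad_has_derivative]) (use A(9) ne[OF that] in blast)
      from has_derivative_inner_left[OF this, of v] show ?thesis
        by (simp add: has_field_derivative_def inner_commute mult_commute_abs linear_cmul[OF hess_apply_linear])
    qed
    obtain t where t: "0 < t" "t < 1" "H (\<xi> + v) - H \<xi> = grad H (\<xi> + t *\<^sub>R v) \<bullet> v"
      using mvt_grad[of H \<xi> v] A(8) ne by auto
    have "grad H (\<xi> + 0 *\<^sub>R v) \<bullet> v \<le> grad H (\<xi> + t *\<^sub>R v) \<bullet> v"
    proof (rule DERIV_nonneg_imp_nondecreasing[where f = "\<lambda>t. grad H (\<xi> + t *\<^sub>R v) \<bullet> v"])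
      fix s assume s: "0 \<le> s" "s \<le> t"
      then show "\<exists>y. ((\<lambda>t. grad H (\<xi> + t *\<^sub>R v) \<bullet> v) has_real_derivative y) (at s) \<and> 0 \<le> y"
        using D[of s] hess_apply_psd[OF n H ne[of s]] t by auto
    qed (use t in auto)
    then show ?thesis using t E by (simp add: v_def inner_diff_right)
  qed
qed

section \<open>The density H^p, its gradient and its second derivative\<close>

lemma
  fixes H :: "real^'n \<Rightarrow> real" and p :: real
  assumes H: "anisotropy H" and p: "p > 0"
  shows Ck_on_Hp: "Ck_on 2 (- {0}) (\<lambda>\<eta>. H \<eta> powr p)"
    and Hp_scale: "\<And>t \<xi>. t > 0 \<Longrightarrow> H (t *\<^sub>R \<xi>) powr p = t powr p * H \<xi> powr p"
    and grad_Hp: "\<And>\<xi>. \<xi> \<noteq> 0 \<Longrightarrow> grad (\<lambda>\<eta>. H \<eta> powr p) \<xi> = (p * H \<xi> powr (p - 1)) *\<^sub>R grad H \<xi>"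
    and partial_Hp_scale: "\<And>t \<xi> i. t > 0 \<Longrightarrow> \<xi> \<noteq> 0 \<Longrightarrow>
      partial i (\<lambda>\<eta>. H \<eta> powr p) (t *\<^sub>R \<xi>) = t powr (p - 1) * partial i (\<lambda>\<eta>. H \<eta> powr p) \<xi>"
    and partial2_Hp_scale: "\<And>t \<xi> i j. t > 0 \<Longrightarrow> \<xi> \<noteq> 0 \<Longrightarrow>
      partial i (partial j (\<lambda>\<eta>. H \<eta> powr p)) (t *\<^sub>R \<xi>) = t powr (p - 2) * partial i (partial j (\<lambda>\<eta>. H \<eta> powr p)) \<xi>"
    and Hp_Euler: "\<And>\<xi>. \<xi> \<noteq> 0 \<Longrightarrow> \<xi> \<bullet> grad (\<lambda>\<eta>. H \<eta> powr p) \<xi> = p * H \<xi> powr p"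
    and partial_Hp_Euler: "\<And>\<xi> j. \<xi> \<noteq> 0 \<Longrightarrow> \<xi> \<bullet> grad (partial j (\<lambda>\<eta>. H \<eta> powr p)) \<xi> = (p - 1) * partial j (\<lambda>\<eta>. H \<eta> powr p) \<xi>"
proof -
  note A = anisotropyD[OF H]
  show C: "Ck_on 2 (- {0}) (\<lambda>\<eta>. H \<eta> powr p)"
    using A by (intro Ck_on_powr) auto
  then have d: "(\<lambda>\<eta>. H \<eta> powr p) differentiable (at \<xi>)" "partial i (\<lambda>\<eta>. H \<eta> powr p) differentiable (at \<xi>)"
    if "\<xi> \<noteq> 0" for \<xi> i using that by (auto simp: eval_nat_numeral)
  show s: "H (t *\<^sub>R \<xi>) powr p = t powr p * H \<xi> powr p" if "t > 0" for t \<xi>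
    using A(4,7) that by (simp add: powr_mult)
  show ps: "partial i (\<lambda>\<eta>. H \<eta> powr p) (t *\<^sub>R \<xi>) = t powr (p - 1) * partial i (\<lambda>\<eta>. H \<eta> powr p) \<xi>"
    if "t > 0" "\<xi> \<noteq> 0" for t \<xi> i
    by (rule homogeneous_partial[where g = "\<lambda>\<eta>. H \<eta> powr p"]) (use s d that in auto)
  show "partial i (partial j (\<lambda>\<eta>. H \<eta> powr p)) (t *\<^sub>R \<xi>) = t powr (p - 2) * partial i (partial j (\<lambda>\<eta>. H \<eta> powr p)) \<xi>"
    if "t > 0" "\<xi> \<noteq> 0" for t \<xi> i j
    using homogeneous_partial[where g = "partial j (\<lambda>\<eta>. H \<eta> powr p)" and d = "p - 1" and \<xi> = \<xi> and t = t and i = i]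
      ps d that by simp
  show "\<xi> \<bullet> grad (\<lambda>\<eta>. H \<eta> powr p) \<xi> = p * H \<xi> powr p" if "\<xi> \<noteq> 0" for \<xi>
    by (rule homogeneous_Euler) (use s d that in auto)
  show "\<xi> \<bullet> grad (partial j (\<lambda>\<eta>. H \<eta> powr p)) \<xi> = (p - 1) * partial j (\<lambda>\<eta>. H \<eta> powr p) \<xi>" if "\<xi> \<noteq> 0" for \<xi> j
    by (rule homogeneous_Euler) (use ps d that in auto)
  show "grad (\<lambda>\<eta>. H \<eta> powr p) \<xi> = (p * H \<xi> powr (p - 1)) *\<^sub>R grad H \<xi>" if "\<xi> \<noteq> 0" for \<xi>
  proof -
    have "((\<lambda>y. y powr p) has_real_derivative p * H \<xi> powr (p - 1)) (at (H \<xi>))"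
      using A(5)[OF that] by (intro has_real_derivative_powr)
    then have "((\<lambda>y. y powr p) has_derivative (\<lambda>y. p * H \<xi> powr (p - 1) * y)) (at (H \<xi>))"
      by (simp add: has_field_derivative_def)
    then have "((\<lambda>x. H x powr p) has_derivative (\<lambda>v. p * H \<xi> powr (p - 1) * (grad H \<xi> \<bullet> v))) (at \<xi>)"
      using has_derivative_compose[where f = H, OF has_derivative_grad] A(8)[OF that] by blast
    then show ?thesis by (intro grad_eqI(1)) simp
  qed
qed

text \<open>Meant for the derivatives of H^p: continuous away from the origin, with a prescribed
  value there.\<close>

lemma borel_if_0:
  fixes g :: "real^'n \<Rightarrow> 'b::topological_space"
  assumes "continuous_on (- {0}) g"
  shows "(\<lambda>\<xi>. if \<xi> = 0 then c else g \<xi>) \<in> borel_measurable borel"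
proof -
  have "(\<lambda>\<xi>. if \<xi> \<in> {0} then c else g \<xi>) \<in> borel_measurable borel"
    by (rule borel_measurable_continuous_on_if) (use assms in auto)
  then show ?thesis by simp
qed

lemma continuous_on_partial_Hp:
  fixes H :: "real^'n \<Rightarrow> real"
  assumes H: "anisotropy H" and p: "p > 0"
  shows "continuous_on (- {0}) (partial i (\<lambda>\<eta>. H \<eta> powr p))"
  by (intro continuous_at_imp_continuous_on ballI differentiable_imp_continuous_within)
    (use Ck_on_Hp[OF H p] in \<open>auto simp: eval_nat_numeral\<close>)

text \<open>The tangent inequality for H^p / p, whose gradient is \<open>flux\<close>: that of
  \<open>H\<close> is multiplied by p H^(p-1) >= 0 and combined with that of r^p. Through it the
  curvature assumption enters the Pohozaev inequality.\<close>

lemma flux_tangent: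
  fixes H :: "real^'n \<Rightarrow> real"
  assumes "CARD('n) \<ge> 2" and H: "anisotropy H" and p: "p \<ge> 1"
  shows "H \<xi> powr p / p + flux p H \<xi> \<bullet> (\<eta> - \<xi>) \<le> H \<eta> powr p / p"
proof (cases "\<xi> = 0")
  case True
  then show ?thesis using anisotropyD(3)[OF H] p by (simp add: flux_def)
next
  case False
  note A = anisotropyD[OF H]
  have "grad H \<xi> \<bullet> (\<eta> - \<xi>) \<le> H \<eta> - H \<xi>"
    using anisotropy_above_tangent[OF assms(1) H False, of \<eta>] homogeneous_Euler[of H 1 \<xi>] A False
    by (simp add: inner_diff_right inner_commute)
  then have "p * H \<xi> powr (p - 1) * (grad H \<xi> \<bullet> (\<eta> - \<xi>)) \<le> p * H \<xi> powr (p - 1) * (H \<eta> - H \<xi>)"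
    using p by (intro mult_left_mono) auto
  also have "\<dots> \<le> H \<eta> powr p - H \<xi> powr p"
    using powr_above_tangent[OF p A(7) A(7), of \<xi> \<eta>] by linarith
  finally have "H \<xi> powr p + p * (H \<xi> powr (p - 1) * (grad H \<xi> \<bullet> (\<eta> - \<xi>))) \<le> H \<eta> powr p" by simp
  from divide_right_mono[OF this, of p] show ?thesis using p False grad_Hp[OF H, of p \<xi>]
    by (simp add: flux_def add_divide_distrib)
qed

lemma flux_inner:
  assumes H: "anisotropy H" and p: "p > 0"
  shows "flux p H \<xi> \<bullet> \<xi> = H \<xi> powr p"
  using Hp_Euler[OF H p, of \<xi>] p anisotropyD(3)[OF H] by (auto simp: flux_def inner_commute)

lemma flux_bound:
  fixes H :: "real^'n \<Rightarrow> real"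
  assumes H: "anisotropy H" and p: "p > 0"
  obtains C where "C > 0" "\<And>\<xi>. norm (flux p H \<xi>) \<le> C * norm \<xi> powr (p - 1)"
proof -
  let ?\<Phi> = "\<lambda>\<eta>. H \<eta> powr p"
  have "\<exists>B\<ge>0. \<forall>\<xi>. \<xi> \<noteq> 0 \<longrightarrow> \<bar>partial i ?\<Phi> \<xi>\<bar> \<le> B * norm \<xi> powr (p - 1)" for i
  proof -
    have c: "continuous_on (sphere 0 1) (partial i ?\<Phi>)"
      by (rule continuous_on_subset[OF continuous_on_partial_Hp[OF H p]]) auto
    show ?thesis
    proof (rule homogeneous_bounded[where g = "partial i ?\<Phi>" and d = "p - 1", OF _ c])
      fix B assume "B \<ge> 0" "\<And>\<xi>. \<xi> \<noteq> 0 \<Longrightarrow> \<bar>partial i ?\<Phi> \<xi>\<bar> \<le> B * norm \<xi> powr (p - 1)"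
      then show ?thesis by blast
    qed (rule partial_Hp_scale[OF H p])
  qed
  then obtain B where B: "\<And>i. B i \<ge> 0" "\<And>i \<xi>. \<xi> \<noteq> 0 \<Longrightarrow> \<bar>partial i ?\<Phi> \<xi>\<bar> \<le> B i * norm \<xi> powr (p - 1)"
    by metis
  define C where "C = sum B UNIV / p + 1"
  show ?thesis
  proof (rule that[of C])
    show "C > 0" using B(1) p by (simp add: C_def sum_nonneg add_nonneg_pos)
    fix \<xi> :: "real^'n"
    show "norm (flux p H \<xi>) \<le> C * norm \<xi> powr (p - 1)"
    proof (cases "\<xi> = 0")
      case False
      have "norm (grad ?\<Phi> \<xi>) \<le> (\<Sum>i\<in>UNIV. \<bar>partial i ?\<Phi> \<xi>\<bar>)"
        using norm_le_l1_cart[of "grad ?\<Phi> \<xi>"] by simp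
      also have "\<dots> \<le> (\<Sum>i\<in>UNIV. B i * norm \<xi> powr (p - 1))" by (intro sum_mono B False)
      finally have *: "norm (grad ?\<Phi> \<xi>) \<le> sum B UNIV * norm \<xi> powr (p - 1)" by (simp add: sum_distrib_right)
      have "norm (flux p H \<xi>) = norm (grad ?\<Phi> \<xi>) / p" using False p by (simp add: flux_def)
      also have "\<dots> \<le> sum B UNIV * norm \<xi> powr (p - 1) / p" using * p by (intro divide_right_mono) auto
      also have "\<dots> \<le> C * norm \<xi> powr (p - 1)" by (simp add: C_def algebra_simps)
      finally show ?thesis .
    qed (simp add: flux_def)
  qed
qed

lemma flux_borel:
  fixes H :: "real^'n \<Rightarrow> real"
  assumes H: "anisotropy H" and p: "p > 0"
  shows "flux p H \<in> borel_measurable borel"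
proof -
  let ?\<Phi> = "\<lambda>\<eta>. H \<eta> powr p"
  have "continuous_on (- {0}) (partial i ?\<Phi>)" for i
    by (rule continuous_on_partial_Hp[OF H p])
  then have "continuous_on (- {0}) (\<lambda>\<xi>. (1 / p) *\<^sub>R grad ?\<Phi> \<xi>)"
    unfolding grad_def by (intro continuous_intros)
  from borel_if_0[OF this, of 0] show ?thesis by (simp add: flux_def[abs_def])
qed

lemma Hp_bounds:
  fixes H :: "real^'n \<Rightarrow> real"
  assumes H: "anisotropy H" and p: "p > 0"
  obtains c C where "c > 0" "C > 0" "\<And>\<xi>. c * norm \<xi> powr p \<le> H \<xi> powr p" "\<And>\<xi>. H \<xi> powr p \<le> C * norm \<xi> powr p"
proof -
  note A = anisotropyD[OF H]
  have c: "continuous_on (sphere 0 1) H" using A(2) by (rule continuous_on_subset) simp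
  have ne: "sphere (0::real^'n) 1 \<noteq> {}" by simp
  obtain x0 where x0: "x0 \<in> sphere 0 1" "\<And>y. y \<in> sphere 0 1 \<Longrightarrow> H x0 \<le> H y"
    using continuous_attains_inf[OF compact_sphere ne c] by auto
  obtain x1 where x1: "x1 \<in> sphere 0 1" "\<And>y. y \<in> sphere 0 1 \<Longrightarrow> H y \<le> H x1"
    using continuous_attains_sup[OF compact_sphere ne c] by auto
  have pos: "H x0 > 0" "H x1 > 0" using A(5)[of x0] A(5)[of x1] x0(1) x1(1) by fastforce+
  have b: "H x0 powr p * norm \<xi> powr p \<le> H \<xi> powr p \<and> H \<xi> powr p \<le> H x1 powr p * norm \<xi> powr p" for \<xi>
  proof (cases "\<xi> = 0")
    case False
    then have s: "\<xi> /\<^sub>R norm \<xi> \<in> sphere 0 1" by simp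
    have e: "H \<xi> = norm \<xi> * H (\<xi> /\<^sub>R norm \<xi>)" using A(4)[of "norm \<xi>" "\<xi> /\<^sub>R norm \<xi>"] False by simp
    have "H x0 powr p \<le> H (\<xi> /\<^sub>R norm \<xi>) powr p" "H (\<xi> /\<^sub>R norm \<xi>) powr p \<le> H x1 powr p"
      using x0(2)[OF s] x1(2)[OF s] pos p A(7) by (auto intro!: powr_mono2)
    then show ?thesis unfolding e using A(7)[of "\<xi> /\<^sub>R norm \<xi>"]
      by (simp add: powr_mult mult.commute[of "H x0 powr p"] mult.commute[of "H x1 powr p"] mult_left_mono)
  qed (use A(3) in simp)
  show ?thesis by (rule that[of "H x0 powr p" "H x1 powr p"]) (use b pos in auto)
qed

text \<open>The power \<open>r\<^bsup>p - 2\<^esup>\<close>, corrected at \<open>p = 2\<close>, \<open>r = 0\<close> where \<open>powr\<close> gives \<open>0\<close>.\<close>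

definition pw :: "real \<Rightarrow> real \<Rightarrow> real" where
  "pw p r = (if p = 2 then 1 else r powr (p - 2))"

text \<open>The second derivative of H^p / p as a bilinear form, with the matrix convention at the
  origin built in. In this form Euler's relations, and the expansion of the quadratic form at the
  gradient of u psi, become short.\<close>

definition hform :: "real \<Rightarrow> (real^'n \<Rightarrow> real) \<Rightarrow> real^'n^'n \<Rightarrow> real^'n \<Rightarrow> real^'n \<Rightarrow> real^'n \<Rightarrow> real" where
  "hform p H A0 \<xi> a b = (\<Sum>i\<in>UNIV. \<Sum>j\<in>UNIV. (1 / p) * hess_Hp p H A0 \<xi> $ i $ j * a $ i * b $ j)"

lemma hform_add_left: "hform p H A0 \<xi> (a + a') b = hform p H A0 \<xi> a b + hform p H A0 \<xi> a' b"
  and hform_add_right: "hform p H A0 \<xi> a (b + b') = hform p H A0 \<xi> a b + hform p H A0 \<xi> a b'"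
  and hform_scale_left: "hform p H A0 \<xi> (c *\<^sub>R a) b = c * hform p H A0 \<xi> a b"
  and hform_scale_right: "hform p H A0 \<xi> a (c *\<^sub>R b) = c * hform p H A0 \<xi> a b"
     apply (simp_all only: hform_def vector_add_component vector_scaleR_component distrib_left distrib_right sum.distrib)
   apply (simp_all add: sum_distrib_left mult_ac)
  done

text \<open>The gradient of H^p is homogeneous of degree p - 1, so its derivative in the direction
  of the base point is p - 1 times itself. Exchanging the two slots uses the symmetry of second
  derivatives. At the origin both sides are 0 whatever the conventional matrix, because one slot
  holds the vector 0.\<close>

lemma
  fixes H :: "real^'n \<Rightarrow> real"
  assumes H: "anisotropy H" and p: "p \<ge> 2"
  shows hform_Euler_left: "hform p H A0 \<xi> \<xi> b = (p - 1) * (flux p H \<xi> \<bullet> b)"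
    and hform_Euler_right: "hform p H A0 \<xi> b \<xi> = (p - 1) * (flux p H \<xi> \<bullet> b)"
proof -
  let ?\<Phi> = "\<lambda>\<eta>. H \<eta> powr p"
  have p0: "p > 0" using p by simp
  show L: "hform p H A0 \<xi> \<xi> b = (p - 1) * (flux p H \<xi> \<bullet> b)" for b
  proof (cases "\<xi> = 0")
    case False
    have "hform p H A0 \<xi> \<xi> b = (\<Sum>i\<in>UNIV. \<Sum>j\<in>UNIV. (1 / p) * b $ j * (\<xi> $ i * partial i (partial j ?\<Phi>) \<xi>))"
      using False by (simp add: hform_def hess_Hp_def hessian_def mult_ac)
    also have "\<dots> = (\<Sum>j\<in>UNIV. \<Sum>i\<in>UNIV. (1 / p) * b $ j * (\<xi> $ i * partial i (partial j ?\<Phi>) \<xi>))"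
      by (rule sum.swap)
    also have "\<dots> = (\<Sum>j\<in>UNIV. (1 / p) * b $ j * (\<xi> \<bullet> grad (partial j ?\<Phi>) \<xi>))"
      by (simp add: inner_vec_def sum_distrib_left)
    also have "\<dots> = (p - 1) * (flux p H \<xi> \<bullet> b)"
      unfolding partial_Hp_Euler[OF H p0 False] using False
      by (simp add: flux_def inner_vec_def sum_distrib_left mult_ac)
    finally show ?thesis .
  qed (simp add: hform_def flux_def)
  have "hform p H A0 \<xi> b \<xi> = hform p H A0 \<xi> \<xi> b"
  proof (cases "\<xi> = 0")
    case False
    have sym: "partial i (partial j ?\<Phi>) \<xi> = partial j (partial i ?\<Phi>) \<xi>" for i j
      by (rule partial_commute[OF _ Ck_on_Hp[OF H p0]]) (use False in auto)
    have "hform p H A0 \<xi> b \<xi> = (\<Sum>i\<in>UNIV. \<Sum>j\<in>UNIV. (1 / p) * partial i (partial j ?\<Phi>) \<xi> * b $ i * \<xi> $ j)"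
      using False by (simp add: hform_def hess_Hp_def hessian_def)
    also have "\<dots> = (\<Sum>j\<in>UNIV. \<Sum>i\<in>UNIV. (1 / p) * partial i (partial j ?\<Phi>) \<xi> * b $ i * \<xi> $ j)"
      by (rule sum.swap)
    also have "\<dots> = hform p H A0 \<xi> \<xi> b"
      unfolding hform_def using False by (subst sym) (simp add: hess_Hp_def hessian_def mult_ac)
    finally show ?thesis .
  qed (simp add: hform_def)
  then show "hform p H A0 \<xi> b \<xi> = (p - 1) * (flux p H \<xi> \<bullet> b)" using L by simp
qed

lemma continuous_on_partial2_Hp:
  fixes H :: "real^'n \<Rightarrow> real"
  assumes H: "anisotropy H" and p: "p > 0"
  shows "continuous_on (- {0}) (partial i (partial j (\<lambda>\<eta>. H \<eta> powr p)))"
  using Ck_on_Hp[OF H p] by (auto simp: eval_nat_numeral)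

lemma hess_Hp_borel:
  fixes H :: "real^'n \<Rightarrow> real"
  assumes H: "anisotropy H" and p: "p > 0"
  shows "(\<lambda>\<xi>. hess_Hp p H A0 \<xi> $ i $ j) \<in> borel_measurable borel"
proof -
  have "(\<lambda>\<xi>. hess_Hp p H A0 \<xi> $ i $ j) =
     (\<lambda>\<xi>. if \<xi> = 0 then hess_Hp p H A0 0 $ i $ j else partial i (partial j (\<lambda>\<eta>. H \<eta> powr p)) \<xi>)"
  proof (rule ext)
    fix \<xi>
    show "hess_Hp p H A0 \<xi> $ i $ j = (if \<xi> = 0 then hess_Hp p H A0 0 $ i $ j else partial i (partial j (\<lambda>\<eta>. H \<eta> powr p)) \<xi>)"
      by (cases "\<xi> = 0") (simp, simp add: hess_Hp_def hessian_def)
  qed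
  with borel_if_0[OF continuous_on_partial2_Hp[OF H p]] show ?thesis by simp
qed

lemma hform_bound:
  fixes H :: "real^'n \<Rightarrow> real"
  assumes H: "anisotropy H" and p: "p \<ge> 2"
  obtains C where "C > 0" "\<And>\<xi> a b. \<bar>hform p H A0 \<xi> a b\<bar> \<le> C * pw p (norm \<xi>) * norm a * norm b"
proof -
  let ?\<Phi> = "\<lambda>\<eta>. H \<eta> powr p"
  have p0: "p > 0" using p by simp
  have "\<exists>B\<ge>0. \<forall>\<xi>. \<bar>hess_Hp p H A0 \<xi> $ i $ j\<bar> \<le> B * pw p (norm \<xi>)" for i j
  proof -
    have c: "continuous_on (sphere 0 1) (partial i (partial j ?\<Phi>))"
      by (rule continuous_on_subset[OF continuous_on_partial2_Hp[OF H p0]]) auto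
    obtain B where B: "B \<ge> 0" "\<And>\<xi>. \<xi> \<noteq> 0 \<Longrightarrow> \<bar>partial i (partial j ?\<Phi>) \<xi>\<bar> \<le> B * norm \<xi> powr (p - 2)"
    proof (rule homogeneous_bounded[where g = "partial i (partial j ?\<Phi>)" and d = "p - 2", OF _ c])
      fix B assume "B \<ge> 0" "\<And>\<xi>. \<xi> \<noteq> 0 \<Longrightarrow> \<bar>partial i (partial j ?\<Phi>) \<xi>\<bar> \<le> B * norm \<xi> powr (p - 2)"
      then show thesis by (rule that)
    qed (rule partial2_Hp_scale[OF H p0])
    \<comment> \<open>At the origin \<open>pw\<close> is 1 for p = 2, so the conventional matrix
      must be covered by the constant; for p > 2 both sides vanish there.\<close>
    define B' where "B' = B + \<bar>hess_Hp p H A0 0 $ i $ j\<bar>"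
    have "\<bar>hess_Hp p H A0 \<xi> $ i $ j\<bar> \<le> B' * pw p (norm \<xi>)" for \<xi>
    proof (cases "\<xi> = 0")
      case True
      show ?thesis
      proof (cases "p = 2")
        case True
        then show ?thesis using \<open>\<xi> = 0\<close> B(1) by (simp add: pw_def B'_def)
      next
        case False
        then show ?thesis using \<open>\<xi> = 0\<close> p by (simp add: hess_Hp_def pw_def)
      qed
    next
      case False
      have "\<bar>hess_Hp p H A0 \<xi> $ i $ j\<bar> = \<bar>partial i (partial j ?\<Phi>) \<xi>\<bar>"
        using False by (simp add: hess_Hp_def hessian_def)
      also have "\<dots> \<le> B * norm \<xi> powr (p - 2)" by (rule B(2)[OF False])
      also have "norm \<xi> powr (p - 2) = pw p (norm \<xi>)" using False by (simp add: pw_def)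
      also have "B * pw p (norm \<xi>) \<le> B' * pw p (norm \<xi>)"
        by (intro mult_right_mono) (auto simp: B'_def pw_def)
      finally show ?thesis .
    qed
    moreover have "B' \<ge> 0" using B by (simp add: B'_def)
    ultimately show ?thesis by blast
  qed
  then obtain B where B: "\<And>i j. B i j \<ge> 0" "\<And>i j \<xi>. \<bar>hess_Hp p H A0 \<xi> $ i $ j\<bar> \<le> B i j * pw p (norm \<xi>)"
    by metis
  define C where "C = (\<Sum>i\<in>UNIV. \<Sum>j\<in>UNIV. B i j) / p + 1"
  show ?thesis
  proof (rule that[of C])
    show "C > 0" using B(1) p by (simp add: C_def sum_nonneg add_nonneg_pos)
    fix \<xi> a b :: "real^'n"
    have pw0: "pw p (norm \<xi>) \<ge> 0" by (simp add: pw_def)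
    have "\<bar>hform p H A0 \<xi> a b\<bar> \<le> (\<Sum>i\<in>UNIV. \<Sum>j\<in>UNIV. \<bar>(1 / p) * hess_Hp p H A0 \<xi> $ i $ j * a $ i * b $ j\<bar>)"
      unfolding hform_def by (rule order_trans[OF sum_abs sum_mono[OF sum_abs]])
    also have "\<dots> \<le> (\<Sum>i\<in>UNIV. \<Sum>j\<in>UNIV. (1 / p) * (B i j * pw p (norm \<xi>)) * norm a * norm b)"
    proof (intro sum_mono)
      fix i j
      show "\<bar>(1 / p) * hess_Hp p H A0 \<xi> $ i $ j * a $ i * b $ j\<bar> \<le> (1 / p) * (B i j * pw p (norm \<xi>)) * norm a * norm b"
        unfolding abs_mult
        by (intro mult_mono component_le_norm_cart) (use p0 B pw0 in auto)
    qed
    also have "\<dots> = ((\<Sum>i\<in>UNIV. \<Sum>j\<in>UNIV. B i j) / p) * pw p (norm \<xi>) * norm a * norm b"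
      by (simp add: sum_distrib_left sum_distrib_right sum_divide_distrib mult_ac)
    also have "\<dots> \<le> C * pw p (norm \<xi>) * norm a * norm b"
      using pw0 by (intro mult_right_mono) (auto simp: C_def)
    finally show "\<bar>hform p H A0 \<xi> a b\<bar> \<le> C * pw p (norm \<xi>) * norm a * norm b" .
  qed
qed

lemma linearized_eq_hform:
  "linearized p H A0 f u \<phi> \<psi> = (LINT x|lebesgue. hform p H A0 (weak_grad u x) (grad \<phi> x) (grad \<psi> x))
     - (LINT x|lebesgue. deriv f (u x) * \<phi> x * \<psi> x)"
  by (simp add: linearized_def hform_def)

section \<open>The nonlinearity\<close>

lemma C1_differentiable_on_deriv:
  fixes f :: "real \<Rightarrow> real"
  assumes "f C1_differentiable_on UNIV"
  shows "(f has_real_derivative deriv f x) (at x)" "continuous_on UNIV (deriv f)"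
proof -
  obtain D where D: "\<And>x. (f has_vector_derivative D x) (at x)" "continuous_on UNIV D"
    using assms unfolding C1_differentiable_on_def by blast
  then have *: "(f has_real_derivative D x) (at x)" for x
    by (simp add: has_real_derivative_iff_has_vector_derivative)
  then have "deriv f = D" by (auto simp: fun_eq_iff intro: DERIV_imp_deriv)
  then show "(f has_real_derivative deriv f x) (at x)" "continuous_on UNIV (deriv f)"
    using * D(2) by auto
qed

lemma antiderivative_exists:
  fixes f :: "real \<Rightarrow> real"
  assumes "continuous_on UNIV f"
  obtains F where "\<And>x. (F has_real_derivative f x) (at x)" "F 0 = 0"
proof -
  obtain F where F: "\<And>x. (F has_vector_derivative f x) (at x)"
    using einterval_antiderivative[of "-\<infinity>" "\<infinity>" f] assms
    by (auto simp: continuous_on_eq_continuous_at)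
  show ?thesis
  proof (rule that[of "\<lambda>x. F x - F 0"])
    show "((\<lambda>x. F x - F 0) has_real_derivative f x) (at x)" for x
      using F[of x] by (auto simp: has_real_derivative_iff_has_vector_derivative intro!: derivative_eq_intros)
  qed simp
qed

lemma nonneg_of_deriv_sign:
  fixes h :: "real \<Rightarrow> real"
  assumes "h 0 = 0" and D: "\<And>s. (h has_real_derivative h' s) (at s)" and sg: "\<And>s. s * h' s \<ge> 0"
  shows "h s \<ge> 0"
proof (cases "s \<ge> 0")
  case True
  have "h 0 \<le> h s"
  proof (rule DERIV_nonneg_imp_increasing_open[OF True, where f = h])
    show "\<exists>y. DERIV h x :> y \<and> 0 \<le> y" if "0 < x" "x < s" for x
      using D[of x] sg[of x] that by (auto simp: zero_le_mult_iff)
    show "continuous_on {0..s} h" using D by (meson DERIV_isCont continuous_at_imp_continuous_on)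
  qed
  then show ?thesis using assms(1) by simp
next
  case False
  have "h 0 \<le> h s"
  proof (rule DERIV_nonpos_imp_decreasing_open[where f = h])
    show "\<exists>y. DERIV h x :> y \<and> y \<le> 0" if "s < x" "x < 0" for x
      using D[of x] sg[of x] that by (auto simp: zero_le_mult_iff)
    show "continuous_on {s..0} h" using D by (meson DERIV_isCont continuous_at_imp_continuous_on)
  qed (use False in simp)
  then show ?thesis using assms(1) by simp
qed

text \<open>The differential inequality says that f(s) s^(-q) is monotone on the positive half line:
  its derivative is a positive factor times the difference of the two sides.\<close>

lemma
  fixes f f' :: "real \<Rightarrow> real"
  assumes D: "\<And>s. s > 0 \<Longrightarrow> (f has_real_derivative f' s) (at s)"
    and "0 < a" "a \<le> b"
  shows growth_from_below: "(\<And>s. s > 0 \<Longrightarrow> q * (s * f s) \<le> s\<^sup>2 * f' s) \<Longrightarrow> f a * (b / a) powr q \<le> f b"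
    and growth_from_above: "(\<And>s. s > 0 \<Longrightarrow> s\<^sup>2 * f' s \<le> q * (s * f s)) \<Longrightarrow> f b \<le> f a * (b / a) powr q"
proof -
  define g where "g s = f s * s powr (- q)" for s
  define g' where "g' s = s powr (- q) / s\<^sup>2 * (s\<^sup>2 * f' s - q * (s * f s))" for s
  have g: "(g has_real_derivative g' s) (at s)" if "s > 0" for s
  proof -
    have "(g has_real_derivative (f' s * s powr (- q) + f s * (- q * s powr (- q - 1)))) (at s)"
      unfolding g_def using that D[OF that] by (auto intro!: derivative_eq_intros)
    moreover have "f' s * s powr (- q) + f s * (- q * s powr (- q - 1)) = g' s"
      using that by (simp add: g'_def powr_diff power2_eq_square field_simps)
    ultimately show ?thesis by simp
  qed
  have eq: "(b / a) powr q = a powr (- q) / b powr (- q)"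
    using assms by (simp add: powr_divide powr_minus_divide)
  show "f a * (b / a) powr q \<le> f b" if "\<And>s. s > 0 \<Longrightarrow> q * (s * f s) \<le> s\<^sup>2 * f' s"
  proof -
    have "g a \<le> g b"
    proof (rule DERIV_nonneg_imp_nondecreasing[OF \<open>a \<le> b\<close>])
      fix x assume "a \<le> x"
      then have "x > 0" using \<open>0 < a\<close> by simp
      moreover have "g' x \<ge> 0" using that[OF \<open>x > 0\<close>] by (simp add: g'_def)
      ultimately show "\<exists>y. (g has_real_derivative y) (at x) \<and> 0 \<le> y" using g by blast
    qed
    then show ?thesis unfolding eq using assms by (simp add: g_def field_simps)
  qed
  show "f b \<le> f a * (b / a) powr q" if "\<And>s. s > 0 \<Longrightarrow> s\<^sup>2 * f' s \<le> q * (s * f s)"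
  proof -
    have "g b \<le> g a"
    proof (rule DERIV_nonpos_imp_nonincreasing[OF \<open>a \<le> b\<close>])
      fix x assume "a \<le> x"
      then have "x > 0" using \<open>0 < a\<close> by simp
      moreover have "g' x \<le> 0" using that[OF \<open>x > 0\<close>] by (simp add: g'_def mult_nonneg_nonpos divide_nonpos_nonneg)
      ultimately show "\<exists>y. (g has_real_derivative y) (at x) \<and> y \<le> 0" using g by blast
    qed
    then show ?thesis unfolding eq using assms by (simp add: g_def field_simps)
  qed
qed

text \<open>Beyond \<open>m\<close> the lower growth inequality compares f(s) with f(m) from below;
  between 0 and \<open>m\<close> the upper one does. The second conclusion is conditional since for
  p >= n no upper growth inequality is assumed, and there the behaviour near 0 is a
  hypothesis.\<close>

lemma nonlinearity_lower_bound:
  fixes f f' :: "real \<Rightarrow> real"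
  assumes D: "\<And>s. (f has_real_derivative f' s) (at s)" and pos: "\<And>s. s \<noteq> 0 \<Longrightarrow> s * f s > 0"
    and low: "\<And>s. \<alpha> * (s * f s) \<le> s\<^sup>2 * f' s" and "m > 0"
  obtains c where "c > 0" "\<And>s. \<bar>s\<bar> \<ge> m \<Longrightarrow> c * \<bar>s\<bar> powr (\<alpha> + 1) \<le> s * f s"
    "(\<And>s. s\<^sup>2 * f' s \<le> \<beta> * (s * f s)) \<Longrightarrow> (\<And>s. \<bar>s\<bar> \<le> m \<Longrightarrow> c * \<bar>s\<bar> powr (\<beta> + 1) \<le> s * f s)"
proof -
  \<comment> \<open>Negative arguments are reduced to positive ones by passing to -f(-s), which
    satisfies the same inequalities.\<close>
  have Dm: "((\<lambda>s. - f (- s)) has_real_derivative f' (- s)) (at s)" for s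
    by (auto intro!: derivative_eq_intros DERIV_chain'[OF _ D])
  have key: "\<exists>c>0. (\<forall>s\<ge>m. c * s powr (\<alpha> + 1) \<le> s * g s) \<and>
      ((\<forall>s>0. s\<^sup>2 * g' s \<le> \<beta> * (s * g s)) \<longrightarrow> (\<forall>s. 0 < s \<and> s \<le> m \<longrightarrow> c * s powr (\<beta> + 1) \<le> s * g s))"
    if g: "\<And>s. (g has_real_derivative g' s) (at s)" "\<And>s. s > 0 \<Longrightarrow> \<alpha> * (s * g s) \<le> s\<^sup>2 * g' s" "g m > 0"
    for g g' :: "real \<Rightarrow> real"
  proof -
    \<comment> \<open>Comparison at \<open>m\<close> gives the constant g(m) / m^\<alpha> beyond
      \<open>m\<close> and g(m) / m^\<beta> up to \<open>m\<close>; the minimum serves both.\<close>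
    define c where "c = min (g m / m powr \<alpha>) (g m / m powr \<beta>)"
    have "c > 0" using g(3) \<open>m > 0\<close> by (simp add: c_def)
    moreover have "c * s powr (\<alpha> + 1) \<le> s * g s" if "s \<ge> m" for s
    proof -
      have "c * s powr \<alpha> \<le> g m / m powr \<alpha> * s powr \<alpha>"
        by (intro mult_right_mono) (auto simp: c_def)
      also have "\<dots> = g m * (s / m) powr \<alpha>"
        using that \<open>m > 0\<close> by (simp add: powr_divide)
      also have "\<dots> \<le> g s"
        by (rule growth_from_below[OF g(1) \<open>m > 0\<close> that g(2)])
      finally have "s * (c * s powr \<alpha>) \<le> s * g s" using that \<open>m > 0\<close> by (intro mult_left_mono) auto
      then show ?thesis using that \<open>m > 0\<close> by (simp add: powr_add mult_ac)
    qed
    moreover have "c * s powr (\<beta> + 1) \<le> s * g s"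
      if up: "\<forall>s>0. s\<^sup>2 * g' s \<le> \<beta> * (s * g s)" and s: "0 < s" "s \<le> m" for s
    proof -
      have "c * s powr \<beta> \<le> g m / m powr \<beta> * s powr \<beta>"
        by (intro mult_right_mono) (auto simp: c_def)
      also have "\<dots> \<le> g s"
        using growth_from_above[OF g(1) s, of \<beta>] up s \<open>m > 0\<close> by (simp add: powr_divide field_simps)
      finally have "s * (c * s powr \<beta>) \<le> s * g s" using s by (intro mult_left_mono) auto
      then show ?thesis using s by (simp add: powr_add mult_ac)
    qed
    ultimately show ?thesis by blast
  qed
  have fm: "f m > 0" "- f (- m) > 0" using pos[of m] pos[of "-m"] \<open>m > 0\<close> by (auto simp: zero_less_mult_iff mult_less_0_iff)
  from key[OF D low fm(1)] obtain c1 where c1': "0 < c1 \<and> (\<forall>s\<ge>m. c1 * s powr (\<alpha> + 1) \<le> s * f s) \<and>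
      ((\<forall>s>0. s\<^sup>2 * f' s \<le> \<beta> * (s * f s)) \<longrightarrow> (\<forall>s. 0 < s \<and> s \<le> m \<longrightarrow> c1 * s powr (\<beta> + 1) \<le> s * f s))"
    by (elim exE)
  have c1: "c1 > 0" "\<And>s. s \<ge> m \<Longrightarrow> c1 * s powr (\<alpha> + 1) \<le> s * f s"
    "(\<forall>s>0. s\<^sup>2 * f' s \<le> \<beta> * (s * f s)) \<Longrightarrow> (\<And>s. 0 < s \<Longrightarrow> s \<le> m \<Longrightarrow> c1 * s powr (\<beta> + 1) \<le> s * f s)"
    using c1' by (elim conjE, iprover)+
  have low': "\<alpha> * (s * - f (- s)) \<le> s\<^sup>2 * f' (- s)" for s using low[of "-s"] by simp
  from key[OF Dm low' fm(2)] obtain c2 where c2': "0 < c2 \<and> (\<forall>s\<ge>m. c2 * s powr (\<alpha> + 1) \<le> s * - f (- s)) \<and>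
      ((\<forall>s>0. s\<^sup>2 * f' (- s) \<le> \<beta> * (s * - f (- s))) \<longrightarrow> (\<forall>s. 0 < s \<and> s \<le> m \<longrightarrow> c2 * s powr (\<beta> + 1) \<le> s * - f (- s)))"
    by (elim exE)
  have c2: "c2 > 0" "\<And>s. s \<ge> m \<Longrightarrow> c2 * s powr (\<alpha> + 1) \<le> s * - f (- s)"
    "(\<forall>s>0. s\<^sup>2 * f' (- s) \<le> \<beta> * (s * - f (- s))) \<Longrightarrow> (\<And>s. 0 < s \<Longrightarrow> s \<le> m \<Longrightarrow> c2 * s powr (\<beta> + 1) \<le> s * - f (- s))"
    using c2' by (elim conjE, iprover)+
  show ?thesis
  proof (rule that[of "min c1 c2"])
    show "min c1 c2 * \<bar>s\<bar> powr (\<alpha> + 1) \<le> s * f s" if "\<bar>s\<bar> \<ge> m" for s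
    proof (cases "s \<ge> 0")
      case True
      have "min c1 c2 * \<bar>s\<bar> powr (\<alpha> + 1) \<le> c1 * s powr (\<alpha> + 1)"
        using True by (auto intro!: mult_right_mono)
      then show ?thesis using c1(2)[of s] that True by simp
    next
      case False
      have "min c1 c2 * \<bar>s\<bar> powr (\<alpha> + 1) \<le> c2 * (- s) powr (\<alpha> + 1)"
        using False by (auto intro!: mult_right_mono)
      also have "\<dots> \<le> s * f s" using c2(2)[of "-s"] that False by simp
      finally show ?thesis .
    qed
    show "min c1 c2 * \<bar>s\<bar> powr (\<beta> + 1) \<le> s * f s"
      if up: "\<And>s. s\<^sup>2 * f' s \<le> \<beta> * (s * f s)" and "\<bar>s\<bar> \<le> m" for s
    proof -
      consider "s > 0" | "s = 0" | "s < 0" by linarith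
      then show ?thesis
      proof cases
        case 1
        have "min c1 c2 * \<bar>s\<bar> powr (\<beta> + 1) \<le> c1 * s powr (\<beta> + 1)"
          using 1 by (auto intro!: mult_right_mono)
        also have "\<dots> \<le> s * f s" using c1(3)[of s] up that 1 by simp
        finally show ?thesis .
      next
        case 3
        have "\<forall>t>0. t\<^sup>2 * f' (- t) \<le> \<beta> * (t * - f (- t))"
        proof (intro allI impI)
          fix t show "t\<^sup>2 * f' (- t) \<le> \<beta> * (t * - f (- t))" using up[of "-t"] by simp
        qed
        from c2(3)[OF this, of "-s"] that(2) 3 have "c2 * (- s) powr (\<beta> + 1) \<le> s * f s" by simp
        moreover have "min c1 c2 * \<bar>s\<bar> powr (\<beta> + 1) \<le> c2 * (- s) powr (\<beta> + 1)"
          using 3 by (auto intro!: mult_right_mono)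
        ultimately show ?thesis by (rule order_trans[rotated])
      qed simp
    qed
  qed (use c1 c2 in simp)
qed

text \<open>The bounds on F are integrated growth inequalities: s f(s) - (\<alpha> + 1) F(s)
  vanishes at 0 and has derivative s f'(s) - \<alpha> f(s), which becomes nonnegative after
  multiplication by s; likewise with \<beta> and the opposite sign.\<close>

lemma
  fixes f f' F :: "real \<Rightarrow> real"
  assumes D: "\<And>s. (f has_real_derivative f' s) (at s)" and F: "\<And>s. (F has_real_derivative f s) (at s)" "F 0 = 0"
    and pos: "\<And>s. s \<noteq> 0 \<Longrightarrow> s * f s > 0"
  shows antiderivative_nonneg: "F s \<ge> 0"
    and antiderivative_pos: "s \<noteq> 0 \<Longrightarrow> F s > 0"
    and antiderivative_upper: "(\<And>s. \<alpha> * (s * f s) \<le> s\<^sup>2 * f' s) \<Longrightarrow> (\<alpha> + 1) * F s \<le> s * f s"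
    and antiderivative_lower: "(\<And>s. s\<^sup>2 * f' s \<le> \<beta> * (s * f s)) \<Longrightarrow> s * f s \<le> (\<beta> + 1) * F s"
proof -
  have sf: "s * f s \<ge> 0" for s using pos[of s] by (cases "s = 0") auto
  show nn: "F s \<ge> 0" for s
    by (rule nonneg_of_deriv_sign[OF F(2,1) sf])
  show "F s > 0" if "s \<noteq> 0"
  proof (rule ccontr)
    assume "\<not> F s > 0"
    then have "F s = 0" using nn[of s] by linarith
    \<comment> \<open>A zero of the nonnegative function \<open>F\<close> is a minimum.\<close>
    then have "f s = 0"
      using DERIV_local_min[OF F(1)[of s], of 1] nn by auto
    then show False using pos[OF that] by simp
  qed
  show "(\<alpha> + 1) * F s \<le> s * f s" if "\<And>s. \<alpha> * (s * f s) \<le> s\<^sup>2 * f' s"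
  proof -
    have "0 \<le> s * f s - (\<alpha> + 1) * F s"
    proof (rule nonneg_of_deriv_sign[where h = "\<lambda>s. s * f s - (\<alpha> + 1) * F s" and h' = "\<lambda>s. s * f' s - \<alpha> * f s"])
      show "((\<lambda>s. s * f s - (\<alpha> + 1) * F s) has_real_derivative (s * f' s - \<alpha> * f s)) (at s)" for s
        by (auto intro!: derivative_eq_intros D F simp: algebra_simps)
      show "0 \<le> s * (s * f' s - \<alpha> * f s)" for s
        using that[of s] by (simp add: power2_eq_square algebra_simps)
    qed (use F in simp)
    then show ?thesis by simp
  qed
  show "s * f s \<le> (\<beta> + 1) * F s" if "\<And>s. s\<^sup>2 * f' s \<le> \<beta> * (s * f s)"
  proof -
    have "0 \<le> (\<beta> + 1) * F s - s * f s"
    proof (rule nonneg_of_deriv_sign[where h = "\<lambda>s. (\<beta> + 1) * F s - s * f s" and h' = "\<lambda>s. \<beta> * f s - s * f' s"])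
      show "((\<lambda>s. (\<beta> + 1) * F s - s * f s) has_real_derivative (\<beta> * f s - s * f' s)) (at s)" for s
        by (auto intro!: derivative_eq_intros D F simp: algebra_simps)
      show "0 \<le> s * (\<beta> * f s - s * f' s)" for s
        using that[of s] by (simp add: power2_eq_square algebra_simps)
    qed (use F in simp)
    then show ?thesis by simp
  qed
qed

section \<open>Young inequalities\<close>

lemma young_gradient:
  fixes p d :: real
  assumes p: "p \<ge> 2" and d: "d > 0"
  obtains C where "C > 0"
    "\<And>y g. y \<ge> 0 \<Longrightarrow> g \<ge> 0 \<Longrightarrow> y\<^sup>2 * pw p g + y * g powr (p - 1) \<le> d * g powr p + C * y powr p"
proof -
  \<comment> \<open>The threshold between two regimes. If K y <= g, each of the two terms is at most
    g^p / K, and 2 / K <= d; otherwise g <= K y and each is at most K^p y^p.\<close>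
  define K where "K = max 1 (2 / d)"
  have K: "K \<ge> 1" "2 / K \<le> d" using d by (auto simp: K_def field_simps max_def)
  have pw2: "r\<^sup>2 * pw p r = r powr p" if "r \<ge> 0" for r
  proof (cases "r = 0")
    case False
    then have "r > 0" using that by simp
    then have "r powr p = r\<^sup>2 * r powr (p - 2)" using powr_add[of r 2 "p - 2"] by (simp add: powr_numeral)
    then show ?thesis using \<open>r > 0\<close> by (auto simp: pw_def powr_numeral)
  qed (use p in \<open>auto simp: pw_def\<close>)
  have pwm: "pw p a \<le> pw p b" if "0 \<le> a" "a \<le> b" for a b
    using that p by (auto simp: pw_def intro: powr_mono2)
  have pow1: "r * r powr (p - 1) = r powr p" if "r \<ge> 0" for r
    using powr_mult_base[OF that, of "p - 1"] by simp
  show ?thesis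
  proof (rule that[of "2 * K powr p"])
    fix y g :: real assume y: "y \<ge> 0" and g: "g \<ge> 0"
    show "y\<^sup>2 * pw p g + y * g powr (p - 1) \<le> d * g powr p + 2 * K powr p * y powr p"
    proof (cases "K * y \<le> g")
      case True
      then have yg: "y \<le> g / K" using K by (simp add: field_simps)
      have "y\<^sup>2 * pw p g \<le> (g / K)\<^sup>2 * pw p g"
        by (intro mult_right_mono power_mono yg y) (simp add: pw_def)
      also have "\<dots> = g powr p / K\<^sup>2" using pw2[OF g] by (simp add: power_divide)
      also have "\<dots> \<le> g powr p / K" using K by (intro divide_left_mono) (auto simp: power2_eq_square)
      finally have 1: "y\<^sup>2 * pw p g \<le> g powr p / K" .
      have "y * g powr (p - 1) \<le> g / K * g powr (p - 1)" by (intro mult_right_mono yg) simp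
      also have "\<dots> = g powr p / K" using pow1[OF g] by simp
      finally have "y\<^sup>2 * pw p g + y * g powr (p - 1) \<le> (2 / K) * g powr p" using 1 by simp
      also have "\<dots> \<le> d * g powr p" by (intro mult_right_mono K) simp
      also have "\<dots> \<le> d * g powr p + 2 * K powr p * y powr p" by simp
      finally show ?thesis .
    next
      case False
      then have gy: "g \<le> K * y" by simp
      have yK: "y \<le> K * y" using K y by (simp add: mult_le_cancel_right1)
      have "y\<^sup>2 * pw p g \<le> (K * y)\<^sup>2 * pw p (K * y)"
        by (intro mult_mono power_mono yK pwm gy g y) (auto simp: pw_def)
      also have "\<dots> = K powr p * y powr p" using pw2[of "K * y"] K y by (simp add: powr_mult)
      finally have 1: "y\<^sup>2 * pw p g \<le> K powr p * y powr p" .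
      have "y * g powr (p - 1) \<le> K * y * (K * y) powr (p - 1)"
        by (intro mult_mono yK powr_mono2 gy g) (use p y K in auto)
      also have "\<dots> = K powr p * y powr p" using pow1[of "K * y"] K y by (simp add: powr_mult)
      finally have "y\<^sup>2 * pw p g + y * g powr (p - 1) \<le> 2 * K powr p * y powr p" using 1 by simp
      also have "\<dots> \<le> d * g powr p + 2 * K powr p * y powr p" using d by simp
      finally show ?thesis .
    qed
  qed (use K in simp)
qed

text \<open>Young's inequality with the exponents r / p and r / (r - p), by cases. If D^p <= d c
  s^(r-p), then (s D)^p <= d c s^r. Otherwise s is bounded by a power of D, and solving for it
  produces the constant.\<close>

lemma young_power:
  fixes p r d c :: real
  assumes p: "p > 0" and r: "r > p" and d: "d > 0" and c: "c > 0"
  obtains C where "C > 0"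
    "\<And>s T D. s \<ge> 0 \<Longrightarrow> D > 0 \<Longrightarrow> c * s powr r \<le> T \<Longrightarrow> (s * D) powr p \<le> d * T + C * D powr (p * r / (r - p))"
proof (rule that[of "(1 / (d * c)) powr (p / (r - p))"])
  fix s T D :: real assume s: "s \<ge> 0" and D: "D > 0" and T: "c * s powr r \<le> T"
  show "(s * D) powr p \<le> d * T + (1 / (d * c)) powr (p / (r - p)) * D powr (p * r / (r - p))"
  proof (cases "s = 0")
    case True
    then show ?thesis using T d r p by simp
  next
    case False
    then have s0: "s > 0" using s by simp
    show ?thesis
    proof (cases "D powr p \<le> d * c * s powr (r - p)")
      case True
      have "(s * D) powr p = s powr p * D powr p" using s D by (simp add: powr_mult)
      also have "\<dots> \<le> s powr p * (d * c * s powr (r - p))" by (intro mult_left_mono True) simp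
      also have "\<dots> = d * (c * s powr r)" using s0 by (simp add: powr_diff)
      also have "\<dots> \<le> d * T" using T d by simp
      also have "\<dots> \<le> d * T + (1 / (d * c)) powr (p / (r - p)) * D powr (p * r / (r - p))" by simp
      finally show ?thesis .
    next
      case False
      then have "s powr (r - p) \<le> D powr p / (d * c)" using d c by (simp add: field_simps)
      then have "(s powr (r - p)) powr (p / (r - p)) \<le> (D powr p / (d * c)) powr (p / (r - p))"
        using p r by (intro powr_mono2) auto
      then have "s powr p \<le> (D powr p * (1 / (d * c))) powr (p / (r - p))"
        using r by (simp add: powr_powr)
      also have "\<dots> = D powr (p * p / (r - p)) * (1 / (d * c)) powr (p / (r - p))"
        using D d c by (subst powr_mult) (auto simp: powr_powr)
      finally have "s powr p * D powr p \<le> D powr (p * p / (r - p)) * (1 / (d * c)) powr (p / (r - p)) * D powr p"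
        by (intro mult_right_mono) auto
      also have "\<dots> = (1 / (d * c)) powr (p / (r - p)) * D powr (p * p / (r - p) + p)"
        by (simp add: powr_add)
      also have "p * p / (r - p) + p = p * r / (r - p)" using r by (simp add: field_simps)
      finally have "(s * D) powr p \<le> (1 / (d * c)) powr (p / (r - p)) * D powr (p * r / (r - p))"
        using s D by (simp add: powr_mult)
      moreover have "d * T \<ge> 0" using T d c order_trans[of 0 "c * s powr r" T] by simp
      ultimately show ?thesis by linarith
    qed
  qed
qed (use d c in simp)

text \<open>\<open>young_gradient\<close> with y = |s| D leaves a multiple of (|s| D)^p, which
  \<open>young_power\<close> absorbs into s f(s): with the exponent \<alpha> + 1 for |s| >= m and
  \<beta> + 1 for |s| <= m, whence the two powers of D. In the applications D is a reciprocal
  length, the size of the gradient of a cutoff relative to the cutoff.\<close>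

lemma young_pointwise:
  fixes p d \<alpha> \<beta> m c :: real and f :: "real \<Rightarrow> real"
  assumes p: "p \<ge> 2" and d: "d > 0" and ab: "\<alpha> > p - 1" "\<beta> > p - 1" and c: "c > 0"
    and lo: "\<And>s. \<bar>s\<bar> \<ge> m \<Longrightarrow> c * \<bar>s\<bar> powr (\<alpha> + 1) \<le> s * f s"
      "\<And>s. \<bar>s\<bar> \<le> m \<Longrightarrow> c * \<bar>s\<bar> powr (\<beta> + 1) \<le> s * f s"
  obtains C where "C > 0"
    "\<And>s g D. g \<ge> 0 \<Longrightarrow> D > 0 \<Longrightarrow> s\<^sup>2 * pw p g * D\<^sup>2 + \<bar>s\<bar> * g powr (p - 1) * D \<le>
      d * (g powr p + s * f s) + C * (D powr (p * (\<alpha> + 1) / (\<alpha> + 1 - p)) + D powr (p * (\<beta> + 1) / (\<beta> + 1 - p)))"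
proof -
  obtain C1 where C1: "C1 > 0"
    "\<And>y g. y \<ge> 0 \<Longrightarrow> g \<ge> 0 \<Longrightarrow> y\<^sup>2 * pw p g + y * g powr (p - 1) \<le> d * g powr p + C1 * y powr p"
    using young_gradient[OF p d] by blast
  \<comment> \<open>The remainder of the first inequality carries the factor \<open>C1\<close>, so
    the second is used with d / C1.\<close>
  have d': "d / C1 > 0" and p0: "p > 0" using d C1 p by auto
  obtain Ca where Ca: "Ca > 0" "\<And>s T D. s \<ge> 0 \<Longrightarrow> D > 0 \<Longrightarrow> c * s powr (\<alpha> + 1) \<le> T \<Longrightarrow>
      (s * D) powr p \<le> d / C1 * T + Ca * D powr (p * (\<alpha> + 1) / (\<alpha> + 1 - p))"
    using young_power[OF p0 _ d' c, of "\<alpha> + 1"] ab by auto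
  obtain Cb where Cb: "Cb > 0" "\<And>s T D. s \<ge> 0 \<Longrightarrow> D > 0 \<Longrightarrow> c * s powr (\<beta> + 1) \<le> T \<Longrightarrow>
      (s * D) powr p \<le> d / C1 * T + Cb * D powr (p * (\<beta> + 1) / (\<beta> + 1 - p))"
    using young_power[OF p0 _ d' c, of "\<beta> + 1"] ab by auto
  show ?thesis
  proof (rule that[of "C1 * (Ca + Cb)"])
    fix s g D :: real assume g: "g \<ge> 0" and D: "D > 0"
    let ?A = "D powr (p * (\<alpha> + 1) / (\<alpha> + 1 - p))" and ?B = "D powr (p * (\<beta> + 1) / (\<beta> + 1 - p))"
    have nn: "0 \<le> Ca * ?B" "0 \<le> Cb * ?A" "0 \<le> Cb * ?B" "0 \<le> Ca * ?A" using Ca Cb by auto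
    have "(\<bar>s\<bar> * D) powr p \<le> d / C1 * (s * f s) + (Ca + Cb) * (?A + ?B)"
    proof (cases "\<bar>s\<bar> \<ge> m")
      case True
      show ?thesis using Ca(2)[OF abs_ge_zero D lo(1)[OF True]] nn by (simp add: distrib_left distrib_right)
    next
      case False
      then have "\<bar>s\<bar> \<le> m" by simp
      then show ?thesis using Cb(2)[OF abs_ge_zero D lo(2)] nn by (fastforce simp add: distrib_left distrib_right)
    qed
    then have "C1 * (\<bar>s\<bar> * D) powr p \<le> C1 * (d / C1 * (s * f s) + (Ca + Cb) * (?A + ?B))"
      using C1(1) by simp
    also have "\<dots> = d * (s * f s) + C1 * (Ca + Cb) * (?A + ?B)"
      using C1(1) by (simp only: distrib_left[of C1] mult.assoc[symmetric]) simp
    finally have "C1 * (\<bar>s\<bar> * D) powr p \<le> d * (s * f s) + C1 * (Ca + Cb) * (?A + ?B)" .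
    moreover have "s\<^sup>2 * pw p g * D\<^sup>2 + \<bar>s\<bar> * g powr (p - 1) * D \<le> d * g powr p + C1 * (\<bar>s\<bar> * D) powr p"
      using C1(2)[of "\<bar>s\<bar> * D" g] g D by (simp add: power_mult_distrib mult_ac)
    ultimately show "s\<^sup>2 * pw p g * D\<^sup>2 + \<bar>s\<bar> * g powr (p - 1) * D \<le> d * (g powr p + s * f s) + C1 * (Ca + Cb) * (?A + ?B)"
      by (simp add: distrib_left)
  qed (use C1 Ca Cb in simp)
qed

section \<open>Finite Morse index\<close>

lemma ball_support_of_Cc1:
  fixes \<phi> :: "real^'n \<Rightarrow> real"
  assumes "\<phi> \<in> Cc1"
  obtains r where "r > 0" "\<And>x. norm x \<ge> r \<Longrightarrow> \<phi> x = 0" "\<And>x. norm x > r \<Longrightarrow> grad \<phi> x = 0"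
proof -
  obtain r where r: "r > 0" "\<And>x. norm x \<ge> r \<Longrightarrow> \<phi> x = 0"
    using compactly_supportedE[of \<phi>] assms unfolding Cc1_def by blast
  have "grad \<phi> x = 0" if "norm x > r" for x
    by (rule partial_eq_0_outside(2)[of r]) (use r that in auto)
  with r that show ?thesis by blast
qed

lemma grad_eq_0_inside:
  fixes \<phi> :: "real^'n \<Rightarrow> real"
  assumes "\<And>x. norm x < r \<Longrightarrow> \<phi> x = 0" "norm x < r"
  shows "grad \<phi> x = 0"
proof -
  have "partial i \<phi> x = 0" for i
    using partial_cong_open(1)[of "ball 0 r" x \<phi> "\<lambda>_. 0" i] assms by simp
  then show ?thesis by (simp add: vec_eq_iff)
qed

lemma partial_sum_scaled:
  fixes \<phi> :: "nat \<Rightarrow> real^'n \<Rightarrow> real"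
  assumes "finite I" "\<And>k. k \<in> I \<Longrightarrow> \<phi> k differentiable (at x)"
  shows "grad (\<lambda>x. \<Sum>k\<in>I. c k * \<phi> k x) x = (\<Sum>k\<in>I. c k *\<^sub>R grad (\<phi> k) x)"
proof (rule grad_eqI(1))
  have "((\<lambda>x. \<Sum>k\<in>I. c k * \<phi> k x) has_derivative (\<lambda>h. \<Sum>k\<in>I. c k * (grad (\<phi> k) x \<bullet> h))) (at x)"
    using assms by (intro has_derivative_sum has_derivative_mult_right has_derivative_grad) auto
  then show "((\<lambda>x. \<Sum>k\<in>I. c k * \<phi> k x) has_derivative (\<lambda>h. (\<Sum>k\<in>I. c k *\<^sub>R grad (\<phi> k) x) \<bullet> h)) (at x)"
    by (simp add: inner_sum_left)
qed

text \<open>Functions with negative energy and pairwise disjoint supports span a negative subspace, so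
  only finitely many of them can be nested outside of each other.\<close>

lemma finite_morse_index_stable_outside:
  fixes u :: "real^'n \<Rightarrow> real"
  assumes fin: "finite_morse_index p H A0 f u"
    and int: "\<And>\<phi>. \<phi> \<in> Cc1 \<Longrightarrow> integrable lebesgue (\<lambda>x. hform p H A0 (weak_grad u x) (grad \<phi> x) (grad \<phi> x))"
      "\<And>\<phi>. \<phi> \<in> Cc1 \<Longrightarrow> integrable lebesgue (\<lambda>x. deriv f (u x) * \<phi> x * \<phi> x)"
  shows "\<exists>R>0. \<forall>\<phi>\<in>Cc1. (\<forall>x. norm x \<le> R \<longrightarrow> \<phi> x = 0) \<longrightarrow> 0 \<le> linearized p H A0 f u \<phi> \<phi>"
proof (rule ccontr)
  assume "\<not> ?thesis"
  then have neg: "\<And>R. R > 0 \<Longrightarrow> \<exists>\<phi>\<in>Cc1. (\<forall>x. norm x \<le> R \<longrightarrow> \<phi> x = 0) \<and> linearized p H A0 f u \<phi> \<phi> < 0"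
    by (meson not_le)
  have neg': "\<forall>R\<in>{0<..}. \<exists>z. case z of (\<phi>, r) \<Rightarrow> \<phi> \<in> Cc1 \<and> (\<forall>x. norm x \<le> R \<longrightarrow> \<phi> x = 0) \<and> linearized p H A0 f u \<phi> \<phi> < 0 \<and>
      r > 0 \<and> (\<forall>x. norm x \<ge> r \<longrightarrow> \<phi> x = 0) \<and> (\<forall>x. norm x > r \<longrightarrow> grad \<phi> x = 0)"
  proof
    fix R :: real assume "R \<in> {0<..}"
    then obtain \<phi> where "\<phi> \<in> Cc1" "\<forall>x. norm x \<le> R \<longrightarrow> \<phi> x = 0" "linearized p H A0 f u \<phi> \<phi> < 0" using neg by blast
    moreover obtain r where "r > 0" "\<And>x. norm x \<ge> r \<Longrightarrow> \<phi> x = 0" "\<And>x. norm x > r \<Longrightarrow> grad \<phi> x = 0"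
      using ball_support_of_Cc1[OF \<open>\<phi> \<in> Cc1\<close>] by blast
    ultimately show "\<exists>z. case z of (\<phi>, r) \<Rightarrow> \<phi> \<in> Cc1 \<and> (\<forall>x. norm x \<le> R \<longrightarrow> \<phi> x = 0) \<and> linearized p H A0 f u \<phi> \<phi> < 0 \<and>
      r > 0 \<and> (\<forall>x. norm x \<ge> r \<longrightarrow> \<phi> x = 0) \<and> (\<forall>x. norm x > r \<longrightarrow> grad \<phi> x = 0)" by blast
  qed
  from bchoice[OF this] obtain Z where Z: "\<forall>R\<in>{0<..}. case Z R of (\<phi>, r) \<Rightarrow> \<phi> \<in> Cc1 \<and> (\<forall>x. norm x \<le> R \<longrightarrow> \<phi> x = 0) \<and> linearized p H A0 f u \<phi> \<phi> < 0 \<and>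
      r > 0 \<and> (\<forall>x. norm x \<ge> r \<longrightarrow> \<phi> x = 0) \<and> (\<forall>x. norm x > r \<longrightarrow> grad \<phi> x = 0)" by blast
  define \<Phi> where "\<Phi> R = fst (Z R)" for R
  define \<rho> where "\<rho> R = snd (Z R)" for R
  have P: "\<And>R. R > 0 \<Longrightarrow> \<Phi> R \<in> Cc1" "\<And>R x. R > 0 \<Longrightarrow> norm x \<le> R \<Longrightarrow> \<Phi> R x = 0"
    "\<And>R. R > 0 \<Longrightarrow> linearized p H A0 f u (\<Phi> R) (\<Phi> R) < 0" "\<And>R. R > 0 \<Longrightarrow> \<rho> R > 0"
    "\<And>R x. R > 0 \<Longrightarrow> norm x \<ge> \<rho> R \<Longrightarrow> \<Phi> R x = 0" "\<And>R x. R > 0 \<Longrightarrow> norm x > \<rho> R \<Longrightarrow> grad (\<Phi> R) x = 0"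
    using Z by (auto simp: \<Phi>_def \<rho>_def split_beta)
  \<comment> \<open>\<open>\<rho> r\<close> bounds the support of the function chosen for the radius
    \<open>r\<close>, so the next function, which vanishes up to \<open>rr (Suc k)\<close>, lives
    outside the supports of all earlier ones.\<close>
  define rr where "rr = rec_nat 1 (\<lambda>_ r. max r (\<rho> r) + 1)"
  have rr: "rr 0 = 1" "rr (Suc k) = max (rr k) (\<rho> (rr k)) + 1" for k by (simp_all add: rr_def)
  have rpos: "rr k > 0" for k by (induction k) (auto simp: rr max_def)
  have rmono: "rr (Suc k) > rr k" "rr (Suc k) > \<rho> (rr k)" for k by (auto simp: rr)
  have rinc: "j \<le> k \<Longrightarrow> rr j \<le> rr k" for j k
    using lift_Suc_mono_le[of rr j k] rmono(1) by (meson less_imp_le)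
  define \<phi> where "\<phi> k = \<Phi> (rr k)" for k
  have C: "\<phi> k \<in> Cc1" for k using P(1) rpos by (simp add: \<phi>_def)
  have dif: "\<phi> k differentiable (at x)" for k x using C[of k] by (auto simp: Cc1_def)
  have neg1: "linearized p H A0 f u (\<phi> k) (\<phi> k) < 0" for k using P(3) rpos by (simp add: \<phi>_def)
  \<comment> \<open>Gradients are included because the energy depends on them. They vanish beyond
    the radius \<open>\<rho>\<close> of the support and on the open ball where the function is
    0.\<close>
  have disj: "\<phi> j x = 0 \<and> grad (\<phi> j) x = 0 \<or> \<phi> k x = 0 \<and> grad (\<phi> k) x = 0" if "j < k" for j k x
  proof (cases "norm x \<ge> rr (Suc j)")
    case True
    then have "norm x > \<rho> (rr j)" using rmono(2)[of j] by simp
    then show ?thesis using P(5,6) rpos by (simp add: \<phi>_def)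
  next
    case False
    then have "norm x < rr k" using rinc[of "Suc j" k] that by simp
    moreover have "\<And>x. norm x < rr k \<Longrightarrow> \<phi> k x = 0" using P(2) rpos by (simp add: \<phi>_def)
    ultimately show ?thesis using grad_eq_0_inside[of "rr k" "\<phi> k" x] by blast
  qed
  have disj': "\<phi> j x = 0 \<and> grad (\<phi> j) x = 0 \<or> \<phi> k x = 0 \<and> grad (\<phi> k) x = 0" if "j \<noteq> k" for j k x
    using disj[of j k x] disj[of k j x] that by (meson linorder_neqE_nat)
  have nz: "\<exists>x. \<phi> k x \<noteq> 0" for k
  proof (rule ccontr)
    assume "\<nexists>x. \<phi> k x \<noteq> 0"
    then have "\<phi> k = (\<lambda>x. 0)" by auto
    then have "linearized p H A0 f u (\<phi> k) (\<phi> k) = 0" by (simp add: linearized_def)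
    then show False using neg1[of k] by simp
  qed
  obtain N where N: "\<forall>V. fun_space.subspace V \<and> V \<subseteq> Cc1 \<and> (\<forall>\<phi>\<in>V - {0}. linearized p H A0 f u \<phi> \<phi> < 0) \<longrightarrow>
      (\<exists>B. finite B \<and> card B \<le> N \<and> \<not> fun_space.dependent B \<and> fun_space.span B = V)"
    using fin unfolding finite_morse_index_def by (elim exE)
  define S where "S = \<phi> ` {..N}"
  define V where "V = fun_space.span S"
  have sum_at: "(\<Sum>k\<in>{..N}. (\<lambda>x. c k * \<phi> k x)) = (\<lambda>x. \<Sum>k\<in>{..N}. c k * \<phi> k x)" for c
  proof -
    have "(\<Sum>k\<in>I. (\<lambda>x. c k * \<phi> k x)) = (\<lambda>x. \<Sum>k\<in>I. c k * \<phi> k x)" if "finite I" for I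
      using that by induction (auto simp: fun_eq_iff)
    then show ?thesis by blast
  qed
  have inj: "inj_on \<phi> {..N}"
  proof (rule inj_onI, rule ccontr)
    fix j k assume "\<phi> j = \<phi> k" "j \<noteq> k"
    moreover obtain x where "\<phi> k x \<noteq> 0" using nz by blast
    ultimately show False using disj'[of j k x] by simp
  qed
  have Vform: "\<exists>c. v = (\<lambda>x. \<Sum>k\<le>N. c k * \<phi> k x)" if vV: "v \<in> V" for v
  proof -
    obtain c where "v = (\<Sum>g\<in>S. (\<lambda>x. c g * g x))"
      using vV fun_space.span_finite[of S] unfolding V_def S_def by auto
    also have "\<dots> = (\<Sum>k\<in>{..N}. (\<lambda>x. c (\<phi> k) * \<phi> k x))"
      unfolding S_def by (subst sum.reindex[OF inj]) (simp only: o_def)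
    finally show ?thesis unfolding sum_at by (rule exI[of _ "\<lambda>k. c (\<phi> k)"])
  qed
  have lin: "linearized p H A0 f u (\<lambda>x. \<Sum>k\<le>N. c k * \<phi> k x) (\<lambda>x. \<Sum>k\<le>N. c k * \<phi> k x) =
     (\<Sum>k\<le>N. (c k)\<^sup>2 * linearized p H A0 f u (\<phi> k) (\<phi> k))" for c
  proof -
    define q where "q x = (\<Sum>k\<le>N. c k *\<^sub>R grad (\<phi> k) x)" for x
    have h: "hform p H A0 (weak_grad u x) (q x) (q x) =
        (\<Sum>k\<le>N. (c k)\<^sup>2 * hform p H A0 (weak_grad u x) (grad (\<phi> k) x) (grad (\<phi> k) x))"
      and d: "deriv f (u x) * (\<Sum>k\<le>N. c k * \<phi> k x) * (\<Sum>k\<le>N. c k * \<phi> k x) =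
        (\<Sum>k\<le>N. (c k)\<^sup>2 * (deriv f (u x) * \<phi> k x * \<phi> k x))" for x
    proof -
      \<comment> \<open>At each point at most one function is active, so the quadratic forms of the
        sum have no cross terms.\<close>
      have "\<exists>k0\<le>N. \<forall>k\<le>N. k \<noteq> k0 \<longrightarrow> \<phi> k x = 0 \<and> grad (\<phi> k) x = 0"
      proof (cases "\<exists>k\<le>N. \<not> (\<phi> k x = 0 \<and> grad (\<phi> k) x = 0)")
        case True
        then show ?thesis using disj' by blast
      qed blast
      then obtain k0 where k0: "k0 \<le> N" "\<And>k. k \<le> N \<Longrightarrow> k \<noteq> k0 \<Longrightarrow> \<phi> k x = 0 \<and> grad (\<phi> k) x = 0" by blast
      have red: "(\<Sum>k\<le>N. F k) = F k0" if "\<And>k. k \<le> N \<Longrightarrow> k \<noteq> k0 \<Longrightarrow> F k = 0" for F :: "nat \<Rightarrow> 'b::comm_monoid_add"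
        using k0(1) that by (subst sum.remove[of _ k0]) auto
      have h0: "hform p H A0 \<xi> 0 0 = 0" for \<xi> by (simp add: hform_def)
      show "hform p H A0 (weak_grad u x) (q x) (q x) =
        (\<Sum>k\<le>N. (c k)\<^sup>2 * hform p H A0 (weak_grad u x) (grad (\<phi> k) x) (grad (\<phi> k) x))"
        unfolding q_def by (subst (1 2 3) red) (auto simp: k0 h0 hform_scale_left hform_scale_right power2_eq_square)
      show "deriv f (u x) * (\<Sum>k\<le>N. c k * \<phi> k x) * (\<Sum>k\<le>N. c k * \<phi> k x) =
        (\<Sum>k\<le>N. (c k)\<^sup>2 * (deriv f (u x) * \<phi> k x * \<phi> k x))"
        by (subst (1 2 3) red) (auto simp: k0 power2_eq_square)
    qed
    have g: "grad (\<lambda>x. \<Sum>k\<le>N. c k * \<phi> k x) x = q x" for x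
      unfolding q_def by (rule partial_sum_scaled) (auto intro: dif)
    show ?thesis
      unfolding linearized_eq_hform g h d
      by (subst (1 2) Bochner_Integration.integral_sum)
        (auto simp: int C sum_subtractf right_diff_distrib)
  qed
  have sub: "V \<subseteq> Cc1"
  proof
    fix v assume "v \<in> V"
    then obtain c where v: "v = (\<lambda>x. \<Sum>k\<le>N. c k * \<phi> k x)" using Vform by blast
    have Ck: "Ck_on 1 UNIV (\<lambda>x. \<Sum>k\<in>I. c k * \<phi> k x)" if "finite I" for I
      using that
    proof induction
      case empty
      then show ?case using Ck_on_const[of 1 UNIV 0] by simp
    next
      case (insert k I)
      have "Ck_on 1 UNIV (\<phi> k)" using C[of k] unfolding Cc1_def by blast
      then have "Ck_on 1 UNIV (\<lambda>x. c k * \<phi> k x + (\<Sum>k\<in>I. c k * \<phi> k x))"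
        by (intro Ck_on_add Ck_on_mult Ck_on_const insert.IH open_UNIV)
      moreover have "(\<lambda>x. \<Sum>k\<in>insert k I. c k * \<phi> k x) = (\<lambda>x. c k * \<phi> k x + (\<Sum>k\<in>I. c k * \<phi> k x))"
        using insert.hyps by simp
      ultimately show ?case by (simp only:)
    qed
    have "v x = 0" if "norm x > rr (Suc N)" for x
    proof -
      have "\<phi> k x = 0" if "k \<le> N" for k
        using P(5)[OF rpos, of k x] rmono(2)[of k] rinc[of "Suc k" "Suc N"] that \<open>norm x > rr (Suc N)\<close>
        by (simp add: \<phi>_def)
      then show ?thesis by (simp add: v)
    qed
    then have "compactly_supported v" by (rule compactly_supportedI)
    with Ck[of "{..N}"] show "v \<in> Cc1" by (simp add: Cc1_def v)
  qed
  have negV: "\<forall>v\<in>V - {0}. linearized p H A0 f u v v < 0"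
  proof
    fix v assume "v \<in> V - {0}"
    then obtain c where v: "v = (\<lambda>x. \<Sum>k\<le>N. c k * \<phi> k x)" "v \<noteq> 0" using Vform by blast
    have "\<exists>k\<le>N. c k \<noteq> 0"
    proof (rule ccontr)
      assume "\<not> (\<exists>k\<le>N. c k \<noteq> 0)"
      then have "v = (\<lambda>x. 0)" by (simp add: v)
      with v(2) show False by (simp add: zero_fun_def)
    qed
    then obtain k0 where k0: "k0 \<le> N" "c k0 \<noteq> 0" by blast
    have "(\<Sum>k\<le>N. (c k)\<^sup>2 * linearized p H A0 f u (\<phi> k) (\<phi> k)) < (\<Sum>k\<le>N. 0)"
    proof (rule sum_strict_mono_ex1)
      show "\<forall>k\<in>{..N}. (c k)\<^sup>2 * linearized p H A0 f u (\<phi> k) (\<phi> k) \<le> 0"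
        using neg1 by (auto intro!: mult_nonneg_nonpos simp: less_imp_le)
      show "\<exists>k\<in>{..N}. (c k)\<^sup>2 * linearized p H A0 f u (\<phi> k) (\<phi> k) < 0"
        using k0 neg1 by (intro bexI[of _ k0] mult_pos_neg) auto
    qed simp
    then show "linearized p H A0 f u v v < 0" by (simp add: v lin)
  qed
  have indep: "\<not> fun_space.dependent S"
  proof
    assume "fun_space.dependent S"
    then obtain c where c: "\<exists>g\<in>S. c g \<noteq> 0" "(\<Sum>g\<in>S. (\<lambda>x. c g * g x)) = 0"
      using fun_space.dependent_finite[of S] by (auto simp: S_def)
    then obtain k where k: "k \<le> N" "c (\<phi> k) \<noteq> 0" by (auto simp: S_def)
    have "(\<Sum>g\<in>S. (\<lambda>x. c g * g x)) = (\<Sum>k\<in>{..N}. (\<lambda>x. c (\<phi> k) * \<phi> k x))"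
      unfolding S_def by (subst sum.reindex[OF inj]) (simp only: o_def)
    then have z: "(\<Sum>k\<le>N. c (\<phi> k) * \<phi> k x) = 0" for x
      using c(2) unfolding sum_at by (simp add: fun_eq_iff)
    obtain x where x: "\<phi> k x \<noteq> 0" using nz by blast
    have "(\<Sum>j\<le>N. c (\<phi> j) * \<phi> j x) = c (\<phi> k) * \<phi> k x"
      by (subst sum.remove[of _ k]) (use k x disj'[of _ k x] in \<open>auto intro!: sum.neutral\<close>)
    then show False using z[of x] k x by simp
  qed
  obtain B where B: "finite B" "card B \<le> N" "\<not> fun_space.dependent B" "fun_space.span B = V"
    using N[rule_format, of V] sub negV fun_space.subspace_span[of S] unfolding V_def[symmetric] by blast
  have "S \<subseteq> fun_space.span B" unfolding B(4) V_def by (rule fun_space.span_superset)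
  then have "card S \<le> card B"
    using fun_space.independent_span_bound[OF B(1) indep] by blast
  moreover have "card S = Suc N" unfolding S_def using card_image[OF inj] by simp
  ultimately show False using B(2) by simp
qed

section \<open>Weak solutions and admissible test functions\<close>

text \<open>Both factors are at most max a b. Together with \<open>pw_mix\<close> this bounds the
  integrands of the equation and of the linearized operator by p-th powers of the gradients
  involved.\<close>

lemma powr_mix:
  fixes a b p :: real
  assumes "a \<ge> 0" "b \<ge> 0" "p \<ge> 1"
  shows "a powr (p - 1) * b \<le> a powr p + b powr p"
proof -
  have m: "r powr (p - 1) * r = r powr p" if "r \<ge> 0" for r
    using powr_mult_base[OF that, of "p - 1"] by (simp add: mult.commute)
  have "a powr (p - 1) * b \<le> max a b powr (p - 1) * max a b"
    using assms by (intro mult_mono powr_mono2) auto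
  also have "\<dots> = max a b powr p" using m[of "max a b"] assms by simp
  also have "\<dots> \<le> a powr p + b powr p" by (simp add: max_def)
  finally show ?thesis .
qed

lemma pw_mix:
  fixes a b p :: real
  assumes "a \<ge> 0" "b \<ge> 0" "p \<ge> 2"
  shows "pw p a * b\<^sup>2 \<le> a powr p + b powr p"
proof (cases "p = 2")
  case True
  then show ?thesis using assms by (simp add: pw_def)
next
  case False
  have m: "r powr (p - 2) * r\<^sup>2 = r powr p" if "r \<ge> 0" for r
  proof (cases "r = 0")
    case False
    then have "r > 0" using that by simp
    then show ?thesis using powr_add[of r "p - 2" 2] by (simp add: powr_numeral)
  qed simp
  have "a powr (p - 2) * b\<^sup>2 \<le> max a b powr (p - 2) * (max a b)\<^sup>2"
    using assms by (intro mult_mono powr_mono2 power_mono) auto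
  also have "\<dots> = max a b powr p" using m[of "max a b"] assms by simp
  also have "\<dots> \<le> a powr p + b powr p" by (simp add: max_def)
  finally show ?thesis using False by (simp add: pw_def)
qed

lemma le_1_plus_powr:
  fixes b p :: real
  assumes "b \<ge> 0" "p \<ge> 1"
  shows "b \<le> 1 + b powr p"
proof (cases "b \<le> 1")
  case False
  then have "b powr 1 \<le> b powr p" using assms by (intro powr_mono) auto
  then show ?thesis using False by simp
qed (simp add: add_increasing2)

lemma ball_dominated_convergence:
  fixes s :: "nat \<Rightarrow> real^'n \<Rightarrow> real"
  assumes [measurable]: "\<And>k. s k \<in> borel_measurable borel" "t \<in> borel_measurable borel" and g: "integrable lborel g"
    and lim: "AE x in lborel. norm x \<le> R \<longrightarrow> (\<lambda>k. s k x) \<longlonglongrightarrow> t x"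
    and bd: "AE x in lborel. norm x \<le> R \<longrightarrow> (\<forall>k. \<bar>s k x\<bar> \<le> g x)" and g0: "\<And>x. 0 \<le> g x"
    and out: "\<And>k x. norm x > R \<Longrightarrow> s k x = 0" "\<And>x. norm x > R \<Longrightarrow> t x = 0"
  shows "(\<lambda>k. LINT x|lborel. s k x) \<longlonglongrightarrow> (LINT x|lborel. t x)" "integrable lborel t" "integrable lborel (s k)"
proof -
  have l: "AE x in lborel. (\<lambda>k. s k x) \<longlonglongrightarrow> t x"
    using lim by eventually_elim (use out in \<open>auto simp: not_le\<close>)
  have b: "AE x in lborel. norm (s k x) \<le> g x" for k
    using bd by eventually_elim (metis g0 norm_zero not_le out(1) real_norm_def)
  show "(\<lambda>k. LINT x|lborel. s k x) \<longlonglongrightarrow> (LINT x|lborel. t x)"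
    by (rule integral_dominated_convergence[OF _ _ g l b]) auto
  show "integrable lborel t"
    by (rule integrable_dominated_convergence[OF _ _ g l b]) auto
  show "integrable lborel (s k)"
    by (rule integrable_dominated_convergence2[OF _ _ g l b]) auto
qed

lemma cball_finite: "emeasure lborel (cball (c :: 'a::euclidean_space) R) < top"
  using emeasure_lborel_cball_finite[of c R] by simp

text \<open>The solution enters through Borel representatives \<open>u\<close> and \<open>G\<close>,
  so that translations, dilations and Fubini's theorem on \<open>lborel\<close> raise no
  measurability questions; \<open>F\<close> is an antiderivative of \<open>f\<close>. Sign and
  growth of \<open>f\<close> and stability are left to the individual lemmas: stability is available
  only outside a ball, and the two cases of the theorem differ in the growth conditions.\<close>

locale weak_solution =
  fixes p :: real and H :: "real^'n \<Rightarrow> real" and A0 :: "real^'n^'n" and f F :: "real \<Rightarrow> real"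
    and u :: "real^'n \<Rightarrow> real" and G :: "real^'n \<Rightarrow> real^'n"
  assumes n2: "CARD('n) \<ge> 2" and p2: "p \<ge> 2" and H: "anisotropy H"
    and f_deriv: "\<And>s. (f has_real_derivative deriv f s) (at s)" and f'_cont: "continuous_on UNIV (deriv f)"
    and F_deriv: "\<And>s. (F has_real_derivative f s) (at s)"
    and u_borel [measurable]: "u \<in> borel_measurable borel" and G_borel [measurable]: "G \<in> borel_measurable borel"
    and u_bounded: "\<And>R. \<exists>C. AE x in lborel. norm x \<le> R \<longrightarrow> \<bar>u x\<bar> \<le> C"
    and G_powr: "\<And>R. set_integrable lborel (cball 0 R) (\<lambda>x. norm (G x) powr p)"
    and G_weak: "\<And>\<phi> i. \<phi> \<in> Cc_infinity \<Longrightarrow>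
      (LINT x|lborel. u x * partial i \<phi> x) = - (LINT x|lborel. G x $ i * \<phi> x)"
    and equation: "\<And>\<phi>. \<phi> \<in> Cc_infinity \<Longrightarrow>
      (LINT x|lborel. flux p H (G x) \<bullet> grad \<phi> x) = (LINT x|lborel. f (u x) * \<phi> x)"
begin

lemma f_cont: "continuous_on UNIV f" and F_cont: "continuous_on UNIV F"
  using f_deriv F_deriv by (meson DERIV_isCont continuous_at_imp_continuous_on)+

lemma f_borel [measurable]: "f \<in> borel_measurable borel" "deriv f \<in> borel_measurable borel" "F \<in> borel_measurable borel"
  using f_cont f'_cont F_cont by (auto intro: borel_measurable_continuous_onI)

lemma H_borel [measurable]: "H \<in> borel_measurable borel"
  using anisotropyD(2)[OF H] by (rule borel_measurable_continuous_onI)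

lemma flux_borel' [measurable]: "flux p H \<in> borel_measurable borel"
  using flux_borel[OF H] p2 by simp

lemma hform_borel [measurable]:
  assumes [measurable]: "a \<in> borel_measurable borel" "b \<in> borel_measurable borel"
  shows "(\<lambda>x. hform p H A0 (G x) (a x) (b x)) \<in> borel_measurable borel"
proof -
  have [measurable]: "(\<lambda>x. hess_Hp p H A0 (G x) $ i $ j) \<in> borel_measurable borel" for i j
    by (rule measurable_compose[OF G_borel hess_Hp_borel[OF H]]) (use p2 in simp)
  have [measurable]: "(\<lambda>x. a x $ i) \<in> borel_measurable borel" "(\<lambda>x. b x $ i) \<in> borel_measurable borel" for i
    by (simp_all add: cart_eq_inner_axis)
  show ?thesis unfolding hform_def by measurable
qed

lemma locally_bounded_comp:
  fixes h :: "real \<Rightarrow> real"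
  assumes "continuous_on UNIV h"
  shows "\<exists>C>0. AE x in lborel. norm x \<le> R \<longrightarrow> \<bar>h (u x)\<bar> \<le> C"
proof -
  obtain C where C: "AE x in lborel. norm x \<le> R \<longrightarrow> \<bar>u x\<bar> \<le> C" using u_bounded by blast
  have "compact (h ` {-C..C})" using assms by (intro compact_continuous_image) (auto intro: continuous_on_subset)
  from bounded_pos[THEN iffD1, OF compact_imp_bounded[OF this]]
  obtain B where "B > 0" "\<forall>z\<in>h ` {-C..C}. norm z \<le> B" by blast
  then have B: "B > 0" "\<And>y. y \<in> {-C..C} \<Longrightarrow> \<bar>h y\<bar> \<le> B" by auto
  have "AE x in lborel. norm x \<le> R \<longrightarrow> \<bar>h (u x)\<bar> \<le> B"
    using C by eventually_elim (auto intro!: B)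
  with B(1) show ?thesis by blast
qed

lemma locally_integrableI_bounded:
  fixes g :: "real^'n \<Rightarrow> 'b::euclidean_space"
  assumes [measurable]: "g \<in> borel_measurable borel" and "\<And>R. \<exists>C. AE x in lborel. norm x \<le> R \<longrightarrow> norm (g x) \<le> C"
  shows "locally_integrable g"
  unfolding locally_integrable_def set_integrable_def
proof (intro conjI allI)
  fix R
  obtain C where "AE x in lborel. norm x \<le> R \<longrightarrow> norm (g x) \<le> C" using assms(2) by blast
  then show "integrable lborel (\<lambda>x. indicator (cball 0 R) x *\<^sub>R g x)"
    by (intro integrableI_bounded_set_indicator[where B = C]) (auto simp: cball_finite)
qed simp

text \<open>The shape of several majorants below: a constant on a ball, |G|^p there, and the
  majorant \<open>w\<close> of the approximating gradients.\<close>

lemma dom_integrable: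
  assumes "integrable lborel w"
  shows "integrable lborel (\<lambda>x. K * (indicator (cball 0 R) x * (1 + norm (G x) powr p) + w x))"
proof -
  have "integrable lborel (indicator (cball 0 R) :: real^'n \<Rightarrow> real)"
    by (intro integrable_real_indicator) (auto simp: cball_finite)
  moreover have "integrable lborel (\<lambda>x. indicator (cball 0 R) x * norm (G x) powr p)"
    using G_powr[of R] by (simp add: set_integrable_def)
  ultimately have "integrable lborel (\<lambda>x. indicator (cball 0 R) x + indicator (cball 0 R) x * norm (G x) powr p + w x)"
    using assms by (intro Bochner_Integration.integrable_add)
  then have "integrable lborel (\<lambda>x. K * (indicator (cball 0 R) x + indicator (cball 0 R) x * norm (G x) powr p + w x))"
    by (intro integrable_mult_right)
  moreover have "(\<lambda>x. K * (indicator (cball 0 R) x * (1 + norm (G x) powr p) + w x)) =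
      (\<lambda>x. K * (indicator (cball 0 R) x + indicator (cball 0 R) x * norm (G x) powr p + w x))"
    by (simp only: distrib_left mult_1_right)
  ultimately show ?thesis by (simp only:)
qed

lemma u_locally_integrable: "locally_integrable u"
  using u_bounded by (intro locally_integrableI_bounded) auto

lemma Gp_locally_integrable: "locally_integrable (\<lambda>x. norm (G x) powr p)"
  using G_powr by (simp add: locally_integrable_def)

lemma G_locally_integrable: "locally_integrable G"
  unfolding locally_integrable_def set_integrable_def
proof (intro conjI allI)
  fix R
  have "integrable lborel (\<lambda>x. 1 * (indicator (cball 0 R) x * (1 + norm (G x) powr p) + 0))"
    by (rule dom_integrable) simp
  then show "integrable lborel (\<lambda>x. indicator (cball 0 R) x *\<^sub>R G x)"
    by (rule Bochner_Integration.integrable_bound)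
      (use p2 le_1_plus_powr[of "norm (G _)" p] in \<open>auto simp: indicator_def\<close>)
qed simp

lemma approximation:
  assumes "C \<ge> 0" "AE x in lborel. norm x \<le> R + 1 \<longrightarrow> \<bar>u x\<bar> \<le> C"
  obtains v :: "nat \<Rightarrow> real^'n \<Rightarrow> real" and w :: "real^'n \<Rightarrow> real"
  where "\<And>k. smooth (v k)"
    and "AE x in lborel. norm x \<le> R \<longrightarrow> (\<lambda>k. v k x) \<longlonglongrightarrow> u x \<and> (\<lambda>k. grad (v k) x) \<longlonglongrightarrow> G x"
    and "\<And>k x. norm x \<le> R \<Longrightarrow> \<bar>v k x\<bar> \<le> C"
    and "AE x in lborel. norm x \<le> R \<longrightarrow> (\<forall>k. norm (grad (v k) x) powr p \<le> w x)"
    and "integrable lborel w" "\<And>x. 0 \<le> w x"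
proof -
  have "p \<ge> 1" using p2 by simp
  show ?thesis
    by (rule mollified_sequence[OF \<open>p \<ge> 1\<close> u_locally_integrable G_locally_integrable Gp_locally_integrable assms(2) G_weak])
      (assumption | rule that; assumption)+
qed

text \<open>By \<open>pw_mix\<close> the quantity |G|^(p-2) |grad phi|^2 is at most |G|^p + |grad
  phi|^p. Both facts feed \<open>finite_morse_index_stable_outside\<close>, where the energy of a
  sum has to be split.\<close>

lemma hform_locally_integrable:
  assumes \<phi>: "\<phi> \<in> Cc1"
  shows "integrable lborel (\<lambda>x. hform p H A0 (G x) (grad \<phi> x) (grad \<phi> x))"
    and "integrable lborel (\<lambda>x. deriv f (u x) * \<phi> x * \<phi> x)"
proof -
  obtain r where r: "r > 0" "\<And>x. norm x \<ge> r \<Longrightarrow> \<phi> x = 0" "\<And>x. norm x > r \<Longrightarrow> grad \<phi> x = 0"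
    using ball_support_of_Cc1[OF \<phi>] by blast
  have c: "continuous_on UNIV \<phi>" "continuous_on UNIV (grad \<phi>)"
  proof -
    have "Ck_on 1 UNIV \<phi>" using \<phi> by (simp add: Cc1_def)
    then show "continuous_on UNIV \<phi>" "continuous_on UNIV (grad \<phi>)"
      using Ck_on_SucD[of 0 UNIV \<phi>] unfolding grad_def by (auto intro!: continuous_on_vec_lambda)
  qed
  note [measurable] = c[THEN borel_measurable_continuous_onI]
  obtain B1 where B1: "B1 > 0" "\<And>x. norm (\<phi> x) \<le> B1"
    using continuous_vanishing_outside_bounded[OF c(1), of r] r by (metis less_imp_le)
  obtain B2 where B2: "B2 > 0" "\<And>x. norm (grad \<phi> x) \<le> B2"
    using continuous_vanishing_outside_bounded[OF c(2), of r] r by metis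
  obtain Ch where Ch: "Ch > 0" "\<And>\<xi> a b. \<bar>hform p H A0 \<xi> a b\<bar> \<le> Ch * pw p (norm \<xi>) * norm a * norm b"
    using hform_bound[OF H p2] by blast
  obtain Cf where Cf: "Cf > 0" "AE x in lborel. norm x \<le> r \<longrightarrow> \<bar>deriv f (u x)\<bar> \<le> Cf"
    using locally_bounded_comp[OF f'_cont] by blast
  have K: "integrable lborel (\<lambda>x. (Ch * (1 + B2 powr p)) * (indicator (cball 0 r) x * (1 + norm (G x) powr p) + 0))"
    by (rule dom_integrable) simp
  show "integrable lborel (\<lambda>x. hform p H A0 (G x) (grad \<phi> x) (grad \<phi> x))"
  proof (rule Bochner_Integration.integrable_bound[OF K])
    show "AE x in lborel. norm (hform p H A0 (G x) (grad \<phi> x) (grad \<phi> x)) \<le>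
      norm ((Ch * (1 + B2 powr p)) * (indicator (cball 0 r) x * (1 + norm (G x) powr p) + 0))"
    proof (rule AE_I2)
      fix x
      show "norm (hform p H A0 (G x) (grad \<phi> x) (grad \<phi> x)) \<le>
        norm ((Ch * (1 + B2 powr p)) * (indicator (cball 0 r) x * (1 + norm (G x) powr p) + 0))"
      proof (cases "norm x \<le> r")
        case True
        have "\<bar>hform p H A0 (G x) (grad \<phi> x) (grad \<phi> x)\<bar> \<le> Ch * (pw p (norm (G x)) * (norm (grad \<phi> x))\<^sup>2)"
          using Ch(2)[of "G x" "grad \<phi> x" "grad \<phi> x"] by (simp add: power2_eq_square mult_ac)
        also have "\<dots> \<le> Ch * (norm (G x) powr p + norm (grad \<phi> x) powr p)"
          using Ch p2 by (intro mult_left_mono pw_mix) auto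
        also have "\<dots> \<le> Ch * (norm (G x) powr p + B2 powr p)"
          using Ch B2 p2 by (intro mult_left_mono add_left_mono powr_mono2) auto
        also have "\<dots> \<le> Ch * ((1 + B2 powr p) * (1 + norm (G x) powr p))"
          using Ch by (intro mult_left_mono) (auto simp: distrib_left distrib_right)
        finally show ?thesis using True Ch by (simp add: abs_mult)
      next
        case False
        then show ?thesis using r(3)[of x] by (simp add: hform_def)
      qed
    qed
  qed simp
  show "integrable lborel (\<lambda>x. deriv f (u x) * \<phi> x * \<phi> x)"
  proof (rule integrableI_bounded_set[where A = "cball 0 r" and B = "Cf * B1 * B1"])
    show "AE x in lborel. x \<in> cball 0 r \<longrightarrow> norm (deriv f (u x) * \<phi> x * \<phi> x) \<le> Cf * B1 * B1"
      using Cf(2)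
    proof eventually_elim
      case (elim x)
      show ?case
      proof
        assume "x \<in> cball 0 r"
        then have "\<bar>deriv f (u x)\<bar> * \<bar>\<phi> x\<bar> * \<bar>\<phi> x\<bar> \<le> Cf * B1 * B1"
          using elim B1 Cf by (intro mult_mono) auto
        then show "norm (deriv f (u x) * \<phi> x * \<phi> x) \<le> Cf * B1 * B1" by (simp add: abs_mult)
      qed
    qed
    show "AE x in lborel. x \<notin> cball 0 r \<longrightarrow> deriv f (u x) * \<phi> x * \<phi> x = 0"
      using r(2) by (intro AE_I2) auto
  qed (auto simp: cball_finite)
qed

text \<open>u psi is not smooth and is replaced by v_k psi with mollified v_k. The product form
  matters: v_k psi vanishes wherever psi does, so a cutoff that is 0 near the origin yields test
  functions to which stability outside a ball applies.\<close>

lemma test_sequence: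
  assumes \<psi>: "\<psi> \<in> Cc_infinity"
  obtains \<phi> r K w where "\<And>k. \<phi> k \<in> Cc_infinity" "\<And>k x. \<psi> x = 0 \<Longrightarrow> \<phi> k x = 0"
    "\<And>x. norm x > r \<Longrightarrow> \<psi> x = 0" "\<And>x. norm x > r \<Longrightarrow> grad \<psi> x = 0" "\<And>k x. norm x > r \<Longrightarrow> grad (\<phi> k) x = 0"
    "AE x in lborel. norm x \<le> r \<longrightarrow> (\<lambda>k. \<phi> k x) \<longlonglongrightarrow> u x * \<psi> x"
    "AE x in lborel. norm x \<le> r \<longrightarrow> (\<lambda>k. grad (\<phi> k) x) \<longlonglongrightarrow> u x *\<^sub>R grad \<psi> x + \<psi> x *\<^sub>R G x"
    "K \<ge> 0" "\<And>k x. \<bar>\<phi> k x\<bar> \<le> K" "integrable lborel w" "\<And>x. 0 \<le> w x"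
    "AE x in lborel. norm x \<le> r \<longrightarrow> (\<forall>k. norm (G x) powr p \<le> w x \<and> norm (grad (\<phi> k) x) powr p \<le> w x)"
proof -
  have sm: "smooth \<psi>" and cs: "compactly_supported \<psi>" using \<psi> by (auto simp: Cc_infinity_iff)
  have p0: "p > 0" "p \<ge> 1" using p2 by auto
  obtain r where r: "r > 0" "\<And>x. norm x \<ge> r \<Longrightarrow> \<psi> x = 0" "\<And>x. norm x > r \<Longrightarrow> grad \<psi> x = 0"
    using ball_support_of_Cc1[of \<psi>] \<psi> Cc_infinity_subset_Cc1 by blast
  obtain C0 where "AE x in lborel. norm x \<le> r + 1 \<longrightarrow> \<bar>u x\<bar> \<le> C0" using u_bounded by blast
  then have C: "AE x in lborel. norm x \<le> r + 1 \<longrightarrow> \<bar>u x\<bar> \<le> max C0 0"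
    by eventually_elim auto
  define C where "C = max C0 0"
  have C0: "C \<ge> 0" by (simp add: C_def)
  obtain v w where v: "\<And>k. smooth (v k)"
      "AE x in lborel. norm x \<le> r \<longrightarrow> (\<lambda>k. v k x) \<longlonglongrightarrow> u x \<and> (\<lambda>k. grad (v k) x) \<longlonglongrightarrow> G x"
      "\<And>k x. norm x \<le> r \<Longrightarrow> \<bar>v k x\<bar> \<le> C"
      "AE x in lborel. norm x \<le> r \<longrightarrow> (\<forall>k. norm (grad (v k) x) powr p \<le> w x)"
      "integrable lborel w" "\<And>x. 0 \<le> w x"
    using approximation[OF C0 C[folded C_def]] by blast
  note cont = smooth_continuous_on[OF sm, of UNIV] smooth_continuous_grad[OF sm, of UNIV]
  obtain B1 where B1: "B1 > 0" "\<And>x. norm (\<psi> x) \<le> B1"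
    using continuous_vanishing_outside_bounded[OF cont(1), of r] r by (metis less_imp_le)
  obtain B2 where B2: "B2 > 0" "\<And>x. norm (grad \<psi> x) \<le> B2"
    using continuous_vanishing_outside_bounded[OF cont(2), of r] r by metis
  define \<phi> where "\<phi> k x = v k x * \<psi> x" for k x
  have \<phi>C: "\<phi> k \<in> Cc_infinity" for k
    unfolding Cc_infinity_iff
  proof
    show "smooth (\<phi> k)" unfolding \<phi>_def[abs_def] by (intro smooth_mult v sm)
    show "compactly_supported (\<phi> k)" by (rule compactly_supportedI[of r]) (use r in \<open>simp add: \<phi>_def\<close>)
  qed
  have g\<phi>: "grad (\<phi> k) x = v k x *\<^sub>R grad \<psi> x + \<psi> x *\<^sub>R grad (v k) x" for k x
    unfolding \<phi>_def[abs_def] by (rule grad_mult) (auto intro: smooth_differentiable sm v)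
  have ng: "norm (grad (\<phi> k) x) \<le> C * B2 + B1 * norm (grad (v k) x)" if "norm x \<le> r" for k x
  proof -
    have "norm (grad (\<phi> k) x) \<le> \<bar>v k x\<bar> * norm (grad \<psi> x) + \<bar>\<psi> x\<bar> * norm (grad (v k) x)"
      unfolding g\<phi> by (rule norm_triangle_le) simp
    also have "\<dots> \<le> C * B2 + B1 * norm (grad (v k) x)"
      using v(3)[OF that] B1(2)[of x] B2 C0 by (intro add_mono mult_mono) auto
    finally show ?thesis .
  qed
  \<comment> \<open>One constant for both terms of the product rule, once |grad v_k| is replaced by
    its maximum with 1.\<close>
  define B where "B = max 1 (C * B2 + B1)"
  have ngp: "norm (grad (\<phi> k) x) powr p \<le> B powr p * (1 + w x)"
    if "norm x \<le> r" "norm (grad (v k) x) powr p \<le> w x" for k x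
  proof -
    have "norm (grad (\<phi> k) x) \<le> B * max 1 (norm (grad (v k) x))"
    proof -
      have "norm (grad (\<phi> k) x) \<le> C * B2 * max 1 (norm (grad (v k) x)) + B1 * max 1 (norm (grad (v k) x))"
      proof (rule order_trans[OF ng[OF that(1)] add_mono])
        show "C * B2 \<le> C * B2 * max 1 (norm (grad (v k) x))"
          using C0 B2(1) mult_left_mono[of 1 "max 1 (norm (grad (v k) x))" "C * B2"] by simp
        show "B1 * norm (grad (v k) x) \<le> B1 * max 1 (norm (grad (v k) x))"
          using B1(1) by (intro mult_left_mono) auto
      qed
      also have "\<dots> \<le> B * max 1 (norm (grad (v k) x))"
        unfolding B_def distrib_right[symmetric] by (intro mult_right_mono) auto
      finally show ?thesis .
    qed
    then have "norm (grad (\<phi> k) x) powr p \<le> (B * max 1 (norm (grad (v k) x))) powr p"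
      using p0 by (intro powr_mono2) auto
    also have "\<dots> = B powr p * max 1 (norm (grad (v k) x)) powr p"
      by (rule powr_mult)
    also have "max 1 (norm (grad (v k) x)) powr p \<le> 1 + w x"
      using that(2) v(6)[of x] by (auto simp: max_def)
    finally show ?thesis by (simp add: mult_left_mono)
  qed
  show ?thesis
  proof (rule that[of \<phi> r "C * B1" "\<lambda>x. (1 + B powr p) * (indicator (cball 0 r) x * (1 + norm (G x) powr p) + w x)"])
    show "grad (\<phi> k) x = 0" if "norm x > r" for k x
      using r(3)[OF that] r(2)[of x] that by (auto simp: g\<phi>)
    show "AE x in lborel. norm x \<le> r \<longrightarrow> (\<lambda>k. \<phi> k x) \<longlonglongrightarrow> u x * \<psi> x"
      using v(2) by eventually_elim (auto simp: \<phi>_def intro!: tendsto_intros)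
    show "AE x in lborel. norm x \<le> r \<longrightarrow> (\<lambda>k. grad (\<phi> k) x) \<longlonglongrightarrow> u x *\<^sub>R grad \<psi> x + \<psi> x *\<^sub>R G x"
      using v(2) by eventually_elim (auto simp: g\<phi> intro!: tendsto_intros)
    show "\<bar>\<phi> k x\<bar> \<le> C * B1" for k x
    proof (cases "norm x \<le> r")
      case True
      then show ?thesis using v(3)[OF True, of k] B1 C0 by (auto simp: \<phi>_def abs_mult intro!: mult_mono)
    next
      case False
      then show ?thesis using r(2)[of x] C0 B1 by (simp add: \<phi>_def)
    qed
    show "AE x in lborel. norm x \<le> r \<longrightarrow> (\<forall>k. norm (G x) powr p \<le> (1 + B powr p) * (indicator (cball 0 r) x * (1 + norm (G x) powr p) + w x) \<and>
        norm (grad (\<phi> k) x) powr p \<le> (1 + B powr p) * (indicator (cball 0 r) x * (1 + norm (G x) powr p) + w x))"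
      using v(4)
    proof eventually_elim
      case (elim x)
      show ?case
      proof (intro impI allI conjI)
        fix k assume x: "norm x \<le> r"
        have b: "a * c \<le> (1 + B powr p) * (1 + norm (G x) powr p + w x)"
          if "0 \<le> a" "a \<le> 1 + B powr p" "c \<le> 1 + norm (G x) powr p + w x" for a c
          using that v(6)[of x] mult_mono[of a "1 + B powr p" "max c 0" "1 + norm (G x) powr p + w x"]
          by (cases "c \<ge> 0") (auto intro: order_trans[OF mult_nonneg_nonpos])
        show "norm (G x) powr p \<le> (1 + B powr p) * (indicator (cball 0 r) x * (1 + norm (G x) powr p) + w x)"
          using b[of 1 "norm (G x) powr p"] x v(6)[of x] by simp
        have "norm (grad (\<phi> k) x) powr p \<le> B powr p * (1 + w x)" using ngp x elim by blast
        then show "norm (grad (\<phi> k) x) powr p \<le> (1 + B powr p) * (indicator (cball 0 r) x * (1 + norm (G x) powr p) + w x)"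
          using b[of "B powr p" "1 + w x"] x by simp
      qed
    qed
    show "integrable lborel (\<lambda>x. (1 + B powr p) * (indicator (cball 0 r) x * (1 + norm (G x) powr p) + w x))"
      by (rule dom_integrable[OF v(5)])
    show "0 \<le> (1 + B powr p) * (indicator (cball 0 r) x * (1 + norm (G x) powr p) + w x)" for x
      using v(6)[of x] by simp
    show "\<And>x. norm x > r \<Longrightarrow> \<psi> x = 0" "\<And>x. norm x > r \<Longrightarrow> grad \<psi> x = 0" using r by auto
  qed (use \<phi>C C0 B1 in \<open>auto simp: \<phi>_def\<close>)
qed

text \<open>Carries the equation and the stability inequality from the functions of
  \<open>test_sequence\<close> to u psi, by four dominated limits: flux, f, Hessian form and f'.
  Stability is assumed for functions vanishing where psi does, which the approximations
  satisfy.\<close>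

lemma
  assumes \<psi>: "\<psi> \<in> Cc_infinity"
  shows weak_form_limit: "(LINT x|lborel. flux p H (G x) \<bullet> (u x *\<^sub>R grad \<psi> x + \<psi> x *\<^sub>R G x)) = (LINT x|lborel. f (u x) * (u x * \<psi> x))"
    and weak_form_integrable: "integrable lborel (\<lambda>x. flux p H (G x) \<bullet> (u x *\<^sub>R grad \<psi> x + \<psi> x *\<^sub>R G x))"
      "integrable lborel (\<lambda>x. f (u x) * (u x * \<psi> x))"
    and stability_limit: "(\<And>\<phi>. \<phi> \<in> Cc_infinity \<Longrightarrow> (\<And>x. \<psi> x = 0 \<Longrightarrow> \<phi> x = 0) \<Longrightarrow>
        (LINT x|lborel. deriv f (u x) * \<phi> x * \<phi> x) \<le> (LINT x|lborel. hform p H A0 (G x) (grad \<phi> x) (grad \<phi> x))) \<Longrightarrow>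
      (LINT x|lborel. deriv f (u x) * (u x * \<psi> x) * (u x * \<psi> x)) \<le>
      (LINT x|lborel. hform p H A0 (G x) (u x *\<^sub>R grad \<psi> x + \<psi> x *\<^sub>R G x) (u x *\<^sub>R grad \<psi> x + \<psi> x *\<^sub>R G x))"
    and stability_integrable: "integrable lborel (\<lambda>x. deriv f (u x) * (u x * \<psi> x) * (u x * \<psi> x))"
      "integrable lborel (\<lambda>x. hform p H A0 (G x) (u x *\<^sub>R grad \<psi> x + \<psi> x *\<^sub>R G x) (u x *\<^sub>R grad \<psi> x + \<psi> x *\<^sub>R G x))"
proof -
  have sm: "smooth \<psi>" using \<psi> by (auto simp: Cc_infinity_iff)
  have p0: "p > 0" "p \<ge> 1" using p2 by auto
  obtain \<phi> r K w where P: "\<And>k. \<phi> k \<in> Cc_infinity" "\<And>k x. \<psi> x = 0 \<Longrightarrow> \<phi> k x = 0"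
    "\<And>x. norm x > r \<Longrightarrow> \<psi> x = 0" "\<And>x. norm x > r \<Longrightarrow> grad \<psi> x = 0" "\<And>k x. norm x > r \<Longrightarrow> grad (\<phi> k) x = 0"
    "AE x in lborel. norm x \<le> r \<longrightarrow> (\<lambda>k. \<phi> k x) \<longlonglongrightarrow> u x * \<psi> x"
    "AE x in lborel. norm x \<le> r \<longrightarrow> (\<lambda>k. grad (\<phi> k) x) \<longlonglongrightarrow> u x *\<^sub>R grad \<psi> x + \<psi> x *\<^sub>R G x"
    "K \<ge> 0" "\<And>k x. \<bar>\<phi> k x\<bar> \<le> K" "integrable lborel w" "\<And>x. 0 \<le> w x"
    "AE x in lborel. norm x \<le> r \<longrightarrow> (\<forall>k. norm (G x) powr p \<le> w x \<and> norm (grad (\<phi> k) x) powr p \<le> w x)"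
    by (rule test_sequence[OF \<psi>]) (rule that; assumption)
  have sm\<phi>: "smooth (\<phi> k)" for k using P(1) by (simp add: Cc_infinity_iff)
  have [measurable]: "\<psi> \<in> borel_measurable borel" "grad \<psi> \<in> borel_measurable borel"
    "\<phi> k \<in> borel_measurable borel" "grad (\<phi> k) \<in> borel_measurable borel" for k
    using smooth_continuous_on[OF sm] smooth_continuous_grad[OF sm] smooth_continuous_on[OF sm\<phi>] smooth_continuous_grad[OF sm\<phi>]
    by (auto intro: borel_measurable_continuous_onI)
  define q where "q x = u x *\<^sub>R grad \<psi> x + \<psi> x *\<^sub>R G x" for x
  have [measurable]: "q \<in> borel_measurable borel" unfolding q_def by measurable
  have q0: "q x = 0" if "norm x > r" for x using P(3,4) that by (simp add: q_def)
  obtain Ca where Ca: "Ca > 0" "\<And>\<xi>. norm (flux p H \<xi>) \<le> Ca * norm \<xi> powr (p - 1)"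
    using flux_bound[OF H p0(1)] by blast
  obtain Ch where Ch: "Ch > 0" "\<And>\<xi> a b. \<bar>hform p H A0 \<xi> a b\<bar> \<le> Ch * pw p (norm \<xi>) * norm a * norm b"
    using hform_bound[OF H p2] by blast
  obtain Cf where Cf: "Cf > 0" "AE x in lborel. norm x \<le> r \<longrightarrow> \<bar>f (u x)\<bar> \<le> Cf"
    using locally_bounded_comp[OF f_cont] by blast
  obtain Cf' where Cf': "Cf' > 0" "AE x in lborel. norm x \<le> r \<longrightarrow> \<bar>deriv f (u x)\<bar> \<le> Cf'"
    using locally_bounded_comp[OF f'_cont] by blast
  \<comment> \<open>The base point \<open>\<xi>\<close> = G x stays fixed and only the directions
    converge, so a discontinuity of the Hessian at the origin, possible for p = 2, is never
    met.\<close>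
  have hform_tendsto: "(\<lambda>k. hform p H A0 \<xi> (a k) (a k)) \<longlonglongrightarrow> hform p H A0 \<xi> b b" if "a \<longlonglongrightarrow> b" for \<xi> a b
    unfolding hform_def using that by (intro tendsto_intros tendsto_vec_nth)
  have bd_flux: "\<bar>flux p H (G x) \<bullet> grad (\<phi> k) x\<bar> \<le> 2 * Ca * w x"
    if "norm (G x) powr p \<le> w x \<and> norm (grad (\<phi> k) x) powr p \<le> w x" for x k
  proof -
    have "\<bar>flux p H (G x) \<bullet> grad (\<phi> k) x\<bar> \<le> Ca * norm (G x) powr (p - 1) * norm (grad (\<phi> k) x)"
      by (rule order_trans[OF Cauchy_Schwarz_ineq2]) (intro mult_right_mono Ca, simp)
    also have "\<dots> \<le> Ca * (norm (G x) powr p + norm (grad (\<phi> k) x) powr p)"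
      unfolding mult.assoc using Ca p0 by (intro mult_left_mono powr_mix) auto
    also have "\<dots> \<le> Ca * (w x + w x)" using that Ca by (intro mult_left_mono add_mono) auto
    finally show ?thesis by simp
  qed
  have bd_hform: "\<bar>hform p H A0 (G x) (grad (\<phi> k) x) (grad (\<phi> k) x)\<bar> \<le> 2 * Ch * w x"
    if "norm (G x) powr p \<le> w x \<and> norm (grad (\<phi> k) x) powr p \<le> w x" for x k
  proof -
    have "\<bar>hform p H A0 (G x) (grad (\<phi> k) x) (grad (\<phi> k) x)\<bar> \<le> Ch * (pw p (norm (G x)) * (norm (grad (\<phi> k) x))\<^sup>2)"
      using Ch(2)[of "G x" "grad (\<phi> k) x" "grad (\<phi> k) x"] by (simp add: power2_eq_square mult_ac)
    also have "\<dots> \<le> Ch * (norm (G x) powr p + norm (grad (\<phi> k) x) powr p)"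
      using Ch p2 by (intro mult_left_mono pw_mix) auto
    also have "\<dots> \<le> Ch * (w x + w x)" using that Ch by (intro mult_left_mono add_mono) auto
    finally show ?thesis by simp
  qed
  have cint: "integrable lborel (\<lambda>x. c * indicator (cball 0 r) x)" for c :: real
    by (intro integrable_mult_right integrable_real_indicator) (auto simp: cball_finite)
  have L1: "AE x in lborel. norm x \<le> r \<longrightarrow> (\<lambda>k. flux p H (G x) \<bullet> grad (\<phi> k) x) \<longlonglongrightarrow> flux p H (G x) \<bullet> q x"
    using P(7) by eventually_elim (auto simp: q_def intro!: tendsto_intros)
  have B1: "AE x in lborel. norm x \<le> r \<longrightarrow> (\<forall>k. \<bar>flux p H (G x) \<bullet> grad (\<phi> k) x\<bar> \<le> 2 * Ca * w x)"
    using P(12) by eventually_elim (use bd_flux in blast)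
  have int1: "integrable lborel (\<lambda>x. 2 * Ca * w x)" "integrable lborel (\<lambda>x. 2 * Ch * w x)" using P(10) by auto
  have nn1: "0 \<le> 2 * Ca * w x" "0 \<le> 2 * Ch * w x" for x using P(11)[of x] Ca Ch by auto
  have \<phi>0: "\<phi> k x = 0" if "norm x > r" for k x using P(2,3) that by blast
  have D1: "(\<lambda>k. LINT x|lborel. flux p H (G x) \<bullet> grad (\<phi> k) x) \<longlonglongrightarrow> (LINT x|lborel. flux p H (G x) \<bullet> q x)"
    "integrable lborel (\<lambda>x. flux p H (G x) \<bullet> q x)"
    by (rule ball_dominated_convergence(1,2)[OF _ _ int1(1) L1 B1 nn1(1)]; (measurable)?; simp add: P(5) q0)+
  have L2: "AE x in lborel. norm x \<le> r \<longrightarrow> (\<lambda>k. f (u x) * \<phi> k x) \<longlonglongrightarrow> f (u x) * (u x * \<psi> x)"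
    using P(6) by eventually_elim (auto intro!: tendsto_intros)
  have B2: "AE x in lborel. norm x \<le> r \<longrightarrow> (\<forall>k. \<bar>f (u x) * \<phi> k x\<bar> \<le> Cf * K * indicator (cball 0 r) x)"
    using Cf(2) by eventually_elim (use P(8,9) Cf(1) in \<open>auto simp: abs_mult intro!: mult_mono\<close>)
  have nn2: "0 \<le> Cf * K * indicator (cball 0 r) x" "0 \<le> Cf' * (K * K) * indicator (cball 0 r) x" for x :: "real^'n"
    using Cf Cf' P(8) by auto
  have D2: "(\<lambda>k. LINT x|lborel. f (u x) * \<phi> k x) \<longlonglongrightarrow> (LINT x|lborel. f (u x) * (u x * \<psi> x))"
    "integrable lborel (\<lambda>x. f (u x) * (u x * \<psi> x))"
    by (rule ball_dominated_convergence(1,2)[OF _ _ cint L2 B2 nn2(1)]; (measurable)?; simp add: P(3) \<phi>0)+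
  have L3: "AE x in lborel. norm x \<le> r \<longrightarrow> (\<lambda>k. hform p H A0 (G x) (grad (\<phi> k) x) (grad (\<phi> k) x)) \<longlonglongrightarrow> hform p H A0 (G x) (q x) (q x)"
    using P(7) by eventually_elim (auto simp: q_def intro!: hform_tendsto)
  have B3: "AE x in lborel. norm x \<le> r \<longrightarrow> (\<forall>k. \<bar>hform p H A0 (G x) (grad (\<phi> k) x) (grad (\<phi> k) x)\<bar> \<le> 2 * Ch * w x)"
    using P(12) by eventually_elim (use bd_hform in blast)
  have h0: "hform p H A0 \<xi> 0 0 = 0" for \<xi> by (simp add: hform_def)
  have D3: "(\<lambda>k. LINT x|lborel. hform p H A0 (G x) (grad (\<phi> k) x) (grad (\<phi> k) x)) \<longlonglongrightarrow> (LINT x|lborel. hform p H A0 (G x) (q x) (q x))"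
    "integrable lborel (\<lambda>x. hform p H A0 (G x) (q x) (q x))"
    by (rule ball_dominated_convergence(1,2)[OF _ _ int1(2) L3 B3 nn1(2)]; (measurable)?; simp add: P(5) q0 h0)+
  have L4: "AE x in lborel. norm x \<le> r \<longrightarrow> (\<lambda>k. deriv f (u x) * \<phi> k x * \<phi> k x) \<longlonglongrightarrow> deriv f (u x) * (u x * \<psi> x) * (u x * \<psi> x)"
    using P(6) by eventually_elim (auto intro!: tendsto_intros)
  have B4: "AE x in lborel. norm x \<le> r \<longrightarrow> (\<forall>k. \<bar>deriv f (u x) * \<phi> k x * \<phi> k x\<bar> \<le> Cf' * (K * K) * indicator (cball 0 r) x)"
    using Cf'(2)
  proof eventually_elim
    case (elim x)
    show ?case
    proof (intro impI allI)
      fix k assume x: "norm x \<le> r"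
      have "\<bar>deriv f (u x)\<bar> * (\<bar>\<phi> k x\<bar> * \<bar>\<phi> k x\<bar>) \<le> Cf' * (K * K)"
        using elim x P(8,9) Cf'(1) by (intro mult_mono) auto
      then show "\<bar>deriv f (u x) * \<phi> k x * \<phi> k x\<bar> \<le> Cf' * (K * K) * indicator (cball 0 r) x"
        using x by (simp add: abs_mult mult.assoc)
    qed
  qed
  have D4: "(\<lambda>k. LINT x|lborel. deriv f (u x) * \<phi> k x * \<phi> k x) \<longlonglongrightarrow> (LINT x|lborel. deriv f (u x) * (u x * \<psi> x) * (u x * \<psi> x))"
    "integrable lborel (\<lambda>x. deriv f (u x) * (u x * \<psi> x) * (u x * \<psi> x))"
    by (rule ball_dominated_convergence(1,2)[OF _ _ cint L4 B4 nn2(2)]; (measurable)?; simp add: P(3) \<phi>0)+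
  show "(LINT x|lborel. flux p H (G x) \<bullet> (u x *\<^sub>R grad \<psi> x + \<psi> x *\<^sub>R G x)) = (LINT x|lborel. f (u x) * (u x * \<psi> x))"
    using LIMSEQ_unique[OF D1(1)[unfolded equation[OF P(1)]] D2(1)] by (simp add: q_def)
  show "integrable lborel (\<lambda>x. flux p H (G x) \<bullet> (u x *\<^sub>R grad \<psi> x + \<psi> x *\<^sub>R G x))"
    "integrable lborel (\<lambda>x. f (u x) * (u x * \<psi> x))"
    "integrable lborel (\<lambda>x. deriv f (u x) * (u x * \<psi> x) * (u x * \<psi> x))"
    "integrable lborel (\<lambda>x. hform p H A0 (G x) (u x *\<^sub>R grad \<psi> x + \<psi> x *\<^sub>R G x) (u x *\<^sub>R grad \<psi> x + \<psi> x *\<^sub>R G x))"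
    using D1(2) D2(2) D3(2) D4(2) by (simp_all add: q_def)
  assume "\<And>\<phi>. \<phi> \<in> Cc_infinity \<Longrightarrow> (\<And>x. \<psi> x = 0 \<Longrightarrow> \<phi> x = 0) \<Longrightarrow>
        (LINT x|lborel. deriv f (u x) * \<phi> x * \<phi> x) \<le> (LINT x|lborel. hform p H A0 (G x) (grad \<phi> x) (grad \<phi> x))"
  from LIMSEQ_le[OF D4(1) D3(1)] this[OF P(1) P(2)]
  show "(LINT x|lborel. deriv f (u x) * (u x * \<psi> x) * (u x * \<psi> x)) \<le>
      (LINT x|lborel. hform p H A0 (G x) (u x *\<^sub>R grad \<psi> x + \<psi> x *\<^sub>R G x) (u x *\<^sub>R grad \<psi> x + \<psi> x *\<^sub>R G x))"
    by (auto simp: q_def)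
qed

end

section \<open>Cutoff functions and testing with the solution\<close>

lemma grad_power:
  fixes g :: "real^'n \<Rightarrow> real"
  assumes "g differentiable (at x)"
  shows "grad (\<lambda>x. g x ^ m) x = (real m * g x ^ (m - 1)) *\<^sub>R grad g x"
proof (rule grad_eqI(1))
  have "((\<lambda>x. g x ^ m) has_derivative (\<lambda>h. of_nat m * (grad g x \<bullet> h) * g x ^ (m - 1))) (at x)"
    by (rule has_derivative_power[OF has_derivative_grad[OF assms]])
  then show "((\<lambda>x. g x ^ m) has_derivative (\<lambda>h. ((real m * g x ^ (m - 1)) *\<^sub>R grad g x) \<bullet> h)) (at x)"
    by (simp add: mult_ac)
qed

text \<open>Obtained from the indicator of the ball of radius 3/2, mollified at scale 1/4.\<close>

lemma cutoff_exists:
  obtains \<zeta> :: "real^'n \<Rightarrow> real" where "smooth \<zeta>" "\<And>x. 0 \<le> \<zeta> x" "\<And>x. \<zeta> x \<le> 1"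
    "\<And>x. norm x \<le> 1 \<Longrightarrow> \<zeta> x = 1" "\<And>x. norm x \<ge> 2 \<Longrightarrow> \<zeta> x = 0"
proof -
  obtain \<kappa> :: "real^'n \<Rightarrow> real" where k: "mollifier (1/4) \<kappa>" using mollifier_exists[of "1/4"] by auto
  have k': "smooth \<kappa>" "\<kappa> x \<ge> 0" "norm x > 1/4 \<Longrightarrow> \<kappa> x = 0" "continuous_on UNIV \<kappa>" for x
    using k smooth_continuous_on by (auto simp: mollifier_def)
  have [measurable]: "cball (0::real^'n) (3/2) \<in> sets borel" by simp
  define c where "c = (indicator (cball (0::real^'n) (3/2)) :: real^'n \<Rightarrow> real)"
  have c: "locally_integrable c"
    unfolding locally_integrable_def set_integrable_def c_def
  proof (intro conjI allI)
    fix R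
    show "integrable lborel (\<lambda>x. indicator (cball 0 R) x *\<^sub>R indicator (cball (0::real^'n) (3/2)) x :: real)"
      by (rule integrableI_bounded_set_indicator[where B = 1]) (auto simp: cball_finite indicator_def)
  qed simp
  have i: "integrable lborel (\<lambda>y. \<kappa> (x - y) * c y)" for x
    using conv_integrable[of \<kappa> "1/4" c x] k'(3,4) c by simp
  have conv: "conv \<kappa> c x = (LINT y|lborel. \<kappa> (x - y) * c y)" for x by (simp add: conv_def)
  show ?thesis
  proof (rule that[of "conv \<kappa> c"])
    show "smooth (conv \<kappa> c)" using smooth_conv[of \<kappa> "1/4" c] k'(1,3) c by blast
    show "0 \<le> conv \<kappa> c x" for x
      unfolding conv using k'(2) by (auto intro!: integral_nonneg_AE simp: c_def)
    show "conv \<kappa> c x \<le> 1" for x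
    proof -
      have "conv \<kappa> c x \<le> (LINT y|lborel. \<kappa> (x - y))"
        unfolding conv using k'(2) by (intro integral_mono i mollifier_reflect(2)[OF k]) (auto simp: c_def indicator_def)
      then show ?thesis using mollifier_reflect(1)[OF k] by simp
    qed
    show "conv \<kappa> c x = 1" if "norm x \<le> 1" for x
    proof -
      have "\<kappa> (x - y) * c y = \<kappa> (x - y)" for y
      proof (cases "norm (x - y) > 1/4")
        case False
        then have "norm y \<le> 3/2" using norm_triangle_ineq2[of y x] that by (simp add: norm_minus_commute)
        then show ?thesis by (simp add: c_def)
      qed (use k'(3) in simp)
      then show ?thesis unfolding conv by (simp only: mollifier_reflect(1)[OF k])
    qed
    show "conv \<kappa> c x = 0" if "norm x \<ge> 2" for x
    proof -
      have "\<kappa> (x - y) * c y = 0" for y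
      proof (cases "norm (x - y) > 1/4")
        case False
        then have "norm y > 3/2" using norm_triangle_ineq2[of x y] that by simp
        then show ?thesis by (simp add: c_def)
      qed (use k'(3) in simp)
      then show ?thesis unfolding conv by (simp only: integral_zero)
    qed
  qed
qed

lemma scaled_gradient_bound:
  fixes \<zeta> :: "real^'n \<Rightarrow> real"
  assumes "smooth \<zeta>" "\<And>x. norm x \<ge> r \<Longrightarrow> \<zeta> x = 0"
  obtains B where "B > 0" "\<And>R x. R > 0 \<Longrightarrow> norm (grad (\<lambda>x. \<zeta> ((1 / R) *\<^sub>R x)) x) \<le> B / R"
proof -
  have "grad \<zeta> x = 0" if "norm x > r" for x
    by (rule partial_eq_0_outside(2)[of r]) (use assms that in auto)
  then obtain B where B: "B > 0" "\<And>x. norm (grad \<zeta> x) \<le> B"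
    using continuous_vanishing_outside_bounded[OF smooth_continuous_grad[OF assms(1)], of r] by metis
  have "norm (grad (\<lambda>x. \<zeta> ((1 / R) *\<^sub>R x)) x) \<le> B / R" if "R > 0" for R x
    using grad_affine(1)[of \<zeta> 0 "1 / R" x] smooth_differentiable[OF assms(1)] B(2)[of "(1 / R) *\<^sub>R x"] that
    by (simp add: divide_right_mono)
  with B(1) that show ?thesis by blast
qed

lemma smooth_scaled: "smooth \<zeta> \<Longrightarrow> smooth (\<lambda>x. \<zeta> (c *\<^sub>R x))"
  using smooth_affine[of \<zeta> 0 c] by simp

text \<open>Scaled by R, the region where it is 1 contains both R <= |x| <= 2R, where the gradient
  of zeta(x/R) lives, and the annulus R/2 <= |x| <= 2R of the dilation errors. It vanishes near the
  origin, where stability may fail.\<close>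

lemma annular_cutoff_exists:
  obtains \<omega> :: "real^'n \<Rightarrow> real" where "smooth \<omega>" "\<And>x. 0 \<le> \<omega> x" "\<And>x. \<omega> x \<le> 1"
    "\<And>x. 1/2 \<le> norm x \<Longrightarrow> norm x \<le> 4 \<Longrightarrow> \<omega> x = 1" "\<And>x. norm x \<ge> 8 \<Longrightarrow> \<omega> x = 0" "\<And>x. norm x \<le> 1/4 \<Longrightarrow> \<omega> x = 0"
proof -
  obtain \<zeta> :: "real^'n \<Rightarrow> real" where z: "smooth \<zeta>" "\<And>x. 0 \<le> \<zeta> x" "\<And>x. \<zeta> x \<le> 1"
    "\<And>x. norm x \<le> 1 \<Longrightarrow> \<zeta> x = 1" "\<And>x. norm x \<ge> 2 \<Longrightarrow> \<zeta> x = 0"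
    using cutoff_exists by blast
  show ?thesis
  proof (rule that[of "\<lambda>x. \<zeta> ((1/4) *\<^sub>R x) * (1 - \<zeta> (4 *\<^sub>R x))"])
    show "smooth (\<lambda>x. \<zeta> ((1/4) *\<^sub>R x) * (1 - \<zeta> (4 *\<^sub>R x)))"
      by (intro smooth_mult smooth_diff smooth_const smooth_scaled z)
    show "0 \<le> \<zeta> ((1/4) *\<^sub>R x) * (1 - \<zeta> (4 *\<^sub>R x))" for x using z(2,3) by simp
    show "\<zeta> ((1/4) *\<^sub>R x) * (1 - \<zeta> (4 *\<^sub>R x)) \<le> 1" for x
      using z(2,3) mult_le_one[of "\<zeta> ((1/4) *\<^sub>R x)" "1 - \<zeta> (4 *\<^sub>R x)"] by simp
  qed (use z(4,5) in auto)
qed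

context weak_solution
begin

lemma Hp_G_integrable:
  assumes \<psi>: "\<psi> \<in> Cc_infinity"
  shows "integrable lborel (\<lambda>x. \<psi> x * H (G x) powr p)" "integrable lborel (\<lambda>x. \<psi> x * norm (G x) powr p)"
proof -
  have sm: "smooth \<psi>" using \<psi> by (auto simp: Cc_infinity_iff)
  obtain r where r: "r > 0" "\<And>x. norm x \<ge> r \<Longrightarrow> \<psi> x = 0" "\<And>x. norm x > r \<Longrightarrow> grad \<psi> x = 0"
    using ball_support_of_Cc1[of \<psi>] \<psi> Cc_infinity_subset_Cc1 by blast
  have [measurable]: "\<psi> \<in> borel_measurable borel"
    using smooth_continuous_on[OF sm] by (auto intro: borel_measurable_continuous_onI)
  obtain B where B: "B > 0" "\<And>x. norm (\<psi> x) \<le> B"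
    using continuous_vanishing_outside_bounded[OF smooth_continuous_on[OF sm], of r] r by (metis less_imp_le)
  have p0: "p > 0" using p2 by simp
  obtain c C where C: "c > 0" "C > 0" "\<And>\<xi>. c * norm \<xi> powr p \<le> H \<xi> powr p"
    "\<And>\<xi>. H \<xi> powr p \<le> C * norm \<xi> powr p"
    using Hp_bounds[OF H p0] by blast
  have D: "integrable lborel (\<lambda>x. ((1 + C) * B) * (indicator (cball 0 r) x * norm (G x) powr p))"
    using G_powr[of r] by (intro integrable_mult_right) (simp add: set_integrable_def)
  have b: "\<bar>\<psi> x * h\<bar> \<le> ((1 + C) * B) * (indicator (cball 0 r) x * norm (G x) powr p)"
    if "0 \<le> h" "h \<le> (1 + C) * norm (G x) powr p" for x h
  proof (cases "norm x \<le> r")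
    case True
    have "\<bar>\<psi> x\<bar> * h \<le> B * ((1 + C) * norm (G x) powr p)"
      using that B by (intro mult_mono) auto
    then show ?thesis using True that by (simp add: abs_mult mult_ac)
  next
    case False
    then show ?thesis using r(2)[of x] by simp
  qed
  show "integrable lborel (\<lambda>x. \<psi> x * H (G x) powr p)"
  proof (rule Bochner_Integration.integrable_bound[OF D])
    have "H (G x) powr p \<le> (1 + C) * norm (G x) powr p" for x
      by (rule order_trans[OF C(4)]) (simp add: distrib_right)
    then have "\<bar>\<psi> x * H (G x) powr p\<bar> \<le> ((1 + C) * B) * (indicator (cball 0 r) x * norm (G x) powr p)" for x
      by (intro b) auto
    then show "AE x in lborel. norm (\<psi> x * H (G x) powr p) \<le> norm (((1 + C) * B) * (indicator (cball 0 r) x * norm (G x) powr p))"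
      unfolding real_norm_def by (intro AE_I2 order_trans[OF _ abs_ge_self])
  qed simp
  show "integrable lborel (\<lambda>x. \<psi> x * norm (G x) powr p)"
  proof (rule Bochner_Integration.integrable_bound[OF D])
    have "norm (G x) powr p \<le> (1 + C) * norm (G x) powr p" for x
      using C(2) by (simp add: distrib_right)
    then have "\<bar>\<psi> x * norm (G x) powr p\<bar> \<le> ((1 + C) * B) * (indicator (cball 0 r) x * norm (G x) powr p)" for x
      by (intro b) auto
    then show "AE x in lborel. norm (\<psi> x * norm (G x) powr p) \<le> norm (((1 + C) * B) * (indicator (cball 0 r) x * norm (G x) powr p))"
      unfolding real_norm_def by (intro AE_I2 order_trans[OF _ abs_ge_self])
  qed simp
qed

text \<open>The equation tested with u psi; Euler's relation turns flux(G) . G into H(G)^p.\<close>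

lemma
  assumes \<psi>: "\<psi> \<in> Cc_infinity"
  shows energy_identity: "(LINT x|lborel. \<psi> x * H (G x) powr p) + (LINT x|lborel. u x * (flux p H (G x) \<bullet> grad \<psi> x)) =
      (LINT x|lborel. u x * f (u x) * \<psi> x)"
    and energy_integrable: "integrable lborel (\<lambda>x. u x * (flux p H (G x) \<bullet> grad \<psi> x))"
      "integrable lborel (\<lambda>x. u x * f (u x) * \<psi> x)"
proof -
  have eq: "flux p H (G x) \<bullet> (u x *\<^sub>R grad \<psi> x + \<psi> x *\<^sub>R G x) = u x * (flux p H (G x) \<bullet> grad \<psi> x) + \<psi> x * H (G x) powr p" for x
    using flux_inner[OF H, of p "G x"] p2 by (simp add: inner_add_right)
  show i: "integrable lborel (\<lambda>x. u x * (flux p H (G x) \<bullet> grad \<psi> x))"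
    using Bochner_Integration.integrable_diff[OF weak_form_integrable(1)[OF \<psi>] Hp_G_integrable(1)[OF \<psi>]]
    unfolding eq by simp
  show "integrable lborel (\<lambda>x. u x * f (u x) * \<psi> x)"
    using weak_form_integrable(2)[OF \<psi>] by (simp add: mult_ac)
  have "(LINT x|lborel. u x * (flux p H (G x) \<bullet> grad \<psi> x)) + (LINT x|lborel. \<psi> x * H (G x) powr p) = (LINT x|lborel. f (u x) * (u x * \<psi> x))"
    using weak_form_limit[OF \<psi>] unfolding eq by (subst Bochner_Integration.integral_add[symmetric]) (auto intro: i Hp_G_integrable \<psi>)
  then show "(LINT x|lborel. \<psi> x * H (G x) powr p) + (LINT x|lborel. u x * (flux p H (G x) \<bullet> grad \<psi> x)) =
      (LINT x|lborel. u x * f (u x) * \<psi> x)" by (simp add: mult_ac)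
qed

lemma Cc_infinity_power:
  assumes "\<psi> \<in> Cc_infinity" "m > 0"
  shows "(\<lambda>x. \<psi> x ^ m) \<in> Cc_infinity"
proof -
  obtain r where r: "r > 0" "\<And>x. norm x \<ge> r \<Longrightarrow> \<psi> x = 0" "\<And>x. norm x > r \<Longrightarrow> grad \<psi> x = 0"
    using ball_support_of_Cc1[of \<psi>] assms(1) Cc_infinity_subset_Cc1 by blast
  show ?thesis unfolding Cc_infinity_iff
    using assms r by (auto simp: Cc_infinity_iff intro: smooth_power compactly_supportedI[of r])
qed

text \<open>By Euler's relations the terms that are linear in \<open>\<nabla>\<psi>\<close> in the stability inequality for
  \<open>u\<psi>\<close> and in the equation tested with \<open>u\<psi>\<^sup>2\<close> cancel.\<close>

lemma stable_inequality:
  assumes \<psi>: "\<psi> \<in> Cc_infinity"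
    and stab: "\<And>\<phi>. \<phi> \<in> Cc_infinity \<Longrightarrow> (\<And>x. \<psi> x = 0 \<Longrightarrow> \<phi> x = 0) \<Longrightarrow>
        (LINT x|lborel. deriv f (u x) * \<phi> x * \<phi> x) \<le> (LINT x|lborel. hform p H A0 (G x) (grad \<phi> x) (grad \<phi> x))"
  shows "(LINT x|lborel. (u x)\<^sup>2 * deriv f (u x) * (\<psi> x)\<^sup>2) \<le> (p - 1) * (LINT x|lborel. u x * f (u x) * (\<psi> x)\<^sup>2)
      + (LINT x|lborel. (u x)\<^sup>2 * hform p H A0 (G x) (grad \<psi> x) (grad \<psi> x))"
    and "integrable lborel (\<lambda>x. (u x)\<^sup>2 * deriv f (u x) * (\<psi> x)\<^sup>2)"
    and "integrable lborel (\<lambda>x. (u x)\<^sup>2 * hform p H A0 (G x) (grad \<psi> x) (grad \<psi> x))"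
proof -
  have \<psi>2: "(\<lambda>x. (\<psi> x)\<^sup>2) \<in> Cc_infinity" using Cc_infinity_power[OF \<psi>] by simp
  have d: "\<psi> differentiable (at x)" for x using \<psi> by (auto simp: Cc_infinity_iff intro: smooth_differentiable)
  let ?q = "\<lambda>x. u x *\<^sub>R grad \<psi> x + \<psi> x *\<^sub>R G x"
  let ?h = "\<lambda>x. (u x)\<^sup>2 * hform p H A0 (G x) (grad \<psi> x) (grad \<psi> x)"
  let ?e = "\<lambda>x. u x * (flux p H (G x) \<bullet> grad (\<lambda>x. (\<psi> x)\<^sup>2) x)"
  have hq: "hform p H A0 (G x) (?q x) (?q x) = ?h x + (p - 1) * ((\<psi> x)\<^sup>2 * H (G x) powr p + ?e x)" for x
  proof -
    have "hform p H A0 (G x) (?q x) (?q x) = (u x)\<^sup>2 * hform p H A0 (G x) (grad \<psi> x) (grad \<psi> x)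
       + u x * \<psi> x * (hform p H A0 (G x) (grad \<psi> x) (G x) + hform p H A0 (G x) (G x) (grad \<psi> x))
       + (\<psi> x)\<^sup>2 * hform p H A0 (G x) (G x) (G x)"
      by (simp add: hform_add_left hform_add_right hform_scale_left hform_scale_right power2_eq_square algebra_simps)
    also have "\<dots> = ?h x + (p - 1) * ((\<psi> x)\<^sup>2 * H (G x) powr p + ?e x)"
      using grad_power[OF d[of x], of 2] flux_inner[OF H, of p "G x"] p2
      by (simp add: hform_Euler_left[OF H p2] hform_Euler_right[OF H p2] algebra_simps)
    finally show ?thesis .
  qed
  note ints = Hp_G_integrable(1)[OF \<psi>2] energy_integrable[OF \<psi>2]
  have i3: "integrable lborel (\<lambda>x. (p - 1) * ((\<psi> x)\<^sup>2 * H (G x) powr p + ?e x))"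
    by (intro integrable_mult_right Bochner_Integration.integrable_add ints)
  show ih: "integrable lborel ?h"
    using Bochner_Integration.integrable_diff[OF stability_integrable(2)[OF \<psi>] i3] unfolding hq by simp
  have eqf: "deriv f (u x) * (u x * \<psi> x) * (u x * \<psi> x) = (u x)\<^sup>2 * deriv f (u x) * (\<psi> x)\<^sup>2" for x
    by (simp add: power2_eq_square mult_ac)
  show "integrable lborel (\<lambda>x. (u x)\<^sup>2 * deriv f (u x) * (\<psi> x)\<^sup>2)"
    using stability_integrable(1)[OF \<psi>] unfolding eqf .
  have "(LINT x|lborel. (u x)\<^sup>2 * deriv f (u x) * (\<psi> x)\<^sup>2) \<le> (LINT x|lborel. hform p H A0 (G x) (?q x) (?q x))"
    using stability_limit[OF \<psi> stab] unfolding eqf by blast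
  also have "\<dots> = (LINT x|lborel. ?h x) + (LINT x|lborel. (p - 1) * ((\<psi> x)\<^sup>2 * H (G x) powr p + ?e x))"
    unfolding hq by (rule Bochner_Integration.integral_add[OF ih i3])
  also have "(LINT x|lborel. (p - 1) * ((\<psi> x)\<^sup>2 * H (G x) powr p + ?e x)) =
      (p - 1) * ((LINT x|lborel. (\<psi> x)\<^sup>2 * H (G x) powr p) + (LINT x|lborel. ?e x))"
    using Bochner_Integration.integral_add[OF ints(1,2)] by simp
  also have "\<dots> = (p - 1) * (LINT x|lborel. u x * f (u x) * (\<psi> x)\<^sup>2)"
    using energy_identity[OF \<psi>2] by simp
  finally show "(LINT x|lborel. (u x)\<^sup>2 * deriv f (u x) * (\<psi> x)\<^sup>2) \<le> (p - 1) * (LINT x|lborel. u x * f (u x) * (\<psi> x)\<^sup>2)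
      + (LINT x|lborel. ?h x)" by simp
qed

end

section \<open>Decay of the energy on annuli\<close>

text \<open>The exponent equals p + p^2 / (q + 1 - p), which decreases in q. Of the two negative
  powers of R that arise, the one belonging to \<beta> therefore decays more slowly and dominates
  for R >= 1.\<close>

lemma theta_mono:
  fixes p \<alpha> \<beta> :: real
  assumes "p > 0" "p - 1 < \<alpha>" "\<alpha> \<le> \<beta>"
  shows "p * (\<beta> + 1) / (\<beta> + 1 - p) \<le> p * (\<alpha> + 1) / (\<alpha> + 1 - p)"
proof -
  have eq: "p * (q + 1) / (q + 1 - p) = p + p * p / (q + 1 - p)" if "p - 1 < q" for q
    using that by (simp add: field_simps)
  show ?thesis
    using assms by (simp add: eq divide_left_mono)
qed

context weak_solution
begin

lemma energy_density_integrable: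
  "integrable lborel (\<lambda>x. indicator (cball 0 R) x * norm (G x) powr p)"
  "integrable lborel (\<lambda>x. indicator (cball 0 R) x * (u x * f (u x)))"
proof -
  show "integrable lborel (\<lambda>x. indicator (cball 0 R) x * norm (G x) powr p)"
    using G_powr[of R] by (simp add: set_integrable_def)
  have "continuous_on UNIV (\<lambda>s. s * f s)" using f_cont by (intro continuous_intros)
  then obtain C where C: "AE x in lborel. norm x \<le> R \<longrightarrow> \<bar>u x * f (u x)\<bar> \<le> C"
    using locally_bounded_comp by blast
  have [measurable]: "cball (0::real^'n) R \<in> sets borel" by simp
  have "integrable lborel (\<lambda>x. indicator (cball 0 R) x *\<^sub>R (u x * f (u x)))"
    by (rule integrableI_bounded_set_indicator[where B = C]) (use C in \<open>auto simp: cball_finite\<close>)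
  then show "integrable lborel (\<lambda>x. indicator (cball 0 R) x * (u x * f (u x)))" by simp
qed

text \<open>Stability bounds \<alpha> times the integral of u f(u) psi^2 by p - 1 times the same
  integral plus gradient terms; the gap \<alpha> - (p - 1) > 0 leaves only gradient terms. The
  energy identity for psi^2 then bounds |G|^p as well. Both kinds of gradient terms are collected in
  one integrand, ready for \<open>young_pointwise\<close>.\<close>

lemma cutoff_energy_estimate:
  fixes \<psi> :: "real^'n \<Rightarrow> real"
  assumes stab: "\<And>\<phi>. \<phi> \<in> Cc_infinity \<Longrightarrow> (\<And>x. \<psi> x = 0 \<Longrightarrow> \<phi> x = 0) \<Longrightarrow>
        (LINT x|lborel. deriv f (u x) * \<phi> x * \<phi> x) \<le> (LINT x|lborel. hform p H A0 (G x) (grad \<phi> x) (grad \<phi> x))"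
    and low: "\<And>s. \<alpha> * (s * f s) \<le> s\<^sup>2 * deriv f s" and \<alpha>: "p - 1 < \<alpha>"
    and \<psi>: "\<psi> \<in> Cc_infinity" "\<And>x. 0 \<le> \<psi> x"
    and Ca: "\<And>\<xi>. norm (flux p H \<xi>) \<le> Ca * norm \<xi> powr (p - 1)"
    and Ch: "0 < Ch" "\<And>\<xi> a b. \<bar>hform p H A0 \<xi> a b\<bar> \<le> Ch * pw p (norm \<xi>) * norm a * norm b"
    and cH: "0 < cH" "\<And>\<xi>. cH * norm \<xi> powr p \<le> H \<xi> powr p"
    and T: "integrable lborel (\<lambda>x. (u x)\<^sup>2 * pw p (norm (G x)) * (norm (grad \<psi> x))\<^sup>2 + \<bar>u x\<bar> * norm (G x) powr (p - 1) * (\<psi> x * norm (grad \<psi> x)))"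
  shows "(LINT x|lborel. u x * f (u x) * (\<psi> x)\<^sup>2) \<le> Ch / (\<alpha> - (p - 1)) * (LINT x|lborel. (u x)\<^sup>2 * pw p (norm (G x)) * (norm (grad \<psi> x))\<^sup>2 + \<bar>u x\<bar> * norm (G x) powr (p - 1) * (\<psi> x * norm (grad \<psi> x)))"
    and "cH * (LINT x|lborel. (\<psi> x)\<^sup>2 * norm (G x) powr p) \<le> (LINT x|lborel. u x * f (u x) * (\<psi> x)\<^sup>2) + 2 * Ca * (LINT x|lborel. (u x)\<^sup>2 * pw p (norm (G x)) * (norm (grad \<psi> x))\<^sup>2 + \<bar>u x\<bar> * norm (G x) powr (p - 1) * (\<psi> x * norm (grad \<psi> x)))"
proof -
  let ?T = "\<lambda>x. (u x)\<^sup>2 * pw p (norm (G x)) * (norm (grad \<psi> x))\<^sup>2 + \<bar>u x\<bar> * norm (G x) powr (p - 1) * (\<psi> x * norm (grad \<psi> x))"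
  have \<psi>2: "(\<lambda>x. (\<psi> x)\<^sup>2) \<in> Cc_infinity" using Cc_infinity_power[OF \<psi>(1)] by simp
  have d: "\<psi> differentiable (at x)" for x using \<psi> by (auto simp: Cc_infinity_iff intro: smooth_differentiable)
  have pwn: "pw p r \<ge> 0" for r by (simp add: pw_def)
  have Tn: "0 \<le> (u x)\<^sup>2 * pw p (norm (G x)) * (norm (grad \<psi> x))\<^sup>2" "0 \<le> \<bar>u x\<bar> * norm (G x) powr (p - 1) * (\<psi> x * norm (grad \<psi> x))" for x
    using pwn \<psi>(2) by auto
  note S = stable_inequality[OF \<psi>(1) stab]
  have "\<alpha> * (LINT x|lborel. u x * f (u x) * (\<psi> x)\<^sup>2) = (LINT x|lborel. \<alpha> * (u x * f (u x) * (\<psi> x)\<^sup>2))"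
    by simp
  also have "\<dots> \<le> (LINT x|lborel. (u x)\<^sup>2 * deriv f (u x) * (\<psi> x)\<^sup>2)"
  proof (rule integral_mono)
    show "\<alpha> * (u x * f (u x) * (\<psi> x)\<^sup>2) \<le> (u x)\<^sup>2 * deriv f (u x) * (\<psi> x)\<^sup>2" for x
      using mult_right_mono[OF low[of "u x"], of "(\<psi> x)\<^sup>2"] by (simp add: mult.assoc)
  qed (use S(2) energy_integrable(2)[OF \<psi>2] in auto)
  also have "\<dots> \<le> (p - 1) * (LINT x|lborel. u x * f (u x) * (\<psi> x)\<^sup>2)
      + (LINT x|lborel. (u x)\<^sup>2 * hform p H A0 (G x) (grad \<psi> x) (grad \<psi> x))" by (rule S(1))
  also have "(LINT x|lborel. (u x)\<^sup>2 * hform p H A0 (G x) (grad \<psi> x) (grad \<psi> x)) \<le> (LINT x|lborel. Ch * ?T x)"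
  proof (rule integral_mono)
    fix x
    have "hform p H A0 (G x) (grad \<psi> x) (grad \<psi> x) \<le> Ch * pw p (norm (G x)) * (norm (grad \<psi> x))\<^sup>2"
      using Ch(2)[of "G x" "grad \<psi> x" "grad \<psi> x"] by (simp add: power2_eq_square mult.assoc)
    then have "(u x)\<^sup>2 * hform p H A0 (G x) (grad \<psi> x) (grad \<psi> x) \<le> (u x)\<^sup>2 * (Ch * pw p (norm (G x)) * (norm (grad \<psi> x))\<^sup>2)"
      by (rule mult_left_mono) simp
    also have "\<dots> = Ch * ((u x)\<^sup>2 * pw p (norm (G x)) * (norm (grad \<psi> x))\<^sup>2)" by simp
    also have "\<dots> \<le> Ch * ?T x" using Ch(1) Tn(2)[of x] by (intro mult_left_mono) auto
    finally show "(u x)\<^sup>2 * hform p H A0 (G x) (grad \<psi> x) (grad \<psi> x) \<le> Ch * ?T x" .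
  qed (use S(3) T in \<open>auto simp del: distrib_left\<close>)
  also have "\<dots> = Ch * (LINT x|lborel. ?T x)" by simp
  finally have "(\<alpha> - (p - 1)) * (LINT x|lborel. u x * f (u x) * (\<psi> x)\<^sup>2) \<le> Ch * (LINT x|lborel. ?T x)"
    by (simp add: algebra_simps)
  then show "(LINT x|lborel. u x * f (u x) * (\<psi> x)\<^sup>2) \<le> Ch / (\<alpha> - (p - 1)) * (LINT x|lborel. ?T x)"
    using \<alpha> by (simp add: field_simps)
  have "cH * (LINT x|lborel. (\<psi> x)\<^sup>2 * norm (G x) powr p) = (LINT x|lborel. cH * ((\<psi> x)\<^sup>2 * norm (G x) powr p))" by simp
  also have "\<dots> \<le> (LINT x|lborel. (\<psi> x)\<^sup>2 * H (G x) powr p)"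
  proof (rule integral_mono)
    show "cH * ((\<psi> x)\<^sup>2 * norm (G x) powr p) \<le> (\<psi> x)\<^sup>2 * H (G x) powr p" for x
      using mult_left_mono[OF cH(2)[of "G x"], of "(\<psi> x)\<^sup>2"] by (simp add: mult_ac)
  qed (use Hp_G_integrable[OF \<psi>2] in auto)
  also have "\<dots> = (LINT x|lborel. u x * f (u x) * (\<psi> x)\<^sup>2) + (LINT x|lborel. - (u x * (flux p H (G x) \<bullet> grad (\<lambda>x. (\<psi> x)\<^sup>2) x)))"
    using energy_identity[OF \<psi>2] by simp
  also have "(LINT x|lborel. - (u x * (flux p H (G x) \<bullet> grad (\<lambda>x. (\<psi> x)\<^sup>2) x))) \<le> (LINT x|lborel. 2 * Ca * ?T x)"
  proof (rule integral_mono)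
    fix x
    have g: "grad (\<lambda>x. (\<psi> x)\<^sup>2) x = (2 * \<psi> x) *\<^sub>R grad \<psi> x" using grad_power[OF d[of x], of 2] by simp
    have "- (u x * (flux p H (G x) \<bullet> grad (\<lambda>x. (\<psi> x)\<^sup>2) x)) \<le> \<bar>u x\<bar> * \<bar>flux p H (G x) \<bullet> grad (\<lambda>x. (\<psi> x)\<^sup>2) x\<bar>"
      by (metis abs_ge_minus_self abs_mult)
    also have "\<dots> \<le> \<bar>u x\<bar> * (Ca * norm (G x) powr (p - 1) * (2 * \<psi> x * norm (grad \<psi> x)))"
    proof (rule mult_left_mono)
      have "\<bar>flux p H (G x) \<bullet> grad (\<lambda>x. (\<psi> x)\<^sup>2) x\<bar> \<le> norm (flux p H (G x)) * (2 * \<psi> x * norm (grad \<psi> x))"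
        using Cauchy_Schwarz_ineq2[of "flux p H (G x)" "grad (\<lambda>x. (\<psi> x)\<^sup>2) x"] \<psi>(2)[of x] by (simp add: g)
      also have "\<dots> \<le> Ca * norm (G x) powr (p - 1) * (2 * \<psi> x * norm (grad \<psi> x))"
        using \<psi>(2)[of x] by (intro mult_right_mono Ca) auto
      finally show "\<bar>flux p H (G x) \<bullet> grad (\<lambda>x. (\<psi> x)\<^sup>2) x\<bar> \<le> Ca * norm (G x) powr (p - 1) * (2 * \<psi> x * norm (grad \<psi> x))" .
    qed simp
    also have "\<dots> = 2 * Ca * (\<bar>u x\<bar> * norm (G x) powr (p - 1) * (\<psi> x * norm (grad \<psi> x)))" by simp
    also have "\<dots> \<le> 2 * Ca * ?T x"
    proof (rule mult_left_mono)
      \<comment> \<open>The sign of \<open>Ca\<close> is read off from its own bound at a unit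
        vector.\<close>
      have "0 \<le> Ca * norm (axis undefined 1 :: real^'n) powr (p - 1)" by (rule order_trans[OF norm_ge_zero Ca])
      then show "0 \<le> 2 * Ca" by (simp add: norm_axis_1)
    qed (use Tn(1)[of x] in simp)
    finally show "- (u x * (flux p H (G x) \<bullet> grad (\<lambda>x. (\<psi> x)\<^sup>2) x)) \<le> 2 * Ca * ?T x" .
  qed (use energy_integrable(1)[OF \<psi>2] T in \<open>auto simp del: distrib_left\<close>)
  also have "\<dots> = 2 * Ca * (LINT x|lborel. ?T x)" by simp
  finally show "cH * (LINT x|lborel. (\<psi> x)\<^sup>2 * norm (G x) powr p) \<le> (LINT x|lborel. u x * f (u x) * (\<psi> x)\<^sup>2) + 2 * Ca * (LINT x|lborel. ?T x)" by simp
qed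

text \<open>The cutoff is a high power psi = eta^M, because Young's inequality with D = 1 / (R eta)
  leaves psi^2 D^q = R^(-q) eta^(2M - q), and this must stay bounded where eta is small. The energy
  that Young's inequality produces on the right has a small coefficient and is absorbed on the left;
  what remains is R^(-tb) times the volume of a ball of radius 8R.\<close>

lemma annular_decay:
  fixes R0 \<alpha> \<beta> m c :: real
  assumes stab: "\<And>\<phi>. \<phi> \<in> Cc_infinity \<Longrightarrow> (\<And>x. norm x \<le> R0 \<Longrightarrow> \<phi> x = 0) \<Longrightarrow>
        (LINT x|lborel. deriv f (u x) * \<phi> x * \<phi> x) \<le> (LINT x|lborel. hform p H A0 (G x) (grad \<phi> x) (grad \<phi> x))"
    and sf: "\<And>s. 0 \<le> s * f s" and low: "\<And>s. \<alpha> * (s * f s) \<le> s\<^sup>2 * deriv f s"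
    and \<alpha>: "p - 1 < \<alpha>" "\<alpha> \<le> \<beta>" and c: "c > 0"
    and lo: "\<And>s. \<bar>s\<bar> \<ge> m \<Longrightarrow> c * \<bar>s\<bar> powr (\<alpha> + 1) \<le> s * f s"
      "\<And>s. \<bar>s\<bar> \<le> m \<Longrightarrow> c * \<bar>s\<bar> powr (\<beta> + 1) \<le> s * f s"
  obtains C where "C \<ge> 0" "\<And>R. R \<ge> 1 \<Longrightarrow> R \<ge> 4 * R0 \<Longrightarrow>
    (LINT x|lborel. indicator {x. R / 2 \<le> norm x \<and> norm x \<le> 4 * R} x * (norm (G x) powr p + u x * f (u x)))
      \<le> C * R powr (real CARD('n) - p * (\<beta> + 1) / (\<beta> + 1 - p))"
proof -
  have p0: "p > 0" "p - 1 < \<beta>" using p2 \<alpha> by auto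
  define ta where "ta = p * (\<alpha> + 1) / (\<alpha> + 1 - p)"
  define tb where "tb = p * (\<beta> + 1) / (\<beta> + 1 - p)"
  have t: "tb \<le> ta" "0 < tb"
    using theta_mono[OF p0(1) \<alpha>] p0 p2 by (auto simp: ta_def tb_def)
  obtain Ca where Ca: "Ca > 0" "\<And>\<xi>. norm (flux p H \<xi>) \<le> Ca * norm \<xi> powr (p - 1)"
    using flux_bound[OF H p0(1)] by blast
  obtain Ch where Ch: "Ch > 0" "\<And>\<xi> a b. \<bar>hform p H A0 \<xi> a b\<bar> \<le> Ch * pw p (norm \<xi>) * norm a * norm b"
    using hform_bound[OF H p2] by blast
  obtain cH CH where cH: "cH > 0" "CH > 0" "\<And>\<xi>. cH * norm \<xi> powr p \<le> H \<xi> powr p" "\<And>\<xi>. H \<xi> powr p \<le> CH * norm \<xi> powr p"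
    using Hp_bounds[OF H p0(1)] by blast
  define K1 where "K1 = Ch / (\<alpha> - (p - 1))"
  \<comment> \<open>\<open>K1\<close> bounds the integral of u f(u) psi^2; inserting this in the
    energy identity gives the second summand, for |G|^p. \<open>K2\<close> belongs to their
    sum.\<close>
  define K2 where "K2 = K1 + (K1 + 2 * Ca) / cH"
  have K: "K1 > 0" "K2 > 0" using Ch Ca cH \<alpha> by (auto simp: K1_def K2_def intro!: add_pos_pos divide_pos_pos)
  obtain m0 :: nat where m0: "ta \<le> real m0" using real_arch_simple by blast
  \<comment> \<open>\<open>2 * M\<close> has to reach the exponents \<open>ta\<close> and
    \<open>tb\<close>; adding 2 also makes \<open>M - 1\<close> positive, so that grad psi vanishes
    where eta does.\<close>
  define M where "M = m0 + 2"
  have M: "M > 0" "ta \<le> real (2 * M)" "tb \<le> real (2 * M)" using m0 t by (auto simp: M_def)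
  obtain \<omega> :: "real^'n \<Rightarrow> real" where om: "smooth \<omega>" "\<And>x. 0 \<le> \<omega> x" "\<And>x. \<omega> x \<le> 1"
    "\<And>x. 1/2 \<le> norm x \<Longrightarrow> norm x \<le> 4 \<Longrightarrow> \<omega> x = 1" "\<And>x. norm x \<ge> 8 \<Longrightarrow> \<omega> x = 0" "\<And>x. norm x \<le> 1/4 \<Longrightarrow> \<omega> x = 0"
    using annular_cutoff_exists by blast
  obtain B where B: "B > 0" "\<And>R x. R > 0 \<Longrightarrow> norm (grad (\<lambda>x. \<omega> ((1 / R) *\<^sub>R x)) x) \<le> B / R"
    using scaled_gradient_bound[OF om(1,5)] by blast
  \<comment> \<open>The gradient of psi is at most M B times psi D. Its first power and its square
    both occur, and (1 + M B)^2 covers both.\<close>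
  define L where "L = (1 + real M * B)\<^sup>2"
  have L: "L > 0" using B unfolding L_def by (intro zero_less_power add_pos_nonneg) auto
  \<comment> \<open>L d = 1 / (2 K2), so that after multiplication by \<open>K2\<close> half of the
    energy reappears on the right.\<close>
  define d where "d = 1 / (2 * K2 * L)"
  have d: "d > 0" using K L by (simp add: d_def)
  obtain Cy where Cy: "Cy > 0"
    "\<And>s g D. g \<ge> 0 \<Longrightarrow> D > 0 \<Longrightarrow> s\<^sup>2 * pw p g * D\<^sup>2 + \<bar>s\<bar> * g powr (p - 1) * D \<le>
      d * (g powr p + s * f s) + Cy * (D powr ta + D powr tb)"
    using young_pointwise[OF p2 d \<alpha>(1) p0(2) c lo] unfolding ta_def tb_def by blast
  define C3 where "C3 = 2 * L * Cy"
  define V where "V = unit_ball_vol (real CARD('n)) * 8 ^ CARD('n)"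
  show ?thesis
  proof (rule that[of "2 * K2 * C3 * V"])
    show "0 \<le> 2 * K2 * C3 * V" using K L Cy by (auto simp: C3_def V_def)
    \<comment> \<open>The cutoff vanishes for |x| <= R / 4, hence on the ball of radius
      \<open>R0\<close>, where stability may fail; R >= 1 lets the smaller exponent
      \<open>tb\<close> dominate.\<close>
    fix R :: real assume R: "R \<ge> 1" "R \<ge> 4 * R0"
    define \<eta> where "\<eta> x = \<omega> ((1 / R) *\<^sub>R x)" for x
    define \<psi> where "\<psi> x = \<eta> x ^ M" for x
    have ch: "smooth \<eta>" "0 \<le> \<eta> x" "\<eta> x \<le> 1" "norm (grad \<eta> x) \<le> B / R" for x
      using smooth_scaled[OF om(1)] om(2,3) B(2)[of R x] R by (auto simp: \<eta>_def[abs_def])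
    have ch0: "\<eta> x = 0" if "norm x \<ge> 8 * R \<or> norm x \<le> R / 4" for x
      using that om(5,6)[of "(1 / R) *\<^sub>R x"] R by (auto simp: \<eta>_def field_simps)
    have ch1: "\<eta> x = 1" if "R / 2 \<le> norm x" "norm x \<le> 4 * R" for x
      unfolding \<eta>_def by (rule om(4)) (use that R in \<open>auto simp: field_simps\<close>)
    have "\<eta> \<in> Cc_infinity"
      unfolding Cc_infinity_iff using ch(1) ch0 by (auto intro: compactly_supportedI[of "8 * R"])
    then have \<psi>C: "\<psi> \<in> Cc_infinity" unfolding \<psi>_def[abs_def] using M(1) by (rule Cc_infinity_power)
    then have \<psi>2: "(\<lambda>x. (\<psi> x)\<^sup>2) \<in> Cc_infinity" using Cc_infinity_power[of \<psi> 2] by simp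
    have \<psi>0: "0 \<le> \<psi> x" for x using ch by (simp add: \<psi>_def)
    have g\<psi>: "norm (grad \<psi> x) \<le> real M * \<eta> x ^ (M - 1) * (B / R)" for x
    proof -
      have "norm (grad \<psi> x) = real M * \<eta> x ^ (M - 1) * norm (grad \<eta> x)"
        unfolding \<psi>_def[abs_def] grad_power[OF smooth_differentiable[OF ch(1)]] using ch(2)[of x] by simp
      also have "\<dots> \<le> real M * \<eta> x ^ (M - 1) * (B / R)"
        using ch(2)[of x] by (intro mult_left_mono ch(4)) auto
      finally show ?thesis .
    qed
    have [measurable]: "\<psi> \<in> borel_measurable borel" "grad \<psi> \<in> borel_measurable borel"
    proof -
      have "smooth \<psi>" using \<psi>C by (simp add: Cc_infinity_iff)
      then show "\<psi> \<in> borel_measurable borel" "grad \<psi> \<in> borel_measurable borel"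
        by (intro borel_measurable_continuous_onI smooth_continuous_on smooth_continuous_grad, assumption)+
    qed
    let ?T = "\<lambda>x. (u x)\<^sup>2 * pw p (norm (G x)) * (norm (grad \<psi> x))\<^sup>2 + \<bar>u x\<bar> * norm (G x) powr (p - 1) * (\<psi> x * norm (grad \<psi> x))"
    let ?e = "\<lambda>x. (\<psi> x)\<^sup>2 * norm (G x) powr p + u x * f (u x) * (\<psi> x)\<^sup>2"
    have pwn: "pw p r \<ge> 0" for r by (simp add: pw_def)
    have [measurable]: "pw p \<in> borel_measurable borel" unfolding pw_def by measurable
    have T0: "0 \<le> ?T x" for x using pwn \<psi>0 by simp
    have Tle: "?T x \<le> (1 / (2 * K2)) * ?e x + C3 * R powr (- tb) * indicator (cball 0 (8 * R)) x" for x
    proof (cases "\<eta> x = 0")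
      \<comment> \<open>Here the length 1 / D degenerates, but psi and its gradient vanish
        too.\<close>
      case True
      then have "grad \<psi> x = 0" "\<psi> x = 0" using g\<psi>[of x] M by (auto simp: \<psi>_def M_def)
      then show ?thesis using L Cy by (simp add: C3_def)
    next
      case False
      then have c0: "\<eta> x > 0" using ch(2)[of x] by simp
      have x8: "norm x \<le> 8 * R" using ch0[of x] False by (meson linear)
      define D where "D = 1 / (R * \<eta> x)"
      have D: "D > 0" using c0 R by (simp add: D_def)
      have gD: "norm (grad \<psi> x) \<le> (1 + real M * B) * (\<psi> x * D)"
      proof -
        have "\<eta> x ^ (M - 1) / R = \<psi> x * D"
          using c0 M(1) by (cases M) (auto simp: \<psi>_def D_def)
        moreover have "real M * \<eta> x ^ (M - 1) * (B / R) = (real M * B) * (\<eta> x ^ (M - 1) / R)" by simp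
        ultimately have "norm (grad \<psi> x) \<le> (real M * B) * (\<psi> x * D)" using g\<psi>[of x] by (simp only:)
        also have "\<dots> \<le> (1 + real M * B) * (\<psi> x * D)"
          using \<psi>0[of x] D by (intro mult_right_mono) auto
        finally show ?thesis .
      qed
      have b1: "1 \<le> 1 + real M * B" using B by simp
      have "(norm (grad \<psi> x))\<^sup>2 \<le> ((1 + real M * B) * (\<psi> x * D))\<^sup>2" by (intro power_mono gD) simp
      then have e1: "(norm (grad \<psi> x))\<^sup>2 \<le> L * (\<psi> x)\<^sup>2 * D\<^sup>2" by (simp add: L_def power_mult_distrib mult.assoc)
      have "\<psi> x * norm (grad \<psi> x) \<le> \<psi> x * ((1 + real M * B) * (\<psi> x * D))" by (intro mult_left_mono gD \<psi>0)
      also have "\<dots> \<le> \<psi> x * (L * (\<psi> x * D))"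
      proof (intro mult_left_mono mult_right_mono \<psi>0)
        show "1 + real M * B \<le> L" unfolding L_def power2_eq_square using mult_left_mono[OF b1, of "1 + real M * B"] b1 by simp
      qed (use D \<psi>0[of x] in simp)
      finally have e2: "\<psi> x * norm (grad \<psi> x) \<le> L * (\<psi> x)\<^sup>2 * D" by (simp add: power2_eq_square mult_ac)
      have "?T x \<le> (u x)\<^sup>2 * pw p (norm (G x)) * (L * (\<psi> x)\<^sup>2 * D\<^sup>2) + \<bar>u x\<bar> * norm (G x) powr (p - 1) * (L * (\<psi> x)\<^sup>2 * D)"
        by (intro add_mono mult_left_mono e1 e2) (auto simp: pwn)
      also have "\<dots> = L * (\<psi> x)\<^sup>2 * ((u x)\<^sup>2 * pw p (norm (G x)) * D\<^sup>2 + \<bar>u x\<bar> * norm (G x) powr (p - 1) * D)"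
        by (simp add: algebra_simps)
      also have "\<dots> \<le> L * (\<psi> x)\<^sup>2 * (d * (norm (G x) powr p + u x * f (u x)) + Cy * (D powr ta + D powr tb))"
        using L by (intro mult_left_mono Cy(2) D) auto
      also have "\<dots> = (L * d) * ?e x + L * Cy * ((\<psi> x)\<^sup>2 * D powr ta + (\<psi> x)\<^sup>2 * D powr tb)"
        by (simp add: algebra_simps)
      also have "L * d = 1 / (2 * K2)" using L by (simp add: d_def)
      also have "(\<psi> x)\<^sup>2 * D powr ta + (\<psi> x)\<^sup>2 * D powr tb \<le> R powr (- tb) + R powr (- tb)"
      proof -
        have "(\<psi> x)\<^sup>2 * D powr q \<le> R powr (- tb)" if q: "q \<le> real (2 * M)" "tb \<le> q" for q
        proof -
          have "D powr q = R powr (- q) * \<eta> x powr (- q)"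
            using R c0 by (simp add: D_def powr_divide powr_mult powr_minus_divide)
          moreover have "(\<psi> x)\<^sup>2 = \<eta> x powr real (2 * M)"
            using c0 by (simp only: \<psi>_def powr_realpow power_mult[symmetric] mult.commute)
          ultimately have "(\<psi> x)\<^sup>2 * D powr q = R powr (- q) * \<eta> x powr (real (2 * M) - q)"
            by (simp add: powr_diff powr_minus_divide)
          also have "\<dots> \<le> R powr (- tb) * 1"
          proof (rule mult_mono)
            show "R powr (- q) \<le> R powr (- tb)" using R q by (intro powr_mono) auto
            show "\<eta> x powr (real (2 * M) - q) \<le> 1" using q ch(3)[of x] c0 by (intro powr_le1) auto
          qed auto
          finally show ?thesis by simp
        qed
        from this[OF M(2) t(1)] this[OF M(3) order_refl] show ?thesis by (rule add_mono)
      qed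
      finally show ?thesis using x8 L Cy by (simp add: C3_def mult_left_mono algebra_simps)
    qed
    have eint: "integrable lborel ?e"
      by (intro Bochner_Integration.integrable_add Hp_G_integrable(2)[OF \<psi>2] energy_integrable(2)[OF \<psi>2])
    have iint: "integrable lborel (indicator (cball 0 (8 * R)) :: real^'n \<Rightarrow> real)"
      by (intro integrable_real_indicator) (auto simp: cball_finite)
    have Dint: "integrable lborel (\<lambda>x. (1 / (2 * K2)) * ?e x + C3 * R powr (- tb) * indicator (cball 0 (8 * R)) x)"
      by (intro Bochner_Integration.integrable_add integrable_mult_right eint iint)
    have Tint: "integrable lborel ?T"
    proof (rule Bochner_Integration.integrable_bound[OF Dint])
      show "AE x in lborel. norm (?T x) \<le> norm ((1 / (2 * K2)) * ?e x + C3 * R powr (- tb) * indicator (cball 0 (8 * R)) x)"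
        unfolding real_norm_def abs_of_nonneg[OF T0] by (intro AE_I2 order_trans[OF Tle abs_ge_self])
    qed measurable
    have stab': "(LINT x|lborel. deriv f (u x) * \<phi> x * \<phi> x) \<le> (LINT x|lborel. hform p H A0 (G x) (grad \<phi> x) (grad \<phi> x))"
      if "\<phi> \<in> Cc_infinity" "\<And>x. \<psi> x = 0 \<Longrightarrow> \<phi> x = 0" for \<phi>
    proof (rule stab[OF that(1)])
      fix x :: "real^'n" assume "norm x \<le> R0"
      then have "\<eta> x = 0" using ch0[of x] R by simp
      then show "\<phi> x = 0" using that(2)[of x] M(1) by (simp add: \<psi>_def)
    qed
    note E = cutoff_energy_estimate[OF stab' low \<alpha>(1) \<psi>C \<psi>0 Ca(2) Ch cH(1,3) Tint]
    define IT where "IT = (LINT x|lborel. ?T x)"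
    define Iu where "Iu = (LINT x|lborel. u x * f (u x) * (\<psi> x)\<^sup>2)"
    define IG where "IG = (LINT x|lborel. (\<psi> x)\<^sup>2 * norm (G x) powr p)"
    have E1: "Iu \<le> K1 * IT" and E2: "cH * IG \<le> Iu + 2 * Ca * IT"
      using E by (simp_all add: K1_def IT_def Iu_def IG_def)
    have "IG \<le> (K1 + 2 * Ca) / cH * IT" using E1 E2 cH(1) by (simp add: field_simps)
    then have I: "IG + Iu \<le> K2 * IT" using E1 by (simp add: K2_def algebra_simps)
    have le: "(LINT x|lborel. ?e x) = IG + Iu"
      unfolding IG_def Iu_def by (intro Bochner_Integration.integral_add Hp_G_integrable(2)[OF \<psi>2] energy_integrable(2)[OF \<psi>2])
    have "IT \<le> (LINT x|lborel. (1 / (2 * K2)) * ?e x + C3 * R powr (- tb) * indicator (cball 0 (8 * R)) x)"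
      unfolding IT_def by (intro integral_mono Tint Dint Tle)
    also have "\<dots> = (LINT x|lborel. (1 / (2 * K2)) * ?e x) + (LINT x|lborel. C3 * R powr (- tb) * indicator (cball (0::real^'n) (8 * R)) x)"
      by (rule Bochner_Integration.integral_add) (intro integrable_mult_right eint iint)+
    also have "\<dots> = (1 / (2 * K2)) * (IG + Iu) + C3 * R powr (- tb) * measure lborel (cball (0::real^'n) (8 * R))"
      by (simp only: integral_mult_right_zero le) simp
    also have "measure lborel (cball (0::real^'n) (8 * R)) = V * R ^ CARD('n)"
      using R by (simp add: content_cball V_def power_mult_distrib)
    finally have IT: "IT \<le> (1 / (2 * K2)) * (IG + Iu) + C3 * R powr (- tb) * (V * R ^ CARD('n))" .
    define Q where "Q = C3 * R powr (- tb) * (V * R ^ CARD('n))"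
    \<comment> \<open>Half of the energy will be moved to the left side; its finiteness is part of
      the integrability proved in \<open>eint\<close>.\<close>
    have "K2 * IT \<le> K2 * ((1 / (2 * K2)) * (IG + Iu) + Q)"
      using IT K unfolding Q_def by (intro mult_left_mono) auto
    also have "\<dots> = (IG + Iu) / 2 + K2 * Q" using K by (simp add: field_simps)
    finally have "K2 * IT \<le> (IG + Iu) / 2 + K2 * Q" .
    from order_trans[OF I this] have "IG + Iu \<le> 2 * (K2 * Q)" by (simp add: field_simps)
    then have fin: "IG + Iu \<le> 2 * K2 * C3 * V * (R powr (- tb) * R ^ CARD('n))" by (simp add: Q_def mult_ac)
    have "(LINT x|lborel. indicator {x. R / 2 \<le> norm x \<and> norm x \<le> 4 * R} x * (norm (G x) powr p + u x * f (u x))) \<le> (LINT x|lborel. ?e x)"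
    proof (rule integral_mono')
      show "indicator {x. R / 2 \<le> norm x \<and> norm x \<le> 4 * R} x * (norm (G x) powr p + u x * f (u x)) \<le> ?e x" for x
        using ch1[of x] sf[of "u x"] by (auto simp: indicator_def \<psi>_def)
      show "0 \<le> ?e x" for x using sf[of "u x"] by simp
    qed (rule eint)
    also have "\<dots> \<le> 2 * K2 * C3 * V * (R powr (- tb) * R ^ CARD('n))" using le fin by simp
    also have "R powr (- tb) * R ^ CARD('n) = R powr (real CARD('n) - tb)"
      using R by (simp add: powr_realpow[symmetric] powr_add[symmetric])
    finally show "(LINT x|lborel. indicator {x. R / 2 \<le> norm x \<and> norm x \<le> 4 * R} x * (norm (G x) powr p + u x * f (u x)))
      \<le> 2 * K2 * C3 * V * R powr (real CARD('n) - p * (\<beta> + 1) / (\<beta> + 1 - p))" by (simp add: tb_def)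
  qed
qed

end

section \<open>Difference quotients along rays\<close>

text \<open>The Jacobian s^(-n) is at most 2^n for s >= 1/2; this is why the dilation factor is
  never taken below 1/2.\<close>

lemma nn_integral_dilation_le:
  fixes h :: "real^'n \<Rightarrow> ennreal"
  assumes [measurable]: "h \<in> borel_measurable borel" "A' \<in> sets borel"
    and s: "1/2 \<le> s" and A: "\<And>x. x \<in> A \<Longrightarrow> s *\<^sub>R x \<in> A'"
  shows "(\<integral>\<^sup>+x. h (s *\<^sub>R x) * indicator A x \<partial>lborel) \<le> 2 ^ CARD('n) * (\<integral>\<^sup>+x. h x * indicator A' x \<partial>lborel)"
proof -
  let ?X = "\<integral>\<^sup>+x. h (s *\<^sub>R x) * indicator A' (s *\<^sub>R x) \<partial>lborel"
  have "(\<integral>\<^sup>+x. h (s *\<^sub>R x) * indicator A x \<partial>lborel) \<le> ?X"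
    by (intro nn_integral_mono) (use A in \<open>auto simp: indicator_def\<close>)
  also have "?X \<le> 2 ^ CARD('n) * (ennreal (\<bar>s\<bar> ^ CARD('n)) * ?X)"
  proof -
    have "(1::real) \<le> (2 * s) ^ CARD('n)" using s by (intro one_le_power) simp
    then have "ennreal 1 \<le> ennreal ((2 * s) ^ CARD('n))" by (intro ennreal_leI)
    also have "\<dots> = 2 ^ CARD('n) * ennreal (\<bar>s\<bar> ^ CARD('n))"
      using s by (simp add: power_mult_distrib ennreal_mult ennreal_power[symmetric])
    finally have "1 * ?X \<le> (2 ^ CARD('n) * ennreal (\<bar>s\<bar> ^ CARD('n))) * ?X" by (intro mult_right_mono) auto
    then show ?thesis by (simp add: mult.assoc)
  qed
  also have "ennreal (\<bar>s\<bar> ^ CARD('n)) * ?X = (\<integral>\<^sup>+x. h x * indicator A' x \<partial>lborel)"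
    using nn_integral_lborel_affine[of s "\<lambda>x. h x * indicator A' x" 0] s by simp
  finally show ?thesis .
qed

text \<open>After exchanging the integrations each slice is a dilation with factor s in [l, 1],
  bounded uniformly in s; the factor 1 - l is the length of this interval.\<close>

lemma ray_fubini:
  fixes h :: "real^'n \<Rightarrow> ennreal"
  assumes [measurable]: "h \<in> borel_measurable borel" "A \<in> sets borel" "A' \<in> sets borel"
    and l: "1/2 \<le> l" "l \<le> 1" and A: "\<And>x s. x \<in> A \<Longrightarrow> 1/2 \<le> s \<Longrightarrow> s \<le> 1 \<Longrightarrow> s *\<^sub>R x \<in> A'"
  shows "(\<integral>\<^sup>+x. (\<integral>\<^sup>+s. h (s *\<^sub>R x) * indicator {l..1} s \<partial>lborel) * indicator A x \<partial>lborel)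
    \<le> ennreal (1 - l) * (2 ^ CARD('n) * (\<integral>\<^sup>+x. h x * indicator A' x \<partial>lborel))"
proof -
  let ?X = "2 ^ CARD('n) * (\<integral>\<^sup>+x. h x * indicator A' x \<partial>lborel)"
  have "(\<integral>\<^sup>+x. (\<integral>\<^sup>+s. h (s *\<^sub>R x) * indicator {l..1} s \<partial>lborel) * indicator A x \<partial>lborel)
     = (\<integral>\<^sup>+x. (\<integral>\<^sup>+s. h (s *\<^sub>R x) * indicator A x * indicator {l..1} s \<partial>lborel) \<partial>lborel)"
    by (subst nn_integral_multc[symmetric]) (auto simp: mult_ac)
  also have "\<dots> = (\<integral>\<^sup>+s. (\<integral>\<^sup>+x. h (s *\<^sub>R x) * indicator A x * indicator {l..1} s \<partial>lborel) \<partial>lborel)"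
  proof (rule lborel_pair.Fubini')
    have "(\<lambda>(s, x). h (s *\<^sub>R x) * indicator A x * indicator {l..1} s) \<in> borel_measurable (borel \<Otimes>\<^sub>M borel)"
      by measurable
    then show "(\<lambda>(s, x). h (s *\<^sub>R x) * indicator A x * indicator {l..1} s) \<in> borel_measurable (lborel \<Otimes>\<^sub>M lborel)"
      by (simp cong: measurable_cong_sets sets_pair_measure_cong)
  qed
  also have "\<dots> \<le> (\<integral>\<^sup>+s. ?X * indicator {l..1} s \<partial>lborel)"
  proof (rule nn_integral_mono)
    fix s :: real
    show "(\<integral>\<^sup>+x. h (s *\<^sub>R x) * indicator A x * indicator {l..1} s \<partial>lborel) \<le> ?X * indicator {l..1} s"
    proof (cases "s \<in> {l..1}")
      case True
      then have "(\<integral>\<^sup>+x. h (s *\<^sub>R x) * indicator A x \<partial>lborel) \<le> ?X"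
        using l by (intro nn_integral_dilation_le A) auto
      then show ?thesis using True by simp
    qed simp
  qed
  also have "\<dots> = ?X * ennreal (1 - l)"
    using l by (subst nn_integral_cmult_indicator) auto
  finally show ?thesis by (simp only: mult.commute)
qed

text \<open>Fundamental theorem of calculus along the segment from lx to x. Stated with an extended
  nonnegative integral, the form in which Fubini's theorem is applied next.\<close>

lemma ray_bound:
  fixes v :: "real^'n \<Rightarrow> real"
  assumes v: "smooth v" and l: "l \<le> 1"
  shows "ennreal \<bar>v x - v (l *\<^sub>R x)\<bar> \<le> (\<integral>\<^sup>+s. ennreal (norm (grad v (s *\<^sub>R x)) * norm x) * indicator {l..1} s \<partial>lborel)"
proof -
  have D: "((\<lambda>s. v (s *\<^sub>R x)) has_vector_derivative (grad v (s *\<^sub>R x) \<bullet> x)) (at s within {l..1})" for s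
  proof -
    have d: "((\<lambda>t. t *\<^sub>R x) has_derivative (\<lambda>t. t *\<^sub>R x)) (at s within {l..1})"
      by (auto intro!: derivative_eq_intros)
    have "((\<lambda>s. v (s *\<^sub>R x)) has_derivative (\<lambda>t. grad v (s *\<^sub>R x) \<bullet> (t *\<^sub>R x))) (at s within {l..1})"
      by (rule has_derivative_compose[OF d has_derivative_grad[OF smooth_differentiable[OF v]]])
    then show ?thesis by (simp add: has_vector_derivative_def)
  qed
  have c: "continuous_on {l..1} (\<lambda>s. grad v (s *\<^sub>R x) \<bullet> x)"
    by (intro continuous_intros continuous_on_compose2[OF smooth_continuous_grad[OF v, of UNIV]]) auto
  from has_bochner_integral_FTC_Icc[OF l D c]
  have b: "has_bochner_integral lborel (\<lambda>s. indicator {l..1} s *\<^sub>R (grad v (s *\<^sub>R x) \<bullet> x)) (v (1 *\<^sub>R x) - v (l *\<^sub>R x))"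
    by blast
  have "ennreal (norm (LINT s|lborel. indicator {l..1} s *\<^sub>R (grad v (s *\<^sub>R x) \<bullet> x))) \<le>
      (\<integral>\<^sup>+s. norm (indicator {l..1} s *\<^sub>R (grad v (s *\<^sub>R x) \<bullet> x)) \<partial>lborel)"
    using b by (intro integral_norm_bound_ennreal) (auto simp: has_bochner_integral_iff)
  also have "\<dots> \<le> (\<integral>\<^sup>+s. ennreal (norm (grad v (s *\<^sub>R x)) * norm x) * indicator {l..1} s \<partial>lborel)"
    by (intro nn_integral_mono) (auto simp: indicator_def Cauchy_Schwarz_ineq2 intro!: ennreal_leI)
  finally show ?thesis using b by (simp add: has_bochner_integral_iff)
qed

text \<open>Yields the first-order error of the Pohozaev argument: it is of order 1 - l and involves
  energies over annuli only, because points of R <= |x| <= 2R multiplied by s in [1/2, 1] stay in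
  R/2 <= |x| <= 2R. Under the ray integral the product |grad v| b^(p-1) is split by
  \<open>powr_mix\<close>.\<close>

lemma difference_quotient_weighted:
  fixes v :: "real^'n \<Rightarrow> real"
  assumes v: "smooth v" and l: "1/2 \<le> l" "l \<le> 1" and R: "R > 0" and p: "p \<ge> 1"
    and [measurable]: "b \<in> borel_measurable borel" and b: "\<And>x. 0 \<le> b x"
  shows "(\<integral>\<^sup>+x. ennreal (\<bar>v x - v (l *\<^sub>R x)\<bar> * b x powr (p - 1)) * indicator {x. R \<le> norm x \<and> norm x \<le> 2 * R} x \<partial>lborel)
    \<le> ennreal (2 * R * (1 - l)) * (2 ^ CARD('n) * (\<integral>\<^sup>+x. ennreal (norm (grad v x) powr p) * indicator {x. R / 2 \<le> norm x \<and> norm x \<le> 2 * R} x \<partial>lborel)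
      + (\<integral>\<^sup>+x. ennreal (b x powr p) * indicator {x. R \<le> norm x \<and> norm x \<le> 2 * R} x \<partial>lborel))"
proof -
  define A where "A = {x::real^'n. R \<le> norm x \<and> norm x \<le> 2 * R}"
  define A' where "A' = {x::real^'n. R / 2 \<le> norm x \<and> norm x \<le> 2 * R}"
  have [measurable]: "A \<in> sets borel" "A' \<in> sets borel" unfolding A_def A'_def by measurable
  have [measurable]: "grad v \<in> borel_measurable borel"
    using smooth_continuous_grad[OF v] by (auto intro: borel_measurable_continuous_onI)
  have AA: "s *\<^sub>R x \<in> A'" if "x \<in> A" "1/2 \<le> s" "s \<le> 1" for x s
  proof -
    have "1/2 * R \<le> s * norm x" "s * norm x \<le> 1 * norm x"
      using that R by (intro mult_mono mult_right_mono; simp add: A_def)+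
    then show ?thesis using that by (simp add: A_def A'_def)
  qed
  let ?h = "\<lambda>x. ennreal (norm (grad v x) powr p)"
  have "(\<integral>\<^sup>+x. ennreal (\<bar>v x - v (l *\<^sub>R x)\<bar> * b x powr (p - 1)) * indicator A x \<partial>lborel) \<le>
    (\<integral>\<^sup>+x. ennreal (2 * R) * ((\<integral>\<^sup>+s. ?h (s *\<^sub>R x) * indicator {l..1} s \<partial>lborel) * indicator A x +
        ennreal (1 - l) * (ennreal (b x powr p) * indicator A x)) \<partial>lborel)"
  proof (rule nn_integral_mono)
    fix x
    show "ennreal (\<bar>v x - v (l *\<^sub>R x)\<bar> * b x powr (p - 1)) * indicator A x \<le>
      ennreal (2 * R) * ((\<integral>\<^sup>+s. ?h (s *\<^sub>R x) * indicator {l..1} s \<partial>lborel) * indicator A x +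
        ennreal (1 - l) * (ennreal (b x powr p) * indicator A x))"
    proof (cases "x \<in> A")
      case True
      have "ennreal (\<bar>v x - v (l *\<^sub>R x)\<bar> * b x powr (p - 1)) = ennreal \<bar>v x - v (l *\<^sub>R x)\<bar> * ennreal (b x powr (p - 1))"
        by (simp add: ennreal_mult)
      also have "\<dots> \<le> (\<integral>\<^sup>+s. ennreal (norm (grad v (s *\<^sub>R x)) * norm x) * indicator {l..1} s \<partial>lborel) * ennreal (b x powr (p - 1))"
        by (intro mult_right_mono ray_bound v l) simp
      also have "\<dots> = (\<integral>\<^sup>+s. ennreal (norm (grad v (s *\<^sub>R x)) * norm x) * indicator {l..1} s * ennreal (b x powr (p - 1)) \<partial>lborel)"
        by (simp add: nn_integral_multc)
      also have "\<dots> \<le> (\<integral>\<^sup>+s. ennreal (2 * R) * (?h (s *\<^sub>R x) * indicator {l..1} s + ennreal (b x powr p) * indicator {l..1} s) \<partial>lborel)"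
      proof (rule nn_integral_mono)
        fix s :: real
        have "norm (grad v (s *\<^sub>R x)) * norm x * b x powr (p - 1) = norm x * (b x powr (p - 1) * norm (grad v (s *\<^sub>R x)))" by simp
        also have "\<dots> \<le> (2 * R) * (b x powr p + norm (grad v (s *\<^sub>R x)) powr p)"
          using True R b p by (intro mult_mono powr_mix) (auto simp: A_def)
        finally have "ennreal (norm (grad v (s *\<^sub>R x)) * norm x * b x powr (p - 1)) \<le> ennreal ((2 * R) * (norm (grad v (s *\<^sub>R x)) powr p + b x powr p))"
          by (intro ennreal_leI) (simp add: add.commute)
        then show "ennreal (norm (grad v (s *\<^sub>R x)) * norm x) * indicator {l..1} s * ennreal (b x powr (p - 1)) \<le>
          ennreal (2 * R) * (?h (s *\<^sub>R x) * indicator {l..1} s + ennreal (b x powr p) * indicator {l..1} s)"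
          using R by (cases "s \<in> {l..1}") (auto simp: ennreal_mult[symmetric] ennreal_plus[symmetric] simp del: ennreal_plus)
      qed
      also have "\<dots> = ennreal (2 * R) * ((\<integral>\<^sup>+s. ?h (s *\<^sub>R x) * indicator {l..1} s \<partial>lborel) + ennreal (b x powr p) * ennreal (1 - l))"
        using l by (simp add: nn_integral_cmult nn_integral_add nn_integral_cmult_indicator)
      finally show ?thesis using True by (simp add: mult.commute)
    qed simp
  qed
  also have "\<dots> = ennreal (2 * R) * ((\<integral>\<^sup>+x. (\<integral>\<^sup>+s. ?h (s *\<^sub>R x) * indicator {l..1} s \<partial>lborel) * indicator A x \<partial>lborel) +
       ennreal (1 - l) * (\<integral>\<^sup>+x. ennreal (b x powr p) * indicator A x \<partial>lborel))"
    by (simp add: nn_integral_cmult nn_integral_add)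
  also have "\<dots> \<le> ennreal (2 * R) * (ennreal (1 - l) * (2 ^ CARD('n) * (\<integral>\<^sup>+x. ?h x * indicator A' x \<partial>lborel)) +
       ennreal (1 - l) * (\<integral>\<^sup>+x. ennreal (b x powr p) * indicator A x \<partial>lborel))"
    by (intro mult_left_mono add_right_mono ray_fubini l AA) auto
  also have "\<dots> = ennreal (2 * R * (1 - l)) * (2 ^ CARD('n) * (\<integral>\<^sup>+x. ?h x * indicator A' x \<partial>lborel) + (\<integral>\<^sup>+x. ennreal (b x powr p) * indicator A x \<partial>lborel))"
    using l R by (simp add: ennreal_mult distrib_left mult.assoc)
  finally show ?thesis by (simp add: A_def A'_def)
qed

text \<open>The Cauchy-Schwarz inequality on [l, 1] contributes one factor 1 - l and
  \<open>ray_fubini\<close> a second one; r^2 <= 1 + r^p holds because p >= 2. Here the whole ball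
  enters, since the Taylor remainder for \<open>F\<close> lives on the whole support of the
  cutoff.\<close>

lemma difference_quotient_square:
  fixes v :: "real^'n \<Rightarrow> real"
  assumes v: "smooth v" and l: "1/2 \<le> l" "l \<le> 1" and R: "R > 0" and p: "p \<ge> 2"
  shows "(\<integral>\<^sup>+x. ennreal ((v x - v (l *\<^sub>R x))\<^sup>2) * indicator (cball 0 R) x \<partial>lborel)
    \<le> ennreal (R\<^sup>2 * (1 - l)\<^sup>2) * (2 ^ CARD('n) * (\<integral>\<^sup>+x. ennreal (1 + norm (grad v x) powr p) * indicator (cball 0 R) x \<partial>lborel))"
proof -
  have [measurable]: "grad v \<in> borel_measurable borel"
    using smooth_continuous_grad[OF v] by (auto intro: borel_measurable_continuous_onI)
  have [measurable]: "cball (0::real^'n) R \<in> sets borel" by simp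
  let ?h = "\<lambda>x. ennreal (1 + norm (grad v x) powr p)"
  have sq: "r\<^sup>2 \<le> 1 + r powr p" if "r \<ge> 0" for r
    using pw_mix[of 1 r p] that p by (simp add: pw_def split: if_splits)
  have "(\<integral>\<^sup>+x. ennreal ((v x - v (l *\<^sub>R x))\<^sup>2) * indicator (cball 0 R) x \<partial>lborel) \<le>
    (\<integral>\<^sup>+x. ennreal (R\<^sup>2 * (1 - l)) * ((\<integral>\<^sup>+s. ?h (s *\<^sub>R x) * indicator {l..1} s \<partial>lborel) * indicator (cball 0 R) x) \<partial>lborel)"
  proof (rule nn_integral_mono)
    fix x
    show "ennreal ((v x - v (l *\<^sub>R x))\<^sup>2) * indicator (cball 0 R) x \<le>
      ennreal (R\<^sup>2 * (1 - l)) * ((\<integral>\<^sup>+s. ?h (s *\<^sub>R x) * indicator {l..1} s \<partial>lborel) * indicator (cball 0 R) x)"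
    proof (cases "x \<in> cball 0 R")
      case True
      have "ennreal ((v x - v (l *\<^sub>R x))\<^sup>2) = (ennreal \<bar>v x - v (l *\<^sub>R x)\<bar>)\<^sup>2"
        by (simp add: ennreal_power)
      also have "\<dots> \<le> (\<integral>\<^sup>+s. ennreal (norm (grad v (s *\<^sub>R x)) * norm x) * indicator {l..1} s \<partial>lborel)\<^sup>2"
        by (intro power_mono ray_bound v l) simp
      \<comment> \<open>The indicator is doubled to split the integrand into the two factors of the
        Cauchy-Schwarz inequality.\<close>
      also have "\<dots> = (\<integral>\<^sup>+s. (ennreal (norm (grad v (s *\<^sub>R x)) * norm x) * indicator {l..1} s) * indicator {l..1} s \<partial>lborel)\<^sup>2"
        by (intro arg_cong[where f = "\<lambda>t. t\<^sup>2"] nn_integral_cong) (auto simp: indicator_def)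
      also have "\<dots> \<le> (\<integral>\<^sup>+s. (ennreal (norm (grad v (s *\<^sub>R x)) * norm x) * indicator {l..1} s)\<^sup>2 \<partial>lborel) * (\<integral>\<^sup>+s. (indicator {l..1} s)\<^sup>2 \<partial>lborel)"
        by (rule Cauchy_Schwarz_nn_integral) measurable
      also have "(\<integral>\<^sup>+s. (indicator {l..1} s)\<^sup>2 \<partial>lborel) = ennreal (1 - l)"
      proof -
        have "(\<integral>\<^sup>+s. (indicator {l..1} s)\<^sup>2 \<partial>lborel) = (\<integral>\<^sup>+s. indicator {l..1} s \<partial>lborel)"
          by (intro nn_integral_cong) (auto simp: indicator_def)
        then show ?thesis using l by simp
      qed
      also have "(\<integral>\<^sup>+s. (ennreal (norm (grad v (s *\<^sub>R x)) * norm x) * indicator {l..1} s)\<^sup>2 \<partial>lborel)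
         \<le> (\<integral>\<^sup>+s. ennreal (R\<^sup>2) * (?h (s *\<^sub>R x) * indicator {l..1} s) \<partial>lborel)"
      proof (rule nn_integral_mono)
        fix s :: real
        have "(norm (grad v (s *\<^sub>R x)) * norm x)\<^sup>2 = (norm x)\<^sup>2 * (norm (grad v (s *\<^sub>R x)))\<^sup>2"
          by (simp add: power_mult_distrib)
        also have "\<dots> \<le> R\<^sup>2 * (1 + norm (grad v (s *\<^sub>R x)) powr p)"
          using True by (intro mult_mono power_mono sq) auto
        finally have "ennreal ((norm (grad v (s *\<^sub>R x)) * norm x)\<^sup>2) \<le> ennreal (R\<^sup>2 * (1 + norm (grad v (s *\<^sub>R x)) powr p))"
          by (rule ennreal_leI)
        then show "(ennreal (norm (grad v (s *\<^sub>R x)) * norm x) * indicator {l..1} s)\<^sup>2 \<le> ennreal (R\<^sup>2) * (?h (s *\<^sub>R x) * indicator {l..1} s)"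
          by (cases "s \<in> {l..1}") (auto simp: ennreal_mult[symmetric] ennreal_power simp del: ennreal_plus)
      qed
      also have "\<dots> = ennreal (R\<^sup>2) * (\<integral>\<^sup>+s. ?h (s *\<^sub>R x) * indicator {l..1} s \<partial>lborel)"
        by (simp add: nn_integral_cmult)
      finally show ?thesis using True l by (simp add: ennreal_mult mult_ac mult_right_mono)
    qed simp
  qed
  also have "\<dots> = ennreal (R\<^sup>2 * (1 - l)) * (\<integral>\<^sup>+x. (\<integral>\<^sup>+s. ?h (s *\<^sub>R x) * indicator {l..1} s \<partial>lborel) * indicator (cball 0 R) x \<partial>lborel)"
    by (rule nn_integral_cmult) measurable
  also have "\<dots> \<le> ennreal (R\<^sup>2 * (1 - l)) * (ennreal (1 - l) * (2 ^ CARD('n) * (\<integral>\<^sup>+x. ?h x * indicator (cball 0 R) x \<partial>lborel)))"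
  proof (intro mult_left_mono ray_fubini l)
    show "s *\<^sub>R x \<in> cball 0 R" if "x \<in> cball 0 R" "1/2 \<le> s" "s \<le> 1" for s and x :: "real^'n"
      using that mult_right_mono[of s 1 "norm x"] by auto
  qed auto
  also have "\<dots> = ennreal (R\<^sup>2 * (1 - l)\<^sup>2) * (2 ^ CARD('n) * (\<integral>\<^sup>+x. ?h x * indicator (cball 0 R) x \<partial>lborel))"
  proof -
    have "ennreal (R\<^sup>2 * (1 - l)\<^sup>2) = ennreal (R\<^sup>2 * (1 - l)) * ennreal (1 - l)"
    proof (subst ennreal_mult[symmetric])
      show "0 \<le> R\<^sup>2 * (1 - l)" "0 \<le> 1 - l" using l by simp_all
    qed (simp add: power2_eq_square mult_ac)
    then show ?thesis by (simp only: mult.assoc)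
  qed
  finally show ?thesis .
qed

lemma AE_dilate:
  fixes P :: "real^'n \<Rightarrow> bool"
  assumes "AE x in lborel. P x" "c \<noteq> 0"
  shows "AE x in lborel. P (c *\<^sub>R x)"
proof -
  \<comment> \<open>The predicate may fail to be Borel, so a Borel null set containing its
    exceptional points is dilated instead.\<close>
  obtain N where N: "{x \<in> space lborel. \<not> P x} \<subseteq> N" "emeasure lborel N = 0" "N \<in> sets lborel"
    using assms(1) by (rule AE_E)
  have [measurable]: "N \<in> sets borel" using N(3) by simp
  have "AE x in lborel. x \<notin> N" using N by (intro AE_not_in) auto
  then have "AE x in lborel. 0 + c *\<^sub>R x \<notin> N"
    by (intro AE_lborel_affine[of c "\<lambda>x. x \<notin> N" 0] assms(2)) measurable
  then show ?thesis by eventually_elim (use N(1) in auto)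
qed

lemma integrable_dilate:
  fixes g :: "real^'n \<Rightarrow> real"
  assumes g: "integrable lborel g" and c: "c \<noteq> 0"
  shows "integrable lborel (\<lambda>x. g (c *\<^sub>R x))"
proof -
  have [measurable]: "g \<in> borel_measurable borel" using g by auto
  have "(\<integral>\<^sup>+x. ennreal (norm (g x)) \<partial>lborel) < \<infinity>" using g by (simp add: integrable_iff_bounded)
  then have "ennreal (\<bar>c\<bar> ^ CARD('n)) * (\<integral>\<^sup>+x. ennreal (norm (g (c *\<^sub>R x))) \<partial>lborel) < \<infinity>"
    using nn_integral_lborel_affine[of c "\<lambda>x. ennreal (norm (g x))" 0] c by simp
  then have "(\<integral>\<^sup>+x. ennreal (norm (g (c *\<^sub>R x))) \<partial>lborel) < \<infinity>"
    using c by (auto simp: ennreal_mult_less_top)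
  then show ?thesis by (intro integrableI_bounded) auto
qed

lemma mvt_unordered:
  fixes F F' :: "real \<Rightarrow> real"
  assumes "\<And>s. (F has_real_derivative F' s) (at s)"
  shows "\<exists>z. min a b \<le> z \<and> z \<le> max a b \<and> F b - F a = F' z * (b - a)"
proof -
  consider "a < b" | "a = b" | "b < a" by linarith
  then show ?thesis
  proof cases
    case 1
    from MVT2[OF 1, of F F'] assms obtain z where "a < z" "z < b" "F b - F a = (b - a) * F' z" by blast
    then show ?thesis using 1 by (intro exI[of _ z]) (auto simp: mult.commute)
  next
    case 2
    then show ?thesis by (intro exI[of _ a]) auto
  next
    case 3
    from MVT2[OF 3, of F F'] assms obtain z where "b < z" "z < a" "F a - F b = (a - b) * F' z" by blast
    then show ?thesis using 3 by (intro exI[of _ z]) (auto simp: algebra_simps)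
  qed
qed

text \<open>Two applications of the mean value theorem; both intermediate points lie between a and
  b, hence where \<open>f'\<close> is bounded by \<open>K\<close>. The direction of the estimate
  matches the tangent inequality for H^p.\<close>

lemma quadratic_remainder:
  fixes F f f' :: "real \<Rightarrow> real"
  assumes F: "\<And>s. (F has_real_derivative f s) (at s)" and f: "\<And>s. (f has_real_derivative f' s) (at s)"
    and K: "\<And>s. \<bar>s\<bar> \<le> C \<Longrightarrow> \<bar>f' s\<bar> \<le> K" and ab: "\<bar>a\<bar> \<le> C" "\<bar>b\<bar> \<le> C"
  shows "F b - F a \<le> f a * (b - a) + K * (b - a)\<^sup>2"
proof -
  obtain z where z: "min a b \<le> z" "z \<le> max a b" "F b - F a = f z * (b - a)" using mvt_unordered[OF F] by blast
  obtain y where y: "min a z \<le> y" "y \<le> max a z" "f z - f a = f' y * (z - a)" using mvt_unordered[OF f] by blast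
  have "\<bar>y\<bar> \<le> C" using y(1,2) z(1,2) ab by (auto simp: min_def max_def split: if_splits)
  have "K \<ge> 0" using K[OF ab(1)] by simp
  have za: "\<bar>z - a\<bar> \<le> \<bar>b - a\<bar>" using z(1,2) by (auto simp: min_def max_def split: if_splits)
  have "F b - F a - f a * (b - a) = (f z - f a) * (b - a)" using z(3) by (simp add: algebra_simps)
  also have "\<dots> \<le> \<bar>f' y\<bar> * \<bar>z - a\<bar> * \<bar>b - a\<bar>" unfolding y(3) by (metis abs_ge_self abs_mult)
  also have "\<dots> \<le> K * \<bar>b - a\<bar> * \<bar>b - a\<bar>"
    using K[OF \<open>\<bar>y\<bar> \<le> C\<close>] za \<open>K \<ge> 0\<close> by (intro mult_mono) auto
  finally show ?thesis by (simp add: power2_eq_square mult.assoc)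
qed

context weak_solution
begin

lemma bounded_on_ball:
  obtains C where "C \<ge> 0" "AE x in lborel. norm x \<le> R \<longrightarrow> \<bar>u x\<bar> \<le> C"
proof -
  obtain C where "AE x in lborel. norm x \<le> R \<longrightarrow> \<bar>u x\<bar> \<le> C" using u_bounded by blast
  then have "AE x in lborel. norm x \<le> R \<longrightarrow> \<bar>u x\<bar> \<le> max C 0" by eventually_elim auto
  then show ?thesis using that[of "max C 0"] by simp
qed

text \<open>Makes eta(x) (u(lx) - u(x)) admissible in the equation and carries the two ray estimates
  over from mollifications to u. In the weighted estimate the weight stays |G|^(p-1) while u is
  approximated, so the left sides are dominated by a multiple of 1 + |G|^p.\<close>

lemma dilation_limits:
  fixes l R :: real and \<eta> :: "real^'n \<Rightarrow> real"
  assumes R: "R > 0" and \<eta>: "smooth \<eta>" "\<And>x. norm x \<ge> 2 * R \<Longrightarrow> \<eta> x = 0" and l: "1/2 \<le> l" "l \<le> 1"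
  shows "(LINT x|lborel. flux p H (G x) \<bullet> ((u (l *\<^sub>R x) - u x) *\<^sub>R grad \<eta> x + \<eta> x *\<^sub>R (l *\<^sub>R G (l *\<^sub>R x) - G x)))
      = (LINT x|lborel. f (u x) * (\<eta> x * (u (l *\<^sub>R x) - u x)))" (is "?eq")
    and "integrable lborel (\<lambda>x. flux p H (G x) \<bullet> ((u (l *\<^sub>R x) - u x) *\<^sub>R grad \<eta> x + \<eta> x *\<^sub>R (l *\<^sub>R G (l *\<^sub>R x) - G x)))" (is "?i1")
    and "integrable lborel (\<lambda>x. f (u x) * (\<eta> x * (u (l *\<^sub>R x) - u x)))" (is "?i2")
    and "(\<integral>\<^sup>+x. ennreal (\<bar>u x - u (l *\<^sub>R x)\<bar> * norm (G x) powr (p - 1)) * indicator {x. R \<le> norm x \<and> norm x \<le> 2 * R} x \<partial>lborel)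
      \<le> ennreal (2 * R * (1 - l)) * (2 ^ CARD('n) * (\<integral>\<^sup>+x. ennreal (norm (G x) powr p) * indicator {x. R / 2 \<le> norm x \<and> norm x \<le> 2 * R} x \<partial>lborel)
      + (\<integral>\<^sup>+x. ennreal (norm (G x) powr p) * indicator {x. R \<le> norm x \<and> norm x \<le> 2 * R} x \<partial>lborel))" (is "?d1")
    and "(\<integral>\<^sup>+x. ennreal ((u x - u (l *\<^sub>R x))\<^sup>2) * indicator (cball 0 (2 * R)) x \<partial>lborel)
      \<le> ennreal ((2 * R)\<^sup>2 * (1 - l)\<^sup>2) * (2 ^ CARD('n) * (\<integral>\<^sup>+x. ennreal (1 + norm (G x) powr p) * indicator (cball 0 (2 * R)) x \<partial>lborel))" (is "?d2")
proof -
  have p0: "p > 0" "p \<ge> 1" using p2 by auto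
  define r where "r = 2 * R"
  have r: "r > 0" using R by (simp add: r_def)
  have l0: "l \<noteq> 0" "l > 0" using l by auto
  obtain C where C: "C \<ge> 0" "AE x in lborel. norm x \<le> r + 1 \<longrightarrow> \<bar>u x\<bar> \<le> C" using bounded_on_ball by blast
  obtain v w where v: "\<And>k. smooth (v k)"
      "AE x in lborel. norm x \<le> r \<longrightarrow> (\<lambda>k. v k x) \<longlonglongrightarrow> u x \<and> (\<lambda>k. grad (v k) x) \<longlonglongrightarrow> G x"
      "\<And>k x. norm x \<le> r \<Longrightarrow> \<bar>v k x\<bar> \<le> C"
      "AE x in lborel. norm x \<le> r \<longrightarrow> (\<forall>k. norm (grad (v k) x) powr p \<le> w x)"
      "integrable lborel w" "\<And>x. 0 \<le> w x"
    using approximation[OF C] by blast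
  \<comment> \<open>Because l <= 1 the dilated point stays in the ball on which the approximations
    converge.\<close>
  have lx: "norm (l *\<^sub>R x) \<le> r" if "norm x \<le> r" for x :: "real^'n"
    using that l mult_mono[of l 1 "norm x" r] by simp
  have v2: "AE x in lborel. norm x \<le> r \<longrightarrow> (\<lambda>k. v k (l *\<^sub>R x)) \<longlonglongrightarrow> u (l *\<^sub>R x) \<and> (\<lambda>k. grad (v k) (l *\<^sub>R x)) \<longlonglongrightarrow> G (l *\<^sub>R x)"
    using AE_dilate[OF v(2) l0(1)] by eventually_elim (use lx in blast)
  have v4: "AE x in lborel. norm x \<le> r \<longrightarrow> (\<forall>k. norm (grad (v k) (l *\<^sub>R x)) powr p \<le> w (l *\<^sub>R x))"
    using AE_dilate[OF v(4) l0(1)] by eventually_elim (use lx in blast)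
  note cont = smooth_continuous_on[OF \<eta>(1), of UNIV] smooth_continuous_grad[OF \<eta>(1), of UNIV]
  have [measurable]: "\<eta> \<in> borel_measurable borel" "grad \<eta> \<in> borel_measurable borel"
    by (intro borel_measurable_continuous_onI cont)+
  have [measurable]: "v k \<in> borel_measurable borel" "grad (v k) \<in> borel_measurable borel" for k
    by (intro borel_measurable_continuous_onI smooth_continuous_on smooth_continuous_grad v)+
  have \<eta>0: "\<eta> x = 0" "grad \<eta> x = 0" if "norm x > r" for x
    using \<eta>(2) that partial_eq_0_outside(2)[of r \<eta> x] by (auto simp: r_def)
  obtain B1 where B1: "B1 > 0" "\<And>x. norm (\<eta> x) \<le> B1"
    using continuous_vanishing_outside_bounded[OF cont(1), of r] \<eta>0 by metis
  obtain B2 where B2: "B2 > 0" "\<And>x. norm (grad \<eta> x) \<le> B2"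
    using continuous_vanishing_outside_bounded[OF cont(2), of r] \<eta>0 by metis
  define \<phi> where "\<phi> k x = (v k (l *\<^sub>R x) - v k x) * \<eta> x" for k x
  have sd: "smooth (\<lambda>x. v k (l *\<^sub>R x) - v k x)" for k by (intro smooth_diff smooth_scaled v)
  have \<phi>C: "\<phi> k \<in> Cc_infinity" for k
    unfolding Cc_infinity_iff
  proof
    show "smooth (\<phi> k)" unfolding \<phi>_def[abs_def] by (intro smooth_mult sd \<eta>)
    show "compactly_supported (\<phi> k)" by (rule compactly_supportedI[of r]) (use \<eta>0 in \<open>simp add: \<phi>_def\<close>)
  qed
  have g\<phi>: "grad (\<phi> k) x = (v k (l *\<^sub>R x) - v k x) *\<^sub>R grad \<eta> x + \<eta> x *\<^sub>R (l *\<^sub>R grad (v k) (l *\<^sub>R x) - grad (v k) x)" for k x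
  proof -
    have "grad (\<lambda>x. v k (0 + l *\<^sub>R x)) x = l *\<^sub>R grad (v k) (0 + l *\<^sub>R x)"
      by (rule grad_affine(1)[OF smooth_differentiable[OF v(1)]])
    then have "grad (\<lambda>x. v k (l *\<^sub>R x) - v k x) x = l *\<^sub>R grad (v k) (l *\<^sub>R x) - grad (v k) x"
      by (subst grad_diff) (simp_all add: smooth_differentiable smooth_scaled v)
    then show ?thesis unfolding \<phi>_def[abs_def]
      by (subst grad_mult) (auto intro: smooth_differentiable sd \<eta>)
  qed
  define q where "q x = (u (l *\<^sub>R x) - u x) *\<^sub>R grad \<eta> x + \<eta> x *\<^sub>R (l *\<^sub>R G (l *\<^sub>R x) - G x)" for x
  have [measurable]: "q \<in> borel_measurable borel" unfolding q_def by measurable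
  have "smooth (\<phi> k)" for k using \<phi>C[of k] by (simp add: Cc_infinity_iff)
  then have [measurable]: "\<phi> k \<in> borel_measurable borel" "grad (\<phi> k) \<in> borel_measurable borel" for k
    by (auto intro!: borel_measurable_continuous_onI smooth_continuous_on smooth_continuous_grad)
  obtain Ca where Ca: "Ca > 0" "\<And>\<xi>. norm (flux p H \<xi>) \<le> Ca * norm \<xi> powr (p - 1)"
    using flux_bound[OF H p0(1)] by blast
  obtain Cf where Cf: "Cf > 0" "AE x in lborel. norm x \<le> r \<longrightarrow> \<bar>f (u x)\<bar> \<le> Cf"
    using locally_bounded_comp[OF f_cont] by blast
  have wint: "integrable lborel (\<lambda>x. w x + w (l *\<^sub>R x))"
    by (intro Bochner_Integration.integrable_add v integrable_dilate l0)
  define K where "K = Ca * (2 * C * B2 + 2 * B1)"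
  have K0: "K \<ge> 0" using Ca C B1 B2 by (simp add: K_def)
  have dv: "\<bar>v k (l *\<^sub>R x) - v k x\<bar> \<le> 2 * C" if "norm x \<le> r" for k x
    using v(3)[OF that, of k] v(3)[OF lx[OF that], of k] by linarith
  have bd: "\<bar>flux p H (G x) \<bullet> grad (\<phi> k) x\<bar> \<le> K * (indicator (cball 0 r) x * (1 + norm (G x) powr p) + (w x + w (l *\<^sub>R x)))"
    if x: "norm x \<le> r" and w: "norm (grad (v k) x) powr p \<le> w x" "norm (grad (v k) (l *\<^sub>R x)) powr p \<le> w (l *\<^sub>R x)" for x k
  proof -
    let ?g = "norm (G x)" and ?a = "norm (grad (v k) (l *\<^sub>R x))" and ?b = "norm (grad (v k) x)"
    have "norm (grad (\<phi> k) x) \<le> \<bar>v k (l *\<^sub>R x) - v k x\<bar> * norm (grad \<eta> x) + \<bar>\<eta> x\<bar> * norm (l *\<^sub>R grad (v k) (l *\<^sub>R x) - grad (v k) x)"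
      unfolding g\<phi> by (rule norm_triangle_le) simp
    also have "\<dots> \<le> 2 * C * B2 + B1 * (?a + ?b)"
    proof (intro add_mono mult_mono dv x B2)
      have "norm (l *\<^sub>R grad (v k) (l *\<^sub>R x) - grad (v k) x) \<le> l * ?a + ?b"
        using norm_triangle_ineq4[of "l *\<^sub>R grad (v k) (l *\<^sub>R x)" "grad (v k) x"] l0 by simp
      also have "\<dots> \<le> ?a + ?b" using l by (simp add: mult_left_le_one_le)
      finally show "norm (l *\<^sub>R grad (v k) (l *\<^sub>R x) - grad (v k) x) \<le> ?a + ?b" .
    qed (use C B1 in auto)
    finally have g: "norm (grad (\<phi> k) x) \<le> 2 * C * B2 + B1 * (?a + ?b)" .
    have "\<bar>flux p H (G x) \<bullet> grad (\<phi> k) x\<bar> \<le> (Ca * ?g powr (p - 1)) * (2 * C * B2 + B1 * (?a + ?b))"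
      by (rule order_trans[OF Cauchy_Schwarz_ineq2]) (use Ca g in \<open>auto intro!: mult_mono\<close>)
    also have "\<dots> = Ca * (2 * C * B2 * (?g powr (p - 1) * 1) + B1 * (?g powr (p - 1) * ?a + ?g powr (p - 1) * ?b))"
      by (simp add: algebra_simps)
    also have "\<dots> \<le> Ca * (2 * C * B2 * (?g powr p + 1 powr p) + B1 * ((?g powr p + ?a powr p) + (?g powr p + ?b powr p)))"
      using Ca C B1 B2 p0 by (intro mult_left_mono add_mono powr_mix) auto
    also have "\<dots> \<le> Ca * (2 * C * B2 * (1 + ?g powr p + (w x + w (l *\<^sub>R x))) + B1 * (2 * (1 + ?g powr p + (w x + w (l *\<^sub>R x)))))"
    proof (intro mult_left_mono add_mono[of "2 * C * B2 * _"])
      show "?g powr p + 1 powr p \<le> 1 + ?g powr p + (w x + w (l *\<^sub>R x))"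
        using v(6)[of x] v(6)[of "l *\<^sub>R x"] by simp
      show "(?g powr p + ?a powr p) + (?g powr p + ?b powr p) \<le> 2 * (1 + ?g powr p + (w x + w (l *\<^sub>R x)))"
        using w v(6)[of x] v(6)[of "l *\<^sub>R x"] by simp
    qed (use Ca C B1 B2 in auto)
    also have "\<dots> = K * (1 + ?g powr p + (w x + w (l *\<^sub>R x)))" by (simp add: K_def algebra_simps)
    finally show ?thesis using x by simp
  qed
  have gint: "integrable lborel (\<lambda>x. K * (indicator (cball 0 r) x * (1 + norm (G x) powr p) + (w x + w (l *\<^sub>R x))))"
    by (rule dom_integrable[OF wint])
  have gnn: "0 \<le> K * (indicator (cball 0 r) x * (1 + norm (G x) powr p) + (w x + w (l *\<^sub>R x)))" for x
    using K0 v(6) by simp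
  have out: "grad (\<phi> k) x = 0" "q x = 0" "\<phi> k x = 0" if "norm x > r" for k x
    using \<eta>0[OF that] by (auto simp: g\<phi> q_def \<phi>_def)
  have L1: "AE x in lborel. norm x \<le> r \<longrightarrow> (\<lambda>k. flux p H (G x) \<bullet> grad (\<phi> k) x) \<longlonglongrightarrow> flux p H (G x) \<bullet> q x"
    using v(2) v2 by eventually_elim (auto simp: g\<phi> q_def intro!: tendsto_intros)
  have Bd1: "AE x in lborel. norm x \<le> r \<longrightarrow> (\<forall>k. \<bar>flux p H (G x) \<bullet> grad (\<phi> k) x\<bar> \<le> K * (indicator (cball 0 r) x * (1 + norm (G x) powr p) + (w x + w (l *\<^sub>R x))))"
    using v(4) v4 by eventually_elim (use bd in blast)
  have D1: "(\<lambda>k. LINT x|lborel. flux p H (G x) \<bullet> grad (\<phi> k) x) \<longlonglongrightarrow> (LINT x|lborel. flux p H (G x) \<bullet> q x)"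
    "integrable lborel (\<lambda>x. flux p H (G x) \<bullet> q x)"
    by (rule ball_dominated_convergence(1,2)[OF _ _ gint L1 Bd1 gnn]; (measurable)?; simp add: out)+
  have L2: "AE x in lborel. norm x \<le> r \<longrightarrow> (\<lambda>k. f (u x) * \<phi> k x) \<longlonglongrightarrow> f (u x) * (\<eta> x * (u (l *\<^sub>R x) - u x))"
    using v(2) v2 by eventually_elim (auto simp: \<phi>_def mult.commute[of "\<eta> _"] intro!: tendsto_intros)
  have Bd2: "AE x in lborel. norm x \<le> r \<longrightarrow> (\<forall>k. \<bar>f (u x) * \<phi> k x\<bar> \<le> Cf * (2 * C * B1) * indicator (cball 0 r) x)"
    using Cf(2)
  proof eventually_elim
    case (elim x)
    show ?case
    proof (intro impI allI)
      fix k assume x: "norm x \<le> r"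
      have "\<bar>f (u x)\<bar> * (\<bar>v k (l *\<^sub>R x) - v k x\<bar> * \<bar>\<eta> x\<bar>) \<le> Cf * (2 * C * B1)"
        using elim x B1 C Cf(1) by (intro mult_mono dv) auto
      then show "\<bar>f (u x) * \<phi> k x\<bar> \<le> Cf * (2 * C * B1) * indicator (cball 0 r) x"
        using x by (simp add: abs_mult \<phi>_def)
    qed
  qed
  have cint: "integrable lborel (\<lambda>x. Cf * (2 * C * B1) * indicator (cball 0 r) x)"
    by (intro integrable_mult_right integrable_real_indicator) (auto simp: cball_finite)
  have cnn: "0 \<le> Cf * (2 * C * B1) * indicator (cball 0 r) x" for x :: "real^'n"
    using Cf B1 C by simp
  have D2: "(\<lambda>k. LINT x|lborel. f (u x) * \<phi> k x) \<longlonglongrightarrow> (LINT x|lborel. f (u x) * (\<eta> x * (u (l *\<^sub>R x) - u x)))"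
    "integrable lborel (\<lambda>x. f (u x) * (\<eta> x * (u (l *\<^sub>R x) - u x)))"
    by (rule ball_dominated_convergence(1,2)[OF _ _ cint L2 Bd2 cnn]; (measurable)?; simp add: out \<eta>0)+
  show ?eq using LIMSEQ_unique[OF D1(1)[unfolded equation[OF \<phi>C]] D2(1)] by (simp add: q_def)
  show ?i1 using D1(2) by (simp add: q_def)
  show ?i2 by (rule D2(2))
  define A where "A = {x::real^'n. R \<le> norm x \<and> norm x \<le> 2 * R}"
  define A' where "A' = {x::real^'n. R / 2 \<le> norm x \<and> norm x \<le> 2 * R}"
  have [measurable]: "A \<in> sets borel" "A' \<in> sets borel" "cball (0::real^'n) r \<in> sets borel" unfolding A_def A'_def by measurable
  have Ar: "norm x \<le> r" if "x \<in> A \<or> x \<in> A'" for x using that by (auto simp: A_def A'_def r_def)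
  have G1: "(\<integral>\<^sup>+x. ennreal (K' * (1 + norm (G x) powr p)) * indicator (cball 0 r) x \<partial>lborel) < \<infinity>" if "K' \<ge> 0" for K'
  proof -
    have "integrable lborel (\<lambda>x. K' * (indicator (cball 0 r) x * (1 + norm (G x) powr p) + 0))" by (rule dom_integrable) simp
    then have "(\<integral>\<^sup>+x. ennreal (norm (K' * (indicator (cball 0 r) x * (1 + norm (G x) powr p) + 0))) \<partial>lborel) < \<infinity>"
      by (rule integrable_iff_bounded[THEN iffD1, THEN conjunct2])
    moreover have "ennreal (norm (K' * (indicator (cball 0 r) x * (1 + norm (G x) powr p) + 0))) = ennreal (K' * (1 + norm (G x) powr p)) * indicator (cball 0 r) x" for x
      using that by (simp add: indicator_def)
    ultimately show ?thesis by (simp only:)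
  qed
  have wfin: "(\<integral>\<^sup>+x. ennreal (1 + w x) * indicator (cball 0 r) x \<partial>lborel) < \<infinity>"
  proof -
    have "integrable lborel (\<lambda>x. indicator (cball 0 r) x + w x)"
      by (intro Bochner_Integration.integrable_add v integrable_real_indicator) (auto simp: cball_finite)
    then have "(\<integral>\<^sup>+x. ennreal (norm (indicator (cball 0 r) x + w x)) \<partial>lborel) < \<infinity>"
      by (rule integrable_iff_bounded[THEN iffD1, THEN conjunct2])
    moreover have "(\<integral>\<^sup>+x. ennreal (1 + w x) * indicator (cball 0 r) x \<partial>lborel) \<le> (\<integral>\<^sup>+x. ennreal (norm (indicator (cball 0 r) x + w x)) \<partial>lborel)"
      by (intro nn_integral_mono) (use v(6) in \<open>auto simp: indicator_def simp del: ennreal_plus\<close>)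
    ultimately show ?thesis by (rule le_less_trans[rotated])
  qed
  have powr_lim: "(\<lambda>k. norm (grad (v k) x) powr p) \<longlonglongrightarrow> norm (G x) powr p" if "(\<lambda>k. grad (v k) x) \<longlonglongrightarrow> G x" for x
    using p0 that by (intro tendsto_powr' tendsto_norm tendsto_const) auto
  have R1: "(\<lambda>k. \<integral>\<^sup>+x. ennreal (norm (grad (v k) x) powr p) * indicator A' x \<partial>lborel) \<longlonglongrightarrow>
      (\<integral>\<^sup>+x. ennreal (norm (G x) powr p) * indicator A' x \<partial>lborel)"
  proof (rule nn_integral_dominated_convergence[where w = "\<lambda>x. ennreal (1 + w x) * indicator (cball 0 r) x"])
    show "AE x in lborel. ennreal (norm (grad (v k) x) powr p) * indicator A' x \<le> ennreal (1 + w x) * indicator (cball 0 r) x" for k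
      using v(4)
    proof eventually_elim
      case (elim x)
      have "norm (grad (v k) x) powr p \<le> 1 + w x" if "x \<in> A'"
        using elim Ar[of x] that by (meson add_increasing le_less zero_less_one)
      then show ?case using Ar[of x] by (cases "x \<in> A'") (auto simp del: ennreal_plus intro: ennreal_leI)
    qed
    show "AE x in lborel. (\<lambda>k. ennreal (norm (grad (v k) x) powr p) * indicator A' x) \<longlonglongrightarrow> ennreal (norm (G x) powr p) * indicator A' x"
      using v(2) by eventually_elim (use Ar powr_lim in \<open>auto simp: indicator_def\<close>)
  qed (use wfin v(5) in auto)
  have LL1: "(\<lambda>k. \<integral>\<^sup>+x. ennreal (\<bar>v k x - v k (l *\<^sub>R x)\<bar> * norm (G x) powr (p - 1)) * indicator A x \<partial>lborel) \<longlonglongrightarrow>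
      (\<integral>\<^sup>+x. ennreal (\<bar>u x - u (l *\<^sub>R x)\<bar> * norm (G x) powr (p - 1)) * indicator A x \<partial>lborel)"
  proof (rule nn_integral_dominated_convergence[where w = "\<lambda>x. ennreal (2 * C * (1 + norm (G x) powr p)) * indicator (cball 0 r) x"])
    show "AE x in lborel. ennreal (\<bar>v k x - v k (l *\<^sub>R x)\<bar> * norm (G x) powr (p - 1)) * indicator A x \<le> ennreal (2 * C * (1 + norm (G x) powr p)) * indicator (cball 0 r) x" for k
    proof (rule AE_I2)
      fix x
      have "\<bar>v k x - v k (l *\<^sub>R x)\<bar> * norm (G x) powr (p - 1) \<le> 2 * C * (1 + norm (G x) powr p)" if "x \<in> A"
        using dv[of x k] Ar[of x] that C powr_mix[of "norm (G x)" 1 p] p0 by (intro mult_mono) (auto simp: abs_minus_commute)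
      then show "ennreal (\<bar>v k x - v k (l *\<^sub>R x)\<bar> * norm (G x) powr (p - 1)) * indicator A x \<le> ennreal (2 * C * (1 + norm (G x) powr p)) * indicator (cball 0 r) x"
        using Ar[of x] by (cases "x \<in> A") (auto simp del: ennreal_plus intro: ennreal_leI)
    qed
    show "AE x in lborel. (\<lambda>k. ennreal (\<bar>v k x - v k (l *\<^sub>R x)\<bar> * norm (G x) powr (p - 1)) * indicator A x) \<longlonglongrightarrow> ennreal (\<bar>u x - u (l *\<^sub>R x)\<bar> * norm (G x) powr (p - 1)) * indicator A x"
      using v(2) v2
    proof eventually_elim
      case (elim x)
      show ?case
      proof (cases "x \<in> A")
        case True
        then show ?thesis using elim Ar[of x] by (auto intro!: tendsto_intros)
      qed simp
    qed
  qed (use G1[of "2 * C"] C in auto)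
  note Q1 = difference_quotient_weighted[OF v(1) l R p0(2), of "\<lambda>x. norm (G x)", folded A_def A'_def]
  have "(\<integral>\<^sup>+x. ennreal (\<bar>u x - u (l *\<^sub>R x)\<bar> * norm (G x) powr (p - 1)) * indicator A x \<partial>lborel)
      \<le> ennreal (2 * R * (1 - l)) * (2 ^ CARD('n) * (\<integral>\<^sup>+x. ennreal (norm (G x) powr p) * indicator A' x \<partial>lborel)
      + (\<integral>\<^sup>+x. ennreal (norm (G x) powr p) * indicator A x \<partial>lborel))"
  proof (rule LIMSEQ_le[OF LL1])
    show "(\<lambda>k. ennreal (2 * R * (1 - l)) * (2 ^ CARD('n) * (\<integral>\<^sup>+x. ennreal (norm (grad (v k) x) powr p) * indicator A' x \<partial>lborel)
      + (\<integral>\<^sup>+x. ennreal (norm (G x) powr p) * indicator A x \<partial>lborel))) \<longlonglongrightarrow>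
      ennreal (2 * R * (1 - l)) * (2 ^ CARD('n) * (\<integral>\<^sup>+x. ennreal (norm (G x) powr p) * indicator A' x \<partial>lborel)
      + (\<integral>\<^sup>+x. ennreal (norm (G x) powr p) * indicator A x \<partial>lborel))"
      by (intro ennreal_tendsto_cmult tendsto_add R1 tendsto_const) (auto simp: power_less_top_ennreal)
  qed (use Q1 in auto)
  then show ?d1 by (simp add: A_def A'_def)
  have R2: "(\<lambda>k. \<integral>\<^sup>+x. ennreal (1 + norm (grad (v k) x) powr p) * indicator (cball 0 r) x \<partial>lborel) \<longlonglongrightarrow>
      (\<integral>\<^sup>+x. ennreal (1 + norm (G x) powr p) * indicator (cball 0 r) x \<partial>lborel)"
  proof (rule nn_integral_dominated_convergence[where w = "\<lambda>x. ennreal (1 + w x) * indicator (cball 0 r) x"])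
    show "AE x in lborel. ennreal (1 + norm (grad (v k) x) powr p) * indicator (cball 0 r) x \<le> ennreal (1 + w x) * indicator (cball 0 r) x" for k
      using v(4) by eventually_elim (auto simp: indicator_def simp del: ennreal_plus intro!: ennreal_leI)
    show "AE x in lborel. (\<lambda>k. ennreal (1 + norm (grad (v k) x) powr p) * indicator (cball 0 r) x) \<longlonglongrightarrow> ennreal (1 + norm (G x) powr p) * indicator (cball 0 r) x"
      using v(2)
    proof eventually_elim
      case (elim x)
      show ?case
      proof (cases "x \<in> cball 0 r")
        case True
        then have "(\<lambda>k. ennreal (1 + norm (grad (v k) x) powr p)) \<longlonglongrightarrow> ennreal (1 + norm (G x) powr p)"
          using elim by (intro tendsto_ennrealI tendsto_add tendsto_const powr_lim) auto
        then show ?thesis using True by simp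
      qed simp
    qed
  qed (use wfin v(5) in auto)
  have LL2: "(\<lambda>k. \<integral>\<^sup>+x. ennreal ((v k x - v k (l *\<^sub>R x))\<^sup>2) * indicator (cball 0 r) x \<partial>lborel) \<longlonglongrightarrow>
      (\<integral>\<^sup>+x. ennreal ((u x - u (l *\<^sub>R x))\<^sup>2) * indicator (cball 0 r) x \<partial>lborel)"
  proof (rule nn_integral_dominated_convergence[where w = "\<lambda>x. ennreal ((2 * C)\<^sup>2 * (1 + norm (G x) powr p)) * indicator (cball 0 r) x"])
    show "AE x in lborel. ennreal ((v k x - v k (l *\<^sub>R x))\<^sup>2) * indicator (cball 0 r) x \<le> ennreal ((2 * C)\<^sup>2 * (1 + norm (G x) powr p)) * indicator (cball 0 r) x" for k
    proof (rule AE_I2)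
      fix x
      have "(v k x - v k (l *\<^sub>R x))\<^sup>2 \<le> (2 * C)\<^sup>2 * (1 + norm (G x) powr p)" if "norm x \<le> r"
      proof -
        have "(v k x - v k (l *\<^sub>R x))\<^sup>2 \<le> (2 * C)\<^sup>2"
          using dv[OF that, of k] C by (intro abs_le_square_iff[THEN iffD1]) (auto simp: abs_minus_commute)
        also have "\<dots> \<le> (2 * C)\<^sup>2 * (1 + norm (G x) powr p)" by (simp add: distrib_left)
        finally show ?thesis .
      qed
      then show "ennreal ((v k x - v k (l *\<^sub>R x))\<^sup>2) * indicator (cball 0 r) x \<le> ennreal ((2 * C)\<^sup>2 * (1 + norm (G x) powr p)) * indicator (cball 0 r) x"
        by (cases "norm x \<le> r") (auto simp del: ennreal_plus intro: ennreal_leI)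
    qed
    show "AE x in lborel. (\<lambda>k. ennreal ((v k x - v k (l *\<^sub>R x))\<^sup>2) * indicator (cball 0 r) x) \<longlonglongrightarrow> ennreal ((u x - u (l *\<^sub>R x))\<^sup>2) * indicator (cball 0 r) x"
      using v(2) v2
    proof eventually_elim
      case (elim x)
      show ?case
      proof (cases "x \<in> cball 0 r")
        case True
        then show ?thesis using elim by (auto intro!: tendsto_intros)
      qed simp
    qed
  qed (use G1[of "(2 * C)\<^sup>2"] in auto)
  note Q2 = difference_quotient_square[OF v(1) l r p2]
  have "(\<integral>\<^sup>+x. ennreal ((u x - u (l *\<^sub>R x))\<^sup>2) * indicator (cball 0 r) x \<partial>lborel)
      \<le> ennreal (r\<^sup>2 * (1 - l)\<^sup>2) * (2 ^ CARD('n) * (\<integral>\<^sup>+x. ennreal (1 + norm (G x) powr p) * indicator (cball 0 r) x \<partial>lborel))"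
  proof (rule LIMSEQ_le[OF LL2])
    show "(\<lambda>k. ennreal (r\<^sup>2 * (1 - l)\<^sup>2) * (2 ^ CARD('n) * (\<integral>\<^sup>+x. ennreal (1 + norm (grad (v k) x) powr p) * indicator (cball 0 r) x \<partial>lborel))) \<longlonglongrightarrow>
      ennreal (r\<^sup>2 * (1 - l)\<^sup>2) * (2 ^ CARD('n) * (\<integral>\<^sup>+x. ennreal (1 + norm (G x) powr p) * indicator (cball 0 r) x \<partial>lborel))"
      by (intro ennreal_tendsto_cmult R2) (auto simp: power_less_top_ennreal)
  qed (use Q2 in blast)
  then show ?d2 by (simp add: r_def)
qed

end

section \<open>The Pohozaev inequality\<close>

text \<open>The substitution y = lx moves the dilation from \<open>h\<close> to the cutoff. The two
  cutoffs differ only on the annulus, and by at most \<open>L\<close>, which accounts for the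
  error.\<close>

lemma dilated_integral:
  fixes h \<eta> :: "real^'n \<Rightarrow> real" and l R L :: real
  defines "A \<equiv> {x::real^'n. R / 2 \<le> norm x \<and> norm x \<le> 2 * R}"
  assumes hm [measurable]: "h \<in> borel_measurable borel" and h: "\<And>x. 0 \<le> h x"
    and hint: "integrable lborel (\<lambda>x. indicator (cball 0 (2 * R)) x * h x)"
    and [measurable]: "\<eta> \<in> borel_measurable borel" and \<eta>: "\<And>x. 0 \<le> \<eta> x" "\<And>x. \<eta> x \<le> 1" "\<And>x. norm x \<ge> 2 * R \<Longrightarrow> \<eta> x = 0"
    and l: "l > 0" and L: "L \<ge> 0" "\<And>y. \<bar>\<eta> ((1 / l) *\<^sub>R y) - \<eta> y\<bar> \<le> L * indicator A y"
  shows "integrable lborel (\<lambda>x. \<eta> x * h x)" "integrable lborel (\<lambda>x. \<eta> x * h (l *\<^sub>R x))"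
    and "integrable lborel (\<lambda>x. indicator A x * h x)"
    and "\<bar>l ^ CARD('n) * (LINT x|lborel. \<eta> x * h (l *\<^sub>R x)) - (LINT x|lborel. \<eta> x * h x)\<bar> \<le> L * (LINT x|lborel. indicator A x * h x)"
proof -
  have [measurable]: "A \<in> sets borel" unfolding A_def by measurable
  show i1: "integrable lborel (\<lambda>x. \<eta> x * h x)"
  proof (rule Bochner_Integration.integrable_bound[OF hint])
    show "AE x in lborel. norm (\<eta> x * h x) \<le> norm (indicator (cball 0 (2 * R)) x * h x)"
    proof (rule AE_I2)
      fix x show "norm (\<eta> x * h x) \<le> norm (indicator (cball 0 (2 * R)) x * h x)"
        using \<eta>(1,2)[of x] \<eta>(3)[of x] h[of x] by (cases "norm x \<le> 2 * R") (auto simp: abs_mult mult_left_le_one_le)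
    qed
  qed measurable
  show i2: "integrable lborel (\<lambda>x. indicator A x * h x)"
    by (rule Bochner_Integration.integrable_bound[OF hint]) (auto simp: A_def indicator_def)
  let ?d = "\<lambda>y. (\<eta> ((1 / l) *\<^sub>R y) - \<eta> y) * h y"
  have db: "\<bar>?d y\<bar> \<le> L * (indicator A y * h y)" for y
    using mult_right_mono[OF L(2)[of y] h[of y]] h[of y] by (simp add: abs_mult mult.assoc)
  have i3: "integrable lborel ?d"
    by (rule Bochner_Integration.integrable_bound[OF integrable_mult_right[OF i2, of L]])
      (use db L(1) h in \<open>auto simp: abs_mult\<close>)
  have i4: "integrable lborel (\<lambda>y. \<eta> ((1 / l) *\<^sub>R y) * h y)"
    using Bochner_Integration.integrable_add[OF i3 i1] by (simp add: algebra_simps)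
  show "integrable lborel (\<lambda>x. \<eta> x * h (l *\<^sub>R x))"
    using integrable_dilate[OF i4, of l] l by simp
  have "(LINT y|lborel. \<eta> ((1 / l) *\<^sub>R y) * h y) = l ^ CARD('n) * (LINT x|lborel. \<eta> x * h (l *\<^sub>R x))"
    using integral_lborel_affine[of l "\<lambda>y. \<eta> ((1 / l) *\<^sub>R y) * h y" 0] l by simp
  then have "l ^ CARD('n) * (LINT x|lborel. \<eta> x * h (l *\<^sub>R x)) - (LINT x|lborel. \<eta> x * h x) = (LINT y|lborel. ?d y)"
    using Bochner_Integration.integral_diff[OF i4 i1] by (simp add: left_diff_distrib)
  also have "\<bar>\<dots>\<bar> \<le> (LINT y|lborel. L * (indicator A y * h y))"
    by (rule order_trans[OF integral_abs_bound]) (intro integral_mono integrable_abs i3 integrable_mult_right i2 db)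
  finally show "\<bar>l ^ CARD('n) * (LINT x|lborel. \<eta> x * h (l *\<^sub>R x)) - (LINT x|lborel. \<eta> x * h x)\<bar> \<le> L * (LINT x|lborel. indicator A x * h x)"
    by simp
qed

text \<open>For |y| < R/2 both arguments stay where zeta is 1, since 1/l <= 2; for |y| > 2R both lie
  where it is 0. On the annulus the mean value theorem applies.\<close>

lemma cutoff_dilation_close:
  fixes \<zeta> :: "real^'n \<Rightarrow> real"
  assumes \<zeta>: "smooth \<zeta>" "\<And>x. norm x \<le> 1 \<Longrightarrow> \<zeta> x = 1" "\<And>x. norm x \<ge> 2 \<Longrightarrow> \<zeta> x = 0"
    and B: "\<And>R x. R > 0 \<Longrightarrow> norm (grad (\<lambda>x. \<zeta> ((1 / R) *\<^sub>R x)) x) \<le> B / R" and R: "R > 0"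
    and l: "1/2 \<le> l" "l \<le> 1"
  shows "\<bar>\<zeta> ((1 / R) *\<^sub>R ((1 / l) *\<^sub>R y)) - \<zeta> ((1 / R) *\<^sub>R y)\<bar> \<le> 4 * B * (1 - l) * indicator {x. R / 2 \<le> norm x \<and> norm x \<le> 2 * R} y"
proof -
  have B0: "B \<ge> 0" using order_trans[OF norm_ge_zero B[of 1 0]] by simp
  have yl: "norm y \<le> norm y / l" using l mult_right_mono[of l 1 "norm y"] by (simp add: field_simps)
  consider "norm y < R / 2" | "norm y > 2 * R" | "R / 2 \<le> norm y" "norm y \<le> 2 * R" by linarith
  then show ?thesis
  proof cases
    case 1
    have "norm y / l \<le> norm y * 2" using l mult_right_mono[of 1 "l * 2" "norm y"] by (simp add: field_simps)
    then have "norm y / l \<le> R" using 1 by simp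
    then have "norm ((1 / R) *\<^sub>R ((1 / l) *\<^sub>R y)) \<le> 1" "norm ((1 / R) *\<^sub>R y) \<le> 1" using 1 R l by (auto simp: field_simps)
    then show ?thesis using \<zeta>(2) B0 l by simp
  next
    case 2
    then have "norm y / l \<ge> 2 * R" using yl by simp
    then have "norm ((1 / R) *\<^sub>R ((1 / l) *\<^sub>R y)) \<ge> 2" "norm ((1 / R) *\<^sub>R y) \<ge> 2" using 2 R l by (auto simp: field_simps)
    then show ?thesis using \<zeta>(3) B0 l by simp
  next
    case 3
    let ?\<eta> = "\<lambda>x. \<zeta> ((1 / R) *\<^sub>R x)" and ?h = "(1 / l - 1) *\<^sub>R y"
    have "?\<eta> differentiable (at z)" for z by (rule smooth_differentiable[OF smooth_scaled[OF \<zeta>(1)]])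
    from mvt_grad[OF this, of y ?h] obtain t where t: "?\<eta> (y + ?h) - ?\<eta> y = grad ?\<eta> (y + t *\<^sub>R ?h) \<bullet> ?h" by blast
    have yh: "y + ?h = (1 / l) *\<^sub>R y" by (simp add: algebra_simps)
    have l1: "1 / l - 1 \<le> 2 * (1 - l)" "0 \<le> 1 / l - 1"
    proof -
      have "1 / l - 1 = (1 - l) / l" using l by (simp add: field_simps)
      moreover have "(1 - l) / l \<le> (1 - l) / (1/2)" using l by (intro divide_left_mono) auto
      ultimately show "1 / l - 1 \<le> 2 * (1 - l)" by simp
      show "0 \<le> 1 / l - 1" using l by simp
    qed
    have "\<bar>?\<eta> ((1 / l) *\<^sub>R y) - ?\<eta> y\<bar> \<le> norm (grad ?\<eta> (y + t *\<^sub>R ?h)) * norm ?h"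
      using t unfolding yh by (simp only: Cauchy_Schwarz_ineq2)
    \<comment> \<open>Gradient at most B / R, relative shift 1/l - 1 <= 2 (1 - l), and |y| <= 2R:
      the radius cancels.\<close>
    also have "\<dots> \<le> (B / R) * (2 * (1 - l) * (2 * R))"
    proof (intro mult_mono B R)
      show "norm ?h \<le> 2 * (1 - l) * (2 * R)" using l1 3 l unfolding norm_scaleR by (intro mult_mono) auto
    qed (use B0 R in auto)
    also have "\<dots> = 4 * B * (1 - l)" using R by simp
    finally show ?thesis using 3 by simp
  qed
qed

text \<open>Only increments to the right are controlled, because t = 1 - l with l below 1; as
  \<open>g\<close> is differentiable, the quotients from the right already tend to \<open>d\<close>.
  The quadratic term disappears in the limit.\<close>

lemma deriv_le_of_increment_bound:
  fixes g :: "real \<Rightarrow> real"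
  assumes D: "(g has_real_derivative d) (at 0)" and \<delta>: "\<delta> > 0"
    and b: "\<And>t. 0 < t \<Longrightarrow> t \<le> \<delta> \<Longrightarrow> g t - g 0 \<le> D * t + K * t\<^sup>2"
  shows "d \<le> D"
proof (rule tendsto_le)
  have "((\<lambda>t. (g t - g 0) / t) \<longlongrightarrow> d) (at 0)" using D by (simp add: DERIV_def)
  then show "((\<lambda>t. (g t - g 0) / t) \<longlongrightarrow> d) (at_right 0)" by (rule filterlim_mono) (simp_all add: at_le)
  show "((\<lambda>t. D + K * t) \<longlongrightarrow> D) (at_right 0)" by (auto intro!: tendsto_eq_intros)
  show "eventually (\<lambda>t. (g t - g 0) / t \<le> D + K * t) (at_right 0)"
    unfolding eventually_at_right_field
  proof (intro exI[of _ \<delta>] conjI \<delta> allI impI)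
    fix t assume t: "0 < t" "t < \<delta>"
    have "(g t - g 0) / t \<le> (D * t + K * t\<^sup>2) / t" using b[of t] t by (intro divide_right_mono) auto
    also have "\<dots> = D + K * t" using t by (simp add: power2_eq_square field_simps)
    finally show "(g t - g 0) / t \<le> D + K * t" .
  qed
qed simp

context weak_solution
begin

lemma u_dilate_bounded:
  assumes "AE x in lborel. norm x \<le> r \<longrightarrow> \<bar>u x\<bar> \<le> C" "0 < l" "l \<le> 1"
  shows "AE x in lborel. norm x \<le> r \<longrightarrow> \<bar>u (l *\<^sub>R x)\<bar> \<le> C"
proof -
  have "norm (l *\<^sub>R x) \<le> r" if "norm x \<le> r" for x :: "real^'n"
    using that assms(2,3) mult_mono[of l 1 "norm x" r] by simp
  with AE_dilate[OF assms(1), of l] assms(2) show ?thesis by (auto elim: AE_mp)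
qed

text \<open>In the gradient of the test function, the part eta (l G(lx) - G(x)) is the increment in
  the tangent inequality at G(x), and homogeneity extracts l^p. The part with grad eta is only
  estimated, by the weighted difference quotient. The errors separate by order: 1 - l times an
  annular integral, and (1 - l)^2 times an integral over the whole ball.\<close>

lemma dilation_inequality:
  fixes l R B Ca CK K :: real and \<eta> :: "real^'n \<Rightarrow> real"
  defines "A \<equiv> {x::real^'n. R / 2 \<le> norm x \<and> norm x \<le> 2 * R}"
  assumes R: "R > 0" and \<eta>: "smooth \<eta>" "\<And>x. 0 \<le> \<eta> x" "\<And>x. \<eta> x \<le> 1" "\<And>x. norm x \<ge> 2 * R \<Longrightarrow> \<eta> x = 0"
      "\<And>x. norm x < R \<Longrightarrow> grad \<eta> x = 0" "\<And>x. norm (grad \<eta> x) \<le> B / R"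
    and l: "1/2 \<le> l" "l \<le> 1"
    and Ca: "Ca > 0" "\<And>\<xi>. norm (flux p H \<xi>) \<le> Ca * norm \<xi> powr (p - 1)"
    and CK: "AE x in lborel. norm x \<le> 2 * R \<longrightarrow> \<bar>u x\<bar> \<le> CK" "\<And>s. \<bar>s\<bar> \<le> CK \<Longrightarrow> \<bar>deriv f s\<bar> \<le> K" "K \<ge> 0"
    and ints: "integrable lborel (\<lambda>x. \<eta> x * F (u x))" "integrable lborel (\<lambda>x. \<eta> x * F (u (l *\<^sub>R x)))"
      "integrable lborel (\<lambda>x. \<eta> x * H (G x) powr p)" "integrable lborel (\<lambda>x. \<eta> x * H (G (l *\<^sub>R x)) powr p)"
      "integrable lborel (\<lambda>x. indicator A x * norm (G x) powr p)"
  shows "(LINT x|lborel. \<eta> x * F (u (l *\<^sub>R x))) - (LINT x|lborel. \<eta> x * F (u x)) \<le>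
      l powr p * ((LINT x|lborel. \<eta> x * H (G (l *\<^sub>R x)) powr p) / p) - (LINT x|lborel. \<eta> x * H (G x) powr p) / p
      + 2 * B * Ca * (2 ^ CARD('n) + 1) * (LINT x|lborel. indicator A x * norm (G x) powr p) * (1 - l)
      + K * (2 * R)\<^sup>2 * 2 ^ CARD('n) * (LINT x|lborel. indicator (cball 0 (2 * R)) x * (1 + norm (G x) powr p)) * (1 - l)\<^sup>2"
proof -
  have p0: "p > 0" "p \<ge> 1" using p2 by auto
  have l0: "l > 0" "l \<noteq> 0" using l by auto
  have B0: "B \<ge> 0" using order_trans[OF norm_ge_zero \<eta>(6)[of 0]] R by (simp add: zero_le_divide_iff)
  note cont = smooth_continuous_on[OF \<eta>(1), of UNIV] smooth_continuous_grad[OF \<eta>(1), of UNIV]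
  have [measurable]: "\<eta> \<in> borel_measurable borel" "grad \<eta> \<in> borel_measurable borel"
    by (intro borel_measurable_continuous_onI cont)+
  note DL = dilation_limits[OF R \<eta>(1,4) l]
  define A1 where "A1 = {x::real^'n. R \<le> norm x \<and> norm x \<le> 2 * R}"
  have [measurable]: "A \<in> sets borel" "A1 \<in> sets borel" "cball (0::real^'n) (2 * R) \<in> sets borel"
    unfolding A_def A1_def by measurable
  define EG where "EG = (LINT x|lborel. indicator A x * norm (G x) powr p)"
  define EB where "EB = (LINT x|lborel. indicator (cball 0 (2 * R)) x * (1 + norm (G x) powr p))"
  have EG0: "EG \<ge> 0" "EB \<ge> 0" unfolding EG_def EB_def by (auto intro!: integral_nonneg_AE)
  have nnA: "(\<integral>\<^sup>+x. ennreal (norm (G x) powr p) * indicator A x \<partial>lborel) = ennreal EG"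
  proof -
    have "(\<integral>\<^sup>+x. ennreal (norm (G x) powr p) * indicator A x \<partial>lborel) = (\<integral>\<^sup>+x. ennreal (indicator A x * norm (G x) powr p) \<partial>lborel)"
      by (intro nn_integral_cong) (auto simp: indicator_def)
    also have "\<dots> = ennreal EG" unfolding EG_def by (rule nn_integral_eq_integral[OF ints(5)]) auto
    finally show ?thesis .
  qed
  have nnA1: "(\<integral>\<^sup>+x. ennreal (norm (G x) powr p) * indicator A1 x \<partial>lborel) \<le> ennreal EG"
    unfolding nnA[symmetric] by (intro nn_integral_mono) (use R in \<open>auto simp: A_def A1_def indicator_def\<close>)
  have nnB: "(\<integral>\<^sup>+x. ennreal (1 + norm (G x) powr p) * indicator (cball 0 (2 * R)) x \<partial>lborel) = ennreal EB"
  proof -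
    have i: "integrable lborel (\<lambda>x. indicator (cball 0 (2 * R)) x * (1 + norm (G x) powr p))"
      using dom_integrable[of "\<lambda>_. 0" 1 "2 * R"] by simp
    have "(\<integral>\<^sup>+x. ennreal (1 + norm (G x) powr p) * indicator (cball 0 (2 * R)) x \<partial>lborel) = (\<integral>\<^sup>+x. ennreal (indicator (cball 0 (2 * R)) x * (1 + norm (G x) powr p)) \<partial>lborel)"
      by (intro nn_integral_cong) (auto simp: indicator_def)
    also have "\<dots> = ennreal EB" unfolding EB_def by (rule nn_integral_eq_integral[OF i]) auto
    finally show ?thesis .
  qed
  let ?w = "\<lambda>x. indicator A1 x * (\<bar>u x - u (l *\<^sub>R x)\<bar> * norm (G x) powr (p - 1))"
  let ?s = "\<lambda>x. indicator (cball 0 (2 * R)) x * (u x - u (l *\<^sub>R x))\<^sup>2"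
  \<comment> \<open>\<open>W\<close> bounds the weighted difference quotient next to grad eta,
    \<open>S\<close> the squared one in the Taylor remainder.\<close>
  define W where "W = 2 * R * (1 - l) * ((2 ^ CARD('n) + 1) * EG)"
  define S where "S = (2 * R)\<^sup>2 * (1 - l)\<^sup>2 * (2 ^ CARD('n) * EB)"
  have WS0: "W \<ge> 0" "S \<ge> 0" using EG0 R l by (auto simp: W_def S_def)
  have p2n: "(2::ennreal) ^ CARD('n) = ennreal (2 ^ CARD('n))" by (simp add: ennreal_power[symmetric])
  have wn: "(\<integral>\<^sup>+x. ennreal (?w x) \<partial>lborel) \<le> ennreal W"
  proof -
    have "(\<integral>\<^sup>+x. ennreal (?w x) \<partial>lborel) = (\<integral>\<^sup>+x. ennreal (\<bar>u x - u (l *\<^sub>R x)\<bar> * norm (G x) powr (p - 1)) * indicator A1 x \<partial>lborel)"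
      by (intro nn_integral_cong) (auto simp: indicator_def)
    also have "\<dots> \<le> ennreal (2 * R * (1 - l)) * (2 ^ CARD('n) * ennreal EG + ennreal EG)"
    proof (rule order_trans[OF DL(4)[folded A_def A1_def]])
      show "ennreal (2 * R * (1 - l)) * (2 ^ CARD('n) * (\<integral>\<^sup>+x. ennreal (norm (G x) powr p) * indicator A x \<partial>lborel)
          + (\<integral>\<^sup>+x. ennreal (norm (G x) powr p) * indicator A1 x \<partial>lborel))
        \<le> ennreal (2 * R * (1 - l)) * (2 ^ CARD('n) * ennreal EG + ennreal EG)"
        unfolding nnA by (intro mult_left_mono add_mono order_refl nnA1) simp
    qed
    also have "\<dots> = ennreal W"
      unfolding p2n using EG0 R l by (simp add: W_def ennreal_mult[symmetric] ennreal_plus[symmetric] algebra_simps del: ennreal_plus)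
    finally show ?thesis .
  qed
  have sn: "(\<integral>\<^sup>+x. ennreal (?s x) \<partial>lborel) \<le> ennreal S"
  proof -
    have "(\<integral>\<^sup>+x. ennreal (?s x) \<partial>lborel) = (\<integral>\<^sup>+x. ennreal ((u x - u (l *\<^sub>R x))\<^sup>2) * indicator (cball 0 (2 * R)) x \<partial>lborel)"
      by (intro nn_integral_cong) (auto simp: indicator_def)
    also have "\<dots> \<le> ennreal ((2 * R)\<^sup>2 * (1 - l)\<^sup>2) * (2 ^ CARD('n) * ennreal EB)"
      by (rule DL(5)[unfolded nnB])
    also have "\<dots> = ennreal S"
      unfolding p2n S_def using EG0 by (simp add: ennreal_mult[symmetric])
    finally show ?thesis .
  qed
  have wi: "integrable lborel ?w" and si: "integrable lborel ?s"
    using le_less_trans[OF wn] le_less_trans[OF sn] by (auto intro!: integrableI_nonneg)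
  have wW: "(LINT x|lborel. ?w x) \<le> W" and sS: "(LINT x|lborel. ?s x) \<le> S"
    using wn sn nn_integral_eq_integral[OF wi] nn_integral_eq_integral[OF si] WS0 by (auto simp: ennreal_le_iff)
  let ?q = "\<lambda>x. (u (l *\<^sub>R x) - u x) *\<^sub>R grad \<eta> x + \<eta> x *\<^sub>R (l *\<^sub>R G (l *\<^sub>R x) - G x)"
  let ?E = "LINT x|lborel. flux p H (G x) \<bullet> ?q x"
  let ?L = "\<lambda>x. l powr p / p * (\<eta> x * H (G (l *\<^sub>R x)) powr p) - 1 / p * (\<eta> x * H (G x) powr p)"
  have "?E \<le> (LINT x|lborel. Ca * (B / R) * ?w x + ?L x)"
  proof (intro integral_mono DL(2))
    show "integrable lborel (\<lambda>x. Ca * (B / R) * ?w x + ?L x)"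
      by (intro Bochner_Integration.integrable_add Bochner_Integration.integrable_diff integrable_mult_right wi ints)
    fix x :: "real^'n"
    have 1: "flux p H (G x) \<bullet> ((u (l *\<^sub>R x) - u x) *\<^sub>R grad \<eta> x) \<le> Ca * (B / R) * ?w x"
    proof (cases "x \<in> A1")
      case True
      have "flux p H (G x) \<bullet> ((u (l *\<^sub>R x) - u x) *\<^sub>R grad \<eta> x) \<le> norm (flux p H (G x)) * norm ((u (l *\<^sub>R x) - u x) *\<^sub>R grad \<eta> x)"
        by (rule norm_cauchy_schwarz)
      also have "\<dots> \<le> (Ca * norm (G x) powr (p - 1)) * (\<bar>u x - u (l *\<^sub>R x)\<bar> * (B / R))"
        unfolding norm_scaleR by (intro mult_mono Ca \<eta>) (use Ca in auto)
      finally show ?thesis using True by (simp add: mult_ac)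
    next
      case False
      then have "grad \<eta> x = 0"
        using \<eta>(5)[of x] partial_eq_0_outside(2)[of "2 * R" \<eta> x] \<eta>(4) by (force simp: A1_def)
      then show ?thesis using False by simp
    qed
    have "flux p H (G x) \<bullet> (l *\<^sub>R G (l *\<^sub>R x) - G x) \<le> l powr p / p * H (G (l *\<^sub>R x)) powr p - 1 / p * H (G x) powr p"
      using flux_tangent[OF n2 H p0(2), of "G x" "l *\<^sub>R G (l *\<^sub>R x)"] Hp_scale[OF H p0(1) l0(1)] by simp
    from mult_left_mono[OF this \<eta>(2)[of x]]
    have 2: "flux p H (G x) \<bullet> (\<eta> x *\<^sub>R (l *\<^sub>R G (l *\<^sub>R x) - G x)) \<le> ?L x" by (simp add: algebra_simps)
    show "flux p H (G x) \<bullet> ?q x \<le> Ca * (B / R) * ?w x + ?L x"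
      unfolding inner_add_right using 1 2 by (rule add_mono)
  qed
  also have "\<dots> = Ca * (B / R) * (LINT x|lborel. ?w x) + (LINT x|lborel. ?L x)"
    by (subst Bochner_Integration.integral_add) (auto intro!: Bochner_Integration.integrable_diff integrable_mult_right wi ints)
  also have "(LINT x|lborel. ?L x) = l powr p * ((LINT x|lborel. \<eta> x * H (G (l *\<^sub>R x)) powr p) / p) - (LINT x|lborel. \<eta> x * H (G x) powr p) / p"
    by (subst Bochner_Integration.integral_diff) (auto intro!: integrable_mult_right ints)
  also have "Ca * (B / R) * (LINT x|lborel. ?w x) \<le> Ca * (B / R) * W"
    using Ca B0 R by (intro mult_left_mono wW) auto
  also have "Ca * (B / R) * W = 2 * B * Ca * (2 ^ CARD('n) + 1) * EG * (1 - l)"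
    using R by (simp add: W_def field_simps)
  finally have E1: "?E \<le> 2 * B * Ca * (2 ^ CARD('n) + 1) * EG * (1 - l) +
      (l powr p * ((LINT x|lborel. \<eta> x * H (G (l *\<^sub>R x)) powr p) / p) - (LINT x|lborel. \<eta> x * H (G x) powr p) / p)" by simp
  have "(LINT x|lborel. \<eta> x * F (u (l *\<^sub>R x)) - \<eta> x * F (u x)) \<le> (LINT x|lborel. f (u x) * (\<eta> x * (u (l *\<^sub>R x) - u x)) + K * ?s x)"
  proof (intro integral_mono_AE Bochner_Integration.integrable_add Bochner_Integration.integrable_diff integrable_mult_right si ints DL(3))
    show "AE x in lborel. \<eta> x * F (u (l *\<^sub>R x)) - \<eta> x * F (u x) \<le> f (u x) * (\<eta> x * (u (l *\<^sub>R x) - u x)) + K * ?s x"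
      using CK(1) u_dilate_bounded[OF CK(1) l0(1) l(2)]
    proof eventually_elim
      case (elim x)
      show ?case
      proof (cases "norm x \<le> 2 * R")
        case True
        have "F (u (l *\<^sub>R x)) - F (u x) \<le> f (u x) * (u (l *\<^sub>R x) - u x) + K * (u (l *\<^sub>R x) - u x)\<^sup>2"
          by (rule quadratic_remainder[OF F_deriv f_deriv CK(2)]) (use elim True in auto)
        from mult_left_mono[OF this \<eta>(2)[of x]]
        have "\<eta> x * F (u (l *\<^sub>R x)) - \<eta> x * F (u x) \<le> f (u x) * (\<eta> x * (u (l *\<^sub>R x) - u x)) + \<eta> x * (K * (u (l *\<^sub>R x) - u x)\<^sup>2)"
          by (simp add: algebra_simps)
        also have "\<eta> x * (K * (u (l *\<^sub>R x) - u x)\<^sup>2) \<le> K * (u (l *\<^sub>R x) - u x)\<^sup>2"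
          using \<eta>(2,3)[of x] CK(3) by (intro mult_left_le_one_le) auto
        finally show ?thesis using True by (simp add: power2_commute)
      qed (use \<eta>(4)[of x] in simp)
    qed
  qed
  also have "\<dots> = ?E + K * (LINT x|lborel. ?s x)"
  proof -
    have "?E = (LINT x|lborel. f (u x) * (\<eta> x * (u (l *\<^sub>R x) - u x)))" by (rule DL(1))
    moreover have "integrable lborel (\<lambda>x. f (u x) * (\<eta> x * (u (l *\<^sub>R x) - u x)))" by (rule DL(3))
    ultimately show ?thesis by (subst Bochner_Integration.integral_add) (auto intro!: integrable_mult_right si)
  qed
  also have "\<dots> \<le> ?E + K * S" using sS CK(3) by (intro add_left_mono mult_left_mono)
  also have "K * S = K * (2 * R)\<^sup>2 * 2 ^ CARD('n) * EB * (1 - l)\<^sup>2" by (simp add: S_def mult_ac)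
  finally have "(LINT x|lborel. \<eta> x * F (u (l *\<^sub>R x)) - \<eta> x * F (u x)) \<le> ?E + K * (2 * R)\<^sup>2 * 2 ^ CARD('n) * EB * (1 - l)\<^sup>2" .
  then show ?thesis using E1 Bochner_Integration.integral_diff[OF ints(2,1)] unfolding EG_def EB_def by linarith
qed

lemma potential_integrable: "integrable lborel (\<lambda>x. indicator (cball 0 R) x * F (u x))"
proof -
  obtain C where C: "AE x in lborel. norm x \<le> R \<longrightarrow> \<bar>F (u x)\<bar> \<le> C"
    using locally_bounded_comp[OF F_cont] by blast
  have "integrable lborel (\<lambda>x. indicator (cball 0 R) x *\<^sub>R F (u x))"
    by (rule integrableI_bounded_set_indicator[where B = C]) (use C in \<open>auto simp: cball_finite\<close>)
  then show ?thesis by simp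
qed

text \<open>Put l = 1 - t. By a change of variables the integrals with dilated arguments are l^(-n)
  times the undilated ones, up to errors of order t on the annulus. The dilation inequality thus
  bounds the increments of an explicit function of t, and its derivative at 0 produces the factors n
  and n - p.\<close>

lemma pohozaev_inequality:
  fixes \<zeta> :: "real^'n \<Rightarrow> real"
  assumes Fnn: "\<And>s. 0 \<le> F s"
    and \<zeta>: "smooth \<zeta>" "\<And>x. 0 \<le> \<zeta> x" "\<And>x. \<zeta> x \<le> 1" "\<And>x. norm x \<le> 1 \<Longrightarrow> \<zeta> x = 1" "\<And>x. norm x \<ge> 2 \<Longrightarrow> \<zeta> x = 0"
    and B: "B > 0" "\<And>R x. R > 0 \<Longrightarrow> norm (grad (\<lambda>x. \<zeta> ((1 / R) *\<^sub>R x)) x) \<le> B / R"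
    and vanish: "\<And>R x. R > 0 \<Longrightarrow> norm x < R \<Longrightarrow> grad (\<lambda>x. \<zeta> ((1 / R) *\<^sub>R x)) x = 0"
  obtains C where "C \<ge> 0" "\<And>R. R > 0 \<Longrightarrow>
    real CARD('n) * (LINT x|lborel. \<zeta> ((1 / R) *\<^sub>R x) * F (u x)) \<le>
      (real CARD('n) - p) / p * (LINT x|lborel. \<zeta> ((1 / R) *\<^sub>R x) * H (G x) powr p)
      + C * (LINT x|lborel. indicator {x. R / 2 \<le> norm x \<and> norm x \<le> 2 * R} x * (norm (G x) powr p + F (u x)))"
proof -
  let ?n = "CARD('n)"
  have p0: "p > 0" "p \<ge> 1" using p2 by auto
  obtain Ca where Ca: "Ca > 0" "\<And>\<xi>. norm (flux p H \<xi>) \<le> Ca * norm \<xi> powr (p - 1)"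
    using flux_bound[OF H p0(1)] by blast
  obtain cH CH where CH: "cH > 0" "CH > 0" "\<And>\<xi>. cH * norm \<xi> powr p \<le> H \<xi> powr p" "\<And>\<xi>. H \<xi> powr p \<le> CH * norm \<xi> powr p"
    using Hp_bounds[OF H p0(1)] by blast
  \<comment> \<open>\<open>D0\<close> comes from the term with grad eta in
    \<open>dilation_inequality\<close>; \<open>D1\<close> is the Jacobian bound 2^n times the
    constant 4 B of \<open>cutoff_dilation_close\<close>.\<close>
  define D0 where "D0 = 2 * B * Ca * (2 ^ ?n + 1)"
  define D1 where "D1 = 2 ^ ?n * (4 * B)"
  have D: "D0 \<ge> 0" "D1 \<ge> 0" using B Ca by (auto simp: D0_def D1_def)
  show ?thesis
  proof (rule that[of "D1 * (1 + CH) + D0"])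
    show "0 \<le> D1 * (1 + CH) + D0" using D CH by simp
    fix R :: real assume R: "R > 0"
    define A where "A = {x::real^'n. R / 2 \<le> norm x \<and> norm x \<le> 2 * R}"
    have [measurable]: "A \<in> sets borel" "cball (0::real^'n) (2 * R) \<in> sets borel" unfolding A_def by measurable
    define \<eta> where "\<eta> x = \<zeta> ((1 / R) *\<^sub>R x)" for x
    have \<eta>: "smooth \<eta>" "\<And>x. 0 \<le> \<eta> x" "\<And>x. \<eta> x \<le> 1" "\<And>x. norm x \<ge> 2 * R \<Longrightarrow> \<eta> x = 0"
      "\<And>x. norm x < R \<Longrightarrow> grad \<eta> x = 0" "\<And>x. norm (grad \<eta> x) \<le> B / R"
      unfolding \<eta>_def[abs_def] using smooth_scaled[OF \<zeta>(1)] \<zeta>(2,3,5) R vanish[OF R] B(2)[OF R] by (auto simp: field_simps)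
    have [measurable]: "\<eta> \<in> borel_measurable borel"
      by (intro borel_measurable_continuous_onI smooth_continuous_on \<eta>)
    obtain CK where CK: "CK \<ge> 0" "AE x in lborel. norm x \<le> 2 * R \<longrightarrow> \<bar>u x\<bar> \<le> CK" using bounded_on_ball by blast
    have "compact (deriv f ` {-CK..CK})" using f'_cont by (intro compact_continuous_image) (auto intro: continuous_on_subset)
    from bounded_pos[THEN iffD1, OF compact_imp_bounded[OF this]]
    obtain K where "K > 0" "\<forall>z\<in>deriv f ` {-CK..CK}. norm z \<le> K" by blast
    then have K: "K \<ge> 0" "\<And>s. \<bar>s\<bar> \<le> CK \<Longrightarrow> \<bar>deriv f s\<bar> \<le> K" by (auto simp: abs_le_iff)
    let ?hF = "\<lambda>x. F (u x)" and ?hL = "\<lambda>x. H (G x) powr p"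
    have hFi: "integrable lborel (\<lambda>x. indicator (cball 0 (2 * R)) x * F (u x))" by (rule potential_integrable)
    have hGi: "integrable lborel (\<lambda>x. indicator (cball 0 (2 * R)) x * norm (G x) powr p)" by (rule energy_density_integrable)
    have hLi: "integrable lborel (\<lambda>x. indicator (cball 0 (2 * R)) x * H (G x) powr p)"
      by (rule Bochner_Integration.integrable_bound[OF integrable_mult_right[OF hGi, of CH]])
        (use CH in \<open>auto simp: indicator_def\<close>)
    have gi: "integrable lborel (\<lambda>x. indicator A x * norm (G x) powr p)"
      by (rule Bochner_Integration.integrable_bound[OF hGi]) (auto simp: A_def indicator_def)
    define IF where "IF = (LINT x|lborel. \<eta> x * F (u x))"
    define IL where "IL = (LINT x|lborel. \<eta> x * H (G x) powr p)"
    define EF where "EF = (LINT x|lborel. indicator A x * F (u x))"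
    define EL where "EL = (LINT x|lborel. indicator A x * H (G x) powr p)"
    define EG where "EG = (LINT x|lborel. indicator A x * norm (G x) powr p)"
    have E0: "EF \<ge> 0" "EL \<ge> 0" "EG \<ge> 0" unfolding EF_def EL_def EG_def using Fnn by (auto intro!: integral_nonneg_AE)
    \<comment> \<open>Depends on R through the bound \<open>K\<close> for f' and through the ball,
      but it multiplies t^2 and disappears in the derivative at t = 0, before R grows.\<close>
    define c2 where "c2 = K * (2 * R)\<^sup>2 * 2 ^ ?n * (LINT x|lborel. indicator (cball 0 (2 * R)) x * (1 + norm (G x) powr p))"
    \<comment> \<open>The undilated integrals with the weights l^(-n) and l^p l^(-n) / p that
      dilation would give them without cutoff errors; the derivative at 0 is n IF + (p - n) IL /
      p.\<close>
    define g where "g t = (1 - t) powr (- real ?n) * IF - (1 - t) powr (p - real ?n) * (IL / p)" for t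
    have close: "\<bar>\<eta> ((1 / (1 - t)) *\<^sub>R y) - \<eta> y\<bar> \<le> 4 * B * t * indicator A y" if "0 < t" "t \<le> 1 / 2" for t y
      using cutoff_dilation_close[OF \<zeta>(1,4,5) B(2) R, of "1 - t" y] that unfolding \<eta>_def A_def by simp
    note d_F = dilated_integral[where \<eta> = \<eta> and h = "\<lambda>x. F (u x)" and R = R, folded A_def, OF _ _ hFi]
    note d_L = dilated_integral[where \<eta> = \<eta> and h = "\<lambda>x. H (G x) powr p" and R = R, folded A_def, OF _ _ hLi]
    have incr: "g t - g 0 \<le> (D1 * (EF + EL / p) + D0 * EG) * t + c2 * t\<^sup>2" if t: "0 < t" "t \<le> 1 / 2" for t
    proof -
      let ?l = "1 - t"
      have l: "1/2 \<le> ?l" "?l \<le> 1" "?l > 0" using t by auto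
      have L0: "4 * B * t \<ge> 0" using B t by simp
      define JF where "JF = (LINT x|lborel. \<eta> x * F (u (?l *\<^sub>R x)))"
      define JL where "JL = (LINT x|lborel. \<eta> x * H (G (?l *\<^sub>R x)) powr p)"
      have F1: "integrable lborel (\<lambda>x. \<eta> x * F (u x))" "integrable lborel (\<lambda>x. \<eta> x * F (u (?l *\<^sub>R x)))"
        "\<bar>?l ^ ?n * JF - IF\<bar> \<le> 4 * B * t * EF"
        unfolding JF_def IF_def EF_def
        by ((rule d_F[OF _ _ _ _ _ _ l(3) L0 close[OF t]]; (rule Fnn \<eta>(2,3) | (rule \<eta>(4), assumption) | measurable)))+
      have L1: "integrable lborel (\<lambda>x. \<eta> x * H (G x) powr p)" "integrable lborel (\<lambda>x. \<eta> x * H (G (?l *\<^sub>R x)) powr p)"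
        "\<bar>?l ^ ?n * JL - IL\<bar> \<le> 4 * B * t * EL"
        unfolding JL_def IL_def EL_def
        by ((rule d_L[OF _ _ _ _ _ _ l(3) L0 close[OF t]]; (rule powr_ge_zero \<eta>(2,3) | (rule \<eta>(4), assumption) | measurable)))+
      have ineq: "JF - IF \<le> ?l powr p * (JL / p) - IL / p + D0 * EG * t + c2 * t\<^sup>2"
        using dilation_inequality[OF R \<eta> l(1,2) Ca CK(2) K(2,1), folded A_def, OF _ _ _ F1(1,2) L1(1,2) gi]
        unfolding JF_def IF_def JL_def IL_def D0_def EG_def c2_def by simp
      \<comment> \<open>The inverse Jacobian l^(-n), at most 2^n because l >= 1/2.\<close>
      define a where "a = ?l powr (- real ?n)"
      have a: "a > 0" "a * ?l ^ ?n = 1" "a \<le> 2 ^ ?n"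
      proof -
        show "a > 0" using l by (simp add: a_def)
        show eq: "a * ?l ^ ?n = 1" using l by (simp add: a_def powr_minus powr_realpow)
        have "(1 / 2) ^ ?n \<le> ?l ^ ?n" using l by (intro power_mono) auto
        then have "a * (1 / 2) ^ ?n \<le> 1" using eq \<open>a > 0\<close> mult_left_mono[of "(1 / 2) ^ ?n" "?l ^ ?n" a] by simp
        then show "a \<le> 2 ^ ?n" by (simp add: power_one_over field_simps)
      qed
      have lp: "0 \<le> ?l powr p" "?l powr p \<le> 1" using l p0 by (auto intro!: powr_le1)
      have "IF - 4 * B * t * EF \<le> ?l ^ ?n * JF" using F1(3) by linarith
      from mult_left_mono[OF this, of a] a have 1: "a * IF - a * (4 * B * t * EF) \<le> JF"
        by (simp add: right_diff_distrib mult.assoc[symmetric])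
      have "?l ^ ?n * JL \<le> IL + 4 * B * t * EL" using L1(3) by linarith
      from mult_left_mono[OF this, of a] a have 2: "JL \<le> a * IL + a * (4 * B * t * EL)"
        by (simp add: distrib_left mult.assoc[symmetric])
      have 3: "a * (4 * B * t * EF) \<le> D1 * EF * t" "a * (4 * B * t * EL) \<le> D1 * EL * t"
        using mult_right_mono[OF a(3), of "4 * B * t * EF"] mult_right_mono[OF a(3), of "4 * B * t * EL"] B t E0
        by (simp_all add: D1_def mult_ac)
      have "?l powr p * JL \<le> ?l powr p * (a * IL) + ?l powr p * (a * (4 * B * t * EL))"
        using mult_left_mono[OF 2 lp(1)] by (simp add: distrib_left)
      also have "?l powr p * (a * (4 * B * t * EL)) \<le> a * (4 * B * t * EL)"
        using lp a B t E0 by (intro mult_left_le_one_le) auto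
      finally have "?l powr p * JL \<le> ?l powr p * (a * IL) + D1 * EL * t" using 3(2) by linarith
      then have 4: "?l powr p * (JL / p) \<le> ?l powr p * a * (IL / p) + D1 * (EL / p) * t"
        using p0 by (simp add: field_simps)
      have "?l powr (p - real ?n) = ?l powr p * a" by (simp add: a_def powr_diff powr_minus divide_inverse)
      then have "g t - g 0 = a * IF - ?l powr p * a * (IL / p) - IF + IL / p" by (simp add: g_def a_def)
      also have "\<dots> \<le> D1 * EF * t + D1 * (EL / p) * t + D0 * EG * t + c2 * t\<^sup>2"
        using 1 3(1) 4 ineq by linarith
      finally show ?thesis by (simp add: algebra_simps)
    qed
    have deriv: "(g has_real_derivative (real ?n * IF + (p - real ?n) * (IL / p))) (at 0)"
      unfolding g_def using p0 by (auto intro!: derivative_eq_intros simp: field_simps)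
    have "real ?n * IF + (p - real ?n) * (IL / p) \<le> D1 * (EF + EL / p) + D0 * EG"
      by (rule deriv_le_of_increment_bound[OF deriv, where \<delta> = "1 / 2"]) (simp, rule incr)
    also have "\<dots> \<le> (D1 * (1 + CH) + D0) * (EG + EF)"
    proof -
      have "EL \<le> (LINT x|lborel. CH * (indicator A x * norm (G x) powr p))"
        unfolding EL_def
      proof (intro integral_mono integrable_mult_right gi)
        show "integrable lborel (\<lambda>x. indicator A x * H (G x) powr p)"
          by (rule Bochner_Integration.integrable_bound[OF hLi]) (auto simp: A_def indicator_def)
        show "indicator A x * H (G x) powr p \<le> CH * (indicator A x * norm (G x) powr p)" for x
          using CH(4)[of "G x"] by (simp add: indicator_def)
      qed
      then have "EL \<le> CH * EG" by (simp add: EG_def)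
      then have "EL / p \<le> CH * EG" using divide_left_mono[of 1 p EL] p0 E0 by simp
      then have "D1 * (EF + EL / p) \<le> D1 * (EF + CH * EG)" using D by (intro mult_left_mono) auto
      also have "\<dots> \<le> D1 * ((1 + CH) * (EG + EF))" using D E0 CH by (intro mult_left_mono) (auto simp: algebra_simps)
      finally have "D1 * (EF + EL / p) \<le> D1 * ((1 + CH) * (EG + EF))" .
      moreover have "D0 * EG \<le> D0 * (EG + EF)" using D E0 by (intro mult_left_mono) auto
      ultimately show ?thesis by (simp add: algebra_simps)
    qed
    also have "EG + EF = (LINT x|lborel. indicator A x * (norm (G x) powr p + F (u x)))"
    proof -
      have "integrable lborel (\<lambda>x. indicator A x * F (u x))"
        by (rule Bochner_Integration.integrable_bound[OF hFi]) (auto simp: A_def indicator_def)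
      then show ?thesis unfolding EG_def EF_def using gi by (simp add: distrib_left)
    qed
    finally have "real ?n * IF \<le> (real ?n - p) / p * IL + (D1 * (1 + CH) + D0) * (LINT x|lborel. indicator A x * (norm (G x) powr p + F (u x)))"
      using p0 by (simp add: field_simps)
    then show "real ?n * (LINT x|lborel. \<zeta> ((1 / R) *\<^sub>R x) * F (u x)) \<le>
      (real ?n - p) / p * (LINT x|lborel. \<zeta> ((1 / R) *\<^sub>R x) * H (G x) powr p)
      + (D1 * (1 + CH) + D0) * (LINT x|lborel. indicator {x. R / 2 \<le> norm x \<and> norm x \<le> 2 * R} x * (norm (G x) powr p + F (u x)))"
      unfolding IF_def IL_def \<eta>_def A_def .
  qed
qed

end

section \<open>The Liouville theorem\<close>

lemma grad_cutoff_vanishes: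
  fixes \<zeta> :: "real^'n \<Rightarrow> real"
  assumes "\<And>x. norm x \<le> 1 \<Longrightarrow> \<zeta> x = 1" "R > 0" "norm x < R"
  shows "grad (\<lambda>x. \<zeta> ((1 / R) *\<^sub>R x)) x = 0"
proof (rule grad_eqI(1))
  have o: "open (ball (0::real^'n) R)" "x \<in> ball 0 R" using assms by auto
  have "((\<lambda>x. \<zeta> ((1 / R) *\<^sub>R x)) has_derivative (\<lambda>_. 0)) (at x)"
    by (rule has_derivative_transform_within_open[OF has_derivative_const[of 1] o]) (use assms in \<open>auto simp: field_simps\<close>)
  moreover have "(\<lambda>_. 0) = (\<bullet>) (0::real^'n)" by auto
  ultimately show "((\<lambda>x. \<zeta> ((1 / R) *\<^sub>R x)) has_derivative (\<bullet>) 0) (at x)" by (simp only:)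
qed

context weak_solution
begin

text \<open>For R >= r the cutoff is 1 on the ball of radius r, so the integral of F(u) over this
  fixed ball is at most e(R), which tends to 0; and F vanishes only at 0.\<close>

lemma vanishes_of_potential_decay:
  fixes \<zeta> :: "real^'n \<Rightarrow> real"
  assumes F: "\<And>s. 0 \<le> F s" "\<And>s. s \<noteq> 0 \<Longrightarrow> 0 < F s"
    and \<zeta>: "smooth \<zeta>" "\<And>x. 0 \<le> \<zeta> x" "\<And>x. norm x \<le> 1 \<Longrightarrow> \<zeta> x = 1" "\<And>x. norm x \<ge> 2 \<Longrightarrow> \<zeta> x = 0"
    and decay: "\<And>R. R \<ge> R1 \<Longrightarrow> (LINT x|lborel. \<zeta> ((1 / R) *\<^sub>R x) * F (u x)) \<le> e R" and e: "(e \<longlongrightarrow> 0) at_top"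
    and int: "\<And>R. R > 0 \<Longrightarrow> integrable lborel (\<lambda>x. \<zeta> ((1 / R) *\<^sub>R x) * F (u x))"
  shows "AE x in lborel. u x = 0"
proof -
  have ball: "AE x in lborel. norm x \<le> r \<longrightarrow> u x = 0" for r
  proof -
    let ?g = "\<lambda>x. indicator (cball 0 r) x * F (u x)"
    have nn: "0 \<le> (LINT x|lborel. ?g x)" using F(1) by (auto intro!: integral_nonneg_AE)
    have "(LINT x|lborel. ?g x) \<le> e R" if R: "R \<ge> max (max R1 r) 1" for R
    proof -
      have "(LINT x|lborel. ?g x) \<le> (LINT x|lborel. \<zeta> ((1 / R) *\<^sub>R x) * F (u x))"
      proof (intro integral_mono potential_integrable int)
        show "?g x \<le> \<zeta> ((1 / R) *\<^sub>R x) * F (u x)" for x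
        proof (cases "norm x \<le> r")
          case True
          then have "\<zeta> ((1 / R) *\<^sub>R x) = 1" using R by (intro \<zeta>(3)) (auto simp: field_simps)
          then show ?thesis using True by simp
        qed (use \<zeta>(2) F(1) in simp)
      qed (use R in auto)
      then show ?thesis using decay[of R] R by simp
    qed
    then have "eventually (\<lambda>R. (LINT x|lborel. ?g x) \<le> e R) at_top"
      unfolding eventually_at_top_linorder by blast
    then have "(LINT x|lborel. ?g x) \<le> 0"
      by (intro tendsto_lowerbound[OF e]) auto
    then have "(LINT x|lborel. ?g x) = 0" using nn by simp
    then have "AE x in lborel. ?g x = 0"
      using integral_nonneg_eq_0_iff_AE[OF potential_integrable[of r]] F(1) by simp
    then show ?thesis
      by eventually_elim (metis F(2) indicator_simps(1) less_irrefl mem_cball_0 mult_1)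
  qed
  have "AE x in lborel. \<forall>k::nat. norm x \<le> real k \<longrightarrow> u x = 0"
    unfolding AE_all_countable using ball by blast
  then show ?thesis by eventually_elim (use real_arch_simple in blast)
qed

text \<open>All integrals keep the cutoff, so integrability of the energy on the whole space is
  never at issue: with X, P and IF the cutoff integrals of u f(u), H(G)^p and F(u), the energy
  identity and the Pohozaev inequality hold up to errors of order R^(n - \<theta>b). For p < n they
  combine to n / (\<beta> + 1) X <= n IF <= (n - p) / p X + error, hence a bound on X, which
  dominates IF. For p >= n the term with P has a nonpositive coefficient and is dropped.\<close>

lemma liouville:
  fixes R0 \<alpha> \<beta> m c :: real
  assumes stab: "\<And>\<phi>. \<phi> \<in> Cc_infinity \<Longrightarrow> (\<And>x. norm x \<le> R0 \<Longrightarrow> \<phi> x = 0) \<Longrightarrow>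
        (LINT x|lborel. deriv f (u x) * \<phi> x * \<phi> x) \<le> (LINT x|lborel. hform p H A0 (G x) (grad \<phi> x) (grad \<phi> x))"
    and pos: "\<And>s. s \<noteq> 0 \<Longrightarrow> s * f s > 0" and F0: "F 0 = 0" and low: "\<And>s. \<alpha> * (s * f s) \<le> s\<^sup>2 * deriv f s"
    and \<alpha>: "p - 1 < \<alpha>" "\<alpha> \<le> \<beta>" and c: "c > 0"
    and lo: "\<And>s. \<bar>s\<bar> \<ge> m \<Longrightarrow> c * \<bar>s\<bar> powr (\<alpha> + 1) \<le> s * f s"
      "\<And>s. \<bar>s\<bar> \<le> m \<Longrightarrow> c * \<bar>s\<bar> powr (\<beta> + 1) \<le> s * f s"
    and \<theta>: "real CARD('n) < p * (\<beta> + 1) / (\<beta> + 1 - p)"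
    and up: "p \<ge> real CARD('n) \<or> (real CARD('n) - p) / p < real CARD('n) / (\<beta> + 1) \<and> (\<forall>s. s\<^sup>2 * deriv f s \<le> \<beta> * (s * f s))"
  shows "AE x in lborel. u x = 0"
proof -
  let ?n = "real CARD('n)"
  define \<theta>a where "\<theta>a = p * (\<alpha> + 1) / (\<alpha> + 1 - p)"
  define \<theta>b where "\<theta>b = p * (\<beta> + 1) / (\<beta> + 1 - p)"
  have p0: "p > 0" "p \<ge> 1" "p - 1 < \<beta>" using p2 \<alpha> by auto
  have \<theta>ab: "\<theta>b \<le> \<theta>a" unfolding \<theta>a_def \<theta>b_def using theta_mono[OF p0(1) \<alpha>] .
  have sf: "0 \<le> s * f s" for s using pos[of s] by (cases "s = 0") auto
  note F_facts = antiderivative_nonneg[OF f_deriv F_deriv F0 pos] antiderivative_pos[OF f_deriv F_deriv F0 pos]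
  have Fnn: "0 \<le> F s" for s by (rule F_facts(1))
  have Fsf: "F s \<le> s * f s" for s
  proof -
    have "(\<alpha> + 1) * F s \<le> s * f s" by (rule antiderivative_upper[OF f_deriv F_deriv F0 pos low])
    moreover have "1 * F s \<le> (\<alpha> + 1) * F s" using \<alpha> p2 Fnn by (intro mult_right_mono) auto
    ultimately show ?thesis by simp
  qed
  obtain Ca where Ca: "Ca > 0" "\<And>\<xi>. norm (flux p H \<xi>) \<le> Ca * norm \<xi> powr (p - 1)"
    using flux_bound[OF H p0(1)] by blast
  obtain \<zeta> :: "real^'n \<Rightarrow> real" where z: "smooth \<zeta>" "\<And>x. 0 \<le> \<zeta> x" "\<And>x. \<zeta> x \<le> 1"
    "\<And>x. norm x \<le> 1 \<Longrightarrow> \<zeta> x = 1" "\<And>x. norm x \<ge> 2 \<Longrightarrow> \<zeta> x = 0"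
    using cutoff_exists by blast
  obtain B where B: "B > 0" "\<And>R x. R > 0 \<Longrightarrow> norm (grad (\<lambda>x. \<zeta> ((1 / R) *\<^sub>R x)) x) \<le> B / R"
    using scaled_gradient_bound[OF z(1,5)] by blast
  have gz: "grad (\<lambda>x. \<zeta> ((1 / R) *\<^sub>R x)) x = 0" if "R > 0" "norm x < R" for R x
    by (rule grad_cutoff_vanishes) (use z(4) that in auto)
  obtain Cp where Cp: "Cp \<ge> 0" "\<And>R. R > 0 \<Longrightarrow>
    ?n * (LINT x|lborel. \<zeta> ((1 / R) *\<^sub>R x) * F (u x)) \<le>
      (?n - p) / p * (LINT x|lborel. \<zeta> ((1 / R) *\<^sub>R x) * H (G x) powr p)
      + Cp * (LINT x|lborel. indicator {x. R / 2 \<le> norm x \<and> norm x \<le> 2 * R} x * (norm (G x) powr p + F (u x)))"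
    by (rule pohozaev_inequality[OF Fnn z B gz]) (assumption | rule that; assumption)+
  obtain Cd where Cd: "Cd \<ge> 0" "\<And>R. R \<ge> 1 \<Longrightarrow> R \<ge> 4 * R0 \<Longrightarrow>
    (LINT x|lborel. indicator {x. R / 2 \<le> norm x \<and> norm x \<le> 4 * R} x * (norm (G x) powr p + u x * f (u x)))
      \<le> Cd * R powr (?n - \<theta>b)"
    by (rule annular_decay[OF stab sf low \<alpha> c lo, folded \<theta>b_def]) (assumption | rule that; assumption)+
  \<comment> \<open>Used with D = 1 / R for the gradient term of the energy identity; nothing is
    absorbed here, so d = 1 suffices.\<close>
  obtain Cy where Cy: "Cy > 0"
    "\<And>s g D. g \<ge> 0 \<Longrightarrow> D > 0 \<Longrightarrow> s\<^sup>2 * pw p g * D\<^sup>2 + \<bar>s\<bar> * g powr (p - 1) * D \<le>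
      1 * (g powr p + s * f s) + Cy * (D powr \<theta>a + D powr \<theta>b)"
    using young_pointwise[OF p2 zero_less_one \<alpha>(1) p0(3) c lo] unfolding \<theta>a_def \<theta>b_def by blast
  define V where "V = unit_ball_vol ?n * 4 ^ CARD('n)"
  \<comment> \<open>Error of the energy identity: \<open>Ca * B\<close> from the flux and the
    gradient of the cutoff, \<open>Cd\<close> from the annular energy, \<open>2 * Cy * V\<close>
    from the remainder in Young's inequality over a ball of radius 4R.\<close>
  define Ce where "Ce = Ca * B * (Cd + 2 * Cy * V)"
  have V: "V \<ge> 0" by (simp add: V_def)
  have Ce: "Ce \<ge> 0" using Ca B Cd Cy V by (simp add: Ce_def)
  define X where "X R = (LINT x|lborel. u x * f (u x) * \<zeta> ((1 / R) *\<^sub>R x))" for R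
  define P where "P R = (LINT x|lborel. \<zeta> ((1 / R) *\<^sub>R x) * H (G x) powr p)" for R
  define IF where "IF R = (LINT x|lborel. \<zeta> ((1 / R) *\<^sub>R x) * F (u x))" for R
  have zC: "(\<lambda>x. \<zeta> ((1 / R) *\<^sub>R x)) \<in> Cc_infinity" if "R > 0" for R
    unfolding Cc_infinity_iff using smooth_scaled[OF z(1)] z(5) that
    by (auto intro!: compactly_supportedI[of "2 * R"] simp: field_simps)
  have Fi: "integrable lborel (\<lambda>x. \<zeta> ((1 / R) *\<^sub>R x) * F (u x))" if R: "R > 0" for R
  proof (rule Bochner_Integration.integrable_bound[OF energy_integrable(2)[OF zC[OF R]]])
    have [measurable]: "(\<lambda>x. \<zeta> ((1 / R) *\<^sub>R x)) \<in> borel_measurable borel"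
      by (intro borel_measurable_continuous_onI smooth_continuous_on smooth_scaled z(1))
    show "(\<lambda>x. \<zeta> ((1 / R) *\<^sub>R x) * F (u x)) \<in> borel_measurable lborel" by simp
    show "AE x in lborel. norm (\<zeta> ((1 / R) *\<^sub>R x) * F (u x)) \<le> norm (u x * f (u x) * \<zeta> ((1 / R) *\<^sub>R x))"
    proof (rule AE_I2)
      fix x
      have "0 \<le> \<zeta> ((1 / R) *\<^sub>R x) * F (u x)" using z(2) Fnn by simp
      moreover have "\<zeta> ((1 / R) *\<^sub>R x) * F (u x) \<le> u x * f (u x) * \<zeta> ((1 / R) *\<^sub>R x)"
        using mult_left_mono[OF Fsf[of "u x"] z(2)[of "(1 / R) *\<^sub>R x"]] by (simp only: mult_ac)
      ultimately show "norm (\<zeta> ((1 / R) *\<^sub>R x) * F (u x)) \<le> norm (u x * f (u x) * \<zeta> ((1 / R) *\<^sub>R x))"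
        unfolding real_norm_def by linarith
    qed
  qed
  have Xnn: "0 \<le> X R" and Pnn: "0 \<le> P R" for R
    unfolding X_def P_def using sf z(2) by (auto intro!: integral_nonneg_AE)
  have main: "?n * IF R \<le> (?n - p) / p * P R + Cp * Cd * R powr (?n - \<theta>b)"
    "P R \<le> X R + Ce * R powr (?n - \<theta>b)" if R: "R \<ge> max 1 (4 * R0)" for R
  proof -
    have R1: "R > 0" "R \<ge> 1" "R \<ge> 4 * R0" using R by auto
    let ?A = "{x::real^'n. R / 2 \<le> norm x \<and> norm x \<le> 2 * R}" and ?N = "{x::real^'n. R / 2 \<le> norm x \<and> norm x \<le> 4 * R}"
    have [measurable]: "?A \<in> sets borel" "?N \<in> sets borel" "cball (0::real^'n) (4 * R) \<in> sets borel" by measurable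
    let ?w = "\<lambda>x. indicator ?N x * (norm (G x) powr p + u x * f (u x))"
    have wb: "integrable lborel (\<lambda>x. indicator (cball 0 (4 * R)) x * norm (G x) powr p + indicator (cball 0 (4 * R)) x * (u x * f (u x)))"
      by (intro Bochner_Integration.integrable_add energy_density_integrable)
    have wi: "integrable lborel ?w"
      by (rule Bochner_Integration.integrable_bound[OF wb]) (auto simp: indicator_def)
    have "(LINT x|lborel. indicator ?A x * (norm (G x) powr p + F (u x))) \<le> (LINT x|lborel. ?w x)"
    proof (rule integral_mono[OF _ wi])
      show le: "indicator ?A x * (norm (G x) powr p + F (u x)) \<le> ?w x" for x
        using Fsf[of "u x"] sf[of "u x"] R1 by (auto simp: indicator_def intro: add_nonneg_nonneg)
      show "integrable lborel (\<lambda>x. indicator ?A x * (norm (G x) powr p + F (u x)))"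
      proof (rule Bochner_Integration.integrable_bound[OF wi])
        show "AE x in lborel. norm (indicator ?A x * (norm (G x) powr p + F (u x))) \<le> norm (?w x)"
        proof (rule AE_I2)
          fix x
          have "0 \<le> indicator ?A x * (norm (G x) powr p + F (u x))" using Fnn by simp
          with le[of x] show "norm (indicator ?A x * (norm (G x) powr p + F (u x))) \<le> norm (?w x)"
            unfolding real_norm_def by linarith
        qed
      qed measurable
    qed
    also note Cd(2)[OF R1(2,3)]
    finally have "Cp * (LINT x|lborel. indicator ?A x * (norm (G x) powr p + F (u x))) \<le> Cp * (Cd * R powr (?n - \<theta>b))"
      using Cp(1) by (rule mult_left_mono)
    then show "?n * IF R \<le> (?n - p) / p * P R + Cp * Cd * R powr (?n - \<theta>b)"
      using Cp(2)[OF R1(1)] unfolding IF_def P_def by (simp add: mult.assoc)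
    let ?q = "\<lambda>x. u x * (flux p H (G x) \<bullet> grad (\<lambda>x. \<zeta> ((1 / R) *\<^sub>R x)) x)"
    let ?k = "\<lambda>x::real^'n. indicator (cball 0 (4 * R)) x * (2 * Cy * R powr (- \<theta>b))"
    have ki: "integrable lborel ?k"
      by (intro integrable_mult_left integrable_real_indicator) (auto simp: cball_finite)
    have "- (LINT x|lborel. ?q x) = (LINT x|lborel. - ?q x)" by simp
    also have "\<dots> \<le> (LINT x|lborel. Ca * B * (?w x + ?k x))"
    proof (intro integral_mono integrable_minus energy_integrable zC R1 integrable_mult_right Bochner_Integration.integrable_add wi ki)
      fix x :: "real^'n"
      show "- ?q x \<le> Ca * B * (?w x + ?k x)"
      proof (cases "x \<in> ?N")
        case False
        \<comment> \<open>The gradient of the cutoff lives on R <= |x| <= 2R, inside the annulus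
          \<open>?N\<close>.\<close>
        have "grad (\<lambda>x. \<zeta> ((1 / R) *\<^sub>R x)) x = 0"
        proof (cases "norm x < R")
          case False
          then have "norm x > 2 * R" using \<open>x \<notin> ?N\<close> R1 by auto
          then show ?thesis by (intro partial_eq_0_outside(2)[of "2 * R"]) (use R1 z(5) in \<open>auto simp: field_simps\<close>)
        qed (use gz[OF R1(1)] in simp)
        then show ?thesis using False Ca B Cy by simp
      next
        case True
        have "R powr (- \<theta>a) \<le> R powr (- \<theta>b)" using R1 \<theta>ab by (intro powr_mono) auto
        then have Rp: "Cy * ((1 / R) powr \<theta>a + (1 / R) powr \<theta>b) \<le> 2 * Cy * R powr (- \<theta>b)"
        proof -
          have "Cy * (R powr (- \<theta>a) + R powr (- \<theta>b)) \<le> Cy * (2 * R powr (- \<theta>b))"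
            using \<open>R powr (- \<theta>a) \<le> R powr (- \<theta>b)\<close> Cy(1) by (intro mult_left_mono) auto
          then show ?thesis using R1 by (simp add: powr_divide powr_minus_divide)
        qed
        have "- ?q x \<le> \<bar>u x\<bar> * norm (flux p H (G x) \<bullet> grad (\<lambda>x. \<zeta> ((1 / R) *\<^sub>R x)) x)"
          by (metis abs_ge_minus_self abs_mult real_norm_def)
        also have "\<dots> \<le> \<bar>u x\<bar> * ((Ca * norm (G x) powr (p - 1)) * (B / R))"
        proof (rule mult_left_mono)
          have "norm (flux p H (G x) \<bullet> grad (\<lambda>x. \<zeta> ((1 / R) *\<^sub>R x)) x) \<le> norm (flux p H (G x)) * norm (grad (\<lambda>x. \<zeta> ((1 / R) *\<^sub>R x)) x)"
            by (rule Cauchy_Schwarz_ineq2[folded real_norm_def])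
          also have "\<dots> \<le> (Ca * norm (G x) powr (p - 1)) * (B / R)"
            using Ca(1) by (intro mult_mono Ca(2) B(2) R1) auto
          finally show "norm (flux p H (G x) \<bullet> grad (\<lambda>x. \<zeta> ((1 / R) *\<^sub>R x)) x) \<le> (Ca * norm (G x) powr (p - 1)) * (B / R)" .
        qed simp
        also have "\<dots> = Ca * B * (\<bar>u x\<bar> * norm (G x) powr (p - 1) * (1 / R))" by simp
        also have "\<dots> \<le> Ca * B * ((norm (G x) powr p + u x * f (u x)) + 2 * Cy * R powr (- \<theta>b))"
        proof (rule mult_left_mono)
          have "0 \<le> (u x)\<^sup>2 * pw p (norm (G x)) * (1 / R)\<^sup>2" by (simp add: pw_def)
          then show "\<bar>u x\<bar> * norm (G x) powr (p - 1) * (1 / R) \<le> norm (G x) powr p + u x * f (u x) + 2 * Cy * R powr (- \<theta>b)"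
            using Cy(2)[of "norm (G x)" "1 / R" "u x"] Rp R1 by simp
        qed (use Ca B in auto)
        finally show ?thesis using True by simp
      qed
    qed
    also have "\<dots> = Ca * B * ((LINT x|lborel. ?w x) + (LINT x|lborel. ?k x))"
      by (simp only: integral_mult_right_zero Bochner_Integration.integral_add[OF wi ki])
    also have "(LINT x|lborel. ?k x) = 2 * Cy * V * R powr (?n - \<theta>b)"
    proof -
      have "(LINT x|lborel. ?k x) = measure lborel (cball (0::real^'n) (4 * R)) * (2 * Cy * R powr (- \<theta>b))"
        by simp
      also have "measure lborel (cball (0::real^'n) (4 * R)) = V * R powr ?n"
        using R1 by (simp add: content_cball V_def power_mult_distrib powr_realpow)
      finally show ?thesis by (simp add: powr_diff powr_minus divide_inverse)
    qed
    also have "Ca * B * ((LINT x|lborel. ?w x) + 2 * Cy * V * R powr (?n - \<theta>b)) \<le> Ca * B * (Cd * R powr (?n - \<theta>b) + 2 * Cy * V * R powr (?n - \<theta>b))"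
      using Cd(2)[OF R1(2,3)] Ca B by (intro mult_left_mono add_right_mono) auto
    finally have "- (LINT x|lborel. ?q x) \<le> Ce * R powr (?n - \<theta>b)" by (simp add: Ce_def algebra_simps)
    then show "P R \<le> X R + Ce * R powr (?n - \<theta>b)"
      using energy_identity[OF zC[OF R1(1)]] unfolding P_def X_def by linarith
  qed
  obtain K where K: "\<And>R. R \<ge> max 1 (4 * R0) \<Longrightarrow> IF R \<le> K * R powr (?n - \<theta>b)"
  proof (cases "p \<ge> ?n")
    case True
    have "IF R \<le> Cp * Cd / ?n * R powr (?n - \<theta>b)" if R: "R \<ge> max 1 (4 * R0)" for R
    proof -
      have "(?n - p) / p * P R \<le> 0" using True p0 Pnn by (intro mult_nonpos_nonneg) (auto simp: divide_le_0_iff)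
      then have "?n * IF R \<le> Cp * Cd * R powr (?n - \<theta>b)" using main(1)[OF R] by linarith
      then show ?thesis by (simp add: field_simps)
    qed
    then show ?thesis by (rule that)
  next
    case False
    then have \<beta>: "(?n - p) / p < ?n / (\<beta> + 1)" "\<And>s. s\<^sup>2 * deriv f s \<le> \<beta> * (s * f s)" using up by auto
    \<comment> \<open>The coefficient left for X when the terms with X on both sides are collected;
      subcriticality makes it positive.\<close>
    define \<kappa> where "\<kappa> = ?n / (\<beta> + 1) - (?n - p) / p"
    have \<kappa>: "\<kappa> > 0" using \<beta> by (simp add: \<kappa>_def)
    have np: "(?n - p) / p \<ge> 0" using False p0 by simp
    have "IF R \<le> ((?n - p) / p * Ce + Cp * Cd) / \<kappa> * R powr (?n - \<theta>b)" if R: "R \<ge> max 1 (4 * R0)" for R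
    proof -
      have R0: "R > 0" using R by simp
      have "X R \<le> (LINT x|lborel. (\<beta> + 1) * (\<zeta> ((1 / R) *\<^sub>R x) * F (u x)))"
        unfolding X_def
      proof (intro integral_mono energy_integrable zC R0 integrable_mult_right Fi)
        show "u x * f (u x) * \<zeta> ((1 / R) *\<^sub>R x) \<le> (\<beta> + 1) * (\<zeta> ((1 / R) *\<^sub>R x) * F (u x))" for x
          using mult_right_mono[OF antiderivative_lower[OF f_deriv F_deriv F0 pos \<beta>(2), of "u x"] z(2)[of "(1 / R) *\<^sub>R x"]]
          by (simp add: mult_ac)
      qed
      then have XI: "X R \<le> (\<beta> + 1) * IF R" by (simp add: IF_def)
      have "IF R \<le> X R" unfolding IF_def X_def
      proof (intro integral_mono energy_integrable zC R0 Fi)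
        show "\<zeta> ((1 / R) *\<^sub>R x) * F (u x) \<le> u x * f (u x) * \<zeta> ((1 / R) *\<^sub>R x)" for x
          using mult_left_mono[OF Fsf[of "u x"] z(2)[of "(1 / R) *\<^sub>R x"]] by (simp add: mult_ac)
      qed
      have "X R / (\<beta> + 1) \<le> IF R" using XI p0 p2 by (simp add: pos_divide_le_eq mult.commute)
      from mult_left_mono[OF this, of ?n] have "?n / (\<beta> + 1) * X R \<le> ?n * IF R" by simp
      also have "\<dots> \<le> (?n - p) / p * (X R + Ce * R powr (?n - \<theta>b)) + Cp * Cd * R powr (?n - \<theta>b)"
        using main(1)[OF R] mult_left_mono[OF main(2)[OF R] np] by linarith
      finally have "\<kappa> * X R \<le> ((?n - p) / p * Ce + Cp * Cd) * R powr (?n - \<theta>b)"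
        unfolding \<kappa>_def by (simp add: algebra_simps)
      then have "X R \<le> ((?n - p) / p * Ce + Cp * Cd) * R powr (?n - \<theta>b) / \<kappa>"
        using \<kappa> by (simp add: pos_le_divide_eq mult.commute)
      then show ?thesis using \<open>IF R \<le> X R\<close> by simp
    qed
    then show ?thesis by (rule that)
  qed
  show ?thesis
  proof (rule vanishes_of_potential_decay[OF Fnn F_facts(2) z(1,2,4,5) _ _ Fi])
    show "(LINT x|lborel. \<zeta> ((1 / R) *\<^sub>R x) * F (u x)) \<le> K * R powr (?n - \<theta>b)" if "R \<ge> max 1 (4 * R0)" for R
      using K[OF that] by (simp add: IF_def)
    have "((\<lambda>R. R powr (?n - \<theta>b)) \<longlongrightarrow> 0) at_top"
      using \<theta> by (intro tendsto_neg_powr filterlim_ident) (simp add: \<theta>b_def)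
    then show "((\<lambda>R. K * R powr (?n - \<theta>b)) \<longlongrightarrow> 0) at_top" by (rule tendsto_mult_right_zero)
  qed
qed

end

section \<open>From Lebesgue measurable data to Borel representatives\<close>

lemma
  fixes a b :: "real^'n \<Rightarrow> 'b::{banach, second_countable_topology}"
  assumes a: "a \<in> borel_measurable lborel" and ab: "AE x in lborel. b x = a x"
  shows lebesgue_measurable_AE: "b \<in> borel_measurable lebesgue"
    and lebesgue_integral_AE: "(LINT x|lebesgue. b x) = (LINT x|lborel. a x)"
    and lebesgue_integrable_AE: "integrable lebesgue b \<longleftrightarrow> integrable lborel a"
proof -
  have a': "a \<in> borel_measurable lebesgue" using a by (rule measurable_completion)
  have ab': "AE x in lebesgue. b x = a x" using ab by (rule AE_completion)
  show b: "b \<in> borel_measurable lebesgue"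
  proof (rule measurableI)
    fix S :: "'b set" assume S: "S \<in> sets borel"
    \<comment> \<open>Preimages under \<open>b\<close> and \<open>a\<close> differ only inside the
      null set \<open>N\<close>, all of whose subsets are Lebesgue measurable.\<close>
    obtain N where N: "{x \<in> space lborel. b x \<noteq> a x} \<subseteq> N" "N \<in> null_sets lborel"
      using ab by (auto elim!: AE_E simp: null_sets_def)
    have "N \<in> sets lebesgue" "b -` S \<inter> N \<in> sets lebesgue"
      using null_sets_completion[OF N(2)] by auto
    moreover have "a -` S \<in> sets lebesgue" using measurable_sets[OF a' S] by simp
    moreover have "b -` S \<inter> space lebesgue = (a -` S - N) \<union> (b -` S \<inter> N)" using N(1) by auto
    ultimately show "b -` S \<inter> space lebesgue \<in> sets lebesgue" by (metis sets.Un sets.Diff)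
  qed simp
  show "(LINT x|lebesgue. b x) = (LINT x|lborel. a x)"
    using integral_cong_AE[OF b a' ab'] integral_completion[OF a] by simp
  show "integrable lebesgue b \<longleftrightarrow> integrable lborel a"
    using integrable_cong_AE[OF b a' ab'] integrable_completion[OF a] by simp
qed

lemma borel_representative_vec:
  fixes G :: "real^'n \<Rightarrow> real^'m"
  assumes "G \<in> borel_measurable lebesgue"
  obtains G' where "G' \<in> borel_measurable borel" "AE x in lborel. G x = G' x"
proof -
  have "\<exists>g\<in>borel_measurable lborel. AE x in lborel. G x $ i = g x" for i
    by (rule completion_ex_borel_measurable_real) (use assms in \<open>simp add: cart_eq_inner_axis\<close>)
  then obtain g where g: "\<And>i. g i \<in> borel_measurable borel" "\<And>i. AE x in lborel. G x $ i = g i x" by simp metis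
  show ?thesis
  proof (rule that)
    show "(\<lambda>x. \<chi> i. g i x) \<in> borel_measurable borel"
      by (subst borel_measurable_euclidean_space) (use g(1) in \<open>auto simp: Basis_vec_def inner_axis\<close>)
    have "AE x in lborel. \<forall>i\<in>UNIV. G x $ i = g i x" by (intro AE_finite_allI g) auto
    then show "AE x in lborel. G x = (\<chi> i. g i x)" by eventually_elim (simp add: vec_eq_iff)
  qed
qed

lemma Lp_loc_representative:
  fixes g g' :: "real^'n \<Rightarrow> 'b::euclidean_space"
  assumes g: "Lp_loc q g" and [measurable]: "g' \<in> borel_measurable borel" and ae: "AE x in lborel. g x = g' x"
  shows "set_integrable lborel (cball 0 R) (\<lambda>x. norm (g' x) powr q)"
proof -
  have [measurable]: "cball (0::real^'n) R \<in> sets borel" by simp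
  have "integrable lebesgue (\<lambda>x. indicator (cball 0 R) x *\<^sub>R norm (g x) powr q)"
    using g unfolding Lp_loc_def set_integrable_def by (meson compact_cball)
  moreover have "integrable lebesgue (\<lambda>x. indicator (cball 0 R) x *\<^sub>R norm (g x) powr q) \<longleftrightarrow>
      integrable lborel (\<lambda>x. indicator (cball 0 R) x *\<^sub>R norm (g' x) powr q)"
    by (rule lebesgue_integrable_AE) (measurable, use ae in \<open>eventually_elim, simp\<close>)
  ultimately show ?thesis by (simp add: set_integrable_def)
qed

lemma L1_loc_representative:
  fixes g g' :: "real^'n \<Rightarrow> 'b::euclidean_space"
  assumes g: "Lp_loc 1 g" and [measurable]: "g' \<in> borel_measurable borel" and ae: "AE x in lborel. g x = g' x"
  shows "locally_integrable g'"
  unfolding locally_integrable_def set_integrable_def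
proof (intro conjI allI)
  fix R
  have [measurable]: "cball (0::real^'n) R \<in> sets borel" by simp
  have "integrable lborel (\<lambda>x. indicator (cball 0 R) x *\<^sub>R norm (g' x))"
    using Lp_loc_representative[OF assms, of R] by (simp add: set_integrable_def)
  then show "integrable lborel (\<lambda>x. indicator (cball 0 R) x *\<^sub>R g' x)"
    by (rule Bochner_Integration.integrable_bound) auto
qed measurable

lemma weak_grad_representative:
  fixes u u' :: "real^'n \<Rightarrow> real"
  assumes G: "is_weak_grad u G"
    and [measurable]: "u' \<in> borel_measurable borel" "G' \<in> borel_measurable borel"
    and ae: "AE x in lborel. u x = u' x" "AE x in lborel. G x = G' x" and \<phi>: "\<phi> \<in> Cc_infinity"
  shows "(LINT x|lborel. u' x * partial i \<phi> x) = - (LINT x|lborel. G' x $ i * \<phi> x)"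
proof -
  have sm: "smooth \<phi>" using \<phi> by (simp add: Cc_infinity_iff)
  have [measurable]: "\<phi> \<in> borel_measurable borel" "grad \<phi> \<in> borel_measurable borel"
    by (intro borel_measurable_continuous_onI smooth_continuous_on smooth_continuous_grad sm)+
  have "(\<lambda>x. grad \<phi> x \<bullet> axis i 1) \<in> borel_measurable borel" by measurable
  then have [measurable]: "partial i \<phi> \<in> borel_measurable borel" by (simp add: inner_axis grad_def)
  have [measurable]: "(\<lambda>x. G' x $ i) \<in> borel_measurable borel" by (simp add: cart_eq_inner_axis)
  have "(LINT x|lebesgue. u x * partial i \<phi> x) = (LINT x|lborel. u' x * partial i \<phi> x)"
    by (rule lebesgue_integral_AE) (measurable, use ae in \<open>eventually_elim, simp\<close>)
  moreover have "(LINT x|lebesgue. G x $ i * \<phi> x) = (LINT x|lborel. G' x $ i * \<phi> x)"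
    by (rule lebesgue_integral_AE) (measurable, use ae(2) in \<open>eventually_elim, simp\<close>)
  ultimately show ?thesis using G \<phi> by (simp add: is_weak_grad_def)
qed

text \<open>Mollifying either gradient gives the gradient of the mollified function, hence the same
  result, and mollifications converge in L^1 on balls. Uniqueness identifies the locally
  p-integrable weak gradient supplied by \<open>W1p_loc\<close> with the one that
  \<open>weak_grad\<close> picks.\<close>

lemma weak_gradient_unique:
  fixes u :: "real^'n \<Rightarrow> real" and G G' :: "real^'n \<Rightarrow> real^'n"
  assumes loc: "locally_integrable u" "locally_integrable G" "locally_integrable G'"
    and weak: "\<And>\<phi> i. \<phi> \<in> Cc_infinity \<Longrightarrow> (LINT x|lborel. u x * partial i \<phi> x) = - (LINT x|lborel. G x $ i * \<phi> x)"
      "\<And>\<phi> i. \<phi> \<in> Cc_infinity \<Longrightarrow> (LINT x|lborel. u x * partial i \<phi> x) = - (LINT x|lborel. G' x $ i * \<phi> x)"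
  shows "AE x in lborel. G x = G' x"
proof -
  have [measurable]: "G \<in> borel_measurable borel" "G' \<in> borel_measurable borel" using loc by auto
  have ball: "AE x in lborel. norm x \<le> R \<longrightarrow> G x = G' x" for R
  proof -
    have [measurable]: "cball (0::real^'n) R \<in> sets borel" by simp
    let ?d = "\<lambda>x. ennreal (norm (G x - G' x)) * indicator (cball 0 R) x"
    have small: "(\<integral>\<^sup>+x. ?d x \<partial>lborel) \<le> ennreal e" if e: "e > 0" for e
    proof -
      obtain d1 where d1: "d1 > 0" "\<And>\<kappa>. mollifier d1 \<kappa> \<Longrightarrow> (\<integral>\<^sup>+x\<in>cball 0 R. ennreal (norm (conv \<kappa> G x - G x)) \<partial>lborel) \<le> ennreal (e / 2)"
        by (rule conv_L1_close[OF loc(2) half_gt_zero[OF e], of R]) (rule that; assumption)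
      obtain d2 where d2: "d2 > 0" "\<And>\<kappa>. mollifier d2 \<kappa> \<Longrightarrow> (\<integral>\<^sup>+x\<in>cball 0 R. ennreal (norm (conv \<kappa> G' x - G' x)) \<partial>lborel) \<le> ennreal (e / 2)"
        by (rule conv_L1_close[OF loc(3) half_gt_zero[OF e], of R]) (rule that; assumption)
      obtain \<kappa> :: "real^'n \<Rightarrow> real" where "mollifier (min d1 d2) \<kappa>" using mollifier_exists[of "min d1 d2"] d1(1) d2(1) by auto
      then have k: "mollifier d1 \<kappa>" "mollifier d2 \<kappa>" using mollifier_mono[of "min d1 d2" \<kappa>] by auto
      have [measurable]: "\<kappa> \<in> borel_measurable borel" by (rule mollifier_borel[OF k(1)])
      have [measurable]: "conv \<kappa> G \<in> borel_measurable borel" "conv \<kappa> G' \<in> borel_measurable borel"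
        unfolding conv_def by measurable
      have k': "smooth \<kappa>" "\<And>x. norm x > d1 \<Longrightarrow> \<kappa> x = 0" using k(1) by (auto simp: mollifier_def)
      have eq: "conv \<kappa> G x = conv \<kappa> G' x" for x
        using grad_conv_weak[OF k' loc(1,2) weak(1)] grad_conv_weak[OF k' loc(1,3) weak(2)] by simp
      have "(\<integral>\<^sup>+x. ?d x \<partial>lborel) \<le> (\<integral>\<^sup>+x. ennreal (norm (conv \<kappa> G x - G x)) * indicator (cball 0 R) x
          + ennreal (norm (conv \<kappa> G' x - G' x)) * indicator (cball 0 R) x \<partial>lborel)"
      proof (rule nn_integral_mono)
        fix x
        have "norm (G x - G' x) \<le> norm (conv \<kappa> G x - G x) + norm (conv \<kappa> G' x - G' x)"
          using norm_triangle_ineq4[of "conv \<kappa> G' x - G' x" "conv \<kappa> G x - G x"] by (simp add: eq)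
        then have "ennreal (norm (G x - G' x)) \<le> ennreal (norm (conv \<kappa> G x - G x)) + ennreal (norm (conv \<kappa> G' x - G' x))"
          by (simp add: ennreal_plus[symmetric] del: ennreal_plus)
        then show "?d x \<le> ennreal (norm (conv \<kappa> G x - G x)) * indicator (cball 0 R) x
          + ennreal (norm (conv \<kappa> G' x - G' x)) * indicator (cball 0 R) x"
          by (simp add: indicator_def)
      qed
      also have "\<dots> \<le> ennreal (e / 2) + ennreal (e / 2)"
        by (subst nn_integral_add) (auto intro!: add_mono d1(2) d2(2) k)
      also have "\<dots> = ennreal e" using e by (simp add: ennreal_plus[symmetric] del: ennreal_plus)
      finally show ?thesis .
    qed
    have "(\<integral>\<^sup>+x. ?d x \<partial>lborel) \<le> 0"
      by (rule ennreal_le_epsilon) (use small in \<open>simp only: add_0_left\<close>)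
    then have I0: "(\<integral>\<^sup>+x. ?d x \<partial>lborel) = 0" by (simp only: le_zero_eq)
    have "?d \<in> borel_measurable lborel" by measurable
    from nn_integral_0_iff_AE[OF this] I0 have "AE x in lborel. ?d x = 0" by (simp only: simp_thms)
    then show ?thesis by eventually_elim (auto simp: indicator_def)
  qed
  have "AE x in lborel. \<forall>k::nat. norm x \<le> real k \<longrightarrow> G x = G' x"
    unfolding AE_all_countable using ball by blast
  then show ?thesis by eventually_elim (use real_arch_simple in blast)
qed

theorem corollary1p5:
  fixes H :: "real^'n \<Rightarrow> real" and A0 :: "real^'n^'n"
    and f :: "real \<Rightarrow> real" and u :: "real^'n \<Rightarrow> real"
    and p \<alpha>0 \<beta>0 c M :: real
  assumes "CARD('n) \<ge> 2" and "p \<ge> 2"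
    and "anisotropy H" and "transpose A0 = A0"
    and "f C1_differentiable_on UNIV"
    and "\<And>s. s \<noteq> 0 \<Longrightarrow> s * f s > 0"
    and "c > 0" and "M > 0"
    and "(p < real CARD('n) \<and> p - 1 < \<alpha>0 \<and> \<alpha>0 \<le> \<beta>0 \<and>
            \<beta>0 < real CARD('n) * p / (real CARD('n) - p) - 1 \<and>
            (\<forall>s. \<alpha>0 * (s * f s) \<le> s\<^sup>2 * deriv f s \<and> s\<^sup>2 * deriv f s \<le> \<beta>0 * (s * f s))) \<or>
         (p \<ge> real CARD('n) \<and> p - 1 < \<alpha>0 \<and> \<alpha>0 \<le> \<beta>0 \<and>
            (\<forall>s. s\<^sup>2 * deriv f s \<ge> \<alpha>0 * (s * f s)) \<and>
            (\<forall>s. \<bar>s\<bar> < M \<longrightarrow> s * f s \<ge> c * \<bar>s\<bar> powr (\<beta>0 + 1)))"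
    and "is_solution p H f u"
    and "finite_morse_index p H A0 f u"
  shows "AE x in lebesgue. u x = 0"
proof -
  note pos = assms(6) and cases = assms(9) and sol = assms(10) and morse = assms(11)
  have p0: "p > 0" using assms(2) by simp
  have f: "\<And>s. (f has_real_derivative deriv f s) (at s)" "continuous_on UNIV (deriv f)"
    using C1_differentiable_on_deriv[OF assms(5)] by auto
  have f_cont: "continuous_on UNIV f" using f(1) by (meson DERIV_isCont continuous_at_imp_continuous_on)
  have [measurable]: "f \<in> borel_measurable borel" "deriv f \<in> borel_measurable borel"
    by (intro borel_measurable_continuous_onI f_cont f(2))+
  have [measurable]: "flux p H \<in> borel_measurable borel" by (rule flux_borel[OF assms(3) p0])
  obtain F where F: "\<And>s. (F has_real_derivative f s) (at s)" "F 0 = 0" using antiderivative_exists[OF f_cont] by blast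
  obtain Gp where Gp: "is_weak_grad u Gp" "Lp_loc p Gp" using sol by (auto simp: is_solution_def W1p_loc_def)
  \<comment> \<open>The chosen weak gradient might differ from \<open>Gp\<close>, the one known to
    be locally p-integrable; the two agree almost everywhere by
    \<open>weak_gradient_unique\<close>.\<close>
  have G: "is_weak_grad u (weak_grad u)" unfolding weak_grad_def using Gp(1) by (rule someI[of "is_weak_grad u"])
  have meas: "u \<in> borel_measurable lebesgue" "Gp \<in> borel_measurable lebesgue" "weak_grad u \<in> borel_measurable lebesgue"
    using Gp(1) G by (auto simp: is_weak_grad_def Lp_loc_def)
  obtain u' where u' [measurable]: "u' \<in> borel_measurable borel" and ue: "AE x in lborel. u x = u' x"
    using completion_ex_borel_measurable_real[OF meas(1)] by auto
  obtain G' where G' [measurable]: "G' \<in> borel_measurable borel" and Ge: "AE x in lborel. Gp x = G' x"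
    using borel_representative_vec[OF meas(2)] by blast
  obtain G'' where G'' [measurable]: "G'' \<in> borel_measurable borel" and Ge'': "AE x in lborel. weak_grad u x = G'' x"
    using borel_representative_vec[OF meas(3)] by blast
  have loc: "locally_integrable u'" "locally_integrable G'" "locally_integrable G''"
    using Gp(1) G L1_loc_representative[OF _ u' ue] L1_loc_representative[OF _ G' Ge] L1_loc_representative[OF _ G'' Ge'']
    by (auto simp: is_weak_grad_def)
  have "AE x in lborel. G' x = G'' x"
    by (rule weak_gradient_unique[OF loc weak_grad_representative[OF Gp(1) u' G' ue Ge] weak_grad_representative[OF G u' G'' ue Ge'']])
  with Ge'' have wG: "AE x in lborel. weak_grad u x = G' x" by eventually_elim simp
  interpret weak_solution p H A0 f F u' G'
  proof
    fix R :: real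
    obtain C where "AE x in lebesgue. x \<in> cball 0 R \<longrightarrow> \<bar>u x\<bar> \<le> C"
      using sol unfolding is_solution_def Linfty_loc_def by (meson compact_cball)
    then have "AE x in lborel. x \<in> cball 0 R \<longrightarrow> \<bar>u x\<bar> \<le> C" by (simp only: AE_completion_iff)
    with ue have "AE x in lborel. norm x \<le> R \<longrightarrow> \<bar>u' x\<bar> \<le> C" by eventually_elim simp
    then show "\<exists>C. AE x in lborel. norm x \<le> R \<longrightarrow> \<bar>u' x\<bar> \<le> C" by blast
    show "set_integrable lborel (cball 0 R) (\<lambda>x. norm (G' x) powr p)" by (rule Lp_loc_representative[OF Gp(2) G' Ge])
  next
    fix \<phi> :: "real^'n \<Rightarrow> real" assume \<phi>: "\<phi> \<in> Cc_infinity"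
    then have sm: "smooth \<phi>" by (simp add: Cc_infinity_iff)
    have [measurable]: "\<phi> \<in> borel_measurable borel" "grad \<phi> \<in> borel_measurable borel"
      by (intro borel_measurable_continuous_onI smooth_continuous_on smooth_continuous_grad sm)+
    have "(LINT x|lebesgue. flux p H (weak_grad u x) \<bullet> grad \<phi> x) = (LINT x|lborel. flux p H (G' x) \<bullet> grad \<phi> x)"
      by (rule lebesgue_integral_AE) (measurable, use wG in \<open>eventually_elim, simp\<close>)
    moreover have "(LINT x|lebesgue. f (u x) * \<phi> x) = (LINT x|lborel. f (u' x) * \<phi> x)"
      by (rule lebesgue_integral_AE) (measurable, use ue in \<open>eventually_elim, simp\<close>)
    ultimately show "(LINT x|lborel. flux p H (G' x) \<bullet> grad \<phi> x) = (LINT x|lborel. f (u' x) * \<phi> x)"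
      using sol \<phi> by (simp add: is_solution_def)
    show "(LINT x|lborel. u' x * partial i \<phi> x) = - (LINT x|lborel. G' x $ i * \<phi> x)" for i
      by (rule weak_grad_representative[OF Gp(1) u' G' ue Ge \<phi>])
  qed (use assms(1-3) f F u' G' in auto)
  have transfer: "integrable lebesgue (\<lambda>x. hform p H A0 (weak_grad u x) (grad \<phi> x) (grad \<phi> x))"
    "integrable lebesgue (\<lambda>x. deriv f (u x) * \<phi> x * \<phi> x)"
    "(LINT x|lebesgue. hform p H A0 (weak_grad u x) (grad \<phi> x) (grad \<phi> x)) = (LINT x|lborel. hform p H A0 (G' x) (grad \<phi> x) (grad \<phi> x))"
    "(LINT x|lebesgue. deriv f (u x) * \<phi> x * \<phi> x) = (LINT x|lborel. deriv f (u' x) * \<phi> x * \<phi> x)" if \<phi>: "\<phi> \<in> Cc1" for \<phi>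
  proof -
    note i = hform_locally_integrable[OF \<phi>]
    have "AE x in lborel. hform p H A0 (weak_grad u x) (grad \<phi> x) (grad \<phi> x) = hform p H A0 (G' x) (grad \<phi> x) (grad \<phi> x)"
      using wG by eventually_elim simp
    note 1 = borel_measurable_integrable[OF i(1)] this
    have "AE x in lborel. deriv f (u x) * \<phi> x * \<phi> x = deriv f (u' x) * \<phi> x * \<phi> x"
      using ue by eventually_elim simp
    note 2 = borel_measurable_integrable[OF i(2)] this
    show "integrable lebesgue (\<lambda>x. hform p H A0 (weak_grad u x) (grad \<phi> x) (grad \<phi> x))"
      "(LINT x|lebesgue. hform p H A0 (weak_grad u x) (grad \<phi> x) (grad \<phi> x)) = (LINT x|lborel. hform p H A0 (G' x) (grad \<phi> x) (grad \<phi> x))"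
      using lebesgue_integrable_AE[OF 1] lebesgue_integral_AE[OF 1] i(1) by auto
    show "integrable lebesgue (\<lambda>x. deriv f (u x) * \<phi> x * \<phi> x)"
      "(LINT x|lebesgue. deriv f (u x) * \<phi> x * \<phi> x) = (LINT x|lborel. deriv f (u' x) * \<phi> x * \<phi> x)"
      using lebesgue_integrable_AE[OF 2] lebesgue_integral_AE[OF 2] i(2) by auto
  qed
  obtain R0 where R0: "\<And>\<phi>. \<phi> \<in> Cc1 \<Longrightarrow> (\<And>x. norm x \<le> R0 \<Longrightarrow> \<phi> x = 0) \<Longrightarrow> 0 \<le> linearized p H A0 f u \<phi> \<phi>"
    using finite_morse_index_stable_outside[OF morse transfer(1,2)] by blast
  have stab: "(LINT x|lborel. deriv f (u' x) * \<phi> x * \<phi> x) \<le> (LINT x|lborel. hform p H A0 (G' x) (grad \<phi> x) (grad \<phi> x))"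
    if \<phi>: "\<phi> \<in> Cc_infinity" "\<And>x. norm x \<le> R0 \<Longrightarrow> \<phi> x = 0" for \<phi>
  proof -
    have C1: "\<phi> \<in> Cc1" using \<phi>(1) Cc_infinity_subset_Cc1 by blast
    show ?thesis using R0[OF C1 \<phi>(2)] transfer(3,4)[OF C1] by (simp add: linearized_eq_hform)
  qed
  let ?n = "real CARD('n)"
  have \<alpha>: "p - 1 < \<alpha>0" "\<alpha>0 \<le> \<beta>0" and low: "\<And>s. \<alpha>0 * (s * f s) \<le> s\<^sup>2 * deriv f s" using cases by auto
  have \<beta>: "\<beta>0 + 1 - p > 0" "\<beta>0 + 1 > 0" using \<alpha> p0 by auto
  have "AE x in lborel. u' x = 0"
  proof (cases "p < ?n")
    case True
    with cases have up: "\<And>s. s\<^sup>2 * deriv f s \<le> \<beta>0 * (s * f s)" and "\<beta>0 < ?n * p / (?n - p) - 1" by auto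
    \<comment> \<open>Subcriticality with denominators cleared. It is equivalent both to the decay
      exponent being negative and to (n - p) / p < n / (\<beta>0 + 1).\<close>
    then have sub: "(?n - p) * (\<beta>0 + 1) < ?n * p" using True by (simp add: field_simps)
    obtain c1 where c1: "c1 > 0" "\<And>s. \<bar>s\<bar> \<ge> 1 \<Longrightarrow> c1 * \<bar>s\<bar> powr (\<alpha>0 + 1) \<le> s * f s"
      "\<And>s. \<bar>s\<bar> \<le> 1 \<Longrightarrow> c1 * \<bar>s\<bar> powr (\<beta>0 + 1) \<le> s * f s"
    proof (rule nonlinearity_lower_bound[OF f(1) pos low zero_less_one, of \<beta>0])
      fix c1 assume c1: "c1 > 0" "\<And>s. \<bar>s\<bar> \<ge> 1 \<Longrightarrow> c1 * \<bar>s\<bar> powr (\<alpha>0 + 1) \<le> s * f s"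
        "(\<And>s. s\<^sup>2 * deriv f s \<le> \<beta>0 * (s * f s)) \<Longrightarrow> (\<And>s. \<bar>s\<bar> \<le> 1 \<Longrightarrow> c1 * \<bar>s\<bar> powr (\<beta>0 + 1) \<le> s * f s)"
      show ?thesis
        by (rule that, rule c1(1), rule c1(2), assumption, rule c1(3)[OF up], assumption)
    qed
    show ?thesis
    proof (rule liouville[OF stab pos F(2) low \<alpha> c1])
      show "?n < p * (\<beta>0 + 1) / (\<beta>0 + 1 - p)"
        using sub \<beta> by (simp add: pos_less_divide_eq algebra_simps)
      have "(?n - p) / p < ?n / (\<beta>0 + 1)"
        using sub \<beta> p0 by (simp add: divide_less_eq pos_less_divide_eq mult.commute)
      then show "p \<ge> ?n \<or> (?n - p) / p < ?n / (\<beta>0 + 1) \<and> (\<forall>s. s\<^sup>2 * deriv f s \<le> \<beta>0 * (s * f s))"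
        using up by blast
    qed
  next
    case False
    with cases have near: "\<And>s. \<bar>s\<bar> < M \<Longrightarrow> c * \<bar>s\<bar> powr (\<beta>0 + 1) \<le> s * f s" by auto
    \<comment> \<open>The hypothesis near 0 covers |s| < M only, while \<open>liouville\<close> asks
      for a closed range |s| <= m; m = M / 2 fits.\<close>
    have m: "M / 2 > 0" using \<open>M > 0\<close> by simp
    obtain c1 where c1: "c1 > 0" "\<And>s. \<bar>s\<bar> \<ge> M / 2 \<Longrightarrow> c1 * \<bar>s\<bar> powr (\<alpha>0 + 1) \<le> s * f s"
      by (rule nonlinearity_lower_bound[OF f(1) pos low m, of \<beta>0]) (assumption | rule that; assumption)+
    show ?thesis
    proof (rule liouville[OF stab pos F(2) low \<alpha>])
      show "min c c1 > 0" using \<open>c > 0\<close> c1(1) by simp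
      show "min c c1 * \<bar>s\<bar> powr (\<alpha>0 + 1) \<le> s * f s" if "\<bar>s\<bar> \<ge> M / 2" for s
        by (rule order_trans[OF mult_right_mono c1(2)[OF that]]) auto
      show "min c c1 * \<bar>s\<bar> powr (\<beta>0 + 1) \<le> s * f s" if "\<bar>s\<bar> \<le> M / 2" for s
      proof -
        have "\<bar>s\<bar> < M" using that \<open>M > 0\<close> by linarith
        show ?thesis by (rule order_trans[OF mult_right_mono near[OF \<open>\<bar>s\<bar> < M\<close>]]) auto
      qed
      \<comment> \<open>For p >= n the threshold p (\<beta>0 + 1) / (\<beta>0 + 1 - p) exceeds p,
        hence n.\<close>
      have "?n * (\<beta>0 + 1 - p) \<le> p * (\<beta>0 + 1 - p)" using False \<beta> by (intro mult_right_mono) auto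
      also have "\<dots> < p * (\<beta>0 + 1)" using p0 by simp
      finally show "?n < p * (\<beta>0 + 1) / (\<beta>0 + 1 - p)" using \<beta> by (simp add: pos_less_divide_eq)
      show "p \<ge> ?n \<or> (?n - p) / p < ?n / (\<beta>0 + 1) \<and> (\<forall>s. s\<^sup>2 * deriv f s \<le> \<beta>0 * (s * f s))"
        using False by simp
    qed
  qed
  with ue have "AE x in lborel. u x = 0" by eventually_elim simp
  then show ?thesis by (rule AE_completion)
qed

end
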